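(* Let $(W,S)$ be a finite Coxeter group with $S=\{s_1,\dots,s_n\}$ (completely ordered), and let $\Phi$ be a $W$-gluing data for abelian categories $(\mathcal{C}_w)_{w\in W}$. For every object $A\in\mathcal{C}(\Phi)$ the canonical complex $C_{\cdot}(A)$ satisfies $H_i(C_{\cdot}(A))=0$ for $i\ne0,n-1$, $H_0(C_{\cdot}(A))\simeq A$, and $H_{n-1}(C_{\cdot}(A))\simeq\iota A$.
   Context: A $W$-gluing data $\Phi$ consists of right-exact functors $\Phi_w:\mathcal{C}_{w'}\to\mathcal{C}_{ww'}$ for all $w,w'\in W$ (same symbol for all $w'$), with $\Phi_1=\mathrm{Id}$, and morphisms of functors $\nu_{w,w'}:\Phi_w\Phi_{w'}\to\Phi_{ww'}$ (on each $\mathcal{C}_{w''}$) with $\nu_{1,w}=\nu_{w,1}=\mathrm{id}$, satisfying associativity $\nu_{ww',w''}\circ(\nu_{w,w'}\Phi_{w''})=\nu_{w,w'w''}\circ(\Phi_w\nu_{w',w''})$, and such that $\nu_{w,w'}$ is an isomorphism whenever $\ell(ww')=\ell(w)+\ell(w')$, where $\ell$ is the length function. For $P\subset W$, $\mathcal{C}(\Phi_P)$ is the abelian category of collections $(A_w,w\in P;\alpha_{w,w'})$ with $A_w\in\mathcal{C}_w$ and morphisms $\alpha_{w,w'}:\Phi_wA_{w'}\to A_{ww'}$ for $w',ww'\in P$, with $\alpha_{1,w'}=\mathrm{id}$ and $\alpha_{w_1,w_2w'}\circ\Phi_{w_1}(\alpha_{w_2,w'})=\alpha_{w_1w_2,w'}\circ\nu_{w_1,w_2}$;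 morphisms are componentwise and compatible with $\alpha$. $\mathcal{C}(\Phi)=\mathcal{C}(\Phi_W)$, and $j_P^*:\mathcal{C}(\Phi)\to\mathcal{C}(\Phi_P)$ is the restriction functor. For $J\subset S$ let $W_J$ be the subgroup generated by $J$. For every coset $W_Jx$ the functor $j^*_{W_Jx}$ has a left adjoint $j_{W_Jx,!}:\mathcal{C}(\Phi_{W_Jx})\to\mathcal{C}(\Phi)$; its $w$-component is $\Phi_{n(w)}A_{p(w)}$, where $p(w)\in W_Jx$ is the element for which $n(w)=wp(w)^{-1}$ has minimal length. For $J\subset K$, since $j_{W_Jx,!}\simeq j_{W_Kx,!}\circ j_{W_Jx,W_Kx;!}$ (with $j_{W_Jx,W_Kx;!}$ the left adjoint of the restriction $\mathcal{C}(\Phi_{W_Kx})\to\mathcal{C}(\Phi_{W_Jx})$), adjunction gives canonical morphisms $j_{W_Jx,!}j^*_{W_Jx}\to j_{W_Kx,!}j^*_{W_Kx}$. The complex: identify $S$ with $[1,n]$. For nonempty $J\subset[1,n]$ put $A(J)=\bigoplus j_{W_{S-J}x,!}j^*_{W_{S-J}x}A$, the sum over all cosets $W_{S-J}x$. For $J\subset J'$ the canonical morphisms above are the components of a morphism $A(J')\to A(J)$; this is a homological coefficient system on the $(n-1)$-simplex, and $C_{\cdot}(A)$ is its chain complex (with the usual simplicial signs): $C_i(A)=\bigoplus_{|J|=i+1}A(J)$, $0\le i\le n-1$. The functor $\iota:\mathcal{C}(\Phi)\to\mathcal{C}(\Phi)$: with $w_0$ the longest element of $W$, $\iota(A_w;\alpha_{w,w'})=(\Phi_{w_0}A_{w_0w};\tilde\alpha_{w,w'})$,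 where $\tilde\alpha_{w,w'}$ is the composition $\Phi_w\Phi_{w_0}A_{w_0w'}\simeq\Phi_{w_0}\Phi_{w_0ww_0}A_{w_0w'}\xrightarrow{\Phi_{w_0}(\alpha_{w_0ww_0,w_0w'})}\Phi_{w_0}A_{w_0ww'}$; the first isomorphism comes from the identity $\tau(w)\tau(w_0)=\tau(w_0)\tau(w_0ww_0)$ in the positive braid monoid ($\tau$ being the canonical section given by reduced decompositions), which acts through the isomorphisms $\nu_{w,w'}$ for length-additive pairs.
   Formalization: The formal theorem assumes n ≥ 2; for n = 1 the complex is the single object C_0, generally isomorphic to neither A nor ιA (e.g. Φ = Id on vector spaces, A = (k,k)), and for n = 0 the complex is zero, so the claim fails there. *)

theory Defs
  imports "HOL-Algebra.Multiplicative_Group" "HOL-Algebra.Generated_Groups"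
begin

section \<open>Finite Coxeter groups\<close>

definition word_val :: "('w, 'x) monoid_scheme \<Rightarrow> 'w list \<Rightarrow> 'w" where
  "word_val W xs = foldr (\<lambda>x y. x \<otimes>\<^bsub>W\<^esub> y) xs \<one>\<^bsub>W\<^esub>"

text \<open>The congruence on words in \<open>S\<close> generated by the relations \<open>(s t)^m = 1\<close>, where \<open>m\<close> is the
  order of \<open>s t\<close> in \<open>W\<close>, whenever that order is finite (the library puts \<open>ord = 0\<close> for elements of
  infinite order). For \<open>s = t\<close> this is \<open>s s = 1\<close>.\<close>

inductive coxeter_equiv :: "('w, 'x) monoid_scheme \<Rightarrow> 'w set \<Rightarrow> 'w list \<Rightarrow> 'w list \<Rightarrow> bool"
  for W S where
    rel: "\<lbrakk>s \<in> S; t \<in> S; m = group.ord W (s \<otimes>\<^bsub>W\<^esub> t); m > 0; xs \<in> lists S; ys \<in> lists S\<rbrakk>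
      \<Longrightarrow> coxeter_equiv W S (xs @ concat (replicate m [s, t]) @ ys) (xs @ ys)"
  | refl: "xs \<in> lists S \<Longrightarrow> coxeter_equiv W S xs xs"
  | sym: "coxeter_equiv W S xs ys \<Longrightarrow> coxeter_equiv W S ys xs"
  | trans: "\<lbrakk>coxeter_equiv W S xs ys; coxeter_equiv W S ys zs\<rbrakk> \<Longrightarrow> coxeter_equiv W S xs zs"

text \<open>\<open>S\<close> is a set of elements of order 2 generating \<open>W\<close>, and the relations above present \<open>W\<close>.\<close>

definition coxeter_system :: "('w, 'x) monoid_scheme \<Rightarrow> 'w set \<Rightarrow> bool" where
  "coxeter_system W S \<longleftrightarrow>
     group W \<and> S \<subseteq> carrier W \<and> generate W S = carrier W \<and>
     (\<forall>s\<in>S. s \<noteq> \<one>\<^bsub>W\<^esub> \<and> s \<otimes>\<^bsub>W\<^esub> s = \<one>\<^bsub>W\<^esub>) \<and>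
     (\<forall>xs\<in>lists S. \<forall>ys\<in>lists S. word_val W xs = word_val W ys \<longrightarrow> coxeter_equiv W S xs ys)"

definition cox_length :: "('w, 'x) monoid_scheme \<Rightarrow> 'w set \<Rightarrow> 'w \<Rightarrow> nat" where
  "cox_length W S w = (LEAST k. \<exists>xs\<in>lists S. length xs = k \<and> word_val W xs = w)"

definition longest_elt :: "('w, 'x) monoid_scheme \<Rightarrow> 'w set \<Rightarrow> 'w" where
  "longest_elt W S =
     (THE w. w \<in> carrier W \<and> (\<forall>v\<in>carrier W. cox_length W S v \<le> cox_length W S w))"


section \<open>Abelian categories\<close>

text \<open>A category with an addition on its hom-sets. Distinct hom-sets are allowed to overlap, but
  need not: an arbitrary category is obtained by tagging arrows with source and target.\<close>

record ('o, 'm) precat =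
  Obj :: "'o set"
  Hom :: "'o \<Rightarrow> 'o \<Rightarrow> 'm set"
  Ide :: "'o \<Rightarrow> 'm"
  Cmp :: "'m \<Rightarrow> 'm \<Rightarrow> 'm"  \<comment> \<open>\<open>Cmp C g f\<close> is \<open>g\<close> after \<open>f\<close>\<close>
  Add :: "'m \<Rightarrow> 'm \<Rightarrow> 'm"
  Zer :: "'o \<Rightarrow> 'o \<Rightarrow> 'm"

definition category :: "('o, 'm) precat \<Rightarrow> bool" where
  "category C \<longleftrightarrow>
     (\<forall>a\<in>Obj C. Ide C a \<in> Hom C a a) \<and>
     (\<forall>a\<in>Obj C. \<forall>b\<in>Obj C. \<forall>c\<in>Obj C. \<forall>f\<in>Hom C a b. \<forall>g\<in>Hom C b c. Cmp C g f \<in> Hom C a c) \<and>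
     (\<forall>a\<in>Obj C. \<forall>b\<in>Obj C. \<forall>f\<in>Hom C a b. Cmp C f (Ide C a) = f \<and> Cmp C (Ide C b) f = f) \<and>
     (\<forall>a\<in>Obj C. \<forall>b\<in>Obj C. \<forall>c\<in>Obj C. \<forall>d\<in>Obj C.
        \<forall>f\<in>Hom C a b. \<forall>g\<in>Hom C b c. \<forall>h\<in>Hom C c d.
          Cmp C h (Cmp C g f) = Cmp C (Cmp C h g) f)"

definition hom_group :: "('o, 'm) precat \<Rightarrow> 'o \<Rightarrow> 'o \<Rightarrow> 'm monoid" where
  "hom_group C a b = \<lparr>carrier = Hom C a b, monoid.mult = Add C, one = Zer C a b\<rparr>"

definition preadditive :: "('o, 'm) precat \<Rightarrow> bool" where
  "preadditive C \<longleftrightarrow>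
     category C \<and>
     (\<forall>a\<in>Obj C. \<forall>b\<in>Obj C. comm_group (hom_group C a b)) \<and>
     (\<forall>a\<in>Obj C. \<forall>b\<in>Obj C. \<forall>c\<in>Obj C. \<forall>f\<in>Hom C a b. \<forall>f'\<in>Hom C a b. \<forall>g\<in>Hom C b c. \<forall>g'\<in>Hom C b c.
        Cmp C g (Add C f f') = Add C (Cmp C g f) (Cmp C g f') \<and>
        Cmp C (Add C g g') f = Add C (Cmp C g f) (Cmp C g' f))"

definition is_zero_object :: "('o, 'm) precat \<Rightarrow> 'o \<Rightarrow> bool" where
  "is_zero_object C z \<longleftrightarrow>
     z \<in> Obj C \<and> (\<forall>a\<in>Obj C. (\<exists>!f. f \<in> Hom C z a) \<and> (\<exists>!f. f \<in> Hom C a z))"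

text \<open>Finite direct sums (biproducts): in the last clause \<open>finprod\<close> is the sum in the hom-group.\<close>

definition is_direct_sum ::
    "('o, 'm) precat \<Rightarrow> 'i set \<Rightarrow> ('i \<Rightarrow> 'o) \<Rightarrow> 'o \<Rightarrow> ('i \<Rightarrow> 'm) \<Rightarrow> ('i \<Rightarrow> 'm) \<Rightarrow> bool" where
  "is_direct_sum C I X B inc prj \<longleftrightarrow>
     finite I \<and> B \<in> Obj C \<and>
     (\<forall>i\<in>I. inc i \<in> Hom C (X i) B \<and> prj i \<in> Hom C B (X i)) \<and>
     (\<forall>i\<in>I. \<forall>j\<in>I. Cmp C (prj j) (inc i) = (if i = j then Ide C (X i) else Zer C (X i) (X j))) \<and>
     finprod (hom_group C B B) (\<lambda>i. Cmp C (inc i) (prj i)) I = Ide C B"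

definition is_kernel :: "('o, 'm) precat \<Rightarrow> 'o \<Rightarrow> 'o \<Rightarrow> 'm \<Rightarrow> 'o \<Rightarrow> 'm \<Rightarrow> bool" where
  "is_kernel C a b f K k \<longleftrightarrow>
     K \<in> Obj C \<and> k \<in> Hom C K a \<and> Cmp C f k = Zer C K b \<and>
     (\<forall>T\<in>Obj C. \<forall>t\<in>Hom C T a. Cmp C f t = Zer C T b \<longrightarrow> (\<exists>!u. u \<in> Hom C T K \<and> Cmp C k u = t))"

definition is_cokernel :: "('o, 'm) precat \<Rightarrow> 'o \<Rightarrow> 'o \<Rightarrow> 'm \<Rightarrow> 'o \<Rightarrow> 'm \<Rightarrow> bool" where
  "is_cokernel C a b f Q q \<longleftrightarrow>
     Q \<in> Obj C \<and> q \<in> Hom C b Q \<and> Cmp C q f = Zer C a Q \<and>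
     (\<forall>T\<in>Obj C. \<forall>t\<in>Hom C b T. Cmp C t f = Zer C a T \<longrightarrow> (\<exists>!u. u \<in> Hom C Q T \<and> Cmp C u q = t))"

definition monic :: "('o, 'm) precat \<Rightarrow> 'o \<Rightarrow> 'o \<Rightarrow> 'm \<Rightarrow> bool" where
  "monic C a b f \<longleftrightarrow>
     (\<forall>T\<in>Obj C. \<forall>g\<in>Hom C T a. \<forall>h\<in>Hom C T a. Cmp C f g = Cmp C f h \<longrightarrow> g = h)"

definition epic :: "('o, 'm) precat \<Rightarrow> 'o \<Rightarrow> 'o \<Rightarrow> 'm \<Rightarrow> bool" where
  "epic C a b f \<longleftrightarrow>
     (\<forall>T\<in>Obj C. \<forall>g\<in>Hom C b T. \<forall>h\<in>Hom C b T. Cmp C g f = Cmp C h f \<longrightarrow> g = h)"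

definition abelian_category :: "('o, 'm) precat \<Rightarrow> bool" where
  "abelian_category C \<longleftrightarrow>
     preadditive C \<and>
     (\<exists>z. is_zero_object C z) \<and>
     (\<forall>a\<in>Obj C. \<forall>b\<in>Obj C. \<exists>B inc prj. is_direct_sum C UNIV (case_bool a b) B inc prj) \<and>
     (\<forall>a\<in>Obj C. \<forall>b\<in>Obj C. \<forall>f\<in>Hom C a b.
        (\<exists>K k. is_kernel C a b f K k) \<and> (\<exists>Q q. is_cokernel C a b f Q q)) \<and>
     (\<forall>a\<in>Obj C. \<forall>b\<in>Obj C. \<forall>f\<in>Hom C a b.
        monic C a b f \<longrightarrow> (\<exists>c\<in>Obj C. \<exists>g\<in>Hom C b c. is_kernel C b c g a f)) \<and>
     (\<forall>a\<in>Obj C. \<forall>b\<in>Obj C. \<forall>f\<in>Hom C a b.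
        epic C a b f \<longrightarrow> (\<exists>c\<in>Obj C. \<exists>g\<in>Hom C c a. is_cokernel C c a g b f))"

definition is_inverse :: "('o, 'm) precat \<Rightarrow> 'o \<Rightarrow> 'o \<Rightarrow> 'm \<Rightarrow> 'm \<Rightarrow> bool" where
  "is_inverse C a b f g \<longleftrightarrow> g \<in> Hom C b a \<and> Cmp C g f = Ide C a \<and> Cmp C f g = Ide C b"

definition is_iso :: "('o, 'm) precat \<Rightarrow> 'o \<Rightarrow> 'o \<Rightarrow> 'm \<Rightarrow> bool" where
  "is_iso C a b f \<longleftrightarrow> f \<in> Hom C a b \<and> (\<exists>g. is_inverse C a b f g)"

definition inv_arr :: "('o, 'm) precat \<Rightarrow> 'o \<Rightarrow> 'o \<Rightarrow> 'm \<Rightarrow> 'm" where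
  "inv_arr C a b f = (THE g. is_inverse C a b f g)"

definition isomorphic :: "('o, 'm) precat \<Rightarrow> 'o \<Rightarrow> 'o \<Rightarrow> bool" where
  "isomorphic C a b \<longleftrightarrow> a \<in> Obj C \<and> b \<in> Obj C \<and> (\<exists>f. is_iso C a b f)"

definition is_functor ::
    "('o, 'm) precat \<Rightarrow> ('p, 'n) precat \<Rightarrow> ('o \<Rightarrow> 'p) \<Rightarrow> ('m \<Rightarrow> 'n) \<Rightarrow> bool" where
  "is_functor C D Fo Fa \<longleftrightarrow>
     (\<forall>a\<in>Obj C. Fo a \<in> Obj D \<and> Fa (Ide C a) = Ide D (Fo a)) \<and>
     (\<forall>a\<in>Obj C. \<forall>b\<in>Obj C. \<forall>f\<in>Hom C a b. Fa f \<in> Hom D (Fo a) (Fo b)) \<and>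
     (\<forall>a\<in>Obj C. \<forall>b\<in>Obj C. \<forall>c\<in>Obj C. \<forall>f\<in>Hom C a b. \<forall>g\<in>Hom C b c.
        Fa (Cmp C g f) = Cmp D (Fa g) (Fa f))"

text \<open>Additive functors sending exact sequences \<open>a \<rightarrow> b \<rightarrow> c \<rightarrow> 0\<close> to exact sequences; exactness of such
  a sequence means that \<open>b \<rightarrow> c\<close> is a cokernel of \<open>a \<rightarrow> b\<close>.\<close>

definition right_exact_functor ::
    "('o, 'm) precat \<Rightarrow> ('p, 'n) precat \<Rightarrow> ('o \<Rightarrow> 'p) \<Rightarrow> ('m \<Rightarrow> 'n) \<Rightarrow> bool" where
  "right_exact_functor C D Fo Fa \<longleftrightarrow>
     is_functor C D Fo Fa \<and>
     (\<forall>a\<in>Obj C. \<forall>b\<in>Obj C. \<forall>f\<in>Hom C a b. \<forall>g\<in>Hom C a b. Fa (Add C f g) = Add D (Fa f) (Fa g)) \<and>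
     (\<forall>a\<in>Obj C. \<forall>b\<in>Obj C. \<forall>f\<in>Hom C a b. \<forall>c g.
        is_cokernel C a b f c g \<longrightarrow> is_cokernel D (Fo a) (Fo b) (Fa f) (Fo c) (Fa g))"


subsection \<open>Chosen direct sums, homology and adjoints\<close>

text \<open>Objects given by a universal property are picked by choice; they are unique up to canonical
  isomorphism whenever they exist.\<close>

definition dsum :: "('o, 'm) precat \<Rightarrow> 'i set \<Rightarrow> ('i \<Rightarrow> 'o) \<Rightarrow> 'o \<times> ('i \<Rightarrow> 'm) \<times> ('i \<Rightarrow> 'm)" where
  "dsum C I X = (SOME (B, inc, prj). is_direct_sum C I X B inc prj)"

definition dsum_obj :: "('o, 'm) precat \<Rightarrow> 'i set \<Rightarrow> ('i \<Rightarrow> 'o) \<Rightarrow> 'o" where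
  "dsum_obj C I X = fst (dsum C I X)"

definition dsum_inj :: "('o, 'm) precat \<Rightarrow> 'i set \<Rightarrow> ('i \<Rightarrow> 'o) \<Rightarrow> 'i \<Rightarrow> 'm" where
  "dsum_inj C I X = fst (snd (dsum C I X))"

definition dsum_prj :: "('o, 'm) precat \<Rightarrow> 'i set \<Rightarrow> ('i \<Rightarrow> 'o) \<Rightarrow> 'i \<Rightarrow> 'm" where
  "dsum_prj C I X = snd (snd (dsum C I X))"

text \<open>The morphism of direct sums with matrix entries \<open>m i j : X i \<rightarrow> Y j\<close>.\<close>

definition dsum_arr ::
    "('o, 'm) precat \<Rightarrow> 'i set \<Rightarrow> ('i \<Rightarrow> 'o) \<Rightarrow> 'j set \<Rightarrow> ('j \<Rightarrow> 'o) \<Rightarrow> ('i \<Rightarrow> 'j \<Rightarrow> 'm) \<Rightarrow> 'm" where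
  "dsum_arr C I X J Y m =
     (THE f. f \<in> Hom C (dsum_obj C I X) (dsum_obj C J Y) \<and>
       (\<forall>i\<in>I. \<forall>j\<in>J. Cmp C (dsum_prj C J Y j) (Cmp C f (dsum_inj C I X i)) = m i j))"

text \<open>The homology of \<open>a \<rightarrow> b \<rightarrow> c\<close> at \<open>b\<close>: the cokernel of the morphism \<open>a \<rightarrow> Ker (b \<rightarrow> c)\<close>
  induced by \<open>a \<rightarrow> b\<close>.\<close>

definition homology_obj :: "('o, 'm) precat \<Rightarrow> 'o \<Rightarrow> 'o \<Rightarrow> 'o \<Rightarrow> 'm \<Rightarrow> 'm \<Rightarrow> 'o" where
  "homology_obj C a b c f g =
     (let (K, k) = (SOME (K, k). is_kernel C b c g K k);
          u = (THE u. u \<in> Hom C a K \<and> Cmp C k u = f)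
      in fst (SOME (Q, q). is_cokernel C a K u Q q))"

text \<open>\<open>(L, e)\<close> is universal from \<open>M\<close> to \<open>G : D \<rightarrow> C\<close>, i.e. \<open>L\<close> is the value at \<open>M\<close> of the left
  adjoint of \<open>G\<close> and \<open>e : M \<rightarrow> G L\<close> is the unit.\<close>

definition is_universal_arrow ::
    "('p, 'n) precat \<Rightarrow> ('o, 'm) precat \<Rightarrow> ('o \<Rightarrow> 'p) \<Rightarrow> ('m \<Rightarrow> 'n) \<Rightarrow> 'p \<Rightarrow> 'o \<Rightarrow> 'n \<Rightarrow> bool" where
  "is_universal_arrow C D Go Ga M L e \<longleftrightarrow>
     L \<in> Obj D \<and> e \<in> Hom C M (Go L) \<and>
     (\<forall>X\<in>Obj D. \<forall>f\<in>Hom C M (Go X). \<exists>!g. g \<in> Hom D L X \<and> Cmp C (Ga g) e = f)"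


section \<open>Gluing data\<close>

text \<open>\<open>PhO D w w'\<close> and \<open>PhA D w w'\<close> are the actions of \<open>\<Phi>\<^sub>w : C\<^sub>w\<^sub>' \<rightarrow> C\<^sub>w\<^sub>w\<^sub>'\<close> on objects and arrows;
  \<open>Nu D w w' w'' X : \<Phi>\<^sub>w \<Phi>\<^sub>w\<^sub>' X \<rightarrow> \<Phi>\<^sub>w\<^sub>w\<^sub>' X\<close> is the component of \<open>\<nu>\<^sub>w\<^sub>,\<^sub>w\<^sub>'\<close> at \<open>X\<close> in \<open>C\<^sub>w\<^sub>'\<^sub>'\<close>.\<close>

record ('w, 'o, 'm) gluing =
  Cat :: "'w \<Rightarrow> ('o, 'm) precat"
  PhO :: "'w \<Rightarrow> 'w \<Rightarrow> 'o \<Rightarrow> 'o"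
  PhA :: "'w \<Rightarrow> 'w \<Rightarrow> 'm \<Rightarrow> 'm"
  Nu :: "'w \<Rightarrow> 'w \<Rightarrow> 'w \<Rightarrow> 'o \<Rightarrow> 'm"

definition gluing_data ::
    "('w, 'x) monoid_scheme \<Rightarrow> 'w set \<Rightarrow> ('w, 'o, 'm) gluing \<Rightarrow> bool" where
  "gluing_data W S D \<longleftrightarrow>
     (\<forall>w\<in>carrier W. \<forall>v\<in>carrier W.
        right_exact_functor (Cat D v) (Cat D (w \<otimes>\<^bsub>W\<^esub> v)) (PhO D w v) (PhA D w v)) \<and>
     (\<forall>v\<in>carrier W. \<forall>X\<in>Obj (Cat D v). PhO D \<one>\<^bsub>W\<^esub> v X = X) \<and>
     (\<forall>v\<in>carrier W. \<forall>X\<in>Obj (Cat D v). \<forall>Y\<in>Obj (Cat D v). \<forall>f\<in>Hom (Cat D v) X Y.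
        PhA D \<one>\<^bsub>W\<^esub> v f = f) \<and>
     (\<forall>w\<in>carrier W. \<forall>w'\<in>carrier W. \<forall>v\<in>carrier W. \<forall>X\<in>Obj (Cat D v).
        Nu D w w' v X \<in> Hom (Cat D (w \<otimes>\<^bsub>W\<^esub> w' \<otimes>\<^bsub>W\<^esub> v))
          (PhO D w (w' \<otimes>\<^bsub>W\<^esub> v) (PhO D w' v X)) (PhO D (w \<otimes>\<^bsub>W\<^esub> w') v X)) \<and>
     (\<forall>w\<in>carrier W. \<forall>w'\<in>carrier W. \<forall>v\<in>carrier W.
        \<forall>X\<in>Obj (Cat D v). \<forall>Y\<in>Obj (Cat D v). \<forall>f\<in>Hom (Cat D v) X Y.
        Cmp (Cat D (w \<otimes>\<^bsub>W\<^esub> w' \<otimes>\<^bsub>W\<^esub> v)) (Nu D w w' v Y) (PhA D w (w' \<otimes>\<^bsub>W\<^esub> v) (PhA D w' v f)) =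
        Cmp (Cat D (w \<otimes>\<^bsub>W\<^esub> w' \<otimes>\<^bsub>W\<^esub> v)) (PhA D (w \<otimes>\<^bsub>W\<^esub> w') v f) (Nu D w w' v X)) \<and>
     (\<forall>w\<in>carrier W. \<forall>v\<in>carrier W. \<forall>X\<in>Obj (Cat D v).
        Nu D \<one>\<^bsub>W\<^esub> w v X = Ide (Cat D (w \<otimes>\<^bsub>W\<^esub> v)) (PhO D w v X) \<and>
        Nu D w \<one>\<^bsub>W\<^esub> v X = Ide (Cat D (w \<otimes>\<^bsub>W\<^esub> v)) (PhO D w v X)) \<and>
     (\<forall>w\<in>carrier W. \<forall>w'\<in>carrier W. \<forall>w''\<in>carrier W. \<forall>v\<in>carrier W. \<forall>X\<in>Obj (Cat D v).
        Cmp (Cat D (w \<otimes>\<^bsub>W\<^esub> w' \<otimes>\<^bsub>W\<^esub> w'' \<otimes>\<^bsub>W\<^esub> v))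
          (Nu D (w \<otimes>\<^bsub>W\<^esub> w') w'' v X) (Nu D w w' (w'' \<otimes>\<^bsub>W\<^esub> v) (PhO D w'' v X)) =
        Cmp (Cat D (w \<otimes>\<^bsub>W\<^esub> w' \<otimes>\<^bsub>W\<^esub> w'' \<otimes>\<^bsub>W\<^esub> v))
          (Nu D w (w' \<otimes>\<^bsub>W\<^esub> w'') v X) (PhA D w (w' \<otimes>\<^bsub>W\<^esub> w'' \<otimes>\<^bsub>W\<^esub> v) (Nu D w' w'' v X))) \<and>
     (\<forall>w\<in>carrier W. \<forall>w'\<in>carrier W.
        cox_length W S (w \<otimes>\<^bsub>W\<^esub> w') = cox_length W S w + cox_length W S w' \<longrightarrow>
        (\<forall>v\<in>carrier W. \<forall>X\<in>Obj (Cat D v).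
           is_iso (Cat D (w \<otimes>\<^bsub>W\<^esub> w' \<otimes>\<^bsub>W\<^esub> v))
             (PhO D w (w' \<otimes>\<^bsub>W\<^esub> v) (PhO D w' v X)) (PhO D (w \<otimes>\<^bsub>W\<^esub> w') v X) (Nu D w w' v X)))"


subsection \<open>The glued categories\<close>

text \<open>An object over \<open>P\<close> is a pair of families \<open>(A, \<alpha>)\<close>, \<open>\<alpha> w w' : \<Phi>\<^sub>w A\<^sub>w\<^sub>' \<rightarrow> A\<^sub>w\<^sub>w\<^sub>'\<close>, both undefined outside
  their index sets so that equality of objects is equality of collections.\<close>

type_synonym ('w, 'o, 'm) glued = "('w \<Rightarrow> 'o) \<times> ('w \<Rightarrow> 'w \<Rightarrow> 'm)"

definition alpha_ix :: "('w, 'x) monoid_scheme \<Rightarrow> 'w set \<Rightarrow> 'w \<Rightarrow> 'w \<Rightarrow> bool" where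
  "alpha_ix W P w w' \<longleftrightarrow> w \<in> carrier W \<and> w' \<in> P \<and> w \<otimes>\<^bsub>W\<^esub> w' \<in> P"

definition glued_objects ::
    "('w, 'x) monoid_scheme \<Rightarrow> ('w, 'o, 'm) gluing \<Rightarrow> 'w set \<Rightarrow> ('w, 'o, 'm) glued set" where
  "glued_objects W D P = {(A, \<alpha>).
     A \<in> (\<Pi>\<^sub>E w\<in>P. Obj (Cat D w)) \<and>
     (\<forall>w w'. \<not> alpha_ix W P w w' \<longrightarrow> \<alpha> w w' = undefined) \<and>
     (\<forall>w w'. alpha_ix W P w w' \<longrightarrow>
        \<alpha> w w' \<in> Hom (Cat D (w \<otimes>\<^bsub>W\<^esub> w')) (PhO D w w' (A w')) (A (w \<otimes>\<^bsub>W\<^esub> w'))) \<and>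
     (\<forall>w'\<in>P. \<alpha> \<one>\<^bsub>W\<^esub> w' = Ide (Cat D w') (A w')) \<and>
     (\<forall>w1\<in>carrier W. \<forall>w2\<in>carrier W. \<forall>w'\<in>P.
        w2 \<otimes>\<^bsub>W\<^esub> w' \<in> P \<and> w1 \<otimes>\<^bsub>W\<^esub> w2 \<otimes>\<^bsub>W\<^esub> w' \<in> P \<longrightarrow>
        Cmp (Cat D (w1 \<otimes>\<^bsub>W\<^esub> w2 \<otimes>\<^bsub>W\<^esub> w'))
          (\<alpha> w1 (w2 \<otimes>\<^bsub>W\<^esub> w')) (PhA D w1 (w2 \<otimes>\<^bsub>W\<^esub> w') (\<alpha> w2 w')) =
        Cmp (Cat D (w1 \<otimes>\<^bsub>W\<^esub> w2 \<otimes>\<^bsub>W\<^esub> w'))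
          (\<alpha> (w1 \<otimes>\<^bsub>W\<^esub> w2) w') (Nu D w1 w2 w' (A w')))}"

definition glued_hom ::
    "('w, 'x) monoid_scheme \<Rightarrow> ('w, 'o, 'm) gluing \<Rightarrow> 'w set \<Rightarrow>
      ('w, 'o, 'm) glued \<Rightarrow> ('w, 'o, 'm) glued \<Rightarrow> ('w \<Rightarrow> 'm) set" where
  "glued_hom W D P = (\<lambda>(A, \<alpha>) (B, \<beta>). {f.
     f \<in> (\<Pi>\<^sub>E w\<in>P. Hom (Cat D w) (A w) (B w)) \<and>
     (\<forall>w w'. alpha_ix W P w w' \<longrightarrow>
        Cmp (Cat D (w \<otimes>\<^bsub>W\<^esub> w')) (f (w \<otimes>\<^bsub>W\<^esub> w')) (\<alpha> w w') =
        Cmp (Cat D (w \<otimes>\<^bsub>W\<^esub> w')) (\<beta> w w') (PhA D w w' (f w')))})"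

definition glued_cat ::
    "('w, 'x) monoid_scheme \<Rightarrow> ('w, 'o, 'm) gluing \<Rightarrow> 'w set \<Rightarrow>
      (('w, 'o, 'm) glued, 'w \<Rightarrow> 'm) precat" where
  "glued_cat W D P = \<lparr>
     Obj = glued_objects W D P,
     Hom = glued_hom W D P,
     Ide = (\<lambda>A. \<lambda>w\<in>P. Ide (Cat D w) (fst A w)),
     Cmp = (\<lambda>g f. \<lambda>w\<in>P. Cmp (Cat D w) (g w) (f w)),
     Add = (\<lambda>f g. \<lambda>w\<in>P. Add (Cat D w) (f w) (g w)),
     Zer = (\<lambda>A B. \<lambda>w\<in>P. Zer (Cat D w) (fst A w) (fst B w))\<rparr>"

text \<open>The restriction functor to \<open>P\<close>, used on the glued category over any larger subset.\<close>

definition res_obj ::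
    "('w, 'x) monoid_scheme \<Rightarrow> 'w set \<Rightarrow> ('w, 'o, 'm) glued \<Rightarrow> ('w, 'o, 'm) glued" where
  "res_obj W P A =
     (restrict (fst A) P, \<lambda>w w'. if alpha_ix W P w w' then snd A w w' else undefined)"

definition res_arr :: "'w set \<Rightarrow> ('w \<Rightarrow> 'm) \<Rightarrow> 'w \<Rightarrow> 'm" where
  "res_arr P f = restrict f P"


subsection \<open>The left adjoints of restriction and the canonical morphisms\<close>

text \<open>For \<open>P \<subseteq> Q\<close>, the left adjoint \<open>j\<^sub>!\<close> of the restriction \<open>j\<^sup>*\<close> from the glued category over \<open>Q\<close> to the
  one over \<open>P\<close>: its value and unit at an object, the transpose \<open>j\<^sub>! M \<rightarrow> X\<close> of \<open>M \<rightarrow> j\<^sup>* X\<close>, its action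
  on arrows \<open>M \<rightarrow> N\<close>, and the counit \<open>j\<^sub>! j\<^sup>* X \<rightarrow> X\<close>.\<close>

definition shriek ::
    "('w, 'x) monoid_scheme \<Rightarrow> ('w, 'o, 'm) gluing \<Rightarrow> 'w set \<Rightarrow> 'w set \<Rightarrow>
      ('w, 'o, 'm) glued \<Rightarrow> ('w, 'o, 'm) glued \<times> ('w \<Rightarrow> 'm)" where
  "shriek W D P Q M =
     (SOME (L, e). is_universal_arrow (glued_cat W D P) (glued_cat W D Q)
        (res_obj W P) (res_arr P) M L e)"

definition shriek_obj ::
    "('w, 'x) monoid_scheme \<Rightarrow> ('w, 'o, 'm) gluing \<Rightarrow> 'w set \<Rightarrow> 'w set \<Rightarrow>
      ('w, 'o, 'm) glued \<Rightarrow> ('w, 'o, 'm) glued" where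
  "shriek_obj W D P Q M = fst (shriek W D P Q M)"

definition shriek_unit ::
    "('w, 'x) monoid_scheme \<Rightarrow> ('w, 'o, 'm) gluing \<Rightarrow> 'w set \<Rightarrow> 'w set \<Rightarrow>
      ('w, 'o, 'm) glued \<Rightarrow> ('w \<Rightarrow> 'm)" where
  "shriek_unit W D P Q M = snd (shriek W D P Q M)"

definition shriek_transpose ::
    "('w, 'x) monoid_scheme \<Rightarrow> ('w, 'o, 'm) gluing \<Rightarrow> 'w set \<Rightarrow> 'w set \<Rightarrow>
      ('w, 'o, 'm) glued \<Rightarrow> ('w, 'o, 'm) glued \<Rightarrow> ('w \<Rightarrow> 'm) \<Rightarrow> ('w \<Rightarrow> 'm)" where
  "shriek_transpose W D P Q M X f =
     (THE g. g \<in> Hom (glued_cat W D Q) (shriek_obj W D P Q M) X \<and>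
        Cmp (glued_cat W D P) (res_arr P g) (shriek_unit W D P Q M) = f)"

definition shriek_arr ::
    "('w, 'x) monoid_scheme \<Rightarrow> ('w, 'o, 'm) gluing \<Rightarrow> 'w set \<Rightarrow> 'w set \<Rightarrow>
      ('w, 'o, 'm) glued \<Rightarrow> ('w, 'o, 'm) glued \<Rightarrow> ('w \<Rightarrow> 'm) \<Rightarrow> ('w \<Rightarrow> 'm)" where
  "shriek_arr W D P Q M N f =
     shriek_transpose W D P Q M (shriek_obj W D P Q N)
       (Cmp (glued_cat W D P) (shriek_unit W D P Q N) f)"

definition shriek_counit ::
    "('w, 'x) monoid_scheme \<Rightarrow> ('w, 'o, 'm) gluing \<Rightarrow> 'w set \<Rightarrow> 'w set \<Rightarrow>
      ('w, 'o, 'm) glued \<Rightarrow> ('w \<Rightarrow> 'm)" where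
  "shriek_counit W D P Q X =
     shriek_transpose W D P Q (res_obj W P X) X (Ide (glued_cat W D P) (res_obj W P X))"

text \<open>For \<open>P \<subseteq> Q\<close>, the isomorphism \<open>j\<^sub>P\<^sub>,\<^sub>! M \<rightarrow> j\<^sub>Q\<^sub>,\<^sub>! j\<^sub>P\<^sub>,\<^sub>Q\<^sub>;\<^sub>! M\<close> of left adjoints of the restriction to \<open>P\<close>,
  determined by compatibility with the units.\<close>

definition shriek_comp ::
    "('w, 'x) monoid_scheme \<Rightarrow> ('w, 'o, 'm) gluing \<Rightarrow> 'w set \<Rightarrow> 'w set \<Rightarrow>
      ('w, 'o, 'm) glued \<Rightarrow> ('w \<Rightarrow> 'm)" where
  "shriek_comp W D P Q M =
     shriek_transpose W D P (carrier W) M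
       (shriek_obj W D Q (carrier W) (shriek_obj W D P Q M))
       (Cmp (glued_cat W D P)
          (res_arr P (shriek_unit W D Q (carrier W) (shriek_obj W D P Q M)))
          (shriek_unit W D P Q M))"

definition shriek_pull ::
    "('w, 'x) monoid_scheme \<Rightarrow> ('w, 'o, 'm) gluing \<Rightarrow> ('w, 'o, 'm) glued \<Rightarrow> 'w set \<Rightarrow>
      ('w, 'o, 'm) glued" where
  "shriek_pull W D A P = shriek_obj W D P (carrier W) (res_obj W P A)"

text \<open>The canonical morphism \<open>j\<^sub>P\<^sub>,\<^sub>! j\<^sub>P\<^sup>* A \<rightarrow> j\<^sub>Q\<^sub>,\<^sub>! j\<^sub>P\<^sub>,\<^sub>Q\<^sub>;\<^sub>! j\<^sub>P\<^sub>,\<^sub>Q\<^sup>* j\<^sub>Q\<^sup>* A \<rightarrow> j\<^sub>Q\<^sub>,\<^sub>! j\<^sub>Q\<^sup>* A\<close> for \<open>P \<subseteq> Q\<close>; the second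
  arrow is \<open>j\<^sub>Q\<^sub>,\<^sub>!\<close> of the counit.\<close>

definition canon_arr ::
    "('w, 'x) monoid_scheme \<Rightarrow> ('w, 'o, 'm) gluing \<Rightarrow> ('w, 'o, 'm) glued \<Rightarrow> 'w set \<Rightarrow> 'w set \<Rightarrow>
      ('w \<Rightarrow> 'm)" where
  "canon_arr W D A P Q =
     Cmp (glued_cat W D (carrier W))
       (shriek_arr W D Q (carrier W) (shriek_obj W D P Q (res_obj W P A)) (res_obj W Q A)
          (shriek_counit W D P Q (res_obj W Q A)))
       (shriek_comp W D P Q (res_obj W P A))"


subsection \<open>The canonical complex\<close>

text \<open>From here on \<open>s\<close> enumerates \<open>S\<close> by \<open>{1..n}\<close>. The cosets \<open>W\<^sub>S\<^sub>-\<^sub>J x\<close> for \<open>J \<subseteq> {1..n}\<close>:\<close>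

definition par_cosets :: "('w, 'x) monoid_scheme \<Rightarrow> nat \<Rightarrow> (nat \<Rightarrow> 'w) \<Rightarrow> nat set \<Rightarrow> 'w set set" where
  "par_cosets W n s J = rcosets\<^bsub>W\<^esub> (generate W (s ` ({1..n} - J)))"

definition coeff_obj ::
    "('w, 'x) monoid_scheme \<Rightarrow> nat \<Rightarrow> (nat \<Rightarrow> 'w) \<Rightarrow> ('w, 'o, 'm) gluing \<Rightarrow> ('w, 'o, 'm) glued \<Rightarrow>
      nat set \<Rightarrow> ('w, 'o, 'm) glued" where
  "coeff_obj W n s D A J =
     dsum_obj (glued_cat W D (carrier W)) (par_cosets W n s J) (shriek_pull W D A)"

text \<open>The morphism \<open>A(J') \<rightarrow> A(J)\<close> for \<open>J \<subseteq> J'\<close>.\<close>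

definition coeff_arr ::
    "('w, 'x) monoid_scheme \<Rightarrow> nat \<Rightarrow> (nat \<Rightarrow> 'w) \<Rightarrow> ('w, 'o, 'm) gluing \<Rightarrow> ('w, 'o, 'm) glued \<Rightarrow>
      nat set \<Rightarrow> nat set \<Rightarrow> ('w \<Rightarrow> 'm)" where
  "coeff_arr W n s D A J' J =
     dsum_arr (glued_cat W D (carrier W))
       (par_cosets W n s J') (shriek_pull W D A) (par_cosets W n s J) (shriek_pull W D A)
       (\<lambda>P Q. if P \<subseteq> Q then canon_arr W D A P Q
              else Zer (glued_cat W D (carrier W)) (shriek_pull W D A P) (shriek_pull W D A Q))"

text \<open>The \<open>i\<close>-dimensional faces of the simplex; empty unless \<open>0 \<le> i \<le> n - 1\<close>, so that the chain objects
  are zero objects in all other degrees.\<close>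

definition faces :: "nat \<Rightarrow> int \<Rightarrow> nat set set" where
  "faces n i = {J. J \<subseteq> {1..n} \<and> J \<noteq> {} \<and> int (card J) = i + 1}"

definition chain_obj ::
    "('w, 'x) monoid_scheme \<Rightarrow> nat \<Rightarrow> (nat \<Rightarrow> 'w) \<Rightarrow> ('w, 'o, 'm) gluing \<Rightarrow> ('w, 'o, 'm) glued \<Rightarrow>
      int \<Rightarrow> ('w, 'o, 'm) glued" where
  "chain_obj W n s D A i =
     dsum_obj (glued_cat W D (carrier W)) (faces n i) (coeff_obj W n s D A)"

text \<open>The differential from degree \<open>i\<close> to degree \<open>i - 1\<close>. If \<open>J = J' - {j}\<close>, its component
  \<open>A(J') \<rightarrow> A(J)\<close> has the sign \<open>(-1)^p\<close>, where \<open>p\<close> is the number of elements of \<open>J'\<close> below \<open>j\<close>.\<close>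

definition chain_diff ::
    "('w, 'x) monoid_scheme \<Rightarrow> nat \<Rightarrow> (nat \<Rightarrow> 'w) \<Rightarrow> ('w, 'o, 'm) gluing \<Rightarrow> ('w, 'o, 'm) glued \<Rightarrow>
      int \<Rightarrow> ('w \<Rightarrow> 'm)" where
  "chain_diff W n s D A i =
     (let C = glued_cat W D (carrier W); X = coeff_obj W n s D A in
      dsum_arr C (faces n i) X (faces n (i - 1)) X
        (\<lambda>J' J. if J \<subseteq> J'
           then (if even (card {k \<in> J'. k < the_elem (J' - J)})
                 then coeff_arr W n s D A J' J
                 else inv\<^bsub>hom_group C (X J') (X J)\<^esub> (coeff_arr W n s D A J' J))
           else Zer C (X J') (X J)))"

definition chain_homology ::
    "('w, 'x) monoid_scheme \<Rightarrow> nat \<Rightarrow> (nat \<Rightarrow> 'w) \<Rightarrow> ('w, 'o, 'm) gluing \<Rightarrow> ('w, 'o, 'm) glued \<Rightarrow>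
      int \<Rightarrow> ('w, 'o, 'm) glued" where
  "chain_homology W n s D A i =
     homology_obj (glued_cat W D (carrier W))
       (chain_obj W n s D A (i + 1)) (chain_obj W n s D A i) (chain_obj W n s D A (i - 1))
       (chain_diff W n s D A (i + 1)) (chain_diff W n s D A i)"


subsection \<open>The functor \<open>\<iota>\<close> on objects\<close>

text \<open>Put \<open>c = w\<^sub>0 w w\<^sub>0\<close> and \<open>u = w\<inverse> w\<^sub>0\<close>. Both \<open>w\<^sub>0 = u c\<close> and \<open>w\<^sub>0 = w u\<close> are length-additive, so in the
  braid monoid \<open>\<tau>(w) \<tau>(w\<^sub>0) = \<tau>(w) \<tau>(u) \<tau>(c) = \<tau>(w\<^sub>0) \<tau>(c)\<close>. The isomorphism
  \<open>\<Phi>\<^sub>w \<Phi>\<^sub>w\<^sub>0 X \<rightarrow> \<Phi>\<^sub>w\<^sub>0 \<Phi>\<^sub>c X\<close> defined by this is \<open>\<Phi>\<^sub>w\<close> applied to the inverse of \<open>\<nu>\<^sub>u\<^sub>,\<^sub>c\<close>, followed by \<open>\<nu>\<^sub>w\<^sub>,\<^sub>u\<close>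
  at \<open>\<Phi>\<^sub>c X\<close>; here \<open>X\<close> is an object over \<open>w\<^sub>0 w'\<close>.\<close>

definition braid_iso ::
    "('w, 'x) monoid_scheme \<Rightarrow> 'w set \<Rightarrow> ('w, 'o, 'm) gluing \<Rightarrow> 'w \<Rightarrow> 'w \<Rightarrow> 'o \<Rightarrow> 'm" where
  "braid_iso W S D w w' X =
     (let w0 = longest_elt W S; c = w0 \<otimes>\<^bsub>W\<^esub> w \<otimes>\<^bsub>W\<^esub> w0; u = inv\<^bsub>W\<^esub> w \<otimes>\<^bsub>W\<^esub> w0; v = w0 \<otimes>\<^bsub>W\<^esub> w' in
      Cmp (Cat D (w \<otimes>\<^bsub>W\<^esub> w'))
        (Nu D w u (c \<otimes>\<^bsub>W\<^esub> v) (PhO D c v X))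
        (PhA D w w'
           (inv_arr (Cat D w') (PhO D u (c \<otimes>\<^bsub>W\<^esub> v) (PhO D c v X)) (PhO D w0 v X) (Nu D u c v X))))"

definition iota_obj ::
    "('w, 'x) monoid_scheme \<Rightarrow> 'w set \<Rightarrow> ('w, 'o, 'm) gluing \<Rightarrow> ('w, 'o, 'm) glued \<Rightarrow>
      ('w, 'o, 'm) glued" where
  "iota_obj W S D A =
     (let w0 = longest_elt W S in
      (\<lambda>w\<in>carrier W. PhO D w0 (w0 \<otimes>\<^bsub>W\<^esub> w) (fst A (w0 \<otimes>\<^bsub>W\<^esub> w)),
       \<lambda>w w'. if alpha_ix W (carrier W) w w'
         then Cmp (Cat D (w \<otimes>\<^bsub>W\<^esub> w'))
           (PhA D w0 (w0 \<otimes>\<^bsub>W\<^esub> w \<otimes>\<^bsub>W\<^esub> w')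
              (snd A (w0 \<otimes>\<^bsub>W\<^esub> w \<otimes>\<^bsub>W\<^esub> w0) (w0 \<otimes>\<^bsub>W\<^esub> w')))
           (braid_iso W S D w w' (fst A (w0 \<otimes>\<^bsub>W\<^esub> w')))
         else undefined))"

end

theory Submission
  imports Defs
begin

text \<open>Everything is computed in the components over the elements \<open>w\<close> of \<open>W\<close>. Kernels, finite direct sums
and isomorphisms of a glued category are those of its components (\<open>glued_kernel_eval\<close>,
\<open>glued_direct_sum_eval\<close>, \<open>glued_isoI\<close>), and structure morphisms that are compatible with a jointly
monic family of arrows to glued objects satisfy the axioms automatically (\<open>glued_create\<close>).

A coset \<open>P\<close> contains an element \<open>p\<close>, its gate for \<open>w\<close>, such that \<open>w = g p\<close> with \<open>g\<close> shortest. The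
component over \<open>w\<close> of \<open>j\<^sub>! j\<^sup>* A\<close> is \<open>\<Phi>\<^sub>g A\<^sub>p\<close> (\<open>ext_obj\<close>, \<open>ext_universal\<close>). If \<open>Q\<close> is a larger
coset with gate \<open>q = m p\<close> and \<open>w = h q\<close>, then \<open>g = h m\<close> is length-additive, and the canonical
morphism is the composite \<open>\<Phi>\<^sub>h\<^sub>m A\<^sub>p \<cong> \<Phi>\<^sub>h \<Phi>\<^sub>m A\<^sub>p \<rightarrow> \<Phi>\<^sub>h A\<^sub>q\<close> of an inverse of \<open>\<nu>\<close> with \<open>\<Phi>\<^sub>h\<close> of a
structure morphism of \<open>A\<close> (\<open>canon_eval\<close>). It is an isomorphism if the gates agree; otherwise \<open>h\<close>
is shorter than \<open>g\<close>.

Fix \<open>w\<close>. The cosets of \<open>W\<^sub>S\<^sub>-\<^sub>J\<close> correspond to the elements \<open>g\<close> all of whose right descents \<open>s\<^sub>j\<close>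
have \<open>j\<close> in \<open>J\<close>. Let \<open>k(g)\<close> be the least index that is not a descent of \<open>g\<close>; it exists unless \<open>g\<close>
is the longest element. Adding and removing \<open>k(g)\<close> matches the pairs \<open>(J, g)\<close>. The incidence
morphism between partners is an isomorphism up to sign, and any other one from an upper to a lower
member of matched pairs strictly shortens \<open>g\<close>. So the matched parts of the differentials are
triangular and invertible, and the complex, augmented by the term \<open>A\<close> for \<open>J = \<emptyset>\<close>, is exact except
at the one unmatched pair, which has \<open>J = {1..n}\<close> and the longest element as \<open>g\<close> (\<open>matched_exact\<close>,
\<open>raise_matching\<close>, \<open>cells_cover\<close>, \<open>exact_at\<close>). This gives the vanishing, and exactness of the
augmented complex at its last two places is \<open>H\<^sub>0 \<cong> A\<close>.

In the top degree the pairs are the elements \<open>x\<close> of \<open>W\<close>, and a chain over \<open>w\<close> has components \<open>z\<^sub>x\<close>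
in \<open>\<Phi>\<^sub>g A\<^sub>x\<close> with \<open>g = w x\<inverse>\<close>. The coset \<open>{x, s\<^sub>j x}\<close> with \<open>\<ell>(g s\<^sub>j) > \<ell>(g)\<close> imposes that \<open>z\<^sub>x\<close> is
the negative of the image of the component at \<open>s\<^sub>j x\<close> under a canonical morphism (\<open>cycle_iff\<close>).
Hence a cycle is determined by its component at \<open>x = w\<^sub>0 w\<close>, and this component is arbitrary: the
cycles over \<open>w\<close> form the object \<open>\<Phi>\<^sub>w\<^sub>0 A\<^sub>w\<^sub>0\<^sub>w\<close>, which is the component of \<open>\<iota> A\<close>
(\<open>top_component_iso\<close>). These isomorphisms respect the structure morphism of \<open>g\<close> up to the sign
\<open>(-1)\<close> to the power \<open>\<ell>(g)\<close>, which disappears after multiplication by \<open>(-1)\<close> to the power \<open>\<ell>(w)\<close>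
over each \<open>w\<close> (\<open>kernel_iota\<close>).

The statements about lengths are derived from the presentation of \<open>W\<close> by counting inversions
modulo 2.\<close>

section \<open>Preadditive categories\<close>

definition arr :: "('o, 'm) precat \<Rightarrow> 'o \<Rightarrow> 'o \<Rightarrow> 'm \<Rightarrow> bool" where
  "arr C a b f \<longleftrightarrow> a \<in> Obj C \<and> b \<in> Obj C \<and> f \<in> Hom C a b"

lemma arr_objD: "arr C a b f \<Longrightarrow> a \<in> Obj C" "arr C a b f \<Longrightarrow> b \<in> Obj C"
  by (auto simp: arr_def)

locale preadditive_category =
  fixes C :: "('o, 'm) precat"
  assumes preadditive: "preadditive C"
begin

abbreviation cmp (infixr "\<cdot>" 70) where "g \<cdot> f \<equiv> Cmp C g f"
abbreviation add (infixl "\<oplus>" 65) where "f \<oplus> g \<equiv> Add C f g"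
abbreviation neg where "neg a b f \<equiv> inv\<^bsub>hom_group C a b\<^esub> f"

abbreviation hsum :: "'o \<Rightarrow> 'o \<Rightarrow> ('i \<Rightarrow> 'm) \<Rightarrow> 'i set \<Rightarrow> 'm" where
  "hsum a b f I \<equiv> finprod (hom_group C a b) f I"

lemma hom_group_simps [simp]:
  "carrier (hom_group C a b) = Hom C a b"
  "monoid.mult (hom_group C a b) f g = f \<oplus> g"
  "one (hom_group C a b) = Zer C a b"
  by (simp_all add: hom_group_def)

lemma category: "category C"
  using preadditive by (simp add: preadditive_def)

lemma hom_comm_group: "a \<in> Obj C \<Longrightarrow> b \<in> Obj C \<Longrightarrow> comm_group (hom_group C a b)"
  using preadditive by (simp add: preadditive_def)

lemma arr_comm_group: "arr C a b f \<Longrightarrow> comm_group (hom_group C a b)"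
  by (simp add: arr_def hom_comm_group)

lemma cmp_arr: "arr C a b f \<Longrightarrow> arr C b c g \<Longrightarrow> arr C a c (g \<cdot> f)"
  using category unfolding category_def arr_def by blast

lemma cmp_assoc:
  "arr C a b f \<Longrightarrow> arr C b c g \<Longrightarrow> arr C c d h \<Longrightarrow> h \<cdot> (g \<cdot> f) = (h \<cdot> g) \<cdot> f"
  using category unfolding category_def arr_def by blast

lemma ide_arr: "a \<in> Obj C \<Longrightarrow> arr C a a (Ide C a)"
  using category unfolding category_def arr_def by blast

lemma cmp_ide: "arr C a b f \<Longrightarrow> f \<cdot> Ide C a = f" "arr C a b f \<Longrightarrow> Ide C b \<cdot> f = f"
  using category unfolding category_def arr_def by blast+

lemma zer_arr: "a \<in> Obj C \<Longrightarrow> b \<in> Obj C \<Longrightarrow> arr C a b (Zer C a b)"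
  using comm_groupE(2)[OF hom_comm_group, of a b] by (simp add: arr_def)

lemma add_arr: "arr C a b f \<Longrightarrow> arr C a b g \<Longrightarrow> arr C a b (f \<oplus> g)"
  using comm_groupE(1)[OF arr_comm_group, of a b f f g] by (simp add: arr_def)

lemma neg_arr: "arr C a b f \<Longrightarrow> arr C a b (neg a b f)"
  using group.inv_closed[OF comm_group.axioms(2)[OF arr_comm_group], of a b f f]
  by (simp add: arr_def)

lemma add_zer: "arr C a b f \<Longrightarrow> f \<oplus> Zer C a b = f" "arr C a b f \<Longrightarrow> Zer C a b \<oplus> f = f"
  using monoid.r_one[of "hom_group C a b" f] monoid.l_one[of "hom_group C a b" f]
    arr_comm_group[of a b f]
  by (auto simp: arr_def comm_group_def comm_monoid_def)

lemma add_neg: "arr C a b f \<Longrightarrow> f \<oplus> neg a b f = Zer C a b"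
    "arr C a b f \<Longrightarrow> neg a b f \<oplus> f = Zer C a b"
  using group.r_inv[of "hom_group C a b" f] group.l_inv[of "hom_group C a b" f]
    arr_comm_group[of a b f]
  by (auto simp: arr_def comm_group_def)

lemma add_commute: "arr C a b f \<Longrightarrow> arr C a b g \<Longrightarrow> f \<oplus> g = g \<oplus> f"
  using comm_groupE(4)[OF arr_comm_group, of a b f f g] by (simp add: arr_def)

lemma add_assoc:
  "arr C a b f \<Longrightarrow> arr C a b g \<Longrightarrow> arr C a b h \<Longrightarrow> (f \<oplus> g) \<oplus> h = f \<oplus> (g \<oplus> h)"
  using comm_groupE(3)[OF arr_comm_group, of a b f f g h] by (simp add: arr_def)

lemma neg_unique:
  assumes "arr C a b f" "arr C a b g" "f \<oplus> g = Zer C a b"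
  shows "g = neg a b f"
  using add_assoc[OF neg_arr[OF assms(1)] assms(1,2)] add_neg(2)[OF assms(1)] assms(3)
    add_zer(2)[OF assms(2)] add_zer(1)[OF neg_arr[OF assms(1)]] by simp

lemma neg_neg: "arr C a b f \<Longrightarrow> neg a b (neg a b f) = f"
  using neg_unique[OF neg_arr _ add_neg(2)] by simp

lemma neg_zer: "a \<in> Obj C \<Longrightarrow> b \<in> Obj C \<Longrightarrow> neg a b (Zer C a b) = Zer C a b"
  using neg_unique[OF zer_arr zer_arr add_zer(1)[OF zer_arr]] by simp

lemma cmp_add:
  "arr C a b f \<Longrightarrow> arr C a b f' \<Longrightarrow> arr C b c g \<Longrightarrow> g \<cdot> (f \<oplus> f') = g \<cdot> f \<oplus> g \<cdot> f'"
  "arr C a b f \<Longrightarrow> arr C b c g \<Longrightarrow> arr C b c g' \<Longrightarrow> (g \<oplus> g') \<cdot> f = g \<cdot> f \<oplus> g' \<cdot> f"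
  using preadditive unfolding preadditive_def arr_def by blast+

lemma add_idem_zer: "arr C a b f \<Longrightarrow> f \<oplus> f = f \<Longrightarrow> f = Zer C a b"
  using add_assoc[of a b f f "neg a b f"] neg_arr[of a b f] add_neg(1)[of a b f] add_zer(1)[of a b f]
  by simp

lemma cmp_zer:
  assumes "arr C a b f"
  shows "c \<in> Obj C \<Longrightarrow> f \<cdot> Zer C c a = Zer C c b" "c \<in> Obj C \<Longrightarrow> Zer C b c \<cdot> f = Zer C a c"
proof -
  have o: "a \<in> Obj C" "b \<in> Obj C" using assms by (auto dest: arr_objD)
  show "f \<cdot> Zer C c a = Zer C c b" if c: "c \<in> Obj C"
    using add_idem_zer[OF cmp_arr[OF zer_arr[OF c o(1)] assms]]
      cmp_add(1)[OF zer_arr[OF c o(1)] zer_arr[OF c o(1)] assms] add_zer(1)[OF zer_arr[OF c o(1)]]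
    by simp
  show "Zer C b c \<cdot> f = Zer C a c" if c: "c \<in> Obj C"
    using add_idem_zer[OF cmp_arr[OF assms zer_arr[OF o(2) c]]]
      cmp_add(2)[OF assms zer_arr[OF o(2) c] zer_arr[OF o(2) c]] add_zer(1)[OF zer_arr[OF o(2) c]]
    by simp
qed

lemma cmp_neg:
  assumes "arr C a b f" "arr C b c g"
  shows "g \<cdot> neg a b f = neg a c (g \<cdot> f)" "neg b c g \<cdot> f = neg a c (g \<cdot> f)"
proof -
  have "g \<cdot> f \<oplus> g \<cdot> neg a b f = Zer C a c"
    using cmp_add(1)[OF assms(1) neg_arr[OF assms(1)] assms(2)] add_neg(1)[OF assms(1)]
      cmp_zer(1)[OF assms(2)] assms by (auto dest: arr_objD)
  then show "g \<cdot> neg a b f = neg a c (g \<cdot> f)"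
    by (rule neg_unique[OF cmp_arr[OF assms] cmp_arr[OF neg_arr[OF assms(1)] assms(2)]])
  have "g \<cdot> f \<oplus> neg b c g \<cdot> f = Zer C a c"
    using cmp_add(2)[OF assms(1,2) neg_arr[OF assms(2)]] add_neg(1)[OF assms(2)]
      cmp_zer(2)[OF assms(1)] assms by (auto dest: arr_objD)
  then show "neg b c g \<cdot> f = neg a c (g \<cdot> f)"
    by (rule neg_unique[OF cmp_arr[OF assms] cmp_arr[OF assms(1) neg_arr[OF assms(2)]]])
qed

lemma diff_zer_eq: "arr C a b f \<Longrightarrow> arr C a b g \<Longrightarrow> f \<oplus> neg a b g = Zer C a b \<Longrightarrow> f = g"
  using neg_unique[OF neg_arr, of a b g f] add_commute[OF neg_arr, of a b g f] neg_neg[of a b g]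
  by simp

subsection \<open>Finite sums of arrows\<close>

lemma hsum_empty: "a \<in> Obj C \<Longrightarrow> b \<in> Obj C \<Longrightarrow> hsum a b f {} = Zer C a b"
  using comm_monoid.finprod_empty[OF comm_group.axioms(1)[OF hom_comm_group]] by simp

lemma hsum_arr:
  assumes "a \<in> Obj C" "b \<in> Obj C" "\<And>i. i \<in> I \<Longrightarrow> arr C a b (f i)"
  shows "arr C a b (hsum a b f I)"
proof -
  interpret comm_group "hom_group C a b" by (rule hom_comm_group) fact+
  have "f \<in> I \<rightarrow> carrier (hom_group C a b)" using assms(3) by (auto simp: arr_def)
  from finprod_closed[OF this] show ?thesis using assms by (simp add: arr_def)
qed

lemma hsum_insert:
  assumes "finite I" "i \<notin> I" "\<And>j. j \<in> insert i I \<Longrightarrow> arr C a b (f j)"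
  shows "hsum a b f (insert i I) = f i \<oplus> hsum a b f I"
proof -
  interpret comm_group "hom_group C a b" by (rule arr_comm_group[OF assms(3)[OF insertI1]])
  have "f \<in> I \<rightarrow> carrier (hom_group C a b)" "f i \<in> carrier (hom_group C a b)"
    using assms(3) by (auto simp: arr_def)
  from finprod_insert[OF assms(1,2) this] show ?thesis by simp
qed

lemma hsum_cong:
  assumes "a \<in> Obj C" "b \<in> Obj C" "\<And>i. i \<in> I \<Longrightarrow> arr C a b (g i)" "\<And>i. i \<in> I \<Longrightarrow> f i = g i"
  shows "hsum a b f I = hsum a b g I"
proof -
  interpret comm_group "hom_group C a b" by (rule hom_comm_group) fact+
  show ?thesis
    by (rule finprod_cong') (use assms in \<open>auto simp: arr_def\<close>)
qed

lemma cmp_hsum: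
  assumes "finite I" "a \<in> Obj C" "\<And>i. i \<in> I \<Longrightarrow> arr C a b (f i)" "arr C b c g"
  shows "g \<cdot> hsum a b f I = hsum a c (\<lambda>i. g \<cdot> f i) I"
  using assms(1,3)
proof (induction I rule: finite_induct)
  case empty
  then show ?case using cmp_zer(1)[OF assms(4,2)] arr_objD[OF assms(4)] assms(2) by (simp add: hsum_empty)
next
  case (insert i I)
  have 1: "arr C a b (f i)" and 2: "arr C a b (hsum a b f I)"
    using insert.prems assms(2) arr_objD(1)[OF assms(4)] by (auto intro!: hsum_arr)
  have "\<And>j. j \<in> insert i I \<Longrightarrow> arr C a c (g \<cdot> f j)"
    using insert.prems assms(4) cmp_arr by blast
  from hsum_insert[OF insert.hyps(1,2) this]
  show ?case using hsum_insert[OF insert.hyps insert.prems] insert cmp_add(1)[OF 1 2 assms(4)] by simp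
qed

lemma hsum_cmp:
  assumes "finite I" "c \<in> Obj C" "\<And>i. i \<in> I \<Longrightarrow> arr C b c (f i)" "arr C a b g"
  shows "hsum b c f I \<cdot> g = hsum a c (\<lambda>i. f i \<cdot> g) I"
  using assms(1,3)
proof (induction I rule: finite_induct)
  case empty
  then show ?case using cmp_zer(2)[OF assms(4,2)] arr_objD[OF assms(4)] assms(2) by (simp add: hsum_empty)
next
  case (insert i I)
  have 1: "arr C b c (f i)" and 2: "arr C b c (hsum b c f I)"
    using insert.prems assms(2) arr_objD(2)[OF assms(4)] by (auto intro!: hsum_arr)
  have "\<And>j. j \<in> insert i I \<Longrightarrow> arr C a c (f j \<cdot> g)"
    using insert.prems assms(4) cmp_arr by blast
  from hsum_insert[OF insert.hyps(1,2) this]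
  show ?case using hsum_insert[OF insert.hyps insert.prems] insert cmp_add(2)[OF assms(4) 1 2] by simp
qed

lemma hsum_zero:
  assumes "a \<in> Obj C" "b \<in> Obj C" "\<And>i. i \<in> I \<Longrightarrow> f i = Zer C a b"
  shows "hsum a b f I = Zer C a b"
proof -
  interpret comm_group "hom_group C a b" by (rule hom_comm_group) fact+
  show ?thesis using finprod_one_eqI[of I f] assms by simp
qed

lemma hsum_single:
  assumes "finite I" "k \<in> I" "arr C a b (f k)" "\<And>i. i \<in> I \<Longrightarrow> i \<noteq> k \<Longrightarrow> f i = Zer C a b"
  shows "hsum a b f I = f k"
proof -
  have o: "a \<in> Obj C" "b \<in> Obj C" using assms(3) by (auto dest: arr_objD)
  have "hsum a b f (insert k (I - {k})) = f k \<oplus> hsum a b f (I - {k})"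
  proof (rule hsum_insert)
    fix j assume "j \<in> insert k (I - {k})"
    then show "arr C a b (f j)"
      using assms zer_arr[OF o] by (cases "j = k") auto
  qed (use assms in auto)
  also have "hsum a b f (I - {k}) = Zer C a b" by (rule hsum_zero) (use assms o in auto)
  finally show ?thesis using assms add_zer(1) by (simp add: insert_absorb)
qed

lemma hsum_pair:
  assumes "finite I" "k \<in> I" "l \<in> I" "k \<noteq> l" "arr C a b (f k)" "arr C a b (f l)"
    "\<And>i. i \<in> I \<Longrightarrow> i \<noteq> k \<Longrightarrow> i \<noteq> l \<Longrightarrow> f i = Zer C a b"
  shows "hsum a b f I = f k \<oplus> f l"
proof -
  have o: "a \<in> Obj C" "b \<in> Obj C" using assms(5) by (auto dest: arr_objD)
  have "hsum a b f (insert k (I - {k})) = f k \<oplus> hsum a b f (I - {k})"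
  proof (rule hsum_insert)
    fix j assume "j \<in> insert k (I - {k})"
    then show "arr C a b (f j)"
      using assms zer_arr[OF o] by (cases "j = k"; cases "j = l") auto
  qed (use assms in auto)
  also have "hsum a b f (I - {k}) = f l" by (rule hsum_single) (use assms in auto)
  finally show ?thesis using assms by (simp add: insert_absorb)
qed

subsection \<open>Direct sums\<close>

text \<open>The second clause does not follow from the first, which only speaks of the hom-sets of the
  summands.\<close>

definition direct_sum_data where
  "direct_sum_data I X B inc prj \<longleftrightarrow> is_direct_sum C I X B inc prj \<and> (\<forall>i\<in>I. X i \<in> Obj C)"

lemma dsd_facts:
  assumes "direct_sum_data I X B inc prj"
  shows dsd_finite: "finite I" and dsd_obj: "B \<in> Obj C"
    and dsd_X: "i \<in> I \<Longrightarrow> X i \<in> Obj C"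
    and dsd_inc: "i \<in> I \<Longrightarrow> arr C (X i) B (inc i)"
    and dsd_prj: "i \<in> I \<Longrightarrow> arr C B (X i) (prj i)"
    and dsd_same: "i \<in> I \<Longrightarrow> prj i \<cdot> inc i = Ide C (X i)"
    and dsd_diff: "i \<in> I \<Longrightarrow> j \<in> I \<Longrightarrow> i \<noteq> j \<Longrightarrow> prj j \<cdot> inc i = Zer C (X i) (X j)"
    and dsd_sum: "hsum B B (\<lambda>i. inc i \<cdot> prj i) I = Ide C B"
  using assms unfolding direct_sum_data_def is_direct_sum_def arr_def by auto

lemma dsd_expand:
  assumes "direct_sum_data I X B inc prj" "arr C T B t" "arr C B U f"
  shows "f \<cdot> t = hsum T U (\<lambda>i. (f \<cdot> inc i) \<cdot> (prj i \<cdot> t)) I"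
proof -
  note D = dsd_facts[OF assms(1)]
  have o: "T \<in> Obj C" "B \<in> Obj C" "U \<in> Obj C" using assms by (auto dest: arr_objD)
  have ip: "\<And>i. i \<in> I \<Longrightarrow> arr C B B (inc i \<cdot> prj i)" by (rule cmp_arr[OF D(5,4)])
  have "t = hsum B B (\<lambda>i. inc i \<cdot> prj i) I \<cdot> t" using D(8) cmp_ide(2)[OF assms(2)] by simp
  also have "\<dots> = hsum T B (\<lambda>i. (inc i \<cdot> prj i) \<cdot> t) I"
    by (rule hsum_cmp[OF D(1) o(2) ip assms(2)])
  finally have "f \<cdot> t = f \<cdot> hsum T B (\<lambda>i. (inc i \<cdot> prj i) \<cdot> t) I" by simp
  also have "\<dots> = hsum T U (\<lambda>i. f \<cdot> ((inc i \<cdot> prj i) \<cdot> t)) I"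
    by (rule cmp_hsum[OF D(1) o(1) cmp_arr[OF assms(2) ip] assms(3)])
  also have "\<dots> = hsum T U (\<lambda>i. (f \<cdot> inc i) \<cdot> (prj i \<cdot> t)) I"
  proof (rule hsum_cong[OF o(1,3)])
    fix i assume i: "i \<in> I"
    note a = D(4)[OF i] D(5)[OF i]
    show "arr C T U ((f \<cdot> inc i) \<cdot> (prj i \<cdot> t))"
      by (rule cmp_arr[OF cmp_arr[OF assms(2) a(2)] cmp_arr[OF a(1) assms(3)]])
    show "f \<cdot> ((inc i \<cdot> prj i) \<cdot> t) = (f \<cdot> inc i) \<cdot> (prj i \<cdot> t)"
      using cmp_assoc[OF assms(2) a(2,1)] cmp_assoc[OF cmp_arr[OF assms(2) a(2)] a(1) assms(3)]
      by simp
  qed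
  finally show ?thesis .
qed

lemma dsd_expand_single:
  assumes "direct_sum_data I X B inc prj" "arr C T B t" "arr C B U f" "k \<in> I"
    "\<And>i. i \<in> I \<Longrightarrow> i \<noteq> k \<Longrightarrow> f \<cdot> inc i = Zer C (X i) U \<or> prj i \<cdot> t = Zer C T (X i)"
  shows "f \<cdot> t = (f \<cdot> inc k) \<cdot> (prj k \<cdot> t)"
  unfolding dsd_expand[OF assms(1-3)]
proof (rule hsum_single)
  note D = dsd_facts[OF assms(1)]
  show "finite I" "k \<in> I" using D assms by auto
  show "arr C T U ((f \<cdot> inc k) \<cdot> prj k \<cdot> t)"
    by (rule cmp_arr[OF cmp_arr[OF assms(2) D(5)[OF assms(4)]] cmp_arr[OF D(4)[OF assms(4)] assms(3)]])
  show "(f \<cdot> inc i) \<cdot> (prj i \<cdot> t) = Zer C T U" if i: "i \<in> I" "i \<noteq> k" for i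
    using assms(5)[OF i] cmp_zer(2)[OF cmp_arr[OF assms(2) D(5)[OF i(1)]] arr_objD(2)[OF assms(3)]]
      cmp_zer(1)[OF cmp_arr[OF D(4)[OF i(1)] assms(3)] arr_objD(1)[OF assms(2)]] by auto
qed

lemma dsd_expand_pair:
  assumes "direct_sum_data I X B inc prj" "arr C T B t" "arr C B U f" "k \<in> I" "l \<in> I" "k \<noteq> l"
    "\<And>i. i \<in> I \<Longrightarrow> i \<noteq> k \<Longrightarrow> i \<noteq> l \<Longrightarrow> f \<cdot> inc i = Zer C (X i) U \<or> prj i \<cdot> t = Zer C T (X i)"
  shows "f \<cdot> t = (f \<cdot> inc k) \<cdot> (prj k \<cdot> t) \<oplus> (f \<cdot> inc l) \<cdot> (prj l \<cdot> t)"
  unfolding dsd_expand[OF assms(1-3)]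
proof (rule hsum_pair)
  note D = dsd_facts[OF assms(1)]
  show "finite I" "k \<in> I" "l \<in> I" "k \<noteq> l" using D assms by auto
  show "arr C T U ((f \<cdot> inc k) \<cdot> prj k \<cdot> t)"
    by (rule cmp_arr[OF cmp_arr[OF assms(2) D(5)[OF assms(4)]] cmp_arr[OF D(4)[OF assms(4)] assms(3)]])
  show "arr C T U ((f \<cdot> inc l) \<cdot> prj l \<cdot> t)"
    by (rule cmp_arr[OF cmp_arr[OF assms(2) D(5)[OF assms(5)]] cmp_arr[OF D(4)[OF assms(5)] assms(3)]])
  show "(f \<cdot> inc i) \<cdot> (prj i \<cdot> t) = Zer C T U" if i: "i \<in> I" "i \<noteq> k" "i \<noteq> l" for i
    using assms(7)[OF i] cmp_zer(2)[OF cmp_arr[OF assms(2) D(5)[OF i(1)]] arr_objD(2)[OF assms(3)]]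
      cmp_zer(1)[OF cmp_arr[OF D(4)[OF i(1)] assms(3)] arr_objD(1)[OF assms(2)]] by auto
qed

lemma dsd_ext:
  assumes "direct_sum_data I X B inc prj" "arr C T B t" "arr C T B t'"
    "\<And>i. i \<in> I \<Longrightarrow> prj i \<cdot> t = prj i \<cdot> t'"
  shows "t = t'"
proof -
  note D = dsd_facts[OF assms(1)]
  have "Ide C B \<cdot> t = Ide C B \<cdot> t'"
    unfolding dsd_expand[OF assms(1,2) ide_arr[OF D(2)]] dsd_expand[OF assms(1,3) ide_arr[OF D(2)]]
  proof (rule hsum_cong)
    fix i assume i: "i \<in> I"
    show "arr C T B ((Ide C B \<cdot> inc i) \<cdot> prj i \<cdot> t')"
      by (rule cmp_arr[OF cmp_arr[OF assms(3) D(5)[OF i]] cmp_arr[OF D(4)[OF i] ide_arr[OF D(2)]]])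
    show "(Ide C B \<cdot> inc i) \<cdot> prj i \<cdot> t = (Ide C B \<cdot> inc i) \<cdot> prj i \<cdot> t'" using assms(4)[OF i] by simp
  qed (use assms D in \<open>auto dest: arr_objD\<close>)
  then show ?thesis using cmp_ide(2)[OF assms(2)] cmp_ide(2)[OF assms(3)] by simp
qed

lemma dsd_ext_inc:
  assumes "direct_sum_data I X B inc prj" "arr C B U t" "arr C B U t'"
    "\<And>i. i \<in> I \<Longrightarrow> t \<cdot> inc i = t' \<cdot> inc i"
  shows "t = t'"
proof -
  note D = dsd_facts[OF assms(1)]
  have "t \<cdot> Ide C B = t' \<cdot> Ide C B"
    unfolding dsd_expand[OF assms(1) ide_arr[OF D(2)] assms(2)]
      dsd_expand[OF assms(1) ide_arr[OF D(2)] assms(3)]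
  proof (rule hsum_cong)
    fix i assume i: "i \<in> I"
    show "arr C B U ((t' \<cdot> inc i) \<cdot> prj i \<cdot> Ide C B)"
      by (rule cmp_arr[OF cmp_arr[OF ide_arr[OF D(2)] D(5)[OF i]] cmp_arr[OF D(4)[OF i] assms(3)]])
    show "(t \<cdot> inc i) \<cdot> prj i \<cdot> Ide C B = (t' \<cdot> inc i) \<cdot> prj i \<cdot> Ide C B" using assms(4)[OF i] by simp
  qed (use assms D in \<open>auto dest: arr_objD\<close>)
  then show ?thesis using cmp_ide(1)[OF assms(2)] cmp_ide(1)[OF assms(3)] by simp
qed

lemma dsd_tuple:
  assumes "direct_sum_data I X B inc prj" "T \<in> Obj C" "\<And>i. i \<in> I \<Longrightarrow> arr C T (X i) (f i)"
  obtains t where "arr C T B t" "\<And>i. i \<in> I \<Longrightarrow> prj i \<cdot> t = f i"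
proof
  note D = dsd_facts[OF assms(1)]
  have a: "\<And>i. i \<in> I \<Longrightarrow> arr C T B (inc i \<cdot> f i)" by (rule cmp_arr[OF assms(3) D(4)])
  let ?t = "hsum T B (\<lambda>i. inc i \<cdot> f i) I"
  show "arr C T B ?t" by (rule hsum_arr[OF assms(2) D(2) a])
  fix k assume k: "k \<in> I"
  have "prj k \<cdot> ?t = hsum T (X k) (\<lambda>i. prj k \<cdot> (inc i \<cdot> f i)) I"
    by (rule cmp_hsum[OF D(1) assms(2) a D(5)[OF k]])
  also have "\<dots> = prj k \<cdot> (inc k \<cdot> f k)"
  proof (rule hsum_single[OF D(1) k])
    show "arr C T (X k) (prj k \<cdot> (inc k \<cdot> f k))" by (rule cmp_arr[OF a[OF k] D(5)[OF k]])
    fix i assume i: "i \<in> I" "i \<noteq> k"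
    have "prj k \<cdot> (inc i \<cdot> f i) = Zer C (X i) (X k) \<cdot> f i"
      using cmp_assoc[OF assms(3)[OF i(1)] D(4)[OF i(1)] D(5)[OF k]] D(7)[OF i(1) k i(2)] by simp
    then show "prj k \<cdot> (inc i \<cdot> f i) = Zer C T (X k)"
      using cmp_zer(2)[OF assms(3)[OF i(1)] D(3)[OF k]] by simp
  qed
  also have "\<dots> = f k"
    using cmp_assoc[OF assms(3)[OF k] D(4)[OF k] D(5)[OF k]] D(6)[OF k] cmp_ide(2)[OF assms(3)[OF k]]
    by simp
  finally show "prj k \<cdot> ?t = f k" .
qed

text \<open>Joint monicity of the projections replaces the decomposition of the identity: the sum of the
  \<open>inc i \<cdot> prj i\<close> and the identity have the same components.\<close>

lemma dsd_intro:
  assumes "finite I" "B \<in> Obj C" "\<And>i. i \<in> I \<Longrightarrow> arr C (X i) B (inc i)"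
    "\<And>i. i \<in> I \<Longrightarrow> arr C B (X i) (prj i)"
    "\<And>i. i \<in> I \<Longrightarrow> prj i \<cdot> inc i = Ide C (X i)"
    "\<And>i j. i \<in> I \<Longrightarrow> j \<in> I \<Longrightarrow> i \<noteq> j \<Longrightarrow> prj j \<cdot> inc i = Zer C (X i) (X j)"
    "\<And>t t'. arr C B B t \<Longrightarrow> arr C B B t' \<Longrightarrow> (\<And>i. i \<in> I \<Longrightarrow> prj i \<cdot> t = prj i \<cdot> t') \<Longrightarrow> t = t'"
  shows "direct_sum_data I X B inc prj"
proof -
  have a: "\<And>i. i \<in> I \<Longrightarrow> arr C B B (inc i \<cdot> prj i)" by (rule cmp_arr[OF assms(4,3)])
  have "hsum B B (\<lambda>i. inc i \<cdot> prj i) I = Ide C B"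
  proof (rule assms(7))
    show "arr C B B (hsum B B (\<lambda>i. inc i \<cdot> prj i) I)" by (rule hsum_arr[OF assms(2,2) a])
    show "arr C B B (Ide C B)" by (rule ide_arr[OF assms(2)])
    fix k assume k: "k \<in> I"
    have "prj k \<cdot> hsum B B (\<lambda>i. inc i \<cdot> prj i) I = hsum B (X k) (\<lambda>i. prj k \<cdot> (inc i \<cdot> prj i)) I"
      by (rule cmp_hsum[OF assms(1,2) a assms(4)[OF k]])
    also have "\<dots> = prj k \<cdot> (inc k \<cdot> prj k)"
    proof (rule hsum_single[OF assms(1) k])
      show "arr C B (X k) (prj k \<cdot> (inc k \<cdot> prj k))" by (rule cmp_arr[OF a[OF k] assms(4)[OF k]])
      fix i assume i: "i \<in> I" "i \<noteq> k"
      have "prj k \<cdot> (inc i \<cdot> prj i) = Zer C (X i) (X k) \<cdot> prj i"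
        using cmp_assoc[OF assms(4)[OF i(1)] assms(3)[OF i(1)] assms(4)[OF k]]
          assms(6)[OF i(1) k i(2)] by simp
      then show "prj k \<cdot> (inc i \<cdot> prj i) = Zer C B (X k)"
        using cmp_zer(2)[OF assms(4)[OF i(1)]] arr_objD(2)[OF assms(4)[OF k]] by simp
    qed
    also have "\<dots> = prj k \<cdot> Ide C B"
      using cmp_assoc[OF assms(4)[OF k] assms(3)[OF k] assms(4)[OF k]] assms(5)[OF k]
        cmp_ide[OF assms(4)[OF k]] by simp
    finally show "prj k \<cdot> hsum B B (\<lambda>i. inc i \<cdot> prj i) I = prj k \<cdot> Ide C B" .
  qed
  then show ?thesis
    using assms(1-6) unfolding direct_sum_data_def is_direct_sum_def arr_def by auto
qed

lemma dsd_empty: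
  assumes "direct_sum_data {} X B inc prj"
  shows "is_zero_object C B"
proof -
  note B = dsd_obj[OF assms]
  show ?thesis
    unfolding is_zero_object_def
  proof (intro conjI ballI B ex1I)
    fix a assume a: "a \<in> Obj C"
    show "Zer C B a \<in> Hom C B a" "Zer C a B \<in> Hom C a B"
      using zer_arr[OF B a] zer_arr[OF a B] by (auto simp: arr_def)
    show "f = Zer C B a" if "f \<in> Hom C B a" for f
      by (rule dsd_ext_inc[OF assms]) (use that a B zer_arr[OF B a] in \<open>auto simp: arr_def\<close>)
    show "f = Zer C a B" if "f \<in> Hom C a B" for f
      by (rule dsd_ext[OF assms]) (use that a B zer_arr[OF a B] in \<open>auto simp: arr_def\<close>)
  qed
qed

text \<open>The chain objects are direct sums of direct sums; this makes them sums over one index set, the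
  cells.\<close>

lemma dsd_flatten:
  assumes "direct_sum_data I X B inc prj"
    "\<And>i. i \<in> I \<Longrightarrow> direct_sum_data (J i) (Y i) (X i) (inc' i) (prj' i)"
  shows "direct_sum_data (Sigma I J) (\<lambda>(i, j). Y i j) B
    (\<lambda>(i, j). inc i \<cdot> inc' i j) (\<lambda>(i, j). prj' i j \<cdot> prj i)"
proof -
  note D = dsd_facts[OF assms(1)]
  note E = dsd_facts[OF assms(2)]
  have mid: "(prj' i' j' \<cdot> prj i') \<cdot> (inc i \<cdot> inc' i j) = prj' i' j' \<cdot> ((prj i' \<cdot> inc i) \<cdot> inc' i j)"
    if "i \<in> I" "j \<in> J i" "i' \<in> I" "j' \<in> J i'" for i j i' j'
  proof -
    note a = E(4)[OF that(1,2)] D(4)[OF that(1)] D(5)[OF that(3)] E(5)[OF that(3,4)]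
    show ?thesis
      using cmp_assoc[OF cmp_arr[OF a(1,2)] a(3,4)] cmp_assoc[OF a(1,2,3)] by simp
  qed
  show ?thesis
  proof (rule dsd_intro)
    show "finite (Sigma I J)" using D(1) E(1) by auto
    show "B \<in> Obj C" by (rule D(2))
    show "arr C (case x of (i, j) \<Rightarrow> Y i j) B (case x of (i, j) \<Rightarrow> inc i \<cdot> inc' i j)"
      if "x \<in> Sigma I J" for x using that by (auto intro: cmp_arr[OF E(4) D(4)])
    show "arr C B (case x of (i, j) \<Rightarrow> Y i j) (case x of (i, j) \<Rightarrow> prj' i j \<cdot> prj i)"
      if "x \<in> Sigma I J" for x using that by (auto intro: cmp_arr[OF D(5) E(5)])
    show "(case x of (i, j) \<Rightarrow> prj' i j \<cdot> prj i) \<cdot> (case x of (i, j) \<Rightarrow> inc i \<cdot> inc' i j)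
        = Ide C (case x of (i, j) \<Rightarrow> Y i j)" if "x \<in> Sigma I J" for x
      using that mid D(6) E(6) cmp_ide(2)[OF E(4)] by auto
    show "(case y of (i, j) \<Rightarrow> prj' i j \<cdot> prj i) \<cdot> (case x of (i, j) \<Rightarrow> inc i \<cdot> inc' i j)
        = Zer C (case x of (i, j) \<Rightarrow> Y i j) (case y of (i, j) \<Rightarrow> Y i j)"
      if xy: "x \<in> Sigma I J" "y \<in> Sigma I J" "x \<noteq> y" for x y
    proof -
      obtain i j i' j' where e: "x = (i, j)" "y = (i', j')" "i \<in> I" "j \<in> J i" "i' \<in> I" "j' \<in> J i'"
        using xy by auto
      show ?thesis
      proof (cases "i = i'")
        case True
        then show ?thesis using e xy mid[OF e(3-6)] D(6) E(7) cmp_ide(2)[OF E(4)] by auto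
      next
        case False
        then show ?thesis
          using e mid[OF e(3-6)] D(7) cmp_zer(2)[OF E(4)[OF e(3,4)] D(3)[OF e(5)]]
            cmp_zer(1)[OF E(5)[OF e(5,6)]] E(3)[OF e(3,4)] by auto
      qed
    qed
    fix t t' assume t: "arr C B B t" "arr C B B t'"
      and eq: "\<And>x. x \<in> Sigma I J \<Longrightarrow> (case x of (i, j) \<Rightarrow> prj' i j \<cdot> prj i) \<cdot> t =
        (case x of (i, j) \<Rightarrow> prj' i j \<cdot> prj i) \<cdot> t'"
    show "t = t'"
    proof (rule dsd_ext[OF assms(1) t])
      fix i assume i: "i \<in> I"
      show "prj i \<cdot> t = prj i \<cdot> t'"
      proof (rule dsd_ext[OF assms(2)[OF i] cmp_arr[OF t(1) D(5)[OF i]] cmp_arr[OF t(2) D(5)[OF i]]])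
        fix j assume j: "j \<in> J i"
        show "prj' i j \<cdot> prj i \<cdot> t = prj' i j \<cdot> prj i \<cdot> t'"
          using eq[of "(i, j)"] i j cmp_assoc[OF t(1) D(5)[OF i] E(5)[OF i j]]
            cmp_assoc[OF t(2) D(5)[OF i] E(5)[OF i j]] by auto
      qed
    qed
  qed
qed

lemma dsd_matrix:
  assumes "direct_sum_data I X B inc prj" "direct_sum_data J Y B' inc' prj'"
    "\<And>i j. i \<in> I \<Longrightarrow> j \<in> J \<Longrightarrow> arr C (X i) (Y j) (m i j)"
  shows "\<exists>!f. f \<in> Hom C B B' \<and> (\<forall>i\<in>I. \<forall>j\<in>J. prj' j \<cdot> (f \<cdot> inc i) = m i j)"
proof -
  note D = dsd_facts[OF assms(1)]
  note E = dsd_facts[OF assms(2)]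
  have "\<forall>j\<in>J. \<exists>f. arr C B (Y j) f \<and> (\<forall>i\<in>I. f \<cdot> inc i = m i j)"
  proof
    fix j assume j: "j \<in> J"
    have a: "arr C B (Y j) (m i j \<cdot> prj i)" if "i \<in> I" for i
      by (rule cmp_arr[OF D(5)[OF that] assms(3)[OF that j]])
    let ?f = "hsum B (Y j) (\<lambda>i. m i j \<cdot> prj i) I"
    have "?f \<cdot> inc k = m k j" if k: "k \<in> I" for k
    proof -
      have "?f \<cdot> inc k = hsum (X k) (Y j) (\<lambda>i. (m i j \<cdot> prj i) \<cdot> inc k) I"
        by (rule hsum_cmp[OF D(1) E(3)[OF j] a D(4)[OF k]])
      also have "\<dots> = (m k j \<cdot> prj k) \<cdot> inc k"
      proof (rule hsum_single[OF D(1) k])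
        show "arr C (X k) (Y j) ((m k j \<cdot> prj k) \<cdot> inc k)" by (rule cmp_arr[OF D(4)[OF k] a[OF k]])
        fix i assume i: "i \<in> I" "i \<noteq> k"
        show "(m i j \<cdot> prj i) \<cdot> inc k = Zer C (X k) (Y j)"
          using cmp_assoc[OF D(4)[OF k] D(5)[OF i(1)] assms(3)[OF i(1) j]] D(7)[OF k i(1)] i(2)
            cmp_zer(1)[OF assms(3)[OF i(1) j]] D(3)[OF k] by simp
      qed
      also have "\<dots> = m k j"
        using cmp_assoc[OF D(4)[OF k] D(5)[OF k] assms(3)[OF k j]] D(6)[OF k]
          cmp_ide(1)[OF assms(3)[OF k j]] by simp
      finally show ?thesis .
    qed
    then show "\<exists>f. arr C B (Y j) f \<and> (\<forall>i\<in>I. f \<cdot> inc i = m i j)"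
      using hsum_arr[OF D(2) E(3)[OF j] a] by (intro exI[of _ ?f]) simp
  qed
  from bchoice[OF this] obtain F where F: "\<And>j. j \<in> J \<Longrightarrow> arr C B (Y j) (F j)"
      "\<And>i j. i \<in> I \<Longrightarrow> j \<in> J \<Longrightarrow> F j \<cdot> inc i = m i j" by auto
  obtain f where f: "arr C B B' f" "\<And>j. j \<in> J \<Longrightarrow> prj' j \<cdot> f = F j"
    by (rule dsd_tuple[OF assms(2) D(2) F(1)]) simp_all
  have fm: "prj' j \<cdot> (f \<cdot> inc i) = m i j" if "i \<in> I" "j \<in> J" for i j
    using cmp_assoc[OF D(4)[OF that(1)] f(1) E(5)[OF that(2)]] f(2)[OF that(2)] F(2)[OF that] by simp
  show ?thesis
  proof (rule ex1I[of _ f])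
    show "f \<in> Hom C B B' \<and> (\<forall>i\<in>I. \<forall>j\<in>J. prj' j \<cdot> (f \<cdot> inc i) = m i j)"
      using f(1) fm by (auto simp: arr_def)
    fix g assume g: "g \<in> Hom C B B' \<and> (\<forall>i\<in>I. \<forall>j\<in>J. prj' j \<cdot> (g \<cdot> inc i) = m i j)"
    then have ga: "arr C B B' g" using D(2) E(2) by (simp add: arr_def)
    show "g = f"
    proof (rule dsd_ext_inc[OF assms(1) ga f(1)])
      fix i assume i: "i \<in> I"
      show "g \<cdot> inc i = f \<cdot> inc i"
        by (rule dsd_ext[OF assms(2) cmp_arr[OF D(4)[OF i] ga] cmp_arr[OF D(4)[OF i] f(1)]])
          (use g i in \<open>simp add: fm\<close>)
    qed
  qed
qed

subsection \<open>Isomorphisms, kernels, cokernels and homology\<close>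

lemma is_isoE:
  assumes "is_iso C a b f" "a \<in> Obj C" "b \<in> Obj C"
  obtains g where "arr C a b f" "arr C b a g" "g \<cdot> f = Ide C a" "f \<cdot> g = Ide C b"
  using assms unfolding is_iso_def is_inverse_def arr_def by blast

lemma is_isoI:
  assumes "arr C a b f" "arr C b a g" "g \<cdot> f = Ide C a" "f \<cdot> g = Ide C b"
  shows "is_iso C a b f"
  using assms unfolding is_iso_def is_inverse_def arr_def by blast

lemma inverse_unique:
  assumes "arr C a b f" "arr C b a g" "arr C b a h" "g \<cdot> f = Ide C a" "f \<cdot> h = Ide C b"
  shows "g = h"
  using cmp_assoc[OF assms(3,1,2)] assms(4,5) cmp_ide(1)[OF assms(2)] cmp_ide(2)[OF assms(3)] by simp

lemma inv_arr_facts: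
  assumes "is_iso C a b f" "a \<in> Obj C" "b \<in> Obj C"
  shows "arr C b a (inv_arr C a b f)" "inv_arr C a b f \<cdot> f = Ide C a" "f \<cdot> inv_arr C a b f = Ide C b"
proof -
  obtain g where g: "arr C a b f" "arr C b a g" "g \<cdot> f = Ide C a" "f \<cdot> g = Ide C b"
    using is_isoE[OF assms] .
  have "is_inverse C a b f g" using g by (simp add: is_inverse_def arr_def)
  moreover have "h = g" if "is_inverse C a b f h" for h
    by (rule inverse_unique[OF g(1) _ g(2) _ g(4)])
      (use that assms(2,3) in \<open>auto simp: is_inverse_def arr_def\<close>)
  ultimately have "inv_arr C a b f = g" unfolding inv_arr_def by (rule the_equality)
  then show "arr C b a (inv_arr C a b f)" "inv_arr C a b f \<cdot> f = Ide C a"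
    "f \<cdot> inv_arr C a b f = Ide C b" using g by auto
qed

lemma iso_cancel_left:
  assumes "is_iso C a b f" "arr C a b f" "arr C T a t" "arr C T a t'" "f \<cdot> t = f \<cdot> t'"
  shows "t = t'"
proof -
  obtain g where g: "arr C b a g" "g \<cdot> f = Ide C a"
    using is_isoE[OF assms(1)] assms(2) by (auto dest: arr_objD)
  have "g \<cdot> (f \<cdot> t) = g \<cdot> (f \<cdot> t')" by (simp only: assms(5))
  then show ?thesis
    by (simp only: cmp_assoc[OF assms(3,2) g(1)] cmp_assoc[OF assms(4,2) g(1)] g(2)
      cmp_ide(2)[OF assms(3)] cmp_ide(2)[OF assms(4)])
qed

lemma iso_cancel_right:
  assumes "is_iso C a b f" "arr C a b f" "arr C b T t" "arr C b T t'" "t \<cdot> f = t' \<cdot> f"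
  shows "t = t'"
proof -
  obtain g where g: "arr C b a g" "f \<cdot> g = Ide C b"
    using is_isoE[OF assms(1)] assms(2) by (auto dest: arr_objD)
  have "(t \<cdot> f) \<cdot> g = (t' \<cdot> f) \<cdot> g" by (simp only: assms(5))
  then show ?thesis
    by (simp only: cmp_assoc[OF g(1) assms(2,3), symmetric] cmp_assoc[OF g(1) assms(2,4), symmetric]
      g(2) cmp_ide(1)[OF assms(3)] cmp_ide(1)[OF assms(4)])
qed

lemma is_iso_cmp:
  assumes "is_iso C a b f" "is_iso C b c g" "arr C a b f" "arr C b c g"
  shows "is_iso C a c (g \<cdot> f)"
proof -
  obtain f' where f: "arr C b a f'" "f' \<cdot> f = Ide C a" "f \<cdot> f' = Ide C b"
    using is_isoE[OF assms(1)] assms(3) by (auto dest: arr_objD)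
  obtain g' where g: "arr C c b g'" "g' \<cdot> g = Ide C b" "g \<cdot> g' = Ide C c"
    using is_isoE[OF assms(2)] assms(4) by (auto dest: arr_objD)
  show ?thesis
  proof (rule is_isoI)
    show "arr C a c (g \<cdot> f)" "arr C c a (f' \<cdot> g')" by (rule cmp_arr assms f g)+
    have "(f' \<cdot> g') \<cdot> g \<cdot> f = f' \<cdot> ((g' \<cdot> g) \<cdot> f)"
      using cmp_assoc[OF cmp_arr[OF assms(3,4)] g(1) f(1)] cmp_assoc[OF assms(3,4) g(1)] by simp
    then show "(f' \<cdot> g') \<cdot> g \<cdot> f = Ide C a" using g f cmp_ide(2)[OF assms(3)] by simp
    have "(g \<cdot> f) \<cdot> f' \<cdot> g' = g \<cdot> ((f \<cdot> f') \<cdot> g')"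
      using cmp_assoc[OF cmp_arr[OF g(1) f(1)] assms(3,4)] cmp_assoc[OF g(1) f(1) assms(3)] by simp
    then show "(g \<cdot> f) \<cdot> f' \<cdot> g' = Ide C c" using g f cmp_ide(2)[OF g(1)] by simp
  qed
qed

lemma is_iso_neg:
  assumes "is_iso C a b f" "arr C a b f"
  shows "is_iso C a b (neg a b f)"
proof -
  obtain f' where f: "arr C b a f'" "f' \<cdot> f = Ide C a" "f \<cdot> f' = Ide C b"
    using is_isoE[OF assms(1)] assms(2) by (auto dest: arr_objD)
  show ?thesis
    by (rule is_isoI[OF neg_arr[OF assms(2)] neg_arr[OF f(1)]])
      (use f cmp_neg[OF assms(2) neg_arr[OF f(1)]] cmp_neg[OF assms(2) f(1)]
        cmp_neg[OF neg_arr[OF f(1)] assms(2)] cmp_neg[OF f(1) assms(2)]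
        neg_neg[OF cmp_arr[OF assms(2) f(1)]] neg_neg[OF cmp_arr[OF f(1) assms(2)]] in simp_all)
qed

lemma kernel_facts:
  assumes "is_kernel C a b f K k" "arr C a b f"
  shows kernel_arr: "arr C K a k" and kernel_zero: "f \<cdot> k = Zer C K b"
    and kernel_mono: "arr C T K u \<Longrightarrow> arr C T K v \<Longrightarrow> k \<cdot> u = k \<cdot> v \<Longrightarrow> u = v"
    and kernel_lift: "arr C T a t \<Longrightarrow> f \<cdot> t = Zer C T b \<Longrightarrow> \<exists>u. arr C T K u \<and> k \<cdot> u = t"
proof -
  show a: "arr C K a k" and z: "f \<cdot> k = Zer C K b"
    using assms unfolding is_kernel_def arr_def by auto
  have U: "\<exists>!u. u \<in> Hom C T K \<and> k \<cdot> u = t" if "arr C T a t" "f \<cdot> t = Zer C T b" for T t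
    using assms(1) that unfolding is_kernel_def arr_def by blast
  show "\<exists>u. arr C T K u \<and> k \<cdot> u = t" if "arr C T a t" "f \<cdot> t = Zer C T b"
    using ex1_implies_ex[OF U[OF that]] that(1) a by (auto simp: arr_def)
  show "u = v" if uv: "arr C T K u" "arr C T K v" "k \<cdot> u = k \<cdot> v"
  proof -
    have "f \<cdot> (k \<cdot> u) = Zer C T b"
      using cmp_assoc[OF uv(1) a assms(2)] z cmp_zer(2)[OF uv(1) arr_objD(2)[OF assms(2)]] by simp
    from U[OF cmp_arr[OF uv(1) a] this] show ?thesis using uv unfolding arr_def by metis
  qed
qed

lemma is_kernelI:
  assumes "arr C K a k" "f \<cdot> k = Zer C K b"
    "\<And>T t. arr C T a t \<Longrightarrow> f \<cdot> t = Zer C T b \<Longrightarrow> \<exists>u. arr C T K u \<and> k \<cdot> u = t"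
    "\<And>T u v. arr C T K u \<Longrightarrow> arr C T K v \<Longrightarrow> k \<cdot> u = k \<cdot> v \<Longrightarrow> u = v"
  shows "is_kernel C a b f K k"
  unfolding is_kernel_def
proof (intro conjI ballI impI)
  show "K \<in> Obj C" "k \<in> Hom C K a" "f \<cdot> k = Zer C K b" using assms(1,2) by (auto simp: arr_def)
  fix T t assume t: "T \<in> Obj C" "t \<in> Hom C T a" "f \<cdot> t = Zer C T b"
  then obtain u where "arr C T K u" "k \<cdot> u = t"
    using assms(1) assms(3)[of T t] by (auto simp: arr_def)
  then show "\<exists>!u. u \<in> Hom C T K \<and> k \<cdot> u = t"
    using assms(4)[of T] by (intro ex1I[of _ u]) (auto simp: arr_def)
qed

lemma kernel_comparison:
  assumes "is_kernel C a b f K k" "is_kernel C a b f K' k'" "arr C a b f"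
  obtains v where "arr C K' K v" "is_iso C K' K v" "k \<cdot> v = k'"
proof -
  note K = kernel_facts[OF assms(1,3)]
  note K' = kernel_facts[OF assms(2,3)]
  obtain v where v: "arr C K' K v" "k \<cdot> v = k'" using K(4)[OF K'(1,2)] by blast
  obtain v' where v': "arr C K K' v'" "k' \<cdot> v' = k" using K'(4)[OF K(1,2)] by blast
  have "v \<cdot> v' = Ide C K"
    by (rule K(3)[OF cmp_arr[OF v'(1) v(1)] ide_arr[OF arr_objD(1)[OF K(1)]]])
      (use cmp_assoc[OF v'(1) v(1) K(1)] v v' cmp_ide(1)[OF K(1)] in simp)
  moreover have "v' \<cdot> v = Ide C K'"
    by (rule K'(3)[OF cmp_arr[OF v(1) v'(1)] ide_arr[OF arr_objD(1)[OF K'(1)]]])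
      (use cmp_assoc[OF v(1) v'(1) K'(1)] v v' cmp_ide(1)[OF K'(1)] in simp)
  ultimately show ?thesis using that[OF v(1) is_isoI[OF v(1) v'(1)] v(2)] by blast
qed

lemma is_cokernelI:
  assumes "arr C b Q q" "q \<cdot> f = Zer C a Q"
    "\<And>T t. arr C b T t \<Longrightarrow> t \<cdot> f = Zer C a T \<Longrightarrow> \<exists>u. arr C Q T u \<and> u \<cdot> q = t"
    "\<And>T u v. arr C Q T u \<Longrightarrow> arr C Q T v \<Longrightarrow> u \<cdot> q = v \<cdot> q \<Longrightarrow> u = v"
  shows "is_cokernel C a b f Q q"
  unfolding is_cokernel_def
proof (intro conjI ballI impI)
  show "Q \<in> Obj C" "q \<in> Hom C b Q" "q \<cdot> f = Zer C a Q" using assms(1,2) by (auto simp: arr_def)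
  fix T t assume t: "T \<in> Obj C" "t \<in> Hom C b T" "t \<cdot> f = Zer C a T"
  then obtain u where "arr C Q T u" "u \<cdot> q = t"
    using assms(1) assms(3)[of T t] by (auto simp: arr_def)
  then show "\<exists>!u. u \<in> Hom C Q T \<and> u \<cdot> q = t"
    using assms(4)[of T] by (intro ex1I[of _ u]) (auto simp: arr_def)
qed

lemma cokernel_unique:
  assumes "is_cokernel C a b f Q q" "is_cokernel C a b f Q' q'" "arr C a b f"
  shows "isomorphic C Q Q'"
proof -
  have o: "Q \<in> Obj C" "Q' \<in> Obj C" "arr C b Q q" "arr C b Q' q'" "q \<cdot> f = Zer C a Q" "q' \<cdot> f = Zer C a Q'"
    using assms by (auto simp: is_cokernel_def arr_def)
  have U: "\<exists>!u. u \<in> Hom C Q T \<and> u \<cdot> q = t" if "arr C b T t" "t \<cdot> f = Zer C a T" for T t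
    using assms(1) that unfolding is_cokernel_def arr_def by blast
  have U': "\<exists>!u. u \<in> Hom C Q' T \<and> u \<cdot> q' = t" if "arr C b T t" "t \<cdot> f = Zer C a T" for T t
    using assms(2) that unfolding is_cokernel_def arr_def by blast
  obtain v where v: "arr C Q Q' v" "v \<cdot> q = q'" using U[OF o(4,6)] o by (auto simp: arr_def)
  obtain v' where v': "arr C Q' Q v'" "v' \<cdot> q' = q" using U'[OF o(3,5)] o by (auto simp: arr_def)
  have "v' \<cdot> v = Ide C Q"
  proof -
    have "v' \<cdot> v \<in> Hom C Q Q \<and> (v' \<cdot> v) \<cdot> q = q"
      using cmp_arr[OF v(1) v'(1)] cmp_assoc[OF o(3) v(1) v'(1)] v v' by (simp add: arr_def)
    moreover have "Ide C Q \<in> Hom C Q Q \<and> Ide C Q \<cdot> q = q"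
      using ide_arr[OF o(1)] cmp_ide(2)[OF o(3)] by (simp add: arr_def)
    ultimately show ?thesis using U[OF o(3,5)] by blast
  qed
  moreover have "v \<cdot> v' = Ide C Q'"
  proof -
    have "v \<cdot> v' \<in> Hom C Q' Q' \<and> (v \<cdot> v') \<cdot> q' = q'"
      using cmp_arr[OF v'(1) v(1)] cmp_assoc[OF o(4) v'(1) v(1)] v v' by (simp add: arr_def)
    moreover have "Ide C Q' \<in> Hom C Q' Q' \<and> Ide C Q' \<cdot> q' = q'"
      using ide_arr[OF o(2)] cmp_ide(2)[OF o(4)] by (simp add: arr_def)
    ultimately show ?thesis using U'[OF o(4,6)] by blast
  qed
  ultimately show ?thesis
    unfolding isomorphic_def using o(1,2) is_isoI[OF v(1) v'(1)] by blast
qed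

lemma isomorphic_trans:
  assumes "isomorphic C a b" "isomorphic C b c"
  shows "isomorphic C a c"
proof -
  obtain f g where "is_iso C a b f" "is_iso C b c g" "a \<in> Obj C" "b \<in> Obj C" "c \<in> Obj C"
    using assms by (auto simp: isomorphic_def)
  then show ?thesis
    using is_iso_cmp[of a b f c g] unfolding isomorphic_def arr_def is_iso_def by blast
qed

lemma isomorphic_zero:
  assumes "isomorphic C a z" "is_zero_object C z"
  shows "is_zero_object C a"
proof -
  obtain f where f: "is_iso C a z f" "a \<in> Obj C" "z \<in> Obj C" using assms(1) by (auto simp: isomorphic_def)
  then obtain g where g: "arr C a z f" "arr C z a g" "g \<cdot> f = Ide C a" "f \<cdot> g = Ide C z"
    using is_isoE by blast
  have Z: "u = v" if "arr C z T u" "arr C z T v" for T u v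
    using assms(2) that unfolding is_zero_object_def arr_def by blast
  have Z': "u = v" if "arr C T z u" "arr C T z v" for T u v
    using assms(2) that unfolding is_zero_object_def arr_def by blast
  show ?thesis
    unfolding is_zero_object_def
  proof (intro conjI ballI f ex1I)
    fix T assume T: "T \<in> Obj C"
    show "Zer C a T \<in> Hom C a T" "Zer C T a \<in> Hom C T a"
      using zer_arr[OF f(2) T] zer_arr[OF T f(2)] by (auto simp: arr_def)
    show "u = Zer C a T" if "u \<in> Hom C a T" for u
    proof (rule iso_cancel_right[OF is_isoI[OF g(2,1) g(4,3)] g(2)])
      show "arr C a T u" "arr C a T (Zer C a T)" using that T f zer_arr by (auto simp: arr_def)
      then show "u \<cdot> g = Zer C a T \<cdot> g" using Z cmp_arr[OF g(2)] by blast
    qed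
    show "u = Zer C T a" if "u \<in> Hom C T a" for u
    proof (rule iso_cancel_left[OF f(1) g(1)])
      show "arr C T a u" "arr C T a (Zer C T a)" using that T f zer_arr by (auto simp: arr_def)
      then show "f \<cdot> u = f \<cdot> Zer C T a" using Z' cmp_arr[OF _ g(1)] by blast
    qed
  qed
qed

text \<open>The definition of homology chooses a kernel, the factorisation through it and a cokernel. The
  first two are fixed here once and for all, and the third is only relevant up to isomorphism.\<close>

lemma homology_obtain:
  assumes "arr C a b f" "arr C b c g" "g \<cdot> f = Zer C a c" "\<exists>K k. is_kernel C b c g K k"
  obtains K k u where "is_kernel C b c g K k" "arr C a K u" "k \<cdot> u = f"
    "\<And>Q q. is_cokernel C a K u Q q \<Longrightarrow> isomorphic C (homology_obj C a b c f g) Q"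
proof -
  obtain K k where Kk: "(SOME (K, k). is_kernel C b c g K k) = (K, k)" by fastforce
  have K: "is_kernel C b c g K k"
    using someI_ex[of "\<lambda>p. case p of (K, k) \<Rightarrow> is_kernel C b c g K k"] assms(4) Kk by auto
  note F = kernel_facts[OF K assms(2)]
  obtain u where u: "arr C a K u" "k \<cdot> u = f" using F(4)[OF assms(1,3)] by blast
  have THE: "(THE u. u \<in> Hom C a K \<and> k \<cdot> u = f) = u"
    using u F(3)[OF _ u(1)] by (intro the_equality) (auto simp: arr_def)
  show ?thesis
  proof (rule that[OF K u])
    fix Q q assume Q: "is_cokernel C a K u Q q"
    obtain Q' q' where Qq: "(SOME (Q, q). is_cokernel C a K u Q q) = (Q', q')" by fastforce
    have "is_cokernel C a K u Q' q'"
      using someI_ex[of "\<lambda>p. case p of (Q, q) \<Rightarrow> is_cokernel C a K u Q q"] Q Qq by auto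
    then show "isomorphic C (homology_obj C a b c f g) Q"
      using cokernel_unique[OF _ Q u(1)] by (simp add: homology_obj_def Kk THE Qq)
  qed
qed

text \<open>For \<open>u\<close> the arrow from the chains to the cycles: the homology vanishes as soon as \<open>u\<close> is epic.\<close>

lemma epic_cokernel_zero:
  assumes "arr C a K u" "is_zero_object C z"
    "\<And>T v w. arr C K T v \<Longrightarrow> arr C K T w \<Longrightarrow> v \<cdot> u = w \<cdot> u \<Longrightarrow> v = w"
  shows "is_cokernel C a K u z (Zer C K z)"
proof (rule is_cokernelI)
  have z: "z \<in> Obj C" using assms(2) by (simp add: is_zero_object_def)
  have K: "K \<in> Obj C" using assms(1) by (simp add: arr_def)
  show "arr C K z (Zer C K z)" by (rule zer_arr[OF K z])
  show "Zer C K z \<cdot> u = Zer C a z" by (rule cmp_zer(2)[OF assms(1) z])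
  show "v = w" if "arr C z T v" "arr C z T w" for T v w
    using assms(2) that unfolding is_zero_object_def arr_def by blast
  fix T t assume t: "arr C K T t" "t \<cdot> u = Zer C a T"
  have T: "T \<in> Obj C" using t by (simp add: arr_def)
  have "t = Zer C K T" by (rule assms(3)[OF t(1) zer_arr[OF K T]]) (use t cmp_zer(2)[OF assms(1) T] in simp)
  then show "\<exists>u. arr C z T u \<and> u \<cdot> Zer C K z = t"
    using cmp_zer(1)[OF zer_arr[OF z T] K] zer_arr[OF z T] by blast
qed

lemma kernel_transport:
  assumes "is_kernel C a b f K' k'" "arr C a b f" "arr C K' K v" "is_iso C K' K v" "arr C K a k" "k \<cdot> v = k'"
  shows "is_kernel C a b f K k"
proof -
  note K' = kernel_facts[OF assms(1,2)]
  note o = arr_objD[OF assms(3)]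
  obtain v' where v': "arr C K K' v'" "v' \<cdot> v = Ide C K'" "v \<cdot> v' = Ide C K"
    using is_isoE[OF assms(4) o] by blast
  have kv: "k' \<cdot> v' = k"
    by (simp only: assms(6)[symmetric] cmp_assoc[OF v'(1) assms(3,5), symmetric] v'(3) cmp_ide(1)[OF assms(5)])
  show ?thesis
  proof (rule is_kernelI[OF assms(5)])
    show "f \<cdot> k = Zer C K b"
      by (simp only: kv[symmetric] cmp_assoc[OF v'(1) K'(1) assms(2)] K'(2)
        cmp_zer(2)[OF v'(1) arr_objD(2)[OF assms(2)]])
    show "\<exists>u. arr C T K u \<and> k \<cdot> u = t" if t: "arr C T a t" "f \<cdot> t = Zer C T b" for T t
    proof -
      obtain u where u: "arr C T K' u" "k' \<cdot> u = t" using K'(4)[OF t] by blast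
      have "k \<cdot> (v \<cdot> u) = t" by (simp only: cmp_assoc[OF u(1) assms(3,5)] assms(6) u(2))
      then show ?thesis using cmp_arr[OF u(1) assms(3)] by blast
    qed
    show "u = w" if uw: "arr C T K u" "arr C T K w" "k \<cdot> u = k \<cdot> w" for T u w
    proof (rule iso_cancel_left[OF is_isoI[OF v'(1) assms(3) v'(3,2)] v'(1) uw(1,2)])
      show "v' \<cdot> u = v' \<cdot> w"
      proof (rule K'(3)[OF cmp_arr[OF uw(1) v'(1)] cmp_arr[OF uw(2) v'(1)]])
        show "k' \<cdot> v' \<cdot> u = k' \<cdot> v' \<cdot> w"
          by (simp only: cmp_assoc[OF uw(1) v'(1) K'(1)] cmp_assoc[OF uw(2) v'(1) K'(1)] kv uw(3))
      qed
    qed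
  qed
qed

subsection \<open>Chosen direct sums\<close>

lemma dsum_data:
  assumes "\<exists>B inc prj. direct_sum_data I X B inc prj"
  shows "direct_sum_data I X (dsum_obj C I X) (dsum_inj C I X) (dsum_prj C I X)"
proof -
  have "\<exists>p. case p of (B, inc, prj) \<Rightarrow> is_direct_sum C I X B inc prj"
    using assms by (auto simp: direct_sum_data_def)
  from someI_ex[OF this]
  have "is_direct_sum C I X (dsum_obj C I X) (dsum_inj C I X) (dsum_prj C I X)"
    unfolding dsum_obj_def dsum_inj_def dsum_prj_def dsum_def by (simp only: case_prod_unfold)
  then show ?thesis using assms by (auto simp: direct_sum_data_def)
qed

lemma dsum_arr_facts:
  assumes "\<exists>B inc prj. direct_sum_data I X B inc prj" "\<exists>B inc prj. direct_sum_data J Y B inc prj"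
    "\<And>i j. i \<in> I \<Longrightarrow> j \<in> J \<Longrightarrow> arr C (X i) (Y j) (m i j)"
  shows "arr C (dsum_obj C I X) (dsum_obj C J Y) (dsum_arr C I X J Y m)"
    "i \<in> I \<Longrightarrow> j \<in> J \<Longrightarrow> dsum_prj C J Y j \<cdot> (dsum_arr C I X J Y m \<cdot> dsum_inj C I X i) = m i j"
  using theI'[OF dsd_matrix[OF dsum_data[OF assms(1)] dsum_data[OF assms(2)] assms(3)]]
    dsd_obj[OF dsum_data[OF assms(1)]] dsd_obj[OF dsum_data[OF assms(2)]]
  unfolding dsum_arr_def arr_def by auto

lemma dsd_reindex:
  assumes "direct_sum_data I X B inc prj" "bij_betw h J I"
  shows "direct_sum_data J (\<lambda>j. X (h j)) B (\<lambda>j. inc (h j)) (\<lambda>j. prj (h j))"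
proof -
  note D = dsd_facts[OF assms(1)]
  have h: "\<And>j. j \<in> J \<Longrightarrow> h j \<in> I" and inj: "inj_on h J" and surj: "\<And>i. i \<in> I \<Longrightarrow> \<exists>j\<in>J. i = h j"
    using assms(2) by (auto simp: bij_betw_def)
  show ?thesis
  proof (rule dsd_intro)
    show "finite J" using D(1) assms(2) bij_betw_finite by blast
    show "prj (h j) \<cdot> inc (h i) = Zer C (X (h i)) (X (h j))" if "i \<in> J" "j \<in> J" "i \<noteq> j" for i j
      using D(7)[OF h h] that inj by (auto simp: inj_on_def)
    fix t t' assume t: "arr C B B t" "arr C B B t'" "\<And>j. j \<in> J \<Longrightarrow> prj (h j) \<cdot> t = prj (h j) \<cdot> t'"
    show "t = t'" by (rule dsd_ext[OF assms(1) t(1,2)]) (use t(3) surj in blast)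
  qed (use D h in auto)
qed

lemma dsd_exists:
  assumes "is_zero_object C z"
    "\<And>a b. a \<in> Obj C \<Longrightarrow> b \<in> Obj C \<Longrightarrow> \<exists>B inc prj. is_direct_sum C UNIV (case_bool a b) B inc prj"
    "finite I" "\<And>i. i \<in> I \<Longrightarrow> X i \<in> Obj C"
  shows "\<exists>B inc prj. direct_sum_data I X B inc prj"
  using assms(3,4)
proof (induction I rule: finite_induct)
  case empty
  have z: "z \<in> Obj C" "\<And>f g. f \<in> Hom C z z \<Longrightarrow> g \<in> Hom C z z \<Longrightarrow> f = g"
    using assms(1) unfolding is_zero_object_def by blast+
  have "direct_sum_data {} X z inc prj" for inc prj
    by (rule dsd_intro) (use z in \<open>auto simp: arr_def\<close>)
  then show ?case by blast
next
  case (insert i I)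
  then obtain B inc prj where B: "direct_sum_data I X B inc prj" by auto
  obtain B' inc' prj' where "is_direct_sum C UNIV (case_bool (X i) B) B' inc' prj'"
    using assms(2)[of "X i" B] insert.prems dsd_obj[OF B] by auto
  then have B': "direct_sum_data UNIV (case_bool (X i) B) B' inc' prj'"
    using insert.prems dsd_obj[OF B] by (auto simp: direct_sum_data_def split: bool.split)
  have "\<exists>inc'' prj''. direct_sum_data (Sigma UNIV (case_bool {i} I)) (\<lambda>(b, j). X j) B' inc'' prj''"
  proof -
    have 1: "direct_sum_data {i} X (X i) (\<lambda>_. Ide C (X i)) (\<lambda>_. Ide C (X i))"
      by (rule dsd_intro) (use insert.prems ide_arr cmp_ide[OF ide_arr] cmp_ide(2) in auto)
    have "direct_sum_data (case_bool {i} I b) X (case_bool (X i) B b)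
        (case_bool (\<lambda>_. Ide C (X i)) inc b) (case_bool (\<lambda>_. Ide C (X i)) prj b)" for b
      using B 1 by (cases b) auto
    from dsd_flatten[OF B' this] show ?thesis by blast
  qed
  then obtain inc'' prj'' where
    F: "direct_sum_data (Sigma UNIV (case_bool {i} I)) (\<lambda>(b, j). X j) B' inc'' prj''" by blast
  have "bij_betw (\<lambda>j. (j = i, j)) (insert i I) (Sigma UNIV (case_bool {i} I))"
    using insert.hyps by (intro bij_betw_byWitness[where f' = snd]) (auto split: bool.splits)
  from dsd_reindex[OF F this] show ?case by auto
qed

subsection \<open>Triangular systems of equations\<close>

text \<open>Back substitution. The rows \<open>l\<close> are treated in the order of decreasing rank \<open>r l\<close>. Row \<open>k\<close> is
  corrected by a multiple of the column \<open>\<phi> k\<close>, in which the entries of the rows treated before are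
  zero.\<close>

lemma triangular_solve:
  assumes S2: "direct_sum_data I2 X2 B2 inc2 prj2" and S1: "direct_sum_data I1 X1 B1 inc1 prj1"
    and d: "arr C B2 B1 d" and L: "L \<subseteq> I1" "\<And>l. l \<in> L \<Longrightarrow> \<phi> l \<in> I2"
    and iso: "\<And>l. l \<in> L \<Longrightarrow> is_iso C (X2 (\<phi> l)) (X1 l) (prj1 l \<cdot> (d \<cdot> inc2 (\<phi> l)))"
    and tri: "\<And>l l'. l \<in> L \<Longrightarrow> l' \<in> L \<Longrightarrow> l \<noteq> l' \<Longrightarrow> (r l :: nat) \<ge> r l' \<Longrightarrow>
      prj1 l \<cdot> (d \<cdot> inc2 (\<phi> l')) = Zer C (X2 (\<phi> l')) (X1 l)"
    and y: "arr C T B1 y"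
  shows "\<exists>b. arr C T B2 b \<and> (\<forall>l\<in>L. prj1 l \<cdot> (d \<cdot> b) = prj1 l \<cdot> y)"
proof -
  note D2 = dsd_facts[OF S2]
  note D1 = dsd_facts[OF S1]
  have T: "T \<in> Obj C" using y by (simp add: arr_def)
  have finL: "finite L" using D1(1) L(1) finite_subset by blast
  have "\<exists>b. arr C T B2 b \<and> (\<forall>l\<in>L'. prj1 l \<cdot> (d \<cdot> b) = prj1 l \<cdot> y)" if "finite L'" "L' \<subseteq> L" for L'
    using that
  proof (induction L' rule: finite_ranking_induct[where f = "\<lambda>l. - int (r l)"])
    case empty
    then show ?case using zer_arr[OF T D2(2)] by blast
  next
    case (insert k L')
    show ?case
    proof (cases "k \<in> L'")
      case True
      then show ?thesis using insert by (simp add: insert_absorb)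
    next
      case False
      obtain b where b: "arr C T B2 b" "\<forall>l\<in>L'. prj1 l \<cdot> (d \<cdot> b) = prj1 l \<cdot> y"
        using insert by auto
      have k: "k \<in> L" "k \<in> I1" "\<phi> k \<in> I2" using insert.prems L by auto
      define m where "m = prj1 k \<cdot> (d \<cdot> inc2 (\<phi> k))"
      have m: "arr C (X2 (\<phi> k)) (X1 k) m"
        unfolding m_def by (rule cmp_arr[OF cmp_arr[OF D2(4)[OF k(3)] d] D1(5)[OF k(2)]])
      obtain m' where m': "arr C (X1 k) (X2 (\<phi> k)) m'" "m \<cdot> m' = Ide C (X1 k)"
        using is_isoE[OF iso[OF k(1), folded m_def]] m by (auto dest: arr_objD)
      have p: "arr C T (X1 k) (prj1 k \<cdot> (d \<cdot> b))" "arr C T (X1 k) (prj1 k \<cdot> y)"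
        by (rule cmp_arr[OF cmp_arr[OF b(1) d] D1(5)[OF k(2)]] cmp_arr[OF y D1(5)[OF k(2)]])+
      define e where "e = prj1 k \<cdot> y \<oplus> neg T (X1 k) (prj1 k \<cdot> (d \<cdot> b))"
      have e: "arr C T (X1 k) e" unfolding e_def by (rule add_arr[OF p(2) neg_arr[OF p(1)]])
      define c where "c = inc2 (\<phi> k) \<cdot> (m' \<cdot> e)"
      have me: "arr C T (X2 (\<phi> k)) (m' \<cdot> e)" by (rule cmp_arr[OF e m'(1)])
      have c: "arr C T B2 c" unfolding c_def by (rule cmp_arr[OF me D2(4)[OF k(3)]])
      have dc: "prj1 l \<cdot> (d \<cdot> c) = (prj1 l \<cdot> (d \<cdot> inc2 (\<phi> k))) \<cdot> (m' \<cdot> e)" if "l \<in> I1" for l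
        unfolding c_def cmp_assoc[OF me D2(4)[OF k(3)] d]
        by (rule cmp_assoc[OF me cmp_arr[OF D2(4)[OF k(3)] d] D1(5)[OF that]])
      have sum: "prj1 l \<cdot> (d \<cdot> (b \<oplus> c)) = prj1 l \<cdot> (d \<cdot> b) \<oplus> prj1 l \<cdot> (d \<cdot> c)" if "l \<in> I1" for l
        using cmp_add(1)[OF b(1) c d] cmp_add(1)[OF cmp_arr[OF b(1) d] cmp_arr[OF c d] D1(5)[OF that]]
        by simp
      have "prj1 l \<cdot> (d \<cdot> (b \<oplus> c)) = prj1 l \<cdot> y" if "l \<in> insert k L'" for l
      proof (cases "l = k")
        case True
        have "prj1 k \<cdot> (d \<cdot> c) = e"
          using dc[OF k(2)] cmp_assoc[OF e m'(1) m] m'(2) cmp_ide(2)[OF e] by (simp add: m_def)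
        then have "prj1 k \<cdot> (d \<cdot> (b \<oplus> c)) = prj1 k \<cdot> (d \<cdot> b) \<oplus> e" using sum[OF k(2)] by simp
        also have "\<dots> = e \<oplus> prj1 k \<cdot> (d \<cdot> b)" by (rule add_commute[OF p(1) e])
        also have "\<dots> = prj1 k \<cdot> y"
          unfolding e_def add_assoc[OF p(2) neg_arr[OF p(1)] p(1)] add_neg(2)[OF p(1)]
          by (rule add_zer(1)[OF p(2)])
        finally show ?thesis using True by simp
      next
        case False
        then have l: "l \<in> L'" "l \<in> L" "l \<in> I1" using that insert.prems L by auto
        have "prj1 l \<cdot> (d \<cdot> inc2 (\<phi> k)) = Zer C (X2 (\<phi> k)) (X1 l)"
          by (rule tri[OF l(2) k(1) False]) (use insert.hyps(2)[OF l(1)] in simp)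
        then have "prj1 l \<cdot> (d \<cdot> c) = Zer C T (X1 l)"
          using dc[OF l(3)] cmp_zer(2)[OF me D1(3)[OF l(3)]] by simp
        then show ?thesis
          using sum[OF l(3)] b(2) l(1) add_zer(1)[OF cmp_arr[OF y D1(5)[OF l(3)]]] by simp
      qed
      then show ?thesis using add_arr[OF b(1) c] by blast
    qed
  qed
  from this[OF finL] show ?thesis by simp
qed

text \<open>The row \<open>l\<close> involves, besides \<open>\<phi> l\<close>, only columns \<open>\<phi> l'\<close> with \<open>r l' > r l\<close>; so the components of
  \<open>t\<close> vanish by induction, from the largest rank down.\<close>

lemma triangular_injective:
  assumes S1: "direct_sum_data I1 X1 B1 inc1 prj1" and S0: "direct_sum_data I0 X0 B0 inc0 prj0"
    and d: "arr C B1 B0 d" and L: "L \<subseteq> I0" "\<And>l. l \<in> L \<Longrightarrow> \<phi> l \<in> I1"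
    and iso: "\<And>l. l \<in> L \<Longrightarrow> is_iso C (X1 (\<phi> l)) (X0 l) (prj0 l \<cdot> (d \<cdot> inc1 (\<phi> l)))"
    and tri: "\<And>l l'. l \<in> L \<Longrightarrow> l' \<in> L \<Longrightarrow> l \<noteq> l' \<Longrightarrow> (r l :: nat) \<ge> r l' \<Longrightarrow>
      prj0 l \<cdot> (d \<cdot> inc1 (\<phi> l')) = Zer C (X1 (\<phi> l')) (X0 l)"
    and t: "arr C T B1 t" and supp: "\<And>i. i \<in> I1 \<Longrightarrow> i \<notin> \<phi> ` L \<Longrightarrow> prj1 i \<cdot> t = Zer C T (X1 i)"
    and dt: "\<And>l. l \<in> L \<Longrightarrow> prj0 l \<cdot> (d \<cdot> t) = Zer C T (X0 l)"
  shows "t = Zer C T B1"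
proof -
  note D1 = dsd_facts[OF S1]
  note D0 = dsd_facts[OF S0]
  have T: "T \<in> Obj C" using t by (simp add: arr_def)
  have finL: "finite L" using D0(1) L(1) finite_subset by blast
  have bound: "r l \<le> Max (r ` L)" if "l \<in> L" for l using that finL by auto
  have up: "prj1 (\<phi> l) \<cdot> t = Zer C T (X1 (\<phi> l))" if "l \<in> L" for l
    using that
  proof (induction "Max (r ` L) - r l" arbitrary: l rule: less_induct)
    case less
    have l: "l \<in> I0" "\<phi> l \<in> I1" using less.prems L by auto
    have pd: "arr C B1 (X0 l) (prj0 l \<cdot> d)" by (rule cmp_arr[OF d D0(5)[OF l(1)]])
    have as: "(prj0 l \<cdot> d) \<cdot> inc1 i = prj0 l \<cdot> (d \<cdot> inc1 i)" if "i \<in> I1" for i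
      using cmp_assoc[OF D1(4)[OF that] d D0(5)[OF l(1)]] by simp
    have "(prj0 l \<cdot> d) \<cdot> t = ((prj0 l \<cdot> d) \<cdot> inc1 (\<phi> l)) \<cdot> (prj1 (\<phi> l) \<cdot> t)"
    proof (rule dsd_expand_single[OF S1 t pd l(2)])
      fix i assume i: "i \<in> I1" "i \<noteq> \<phi> l"
      show "(prj0 l \<cdot> d) \<cdot> inc1 i = Zer C (X1 i) (X0 l) \<or> prj1 i \<cdot> t = Zer C T (X1 i)"
      proof (cases "i \<in> \<phi> ` L")
        case True
        then obtain l' where l': "l' \<in> L" "i = \<phi> l'" by auto
        show ?thesis
        proof (cases "r l' > r l")
          case True
          then have "Max (r ` L) - r l' < Max (r ` L) - r l" using bound[OF l'(1)] by simp
          then show ?thesis using less.hyps l' by blast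
        next
          case False
          then show ?thesis using tri[OF less.prems l'(1)] as i l' by fastforce
        qed
      qed (use supp i in auto)
    qed
    moreover have "(prj0 l \<cdot> d) \<cdot> t = Zer C T (X0 l)"
      using cmp_assoc[OF t d D0(5)[OF l(1)]] dt[OF less.prems] by simp
    ultimately have z: "(prj0 l \<cdot> (d \<cdot> inc1 (\<phi> l))) \<cdot> (prj1 (\<phi> l) \<cdot> t) = Zer C T (X0 l)"
      using as[OF l(2)] by simp
    have m: "arr C (X1 (\<phi> l)) (X0 l) (prj0 l \<cdot> (d \<cdot> inc1 (\<phi> l)))"
      by (rule cmp_arr[OF cmp_arr[OF D1(4)[OF l(2)] d] D0(5)[OF l(1)]])
    show ?case
      by (rule iso_cancel_left[OF iso[OF less.prems] m cmp_arr[OF t D1(5)[OF l(2)]] zer_arr[OF T D1(3)[OF l(2)]]])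
        (use z cmp_zer(1)[OF m T] in simp)
  qed
  show ?thesis
  proof (rule dsd_ext[OF S1 t zer_arr[OF T D1(2)]])
    fix i assume i: "i \<in> I1"
    have "prj1 i \<cdot> t = Zer C T (X1 i)" using up supp[OF i] by (cases "i \<in> \<phi> ` L") auto
    then show "prj1 i \<cdot> t = prj1 i \<cdot> Zer C T B1" using cmp_zer(1)[OF D1(5)[OF i] T] by simp
  qed
qed

text \<open>An acyclic matching without unmatched cells in the middle degree: each index in \<open>I1\<close> is a lower
  cell \<open>l \<in> L1\<close>, matched with \<open>\<phi>1 l\<close> above, or an upper cell \<open>\<phi>0 l\<close>, matched with \<open>l \<in> L0\<close> below.
  For a cycle \<open>t\<close>, \<open>triangular_solve\<close> finds \<open>b\<close> such that \<open>d2 \<cdot> b\<close> and \<open>t\<close> agree on the lower cells.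
  Their difference is a cycle supported on upper cells, and is zero by \<open>triangular_injective\<close>.\<close>

lemma matched_exact:
  assumes S2: "direct_sum_data I2 X2 B2 inc2 prj2" and S1: "direct_sum_data I1 X1 B1 inc1 prj1"
    and S0: "direct_sum_data I0 X0 B0 inc0 prj0"
    and d2: "arr C B2 B1 d2" and d1: "arr C B1 B0 d1" and dd: "d1 \<cdot> d2 = Zer C B2 B0"
    and L1: "L1 \<subseteq> I1" "\<And>l. l \<in> L1 \<Longrightarrow> \<phi>1 l \<in> I2"
    and iso1: "\<And>l. l \<in> L1 \<Longrightarrow> is_iso C (X2 (\<phi>1 l)) (X1 l) (prj1 l \<cdot> (d2 \<cdot> inc2 (\<phi>1 l)))"
    and tri1: "\<And>l l'. l \<in> L1 \<Longrightarrow> l' \<in> L1 \<Longrightarrow> l \<noteq> l' \<Longrightarrow> (r1 l :: nat) \<ge> r1 l' \<Longrightarrow>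
      prj1 l \<cdot> (d2 \<cdot> inc2 (\<phi>1 l')) = Zer C (X2 (\<phi>1 l')) (X1 l)"
    and L0: "L0 \<subseteq> I0" "\<And>l. l \<in> L0 \<Longrightarrow> \<phi>0 l \<in> I1"
    and iso0: "\<And>l. l \<in> L0 \<Longrightarrow> is_iso C (X1 (\<phi>0 l)) (X0 l) (prj0 l \<cdot> (d1 \<cdot> inc1 (\<phi>0 l)))"
    and tri0: "\<And>l l'. l \<in> L0 \<Longrightarrow> l' \<in> L0 \<Longrightarrow> l \<noteq> l' \<Longrightarrow> (r0 l :: nat) \<ge> r0 l' \<Longrightarrow>
      prj0 l \<cdot> (d1 \<cdot> inc1 (\<phi>0 l')) = Zer C (X1 (\<phi>0 l')) (X0 l)"
    and cover: "I1 \<subseteq> L1 \<union> \<phi>0 ` L0"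
    and t: "arr C T B1 t" "d1 \<cdot> t = Zer C T B0"
  shows "\<exists>b. arr C T B2 b \<and> d2 \<cdot> b = t"
proof -
  note D1 = dsd_facts[OF S1]
  note D0 = dsd_facts[OF S0]
  have T: "T \<in> Obj C" using t by (simp add: arr_def)
  obtain b where b: "arr C T B2 b" "\<forall>l\<in>L1. prj1 l \<cdot> (d2 \<cdot> b) = prj1 l \<cdot> t"
    using triangular_solve[OF S2 S1 d2 L1 iso1 tri1 t(1)] by blast
  have db: "arr C T B1 (d2 \<cdot> b)" by (rule cmp_arr[OF b(1) d2])
  let ?e = "t \<oplus> neg T B1 (d2 \<cdot> b)"
  have e: "arr C T B1 ?e" by (rule add_arr[OF t(1) neg_arr[OF db]])
  have "?e = Zer C T B1"
  proof (rule triangular_injective[OF S1 S0 d1 L0 iso0 tri0 e])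
    fix i assume i: "i \<in> I1" "i \<notin> \<phi>0 ` L0"
    then have "i \<in> L1" using cover by auto
    then show "prj1 i \<cdot> ?e = Zer C T (X1 i)"
      using cmp_add(1)[OF t(1) neg_arr[OF db] D1(5)[OF i(1)]] cmp_neg(1)[OF db D1(5)[OF i(1)]] b(2)
        add_neg(1)[OF cmp_arr[OF t(1) D1(5)[OF i(1)]]] by simp
  next
    fix l assume "l \<in> L0"
    then have l: "l \<in> I0" using L0 by auto
    have "d1 \<cdot> (d2 \<cdot> b) = Zer C T B0"
      using cmp_assoc[OF b(1) d2 d1] dd cmp_zer(2)[OF b(1) D0(2)] by simp
    then have "d1 \<cdot> ?e = Zer C T B0"
      using cmp_add(1)[OF t(1) neg_arr[OF db] d1] cmp_neg(1)[OF db d1] t(2)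
        neg_zer[OF T D0(2)] add_zer(1)[OF zer_arr[OF T D0(2)]] by simp
    then show "prj0 l \<cdot> (d1 \<cdot> ?e) = Zer C T (X0 l)" using cmp_zer(1)[OF D0(5)[OF l] T] by simp
  qed
  then have "d2 \<cdot> b = t" using diff_zer_eq[OF t(1) db] by simp
  then show ?thesis using b(1) by blast
qed

end

section \<open>Coxeter groups\<close>

locale coxeter =
  fixes W :: "('w, 'x) monoid_scheme" (structure) and S :: "'w set"
  assumes coxeter: "coxeter_system W S"
begin

sublocale group W
  using coxeter by (simp add: coxeter_system_def)

lemma mult_cancel:
  "x \<in> carrier W \<Longrightarrow> y \<in> carrier W \<Longrightarrow> inv x \<otimes> (x \<otimes> y) = y"
  "x \<in> carrier W \<Longrightarrow> y \<in> carrier W \<Longrightarrow> x \<otimes> (inv x \<otimes> y) = y"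
  by (simp_all add: m_assoc[symmetric])

abbreviation len :: "'w \<Rightarrow> nat" where "len \<equiv> cox_length W S"
abbreviation val :: "'w list \<Rightarrow> 'w" where "val \<equiv> word_val W"

lemma S_carrier: "s \<in> S \<Longrightarrow> s \<in> carrier W"
  and S_sq: "s \<in> S \<Longrightarrow> s \<otimes> s = \<one>"
  and S_not_one: "s \<in> S \<Longrightarrow> s \<noteq> \<one>"
  and S_generate: "generate W S = carrier W"
  and S_presentation: "xs \<in> lists S \<Longrightarrow> ys \<in> lists S \<Longrightarrow> val xs = val ys \<Longrightarrow> coxeter_equiv W S xs ys"
  using coxeter unfolding coxeter_system_def by blast+

lemma S_inv: "s \<in> S \<Longrightarrow> inv s = s"
  using S_carrier S_sq inv_equality by blast

lemma val_simps [simp]: "val [] = \<one>" "val (x # xs) = x \<otimes> val xs"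
  by (simp_all add: word_val_def)

lemma val_closed: "xs \<in> lists S \<Longrightarrow> val xs \<in> carrier W"
  by (induction xs) (auto simp: S_carrier)

lemma val_append: "xs \<in> lists S \<Longrightarrow> ys \<in> lists S \<Longrightarrow> val (xs @ ys) = val xs \<otimes> val ys"
  by (induction xs) (auto simp: S_carrier val_closed m_assoc)

lemma val_rev: "xs \<in> lists S \<Longrightarrow> val (rev xs) = inv (val xs)"
proof (induction xs)
  case (Cons x xs)
  then show ?case
    using val_append[of "rev xs" "[x]"] by (auto simp: in_lists_conv_set S_carrier val_closed S_inv inv_mult_group)
qed simp

lemma generate_word:
  assumes "K \<subseteq> S" "u \<in> generate W K"
  shows "\<exists>xs\<in>lists K. val xs = u"
  using assms(2)
proof (induction u rule: generate.induct)
  case one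
  then show ?case by (intro bexI[of _ "[]"]) auto
next
  case (incl h)
  then show ?case using assms(1) S_carrier by (intro bexI[of _ "[h]"]) auto
next
  case (inv h)
  then show ?case using assms(1) S_carrier S_inv[of h] by (intro bexI[of _ "[h]"]) auto
next
  case (eng h1 h2)
  then obtain xs ys where "xs \<in> lists K" "ys \<in> lists K" "val xs = h1" "val ys = h2" by blast
  moreover from this have "xs \<in> lists S" "ys \<in> lists S" using assms(1) by auto
  ultimately show ?case using val_append by (intro bexI[of _ "xs @ ys"]) auto
qed

lemma word_generate: "K \<subseteq> S \<Longrightarrow> xs \<in> lists K \<Longrightarrow> val xs \<in> generate W K"
  by (induction xs) (auto intro: generate.intros)

lemma generate_subgroup: "K \<subseteq> S \<Longrightarrow> subgroup (generate W K) W"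
  using generate_is_subgroup S_carrier by blast

lemma obtain_word:
  assumes "w \<in> carrier W"
  obtains xs where "xs \<in> lists S" "val xs = w"
  using generate_word[of S w] assms S_generate by auto

subsection \<open>The length function\<close>

lemma len_word:
  assumes "w \<in> carrier W"
  obtains xs where "xs \<in> lists S" "length xs = len w" "val xs = w"
proof -
  obtain ys where "ys \<in> lists S" "val ys = w" using obtain_word[OF assms] .
  then have "\<exists>xs\<in>lists S. length xs = length ys \<and> val xs = w" by blast
  from LeastI[of "\<lambda>k. \<exists>xs\<in>lists S. length xs = k \<and> val xs = w", OF this]
  show ?thesis using that unfolding cox_length_def by blast
qed

lemma len_le: "xs \<in> lists S \<Longrightarrow> len (val xs) \<le> length xs"
  unfolding cox_length_def by (rule Least_le) blast

lemma equiv_parity: "coxeter_equiv W S xs ys \<Longrightarrow> even (length xs) = even (length ys)"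
proof (induction rule: coxeter_equiv.induct)
  case (rel s t m xs ys)
  have "length (concat (replicate m [s, t])) = 2 * m" by (induction m) auto
  then show ?case by simp
qed auto

lemma len_word_parity:
  assumes "xs \<in> lists S" shows "even (len (val xs)) = even (length xs)"
proof -
  obtain ys where ys: "ys \<in> lists S" "length ys = len (val xs)" "val ys = val xs"
    using len_word[OF val_closed[OF assms]] .
  then show ?thesis using equiv_parity[OF S_presentation[OF ys(1) assms ys(3)]] by simp
qed

lemma len_one [simp]: "len \<one> = 0"
  using len_le[of "[]"] by simp

lemma len_zero: "w \<in> carrier W \<Longrightarrow> len w = 0 \<Longrightarrow> w = \<one>"
  by (metis len_word length_0_conv val_simps(1))

lemma len_mult_le:
  assumes "u \<in> carrier W" "v \<in> carrier W"
  shows "len (u \<otimes> v) \<le> len u + len v"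
proof -
  obtain xs ys where "xs \<in> lists S" "length xs = len u" "val xs = u"
    "ys \<in> lists S" "length ys = len v" "val ys = v" using len_word assms by metis
  then show ?thesis using len_le[of "xs @ ys"] val_append by auto
qed

lemma len_mult_parity:
  assumes "u \<in> carrier W" "v \<in> carrier W"
  shows "even (len (u \<otimes> v)) = even (len u + len v)"
proof -
  obtain xs ys where "xs \<in> lists S" "length xs = len u" "val xs = u"
    "ys \<in> lists S" "length ys = len v" "val ys = v" using len_word assms by metis
  then show ?thesis using len_word_parity[of "xs @ ys"] val_append by auto
qed

lemma len_inv:
  assumes "w \<in> carrier W" shows "len (inv w) = len w"
proof -
  have le: "len (inv w) \<le> len w" if w: "w \<in> carrier W" for w
  proof -
    obtain xs where "xs \<in> lists S" "length xs = len w" "val xs = w" using len_word[OF w] .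
    then show ?thesis using len_le[of "rev xs"] val_rev[of xs] by (auto simp: in_lists_conv_set)
  qed
  show ?thesis using le[OF assms] le[of "inv w"] assms by simp
qed

lemma len_S: "s \<in> S \<Longrightarrow> len s = 1"
  using len_le[of "[s]"] len_zero[of s] S_carrier[of s] S_not_one[of s] by (cases "len s") auto

lemma len_mult_S:
  assumes "w \<in> carrier W" "s \<in> S"
  shows "len (w \<otimes> s) = len w + 1 \<or> len (w \<otimes> s) + 1 = len w"
proof -
  have "len (w \<otimes> s) \<le> len w + 1" using len_mult_le[of w s] assms S_carrier len_S by simp
  moreover have "w \<otimes> s \<otimes> s = w" using assms S_carrier S_sq by (simp add: m_assoc)
  then have "len w \<le> len (w \<otimes> s) + 1" using len_mult_le[of "w \<otimes> s" s] assms S_carrier len_S by simp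
  moreover have "even (len (w \<otimes> s)) = even (len w + 1)"
    using len_mult_parity[of w s] assms S_carrier len_S by simp
  then have "len (w \<otimes> s) \<noteq> len w" by auto
  ultimately show ?thesis by linarith
qed

subsection \<open>Inversions and the exchange condition\<close>

text \<open>The reflections of a word \<open>x\<^sub>1 \<dots> x\<^sub>k\<close> are the elements \<open>y\<inverse> x\<^sub>j y\<close> with \<open>y = x\<^sub>j\<^sub>+\<^sub>1 \<dots> x\<^sub>k\<close>. This
  is the parity of the number of indices whose reflection is \<open>t\<close>. The number itself depends on the
  word, its parity only on the value of the word.\<close>

primrec inversion_parity :: "'w list \<Rightarrow> 'w \<Rightarrow> bool" where
  "inversion_parity [] t = False"
| "inversion_parity (x # xs) t = ((val xs \<otimes> t \<otimes> inv (val xs) = x) \<noteq> inversion_parity xs t)"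

lemma conj_eq_iff:
  assumes "a \<in> carrier W" "x \<in> carrier W" "y \<in> carrier W"
  shows "a \<otimes> x \<otimes> inv a = y \<longleftrightarrow> x = inv a \<otimes> y \<otimes> a"
proof -
  have "inv a \<otimes> (a \<otimes> x \<otimes> inv a) \<otimes> a = (inv a \<otimes> a) \<otimes> x \<otimes> (inv a \<otimes> a)"
    "a \<otimes> (inv a \<otimes> y \<otimes> a) \<otimes> inv a = (a \<otimes> inv a) \<otimes> y \<otimes> (a \<otimes> inv a)"
    using assms by (simp_all only: m_assoc m_closed inv_closed)
  then show ?thesis using assms by auto
qed

lemma inversion_parity_append:
  assumes "xs \<in> lists S" "ys \<in> lists S" "t \<in> carrier W"
  shows "inversion_parity (xs @ ys) t =
    (inversion_parity xs (val ys \<otimes> t \<otimes> inv (val ys)) \<noteq> inversion_parity ys t)"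
  using assms(1)
proof (induction xs)
  case (Cons x xs)
  then have "val (xs @ ys) \<otimes> t \<otimes> inv (val (xs @ ys)) =
      val xs \<otimes> (val ys \<otimes> t \<otimes> inv (val ys)) \<otimes> inv (val xs)"
    using assms val_closed by (simp add: val_append inv_mult_group m_assoc)
  with Cons show ?case by auto
qed simp

text \<open>The reflections of the word \<open>s t \<dots> s t\<close> of length \<open>2 m\<close> are the elements \<open>t (s t)\<^sup>j\<close> with
  \<open>j < 2 m\<close>.\<close>

lemma inversion_parity_dihedral:
  assumes "s \<in> S" "t \<in> S" "x \<in> carrier W"
  shows "inversion_parity (concat (replicate m [s, t])) x =
    odd (card {j. j < 2 * m \<and> t \<otimes> (s \<otimes> t) [^] j = x})"
proof (induction m)
  case (Suc m)
  note c = S_carrier[OF assms(1)] S_carrier[OF assms(2)] assms(3)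
  let ?r = "s \<otimes> t" and ?ws = "concat (replicate m [s, t])"
  let ?A = "\<lambda>m. {j. j < 2 * m \<and> t \<otimes> ?r [^] j = x}"
  have ws: "?ws \<in> lists S" using assms by (induction m) auto
  have v: "val ?ws = ?r [^] m" 
  proof (induction m)
    case (Suc m)
    then show ?case using nat_pow_mult[of ?r 1 m] c by (simp add: m_assoc)
  qed simp
  \<comment> \<open>conjugation by \<open>t\<close> inverts the powers of \<open>s t\<close>\<close>
  have tr: "?r [^] k \<otimes> t \<otimes> ?r [^] k = t" for k :: nat
  proof (induction k)
    case (Suc k)
    have "?r [^] Suc k = ?r \<otimes> ?r [^] k" using nat_pow_mult[of ?r 1 k] c by simp
    then have "?r [^] Suc k \<otimes> t \<otimes> ?r [^] Suc k = ?r \<otimes> (?r [^] k \<otimes> t \<otimes> ?r [^] k) \<otimes> ?r"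
      using c by (simp add: m_assoc)
    also have "\<dots> = s \<otimes> ((t \<otimes> t) \<otimes> (s \<otimes> t))" using Suc c by (simp add: m_assoc)
    also have "\<dots> = (s \<otimes> s) \<otimes> t" using c S_sq[OF assms(2)] by (simp add: m_assoc)
    finally show ?case using c S_sq[OF assms(1)] by simp
  qed (use c in simp)
  have conj: "?r [^] m \<otimes> x \<otimes> inv (?r [^] m) = y \<longleftrightarrow> x = inv (?r [^] m) \<otimes> y \<otimes> ?r [^] m"
    if "y \<in> carrier W" for y
    by (rule conj_eq_iff) (use c that in auto)
  have inv_t: "inv (?r [^] m) \<otimes> t = t \<otimes> ?r [^] m"
  proof -
    have "inv (?r [^] m) \<otimes> (?r [^] m \<otimes> t \<otimes> ?r [^] m) = t \<otimes> ?r [^] m"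
      using c by (simp add: m_assoc[symmetric])
    then show ?thesis using tr[of m] by simp
  qed
  have "inv (?r [^] m) \<otimes> t \<otimes> ?r [^] m = t \<otimes> ?r [^] (2 * m)"
    using inv_t c by (simp add: m_assoc nat_pow_mult mult_2)
  then have 1: "?r [^] m \<otimes> x \<otimes> inv (?r [^] m) = t \<longleftrightarrow> t \<otimes> ?r [^] (2 * m) = x"
    using conj[of t] c by auto
  have "inv (?r [^] m) \<otimes> (t \<otimes> s \<otimes> t) \<otimes> ?r [^] m = (inv (?r [^] m) \<otimes> t) \<otimes> (?r \<otimes> ?r [^] m)"
    using c by (simp add: m_assoc)
  also have "\<dots> = t \<otimes> (?r [^] m \<otimes> (?r [^] (1::nat) \<otimes> ?r [^] m))" using inv_t c by (simp add: m_assoc)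
  also have "\<dots> = t \<otimes> ?r [^] Suc (2 * m)"
    using c by (simp only: nat_pow_mult m_closed) (simp add: mult_2)
  finally have 2: "?r [^] m \<otimes> x \<otimes> inv (?r [^] m) = t \<otimes> s \<otimes> t \<longleftrightarrow> t \<otimes> ?r [^] Suc (2 * m) = x"
    using conj[of "t \<otimes> s \<otimes> t"] c by auto
  \<comment> \<open>the two new letters contribute the indices \<open>2 * m\<close> and \<open>2 * m + 1\<close>\<close>
  have st: "inversion_parity [s, t] y = ((y = t \<otimes> s \<otimes> t) \<noteq> (y = t))" if "y \<in> carrier W" for y
  proof -
    have "t \<otimes> y \<otimes> t = s \<longleftrightarrow> y = t \<otimes> s \<otimes> t"
      using conj_eq_iff[of t y s] c that S_inv[OF assms(2)] by simp
    then show ?thesis using that c S_inv[OF assms(2)] by (auto)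
  qed
  have eq: "?A (Suc m) = ?A m \<union> {j. j = 2 * m \<and> t \<otimes> ?r [^] (2 * m) = x} \<union>
      {j. j = Suc (2 * m) \<and> t \<otimes> ?r [^] (Suc (2 * m)) = x}"
    by (auto simp: less_Suc_eq)
  have "card (?A (Suc m)) = card (?A m) + (if t \<otimes> ?r [^] (2 * m) = x then 1 else 0) +
      (if t \<otimes> ?r [^] (Suc (2 * m)) = x then 1 else 0)"
    unfolding eq by (subst card_Un_disjoint; (subst card_Un_disjoint)?) auto
  moreover have "inversion_parity (concat (replicate (Suc m) [s, t])) x =
      (inversion_parity [s, t] (?r [^] m \<otimes> x \<otimes> inv (?r [^] m)) \<noteq> inversion_parity ?ws x)"
    using inversion_parity_append[of "[s, t]" ?ws x] ws assms v by simp
  ultimately show ?case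
    using Suc 1 2 st[of "?r [^] m \<otimes> x \<otimes> inv (?r [^] m)"] c by auto
qed simp

text \<open>By \<open>inversion_parity_append\<close> it suffices to look at the relators \<open>(s t)\<^sup>m\<close>. There the reflections
  for the indices \<open>j\<close> and \<open>j + m\<close> coincide, so each reflection occurs an even number of times.\<close>

lemma inversion_parity_equiv:
  "coxeter_equiv W S xs ys \<Longrightarrow> xs \<in> lists S \<and> ys \<in> lists S \<and> val xs = val ys \<and>
    (\<forall>t\<in>carrier W. inversion_parity xs t = inversion_parity ys t)"
proof (induction rule: coxeter_equiv.induct)
  case (rel s t m xs ys)
  note c = S_carrier[OF rel(1)] S_carrier[OF rel(2)]
  let ?r = "s \<otimes> t" and ?ws = "concat (replicate m [s, t])"
  have ws: "?ws \<in> lists S" using rel by (induction m) auto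
  have v: "val (concat (replicate k [s, t])) = ?r [^] k" for k
  proof (induction k)
    case (Suc m)
    then show ?case using nat_pow_mult[of ?r 1 m] c by (simp add: m_assoc)
  qed simp
  have rm: "?r [^] m = \<one>" using rel(3) pow_ord_eq_1[of ?r] c by simp
  have *: "\<not> inversion_parity ?ws x" if x: "x \<in> carrier W" for x
  proof -
    let ?A = "{j. j < m \<and> t \<otimes> ?r [^] j = x}"
    have p: "?r [^] (j + m) = ?r [^] j" for j
      using nat_pow_mult[of ?r j m, symmetric] c rm by simp
    have eq: "{j. j < 2 * m \<and> t \<otimes> ?r [^] j = x} = ?A \<union> (\<lambda>j. j + m) ` ?A"
    proof (rule Set.set_eqI, rule iffI)
      fix j assume j: "j \<in> {j. j < 2 * m \<and> t \<otimes> ?r [^] j = x}"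
      show "j \<in> ?A \<union> (\<lambda>j. j + m) ` ?A"
      proof (cases "j < m")
        case False
        then have "j = (j - m) + m" "j - m \<in> ?A" using j p[of "j - m"] by auto
        then show ?thesis by blast
      qed (use j in auto)
    qed (use p in auto)
    have "card ((\<lambda>j. j + m) ` ?A) = card ?A" by (rule card_image) (auto simp: inj_on_def)
    then have "card {j. j < 2 * m \<and> t \<otimes> ?r [^] j = x} = 2 * card ?A"
      unfolding eq by (subst card_Un_disjoint) auto
    then show ?thesis using inversion_parity_dihedral[OF rel(1,2) x, of m] by simp
  qed
  have "val (?ws @ ys) = val ys" using val_append[OF ws rel(6)] v rm val_closed[OF rel(6)] by simp
  moreover have "?ws @ ys \<in> lists S" using ws rel by auto
  ultimately show ?case
    using rel ws * val_closed[OF rel(6)]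
    by (auto simp: val_append inversion_parity_append)
qed auto

text \<open>By the lemma above, the choice of the word does not matter; this is the only place where the
  presentation of \<open>W\<close> enters, apart from the parity of the length. For a reflection \<open>t\<close> it means
  that \<open>w t\<close> is shorter than \<open>w\<close>.\<close>

definition inverts :: "'w \<Rightarrow> 'w \<Rightarrow> bool" where
  "inverts w t \<longleftrightarrow> (\<exists>xs\<in>lists S. val xs = w \<and> inversion_parity xs t)"

lemma inverts_val:
  assumes "xs \<in> lists S" "t \<in> carrier W"
  shows "inverts (val xs) t = inversion_parity xs t"
  using inversion_parity_equiv[OF S_presentation[OF assms(1)]] assms unfolding inverts_def by metis

lemma inverts_mult:
  assumes "u \<in> carrier W" "v \<in> carrier W" "t \<in> carrier W"
  shows "inverts (u \<otimes> v) t = (inverts u (v \<otimes> t \<otimes> inv v) \<noteq> inverts v t)"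
proof -
  obtain xs ys where "xs \<in> lists S" "val xs = u" "ys \<in> lists S" "val ys = v"
    using obtain_word assms by metis
  then show ?thesis
    using inversion_parity_append[of xs ys t] inverts_val[of "xs @ ys" t] inverts_val[of ys t]
      inverts_val[of xs "v \<otimes> t \<otimes> inv v"] val_append[of xs ys] assms by auto
qed

lemma inverts_one: "t \<in> carrier W \<Longrightarrow> \<not> inverts \<one> t"
  using inverts_val[of "[]" t] by simp

lemma inverts_S: "s \<in> S \<Longrightarrow> t \<in> carrier W \<Longrightarrow> inverts s t \<longleftrightarrow> t = s"
  using inverts_val[of "[s]" t] S_carrier by simp

lemma inverts_self:
  assumes "v \<in> carrier W" "s \<in> S" "t = v \<otimes> s \<otimes> inv v"
  shows "inverts t t"
proof -
  have c: "s \<in> carrier W" "t \<in> carrier W" using assms S_carrier by auto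
  have a: "inv v \<otimes> t \<otimes> v = s" using conj_eq_iff[of v s t] assms(1,3) c by simp
  have "inverts t t = (inverts (v \<otimes> s) (inv v \<otimes> t \<otimes> inv (inv v)) \<noteq> inverts (inv v) t)"
    using inverts_mult[of "v \<otimes> s" "inv v" t] assms c by simp
  also have "\<dots> = (inverts (v \<otimes> s) s \<noteq> inverts (inv v) t)" using a assms by simp
  also have "inverts (v \<otimes> s) s = (\<not> inverts v s)"
    using inverts_mult[of v s s] inverts_S[OF assms(2) c(1)] S_inv[OF assms(2)] S_sq[OF assms(2)]
      assms c by (simp add: m_assoc)
  also have "inverts (inv v) t = inverts v s"
  proof -
    have "inverts (v \<otimes> inv v) t = (inverts v s \<noteq> inverts (inv v) t)"
      using inverts_mult[of v "inv v" t] assms(1) c a by simp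
    then show ?thesis using inverts_one[OF c(2)] assms(1) by simp
  qed
  finally show ?thesis by simp
qed

text \<open>The exchange condition: right multiplication by the reflection of an index deletes the letter
  there.\<close>

lemma inversion_deletion:
  assumes "xs \<in> lists S" "t \<in> carrier W" "inversion_parity xs t"
  shows "\<exists>ys. set ys \<subseteq> set xs \<and> Suc (length ys) = length xs \<and> val ys = val xs \<otimes> t"
  using assms(1,3)
proof (induction xs)
  case (Cons x xs)
  then have c: "x \<in> S" "x \<in> carrier W" "xs \<in> lists S" "val xs \<in> carrier W"
    using S_carrier val_closed by auto
  show ?case
  proof (cases "val xs \<otimes> t \<otimes> inv (val xs) = x")
    case True
    then have "x \<otimes> val xs = val xs \<otimes> t" using c assms(2) by (auto simp: m_assoc)
    then have "val (x # xs) \<otimes> t = val xs"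
      using c assms(2) S_sq[OF c(1)] by (metis val_simps(2) m_assoc l_one)
    then show ?thesis by (intro exI[of _ xs]) auto
  next
    case False
    then obtain ys where "set ys \<subseteq> set xs" "Suc (length ys) = length xs" "val ys = val xs \<otimes> t"
      using Cons by auto
    then show ?thesis using c assms(2) by (intro exI[of _ "x # ys"]) (auto simp: m_assoc)
  qed
qed simp

text \<open>Deletion gives one direction for every \<open>w\<close>. As \<open>t\<close> inverts itself, exactly one of \<open>w\<close> and \<open>w t\<close>
  inverts \<open>t\<close>, and the first direction for \<open>w t\<close> is the other direction for \<open>w\<close>.\<close>

lemma inverts_iff:
  assumes "w \<in> carrier W" "v \<in> carrier W" "s \<in> S" "t = v \<otimes> s \<otimes> inv v"
  shows "inverts w t \<longleftrightarrow> len (w \<otimes> t) < len w"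
proof -
  have t: "t \<in> carrier W" using assms S_carrier by auto
  have less: "len (w \<otimes> t) < len w" if w: "w \<in> carrier W" "inverts w t" for w
  proof -
    obtain xs where xs: "xs \<in> lists S" "length xs = len w" "val xs = w" using len_word[OF w(1)] .
    then obtain ys where "set ys \<subseteq> set xs" "Suc (length ys) = length xs" "val ys = w \<otimes> t"
      using inversion_deletion[OF xs(1) t] inverts_val[OF xs(1) t] w by auto
    moreover from this have "ys \<in> lists S" using xs(1) by auto
    ultimately show ?thesis using len_le[of ys] xs(2) by simp
  qed
  have tt: "t \<otimes> t = \<one>"
  proof -
    have "t \<otimes> t = v \<otimes> ((s \<otimes> s) \<otimes> inv v)"
      using assms S_carrier[OF assms(3)] by (simp add: m_assoc mult_cancel)
    then show ?thesis using assms S_sq by simp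
  qed
  show ?thesis
  proof
    assume lt: "len (w \<otimes> t) < len w"
    show "inverts w t"
    proof (rule ccontr)
      assume "\<not> inverts w t"
      moreover have "t \<otimes> t \<otimes> inv t = t" using t by (simp add: m_assoc)
      ultimately have "inverts (w \<otimes> t) t"
        using inverts_mult[OF assms(1) t t] inverts_self[OF assms(2-4)] by simp
      from less[OF _ this] have "len (w \<otimes> t \<otimes> t) < len (w \<otimes> t)" using assms(1) t by simp
      then show False using lt tt assms(1) t by (simp add: m_assoc)
    qed
  qed (use less assms(1) in auto)
qed

lemma inverts_S_iff:
  assumes "w \<in> carrier W" "s \<in> S"
  shows "inverts w s \<longleftrightarrow> len (w \<otimes> s) < len w"
  using inverts_iff[OF assms(1) one_closed assms(2), of s] S_carrier[OF assms(2)] by simp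

subsection \<open>Cosets of parabolic subgroups\<close>

text \<open>Induction on a word for \<open>u\<close>. When a letter \<open>k\<close> is added, \<open>n u\<close> and \<open>u\<close> become longer or shorter
  together, because \<open>n\<close> does not invert the reflection \<open>u k u\<inverse>\<close>: this reflection lies in the
  parabolic subgroup, so it cannot shorten \<open>n\<close>.\<close>

lemma min_coset_additive:
  assumes "K \<subseteq> S" "n \<in> carrier W" "\<And>u. u \<in> generate W K \<Longrightarrow> len n \<le> len (n \<otimes> u)"
    "u \<in> generate W K"
  shows "len (n \<otimes> u) = len n + len u"
proof -
  have "len (n \<otimes> val xs) = len n + len (val xs)" if "xs \<in> lists K" for xs
    using that
  proof (induction xs rule: rev_induct)
    case (snoc k xs)
    then have k: "k \<in> S" "k \<in> carrier W" "k \<in> K" and xs: "xs \<in> lists S" "xs \<in> lists K"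
      using assms(1) S_carrier by auto
    let ?u = "val xs" and ?t = "val xs \<otimes> k \<otimes> inv (val xs)"
    have u: "?u \<in> carrier W" by (rule val_closed[OF xs(1)])
    have "?t \<in> generate W K"
      using word_generate[OF assms(1) xs(2)] generate.incl[OF k(3)]
        subgroup.m_inv_closed[OF generate_subgroup[OF assms(1)]] by (auto intro!: generate.eng)
    then have "len n \<le> len (n \<otimes> ?t)" by (rule assms(3))
    then have "\<not> inverts n ?t" using inverts_iff[OF assms(2) u k(1) HOL.refl] by simp
    then have iff: "inverts (n \<otimes> ?u) k \<longleftrightarrow> inverts ?u k"
      using inverts_mult[OF assms(2) u k(2)] by simp
    have v: "val (xs @ [k]) = ?u \<otimes> k" using val_append[OF xs(1), of "[k]"] k by simp
    have "len (n \<otimes> ?u \<otimes> k) = len n + len (?u \<otimes> k)"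
      using iff inverts_S_iff[OF u k(1)] inverts_S_iff[OF _ k(1), of "n \<otimes> ?u"] snoc assms(2) u
        len_mult_S[OF u k(1)] len_mult_S[OF _ k(1), of "n \<otimes> ?u"] by auto
    then show ?case using v u k assms(2) by (simp add: m_assoc)
  qed (use assms(2) in simp)
  then show ?thesis using generate_word[OF assms(1,4)] by blast
qed

text \<open>The descent is the last letter of a shortest word over \<open>K\<close> for \<open>u\<close>: otherwise the exchange
  condition would delete two letters of this word, and deletion stays within \<open>K\<close>.\<close>

lemma parabolic_descent:
  assumes "K \<subseteq> S" "u \<in> generate W K" "u \<noteq> \<one>"
  obtains k where "k \<in> K" "len (u \<otimes> k) < len u"
proof -
  define P where "P = (\<lambda>xs. xs \<in> lists K \<and> val xs = u)"
  obtain xs0 where "P xs0" using generate_word[OF assms(1,2)] by (auto simp: P_def)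
  then obtain xs where xs: "P xs" "\<And>ys. P ys \<Longrightarrow> length xs \<le> length ys"
    using ex_has_least_nat[of P xs0 length] by blast
  have ne: "xs \<noteq> []" using xs(1) assms(3) by (auto simp: P_def)
  then obtain zs k where e: "xs = zs @ [k]" by (metis rev_exhaust)
  have k: "k \<in> K" "k \<in> S" "k \<in> carrier W" and zs: "zs \<in> lists K" "zs \<in> lists S"
    using xs(1) assms(1) S_carrier by (auto simp: P_def e)
  have u: "u = val zs \<otimes> k" using xs(1) val_append[OF zs(2), of "[k]"] k by (auto simp: P_def e)
  have z: "val zs \<in> carrier W" by (rule val_closed[OF zs(2)])
  have "\<not> inverts (val zs) k"
  proof
    assume "inverts (val zs) k"
    then obtain ys where ys: "set ys \<subseteq> set zs" "Suc (length ys) = length zs" "val ys = u"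
      using inversion_deletion[OF zs(2) k(3)] inverts_val[OF zs(2) k(3)] u by auto
    then have "P ys" using zs(1) by (auto simp: P_def)
    from xs(2)[OF this] ys(2) e show False by simp
  qed
  then have "\<not> len u < len (val zs)" using inverts_S_iff[OF z k(2)] u by simp
  moreover have "u \<otimes> k = val zs" using u z k S_sq[OF k(2)] by (simp add: m_assoc)
  ultimately have "len (u \<otimes> k) < len u"
    using len_mult_S[OF z k(2)] u by auto
  with k(1) show ?thesis using that by blast
qed

text \<open>Write \<open>g\<close> as a shortest element of its coset times some \<open>v\<close> in the parabolic subgroup. If \<open>v\<close> were
  not the identity, it would have a descent in \<open>K\<close>, and by additivity so would \<open>g\<close>.\<close>

lemma no_descent_additive:
  assumes "K \<subseteq> S" "g \<in> carrier W" "\<And>k. k \<in> K \<Longrightarrow> len g < len (g \<otimes> k)" "u \<in> generate W K"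
  shows "len (g \<otimes> u) = len g + len u"
proof -
  note G = generate_subgroup[OF assms(1)]
  have sub: "x \<in> carrier W" if "x \<in> generate W K" for x
    using subgroup.mem_carrier[OF G that] .
  obtain a where a: "a \<in> generate W K" "\<And>b. b \<in> generate W K \<Longrightarrow> len (g \<otimes> a) \<le> len (g \<otimes> b)"
    using ex_has_least_nat[of "\<lambda>x. x \<in> generate W K" \<one> "\<lambda>x. len (g \<otimes> x)"] generate.one by blast
  have min: "len (g \<otimes> a) \<le> len (g \<otimes> a \<otimes> u)" if "u \<in> generate W K" for u
    using a(2)[OF generate.eng[OF a(1) that]] assms(2) sub[OF a(1)] sub[OF that] by (simp add: m_assoc)
  have add: "len (g \<otimes> a \<otimes> u) = len (g \<otimes> a) + len u" if "u \<in> generate W K" for u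
    using min_coset_additive[OF assms(1) _ min that] assms(2) sub[OF a(1)] by simp
  have ia: "inv a \<in> generate W K" using subgroup.m_inv_closed[OF G a(1)] .
  have "inv a = \<one>"
  proof (rule ccontr)
    assume "inv a \<noteq> \<one>"
    then obtain k where k: "k \<in> K" "len (inv a \<otimes> k) < len (inv a)"
      using parabolic_descent[OF assms(1) ia] by blast
    have kc: "k \<in> carrier W" using assms(1) k S_carrier by blast
    have e: "g \<otimes> a \<otimes> (inv a \<otimes> k) = g \<otimes> k" "g \<otimes> a \<otimes> inv a = g"
      using assms(2) sub[OF a(1)] kc by (simp_all add: m_assoc mult_cancel)
    have "len (g \<otimes> k) = len (g \<otimes> a) + len (inv a \<otimes> k)"
      using add[OF generate.eng[OF ia generate.incl[OF k(1)]]] by (simp only: e)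
    moreover have "len g = len (g \<otimes> a) + len (inv a)" using add[OF ia] by (simp only: e)
    ultimately show False using k(2) assms(3)[OF k(1)] by linarith
  qed
  then have a1: "a = \<one>" using sub[OF a(1)] inv_eq_1_iff by blast
  show ?thesis using add[OF assms(4)] assms(2) by (simp only: a1 r_one)
qed

text \<open>Here \<open>w \<otimes> inv q\<close> is the element that carries \<open>q\<close> to \<open>w\<close>. In a gated set there is for each \<open>w\<close> an
  element \<open>p\<close> through which a shortest way from \<open>w\<close> to any element of the set passes. The
  construction of the left adjoint of restriction uses nothing else about cosets of parabolic
  subgroups.\<close>

definition gated :: "'w set \<Rightarrow> bool" where
  "gated P \<longleftrightarrow> P \<subseteq> carrier W \<and>
    (\<forall>w\<in>carrier W. \<exists>p\<in>P. \<forall>q\<in>P. len (w \<otimes> inv q) = len (w \<otimes> inv p) + len (p \<otimes> inv q))"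

definition gate :: "'w set \<Rightarrow> 'w \<Rightarrow> 'w" where
  "gate P w = (SOME p. p \<in> P \<and> (\<forall>q\<in>P. len (w \<otimes> inv q) = len (w \<otimes> inv p) + len (p \<otimes> inv q)))"

lemma gated_carrier: "gated P \<Longrightarrow> p \<in> P \<Longrightarrow> p \<in> carrier W"
  unfolding gated_def by blast

lemma gate_facts:
  assumes "gated P" "w \<in> carrier W"
  shows gate_in: "gate P w \<in> P" and gate_carrier: "gate P w \<in> carrier W"
    and gate_len: "q \<in> P \<Longrightarrow> len (w \<otimes> inv q) = len (w \<otimes> inv (gate P w)) + len (gate P w \<otimes> inv q)"
proof -
  have "\<exists>p. p \<in> P \<and> (\<forall>q\<in>P. len (w \<otimes> inv q) = len (w \<otimes> inv p) + len (p \<otimes> inv q))"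
    using assms unfolding gated_def by blast
  from someI_ex[OF this]
  have g: "gate P w \<in> P \<and> (\<forall>q\<in>P. len (w \<otimes> inv q) = len (w \<otimes> inv (gate P w)) + len (gate P w \<otimes> inv q))"
    unfolding gate_def .
  then show "gate P w \<in> P" by (rule conjunct1)
  then show "gate P w \<in> carrier W" using assms(1) gated_carrier by blast
  show "len (w \<otimes> inv q) = len (w \<otimes> inv (gate P w)) + len (gate P w \<otimes> inv q)" if "q \<in> P"
    using g that by blast
qed

lemma gate_eqI:
  assumes "gated P" "w \<in> carrier W" "p \<in> P" "len (w \<otimes> inv p) \<le> len (w \<otimes> inv (gate P w))"
  shows "gate P w = p"
proof -
  note g = gate_facts[OF assms(1,2)]
  have p: "p \<in> carrier W" using assms(1,3) gated_carrier by blast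
  have "len (gate P w \<otimes> inv p) = 0" using g(3)[OF assms(3)] assms(4) by linarith
  then have "gate P w \<otimes> inv p = \<one>" using len_zero g(2) p by simp
  then show ?thesis using g(2) p by (metis inv_equality inv_inv inv_closed)
qed

lemma gate_self: "gated P \<Longrightarrow> w \<in> P \<Longrightarrow> gate P w = w"
  using gate_eqI[of P w w] gated_carrier[of P w] by simp

lemma coset_memD:
  assumes "K \<subseteq> S" "x \<in> carrier W" "p \<in> generate W K #> x" "q \<in> generate W K #> x"
  shows "p \<otimes> inv q \<in> generate W K" "p \<in> carrier W"
proof -
  note G = generate_subgroup[OF assms(1)]
  obtain a b where ab: "a \<in> generate W K" "b \<in> generate W K" "p = a \<otimes> x" "q = b \<otimes> x"
    using assms(3,4) by (auto simp: r_coset_def)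
  then have c: "a \<in> carrier W" "b \<in> carrier W" using subgroup.mem_carrier[OF G] by auto
  have "p \<otimes> inv q = a \<otimes> inv b"
    using ab c assms(2) by (simp add: inv_mult_group m_assoc mult_cancel)
  then show "p \<otimes> inv q \<in> generate W K"
    using generate.eng[OF ab(1) subgroup.m_inv_closed[OF G ab(2)]] c assms(2) by simp
  show "p \<in> carrier W" using ab c assms(2) by simp
qed

lemma coset_memI:
  assumes "K \<subseteq> S" "x \<in> carrier W" "p \<in> generate W K #> x" "u \<in> generate W K"
  shows "u \<otimes> p \<in> generate W K #> x"
proof -
  note G = generate_subgroup[OF assms(1)]
  obtain a where a: "a \<in> generate W K" "p = a \<otimes> x"
    using assms(3) by (auto simp: r_coset_def)
  then have "u \<otimes> p = (u \<otimes> a) \<otimes> x"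
    using subgroup.mem_carrier[OF G] assms(2,4) by (simp add: m_assoc)
  then show ?thesis using generate.eng[OF assms(4) a(1)] by (auto simp: r_coset_def)
qed

text \<open>The gate of \<open>w\<close> is an element \<open>p\<close> for which \<open>w p\<inverse>\<close> is shortest; then \<open>w p\<inverse>\<close> is shortest in its
  left coset of the parabolic subgroup.\<close>

lemma coset_gated:
  assumes "K \<subseteq> S" "x \<in> carrier W"
  shows "gated (generate W K #> x)" (is "gated ?P")
  unfolding gated_def
proof (intro conjI ballI)
  note G = generate_subgroup[OF assms(1)]
  have xP: "x \<in> ?P" using generate.one[of W K] assms(2) by (force simp: r_coset_def)
  show c: "?P \<subseteq> carrier W" using coset_memD(2)[OF assms] by blast
  fix w assume w: "w \<in> carrier W"
  obtain p where p: "p \<in> ?P" "\<And>q. q \<in> ?P \<Longrightarrow> len (w \<otimes> inv p) \<le> len (w \<otimes> inv q)"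
    using ex_has_least_nat[of "\<lambda>p. p \<in> ?P" x "\<lambda>p. len (w \<otimes> inv p)"] xP by auto
  have pc: "p \<in> carrier W" using c p(1) by blast
  have min: "len (w \<otimes> inv p) \<le> len (w \<otimes> inv p \<otimes> u)" if "u \<in> generate W K" for u
  proof -
    have u: "inv u \<in> generate W K" "u \<in> carrier W"
      using subgroup.m_inv_closed[OF G that] subgroup.mem_carrier[OF G that] .
    have "w \<otimes> inv (inv u \<otimes> p) = w \<otimes> inv p \<otimes> u" using w pc u by (simp add: inv_mult_group m_assoc)
    then show ?thesis using p(2)[OF coset_memI[OF assms p(1) u(1)]] by simp
  qed
  show "\<exists>p\<in>?P. \<forall>q\<in>?P. len (w \<otimes> inv q) = len (w \<otimes> inv p) + len (p \<otimes> inv q)"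
  proof (intro bexI[OF _ p(1)] ballI)
    fix q assume q: "q \<in> ?P"
    have qc: "q \<in> carrier W" using c q by blast
    have "w \<otimes> inv q = w \<otimes> inv p \<otimes> (p \<otimes> inv q)" using w pc qc by (simp add: m_assoc mult_cancel)
    then show "len (w \<otimes> inv q) = len (w \<otimes> inv p) + len (p \<otimes> inv q)"
      using min_coset_additive[OF assms(1) _ min coset_memD(1)[OF assms p(1) q]] w pc by simp
  qed
qed

end

subsection \<open>The longest element\<close>

locale finite_coxeter = coxeter +
  assumes finite_carrier: "finite (carrier W)"
begin

abbreviation w0 :: 'a where "w0 \<equiv> longest_elt W S"

text \<open>The proof of \<open>min_coset_additive\<close> with the opposite conclusion for each letter: \<open>w\<close> inverts every
  reflection, since multiplication by a reflection changes the parity of the length and cannot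
  increase it beyond the maximum.\<close>

lemma maximal_additive:
  assumes w: "w \<in> carrier W" "\<And>v. v \<in> carrier W \<Longrightarrow> len v \<le> len w" and u: "u \<in> carrier W"
  shows "len (w \<otimes> u) + len u = len w"
proof -
  have "len (w \<otimes> val xs) + len (val xs) = len w" if "xs \<in> lists S" for xs
    using that
  proof (induction xs rule: rev_induct)
    case (snoc k xs)
    then have k: "k \<in> S" "k \<in> carrier W" and xs: "xs \<in> lists S" using S_carrier by auto
    let ?u = "val xs" and ?t = "val xs \<otimes> k \<otimes> inv (val xs)"
    have u: "?u \<in> carrier W" by (rule val_closed[OF xs])
    have t: "?t \<in> carrier W" using u k by simp
    have "even (len ?t) \<noteq> even (len \<one>)"
    proof -
      have "even (len ?t) = even (len ?u + len k + len (inv ?u))"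
        using len_mult_parity[of "?u \<otimes> k" "inv ?u"] len_mult_parity[of ?u k] u k by simp
      then show ?thesis using len_S[OF k(1)] len_inv[OF u] by simp
    qed
    then have "len (w \<otimes> ?t) \<noteq> len w" using len_mult_parity[OF w(1) t] by auto
    then have "len (w \<otimes> ?t) < len w" using w(2)[of "w \<otimes> ?t"] w(1) t by fastforce
    then have "inverts w ?t" using inverts_iff[OF w(1) u k(1) HOL.refl] by simp
    then have iff: "inverts (w \<otimes> ?u) k \<longleftrightarrow> \<not> inverts ?u k"
      using inverts_mult[OF w(1) u k(2)] by simp
    have v: "val (xs @ [k]) = ?u \<otimes> k" using val_append[OF xs(1), of "[k]"] k by simp
    have "len (w \<otimes> ?u \<otimes> k) + len (?u \<otimes> k) = len w"
      using iff inverts_S_iff[OF u k(1)] inverts_S_iff[OF _ k(1), of "w \<otimes> ?u"] snoc w(1) u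
        len_mult_S[OF u k(1)] len_mult_S[OF _ k(1), of "w \<otimes> ?u"] by auto
    then show ?case using v u k w(1) by (simp add: m_assoc)
  qed (use w(1) in simp)
  then show ?thesis using obtain_word[OF u] by metis
qed

lemma w0_facts:
  shows w0_carrier: "w0 \<in> carrier W" and w0_max: "v \<in> carrier W \<Longrightarrow> len v \<le> len w0"
proof -
  have "\<forall>v. v \<in> carrier W \<longrightarrow> len v < Suc (Max (len ` carrier W))"
    using finite_carrier by (simp add: less_Suc_eq_le)
  from ex_has_greatest_nat[OF one_closed this] obtain w
    where w: "w \<in> carrier W" "\<And>v. v \<in> carrier W \<Longrightarrow> len v \<le> len w" by blast
  have "longest_elt W S = w"
    unfolding longest_elt_def
  proof (rule the_equality)
    fix v assume v: "v \<in> carrier W \<and> (\<forall>u\<in>carrier W. len u \<le> len v)"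
    have "len (w \<otimes> (inv w \<otimes> v)) + len (inv w \<otimes> v) = len w"
      by (rule maximal_additive[OF w]) (use w v in auto)
    moreover have "w \<otimes> (inv w \<otimes> v) = v" using w v by (simp add: m_assoc[symmetric])
    moreover have "len w \<le> len v" using v w by blast
    ultimately have "len (inv w \<otimes> v) = 0" by simp
    then have "inv w \<otimes> v = \<one>" using len_zero w v by simp
    then show "v = w" using mult_cancel(2)[of w v] w v by simp
  qed (use w in blast)
  then show "w0 \<in> carrier W" "v \<in> carrier W \<Longrightarrow> len v \<le> len w0" using w by auto
qed

lemma w0_additive: "g \<in> carrier W \<Longrightarrow> len w0 = len g + len (inv g \<otimes> w0)"
proof -
  assume g: "g \<in> carrier W"
  have "len (w0 \<otimes> (inv w0 \<otimes> g)) + len (inv w0 \<otimes> g) = len w0"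
    by (rule maximal_additive[OF w0_facts]) (use g w0_carrier in auto)
  moreover have "w0 \<otimes> (inv w0 \<otimes> g) = g" using g w0_carrier by (simp add: m_assoc[symmetric])
  moreover have "inv (inv w0 \<otimes> g) = inv g \<otimes> w0" using g w0_carrier by (simp add: inv_mult_group)
  ultimately show ?thesis using len_inv[of "inv w0 \<otimes> g"] g w0_carrier by simp
qed

lemma w0_sq: "w0 \<otimes> w0 = \<one>"
proof -
  have "len (w0 \<otimes> w0) + len w0 = len w0" by (rule maximal_additive[OF w0_facts w0_carrier])
  then show ?thesis using len_zero w0_carrier by simp
qed

lemma w0_inv: "inv w0 = w0"
  using w0_sq w0_carrier inv_equality by blast

text \<open>As \<open>\<ell>(w\<^sub>0 v) = \<ell>(w\<^sub>0) - \<ell>(v)\<close>, a descent of \<open>w\<^sub>0 g\<close> is an ascent of \<open>g\<close>; and \<open>w\<^sub>0 g\<close> has a descent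
  unless it is the identity.\<close>

lemma all_descents:
  assumes "g \<in> carrier W" "\<And>s. s \<in> S \<Longrightarrow> len (g \<otimes> s) < len g"
  shows "g = w0"
proof (rule ccontr)
  assume ne: "g \<noteq> w0"
  have gg: "w0 \<otimes> (w0 \<otimes> g) = g" using assms(1) w0_carrier w0_sq by (simp add: m_assoc[symmetric])
  have "w0 \<otimes> g \<noteq> \<one>"
  proof
    assume "w0 \<otimes> g = \<one>"
    then show False using gg ne w0_carrier by simp
  qed
  moreover have "w0 \<otimes> g \<in> generate W S" using S_generate assms(1) w0_carrier by simp
  ultimately obtain k where k: "k \<in> S" "len (w0 \<otimes> g \<otimes> k) < len (w0 \<otimes> g)"
    using parabolic_descent[of S "w0 \<otimes> g"] by blast
  have kc: "k \<in> carrier W" using k S_carrier by blast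
  have "len (w0 \<otimes> (w0 \<otimes> g)) + len (w0 \<otimes> g) = len w0"
    by (rule maximal_additive[OF w0_facts]) (use assms(1) w0_carrier in simp_all)
  moreover have "len (w0 \<otimes> (w0 \<otimes> g \<otimes> k)) + len (w0 \<otimes> g \<otimes> k) = len w0"
    by (rule maximal_additive[OF w0_facts]) (use assms(1) w0_carrier kc in simp_all)
  moreover have "w0 \<otimes> (w0 \<otimes> g \<otimes> k) = g \<otimes> k"
    using assms(1) w0_carrier w0_sq kc by (simp add: m_assoc[symmetric])
  moreover have "len (g \<otimes> k) < len g" by (rule assms(2)[OF k(1)])
  ultimately show False using k(2) gg by simp
qed

end

section \<open>Gluing data and glued categories\<close>

locale gluing_system = coxeter W S
  for W :: "('w, 'x) monoid_scheme" (structure) and S :: "'w set" +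
  fixes D :: "('w, 'o, 'm) gluing"
  assumes gluing: "gluing_data W S D"
    and abelian: "\<And>w. w \<in> carrier W \<Longrightarrow> abelian_category (Cat D w)"
begin

abbreviation ob :: "'w \<Rightarrow> 'o \<Rightarrow> bool" where "ob v X \<equiv> X \<in> Obj (Cat D v)"
abbreviation ar :: "'w \<Rightarrow> 'o \<Rightarrow> 'o \<Rightarrow> 'm \<Rightarrow> bool" where "ar v \<equiv> arr (Cat D v)"
abbreviation cmp_at :: "'m \<Rightarrow> 'w \<Rightarrow> 'm \<Rightarrow> 'm" ("_ \<cdot>\<^bsub>_\<^esub> _" [71, 0, 70] 70) where
  "g \<cdot>\<^bsub>v\<^esub> f \<equiv> Cmp (Cat D v) g f"
abbreviation idn :: "'w \<Rightarrow> 'o \<Rightarrow> 'm" where "idn v \<equiv> Ide (Cat D v)"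

lemma C_pre: "v \<in> carrier W \<Longrightarrow> preadditive_category (Cat D v)"
  using abelian by (simp add: abelian_category_def preadditive_category_def)

lemmas C_cmp_arr = preadditive_category.cmp_arr[OF C_pre]
lemmas C_assoc = preadditive_category.cmp_assoc[OF C_pre]
lemmas C_ide_arr = preadditive_category.ide_arr[OF C_pre]
lemmas C_ide = preadditive_category.cmp_ide[OF C_pre]
lemmas C_zer_arr = preadditive_category.zer_arr[OF C_pre]

lemmas gluing_rules =
  gluing[unfolded gluing_data_def, THEN conjunct1, rule_format]
  gluing[unfolded gluing_data_def, THEN conjunct2, THEN conjunct1, rule_format]
  gluing[unfolded gluing_data_def, THEN conjunct2, THEN conjunct2, THEN conjunct1, rule_format]
  gluing[unfolded gluing_data_def, THEN conjunct2, THEN conjunct2, THEN conjunct2, THEN conjunct1, rule_format]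
  gluing[unfolded gluing_data_def, THEN conjunct2, THEN conjunct2, THEN conjunct2, THEN conjunct2, THEN conjunct1, rule_format]
  gluing[unfolded gluing_data_def, THEN conjunct2, THEN conjunct2, THEN conjunct2, THEN conjunct2, THEN conjunct2, THEN conjunct1, rule_format]
  gluing[unfolded gluing_data_def, THEN conjunct2, THEN conjunct2, THEN conjunct2, THEN conjunct2, THEN conjunct2, THEN conjunct2, THEN conjunct1, rule_format]
  gluing[unfolded gluing_data_def, THEN conjunct2, THEN conjunct2, THEN conjunct2, THEN conjunct2, THEN conjunct2, THEN conjunct2, THEN conjunct2, rule_format]

lemma Ph_right_exact:
  "w \<in> carrier W \<Longrightarrow> v \<in> carrier W \<Longrightarrow>
    right_exact_functor (Cat D v) (Cat D (w \<otimes> v)) (PhO D w v) (PhA D w v)"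
  by (rule gluing_rules(1))

lemma PhO_ob: "w \<in> carrier W \<Longrightarrow> v \<in> carrier W \<Longrightarrow> ob v X \<Longrightarrow> u = w \<otimes> v \<Longrightarrow> ob u (PhO D w v X)"
  using Ph_right_exact[of w v] unfolding right_exact_functor_def is_functor_def by blast

lemma PhA_ar:
  assumes "w \<in> carrier W" "v \<in> carrier W" "ar v X Y f" "u = w \<otimes> v"
  shows "ar u (PhO D w v X) (PhO D w v Y) (PhA D w v f)"
proof -
  have "\<forall>a\<in>Obj (Cat D v). \<forall>b\<in>Obj (Cat D v). \<forall>f\<in>Hom (Cat D v) a b.
      PhA D w v f \<in> Hom (Cat D u) (PhO D w v a) (PhO D w v b)"
    using Ph_right_exact[OF assms(1,2)] assms(4) unfolding right_exact_functor_def is_functor_def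
    by blast
  then show ?thesis using assms(3) PhO_ob[OF assms(1,2) _ assms(4)] unfolding arr_def by blast
qed

lemma PhA_cmp:
  assumes "w \<in> carrier W" "v \<in> carrier W" "ar v X Y f" "ar v Y Z g" "u = w \<otimes> v"
  shows "PhA D w v (g \<cdot>\<^bsub>v\<^esub> f) = PhA D w v g \<cdot>\<^bsub>u\<^esub> PhA D w v f"
  using Ph_right_exact[OF assms(1,2)] assms(3-) unfolding right_exact_functor_def is_functor_def arr_def
  by blast

lemma PhA_ide:
  assumes "w \<in> carrier W" "v \<in> carrier W" "ob v X" "u = w \<otimes> v"
  shows "PhA D w v (idn v X) = idn u (PhO D w v X)"
  using Ph_right_exact[OF assms(1,2)] assms(3-) unfolding right_exact_functor_def is_functor_def
  by blast

lemma PhA_add: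
  assumes "w \<in> carrier W" "v \<in> carrier W" "ar v X Y f" "ar v X Y g" "u = w \<otimes> v"
  shows "PhA D w v (Add (Cat D v) f g) = Add (Cat D u) (PhA D w v f) (PhA D w v g)"
  using Ph_right_exact[OF assms(1,2)] assms(3-) unfolding right_exact_functor_def arr_def
  by blast

lemma PhA_zer:
  assumes "w \<in> carrier W" "v \<in> carrier W" "ob v X" "ob v Y" "u = w \<otimes> v"
  shows "PhA D w v (Zer (Cat D v) X Y) = Zer (Cat D u) (PhO D w v X) (PhO D w v Y)"
proof -
  interpret V: preadditive_category "Cat D v" by (rule C_pre[OF assms(2)])
  interpret U: preadditive_category "Cat D u" by (rule C_pre) (use assms in simp)
  note z = V.zer_arr[OF assms(3,4)]
  show ?thesis
    by (rule U.add_idem_zer[OF PhA_ar[OF assms(1,2) z assms(5)]])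
      (use PhA_add[OF assms(1,2) z z assms(5)] V.add_zer(1)[OF z] in simp)
qed

lemma Ph_one:
  "v \<in> carrier W \<Longrightarrow> ob v X \<Longrightarrow> PhO D \<one> v X = X"
  "v \<in> carrier W \<Longrightarrow> ar v X Y f \<Longrightarrow> PhA D \<one> v f = f"
  unfolding arr_def by (rule gluing_rules(2), assumption+) (blast intro: gluing_rules(3))

lemma nu_ar:
  assumes "w \<in> carrier W" "w' \<in> carrier W" "v \<in> carrier W" "ob v X"
    "u = w' \<otimes> v" "x = w \<otimes> w'" "z = w \<otimes> u"
  shows "ar z (PhO D w u (PhO D w' v X)) (PhO D x v X) (Nu D w w' v X)"
proof -
  have z: "z = w \<otimes> w' \<otimes> v" "z = x \<otimes> v" using assms by (simp_all add: m_assoc)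
  have "Nu D w w' v X \<in> Hom (Cat D (w \<otimes> w' \<otimes> v)) (PhO D w (w' \<otimes> v) (PhO D w' v X)) (PhO D (w \<otimes> w') v X)"
    by (rule gluing_rules(4)[OF assms(1-4)])
  moreover have "ob u (PhO D w' v X)" "ob z (PhO D x v X)"
    using assms by (auto intro!: PhO_ob simp: z(2) simp del: assms(6,7))
  moreover from this have "ob z (PhO D w u (PhO D w' v X))"
    using assms by (auto intro!: PhO_ob)
  ultimately show ?thesis unfolding arr_def assms(5,6)[symmetric] z(2)[symmetric] by blast
qed

lemma nu_nat:
  assumes "w \<in> carrier W" "w' \<in> carrier W" "v \<in> carrier W" "ar v X Y f"
    "u = w' \<otimes> v" "x = w \<otimes> w'" "z = w \<otimes> u"
  shows "Nu D w w' v Y \<cdot>\<^bsub>z\<^esub> PhA D w u (PhA D w' v f) = PhA D x v f \<cdot>\<^bsub>z\<^esub> Nu D w w' v X"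
proof -
  have z: "z = w \<otimes> w' \<otimes> v" using assms by (simp add: m_assoc)
  show ?thesis
    using gluing_rules(5)[OF assms(1-3) arr_objD[OF assms(4)]] assms(4)
    unfolding z assms(5,6) arr_def by blast
qed

lemma nu_one:
  assumes "w \<in> carrier W" "v \<in> carrier W" "ob v X" "u = w \<otimes> v"
  shows "Nu D \<one> w v X = idn u (PhO D w v X)" "Nu D w \<one> v X = idn u (PhO D w v X)"
  using gluing_rules(6)[OF assms(1-3)] assms(4) by simp_all

lemma nu_assoc:
  assumes "w \<in> carrier W" "w' \<in> carrier W" "w'' \<in> carrier W" "v \<in> carrier W" "ob v X"
    "a = w \<otimes> w'" "b = w' \<otimes> w''" "u = w'' \<otimes> v" "t = w' \<otimes> u" "z = w \<otimes> t"
  shows "Nu D a w'' v X \<cdot>\<^bsub>z\<^esub> Nu D w w' u (PhO D w'' v X) =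
    Nu D w b v X \<cdot>\<^bsub>z\<^esub> PhA D w t (Nu D w' w'' v X)"
proof -
  have z: "z = w \<otimes> w' \<otimes> w'' \<otimes> v" "t = w' \<otimes> w'' \<otimes> v" using assms by (simp_all add: m_assoc)
  show ?thesis
    unfolding z assms(6-8) by (rule gluing_rules(7)[OF assms(1-5)])
qed

definition additive :: "'w \<Rightarrow> 'w \<Rightarrow> bool" where
  "additive g m \<longleftrightarrow> len (g \<otimes> m) = len g + len m"

lemma nu_iso:
  assumes "w \<in> carrier W" "w' \<in> carrier W" "v \<in> carrier W" "ob v X" "additive w w'"
    "u = w' \<otimes> v" "x = w \<otimes> w'" "z = w \<otimes> u"
  shows "is_iso (Cat D z) (PhO D w u (PhO D w' v X)) (PhO D x v X) (Nu D w w' v X)"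
proof -
  have z: "z = w \<otimes> w' \<otimes> v" using assms by (simp add: m_assoc)
  have "cox_length W S (w \<otimes> w') = cox_length W S w + cox_length W S w'"
    using assms(5) by (simp add: additive_def)
  then show ?thesis
    unfolding z assms(6,7) by (rule gluing_rules(8)[OF assms(1,2) _ assms(3,4)])
qed

subsection \<open>Objects and morphisms of glued categories\<close>

abbreviation G :: "'w set \<Rightarrow> (('w, 'o, 'm) glued, 'w \<Rightarrow> 'm) precat" where "G P \<equiv> glued_cat W D P"

context
  fixes P :: "'w set"
  assumes P: "P \<subseteq> carrier W"
begin

lemma glued_ob: "A \<in> Obj (G P) \<Longrightarrow> p \<in> P \<Longrightarrow> ob p (fst A p)"
  unfolding glued_cat_def glued_objects_def by (auto simp: PiE_def)

lemma glued_alpha: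
  assumes "A \<in> Obj (G P)" "g \<in> carrier W" "p \<in> P" "q \<in> P" "q = g \<otimes> p"
  shows "ar q (PhO D g p (fst A p)) (fst A q) (snd A g p)"
proof -
  have "alpha_ix W P g p" using assms by (simp add: alpha_ix_def)
  then have "snd A g p \<in> Hom (Cat D q) (PhO D g p (fst A p)) (fst A q)"
    using assms(1) unfolding glued_cat_def glued_objects_def assms(5) by auto
  then show ?thesis
    using glued_ob[OF assms(1,3)] glued_ob[OF assms(1,4)] PhO_ob[OF assms(2) subsetD[OF P assms(3)] _ assms(5)]
    by (simp add: arr_def)
qed

lemma glued_alpha_one: "A \<in> Obj (G P) \<Longrightarrow> p \<in> P \<Longrightarrow> snd A \<one> p = idn p (fst A p)"
  unfolding glued_cat_def glued_objects_def by auto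

lemma glued_cocycle:
  assumes "A \<in> Obj (G P)" "w1 \<in> carrier W" "w2 \<in> carrier W" "p \<in> P" "q \<in> P" "r \<in> P"
    "q = w2 \<otimes> p" "r = w1 \<otimes> q" "x = w1 \<otimes> w2"
  shows "snd A w1 q \<cdot>\<^bsub>r\<^esub> PhA D w1 q (snd A w2 p) = snd A x p \<cdot>\<^bsub>r\<^esub> Nu D w1 w2 p (fst A p)"
proof -
  have r: "r = w1 \<otimes> w2 \<otimes> p" using assms subsetD[OF P] by (simp add: m_assoc)
  have "\<forall>w1\<in>carrier W. \<forall>w2\<in>carrier W. \<forall>w'\<in>P.
        w2 \<otimes> w' \<in> P \<and> w1 \<otimes> w2 \<otimes> w' \<in> P \<longrightarrow>
        Cmp (Cat D (w1 \<otimes> w2 \<otimes> w'))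
          (snd A w1 (w2 \<otimes> w')) (PhA D w1 (w2 \<otimes> w') (snd A w2 w')) =
        Cmp (Cat D (w1 \<otimes> w2 \<otimes> w'))
          (snd A (w1 \<otimes> w2) w') (Nu D w1 w2 w' (fst A w'))"
    using assms(1) unfolding glued_cat_def glued_objects_def by auto
  moreover have "w2 \<otimes> p \<in> P \<and> w1 \<otimes> w2 \<otimes> p \<in> P" using assms(5-7) r by simp
  ultimately show ?thesis using assms(2-4) unfolding r assms(7,9) by blast
qed

lemma glued_objI:
  assumes "A = (\<lambda>w\<in>P. Bo w, \<lambda>g p. if alpha_ix W P g p then \<beta> g p else undefined)"
    "\<And>w. w \<in> P \<Longrightarrow> ob w (Bo w)"
    "\<And>g p q. g \<in> carrier W \<Longrightarrow> p \<in> P \<Longrightarrow> q \<in> P \<Longrightarrow> q = g \<otimes> p \<Longrightarrow> ar q (PhO D g p (Bo p)) (Bo q) (\<beta> g p)"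
    "\<And>p. p \<in> P \<Longrightarrow> \<beta> \<one> p = idn p (Bo p)"
    "\<And>w1 w2 p q r x. w1 \<in> carrier W \<Longrightarrow> w2 \<in> carrier W \<Longrightarrow> p \<in> P \<Longrightarrow> q \<in> P \<Longrightarrow> r \<in> P \<Longrightarrow>
      q = w2 \<otimes> p \<Longrightarrow> r = w1 \<otimes> q \<Longrightarrow> x = w1 \<otimes> w2 \<Longrightarrow>
      \<beta> w1 q \<cdot>\<^bsub>r\<^esub> PhA D w1 q (\<beta> w2 p) = \<beta> x p \<cdot>\<^bsub>r\<^esub> Nu D w1 w2 p (Bo p)"
  shows "A \<in> Obj (G P)"
proof -
  have 1: "p \<in> P \<and> g \<otimes> p \<in> P \<and> \<beta> g p \<in> Hom (Cat D (g \<otimes> p)) (PhO D g p (Bo p)) (Bo (g \<otimes> p))"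
    if "alpha_ix W P g p" for g p
    using that assms(3)[of g p "g \<otimes> p"] by (simp add: alpha_ix_def arr_def)
  have 2: "alpha_ix W P \<one> p" if "p \<in> P" for p using that subsetD[OF P] by (simp add: alpha_ix_def)
  have 3: "(if alpha_ix W P w1 (w2 \<otimes> p) then \<beta> w1 (w2 \<otimes> p) else undefined) \<cdot>\<^bsub>w1 \<otimes> w2 \<otimes> p\<^esub>
        PhA D w1 (w2 \<otimes> p) (if alpha_ix W P w2 p then \<beta> w2 p else undefined) =
      (if alpha_ix W P (w1 \<otimes> w2) p then \<beta> (w1 \<otimes> w2) p else undefined) \<cdot>\<^bsub>w1 \<otimes> w2 \<otimes> p\<^esub>
        Nu D w1 w2 p ((\<lambda>w\<in>P. Bo w) p)"
    if h: "w1 \<in> carrier W" "w2 \<in> carrier W" "p \<in> P" "w2 \<otimes> p \<in> P" "w1 \<otimes> w2 \<otimes> p \<in> P" for w1 w2 p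
  proof -
    have e: "w1 \<otimes> (w2 \<otimes> p) = w1 \<otimes> w2 \<otimes> p" using h subsetD[OF P] by (simp add: m_assoc)
    have "alpha_ix W P w1 (w2 \<otimes> p)" "alpha_ix W P w2 p" "alpha_ix W P (w1 \<otimes> w2) p"
      using h e by (auto simp: alpha_ix_def)
    then show ?thesis
      using assms(5)[OF h HOL.refl e[symmetric] HOL.refl] h(3) by simp
  qed
  have "A \<in> glued_objects W D P"
    unfolding assms(1) glued_objects_def
    by (auto simp: 3 2 assms(2,4) dest: 1)
  then show ?thesis by (simp add: glued_cat_def)
qed

lemma glued_eqI:
  assumes "A \<in> Obj (G P)" "B \<in> Obj (G P)" "\<And>p. p \<in> P \<Longrightarrow> fst A p = fst B p"
    "\<And>g p q. g \<in> carrier W \<Longrightarrow> p \<in> P \<Longrightarrow> q \<in> P \<Longrightarrow> q = g \<otimes> p \<Longrightarrow> snd A g p = snd B g p"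
  shows "A = B"
proof (rule prod_eqI)
  show "fst A = fst B"
    using assms(1,2,3) unfolding glued_cat_def glued_objects_def
    by (auto simp: PiE_def intro: extensionalityI)
  have u: "\<not> alpha_ix W P g p \<Longrightarrow> snd A g p = undefined" "\<not> alpha_ix W P g p \<Longrightarrow> snd B g p = undefined"
    for g p using assms(1,2) unfolding glued_cat_def glued_objects_def by auto
  show "snd A = snd B"
  proof (intro ext)
    fix g p show "snd A g p = snd B g p"
      using u[of g p] assms(4)[of g p "g \<otimes> p"] by (cases "alpha_ix W P g p") (auto simp: alpha_ix_def)
  qed
qed

lemma glued_arr_comp: "arr (G P) A B f \<Longrightarrow> p \<in> P \<Longrightarrow> ar p (fst A p) (fst B p) (f p)"
  using glued_ob[of A p] glued_ob[of B p]
  unfolding arr_def glued_cat_def glued_hom_def by (auto simp: PiE_def Pi_def split: prod.splits)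

lemma glued_arr_sq:
  assumes "arr (G P) A B f" "g \<in> carrier W" "p \<in> P" "q \<in> P" "q = g \<otimes> p"
  shows "f q \<cdot>\<^bsub>q\<^esub> snd A g p = snd B g p \<cdot>\<^bsub>q\<^esub> PhA D g p (f p)"
proof -
  have "alpha_ix W P g p" using assms by (simp add: alpha_ix_def)
  then show ?thesis
    using assms(1) unfolding arr_def glued_cat_def glued_hom_def assms(5) by (auto split: prod.splits)
qed

lemma glued_arr_ext: "arr (G P) A B f \<Longrightarrow> f \<in> extensional P"
  unfolding arr_def glued_cat_def glued_hom_def by (auto simp: PiE_def split: prod.splits)

lemma glued_arrI:
  assumes "A \<in> Obj (G P)" "B \<in> Obj (G P)" "f \<in> extensional P"
    "\<And>p. p \<in> P \<Longrightarrow> ar p (fst A p) (fst B p) (f p)"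
    "\<And>g p q. g \<in> carrier W \<Longrightarrow> p \<in> P \<Longrightarrow> q \<in> P \<Longrightarrow> q = g \<otimes> p \<Longrightarrow>
      f q \<cdot>\<^bsub>q\<^esub> snd A g p = snd B g p \<cdot>\<^bsub>q\<^esub> PhA D g p (f p)"
  shows "arr (G P) A B f"
  using assms unfolding arr_def glued_cat_def glued_hom_def
  by (auto simp: PiE_def Pi_def alpha_ix_def split: prod.splits)

lemma glued_arr_eqI:
  assumes "arr (G P) A B f" "arr (G P) A' B' g" "\<And>p. p \<in> P \<Longrightarrow> f p = g p"
  shows "f = g"
  using extensionalityI[OF glued_arr_ext[OF assms(1)] glued_arr_ext[OF assms(2)] assms(3)] .

lemma glued_sel:
  "p \<in> P \<Longrightarrow> Cmp (G P) g f p = g p \<cdot>\<^bsub>p\<^esub> f p"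
  "p \<in> P \<Longrightarrow> Ide (G P) A p = idn p (fst A p)"
  "p \<in> P \<Longrightarrow> Add (G P) f g p = Add (Cat D p) (f p) (g p)"
  "p \<in> P \<Longrightarrow> Zer (G P) A B p = Zer (Cat D p) (fst A p) (fst B p)"
  "Cmp (G P) g f \<in> extensional P" "Ide (G P) A \<in> extensional P"
  "Add (G P) f g \<in> extensional P" "Zer (G P) A B \<in> extensional P"
  by (simp_all add: glued_cat_def)

lemma glued_cmp_arr:
  assumes f: "arr (G P) A B f" and g: "arr (G P) B E g"
  shows "arr (G P) A E (Cmp (G P) g f)"
proof (rule glued_arrI)
  show "A \<in> Obj (G P)" "E \<in> Obj (G P)" using f g by (auto simp: arr_def)
  show "Cmp (G P) g f \<in> extensional P" by (rule glued_sel)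
  show "ar p (fst A p) (fst E p) (Cmp (G P) g f p)" if "p \<in> P" for p
    unfolding glued_sel(1)[OF that]
    by (rule C_cmp_arr[OF subsetD[OF P that] glued_arr_comp[OF f that] glued_arr_comp[OF g that]])
  fix h p q assume h: "h \<in> carrier W" "p \<in> P" "q \<in> P" "q = h \<otimes> p"
  note c = subsetD[OF P h(2)] subsetD[OF P h(3)]
  have o: "A \<in> Obj (G P)" "B \<in> Obj (G P)" "E \<in> Obj (G P)" using f g by (auto simp: arr_def)
  note a = glued_alpha[OF o(1) h] glued_alpha[OF o(2) h] glued_alpha[OF o(3) h]
  note fq = glued_arr_comp[OF f h(3)] note gq = glued_arr_comp[OF g h(3)]
  note fp = glued_arr_comp[OF f h(2)] note gp = glued_arr_comp[OF g h(2)]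
  note Ff = PhA_ar[OF h(1) c(1) fp h(4)] note Fg = PhA_ar[OF h(1) c(1) gp h(4)]
  have "(g q \<cdot>\<^bsub>q\<^esub> f q) \<cdot>\<^bsub>q\<^esub> snd A h p = (g q \<cdot>\<^bsub>q\<^esub> snd B h p) \<cdot>\<^bsub>q\<^esub> PhA D h p (f p)"
    by (simp only: C_assoc[OF c(2) a(1) fq gq, symmetric] glued_arr_sq[OF f h] C_assoc[OF c(2) Ff a(2) gq])
  also have "\<dots> = snd E h p \<cdot>\<^bsub>q\<^esub> PhA D h p (g p \<cdot>\<^bsub>p\<^esub> f p)"
    by (simp only: glued_arr_sq[OF g h] C_assoc[OF c(2) Ff Fg a(3), symmetric] PhA_cmp[OF h(1) c(1) fp gp h(4)])
  finally show "Cmp (G P) g f q \<cdot>\<^bsub>q\<^esub> snd A h p = snd E h p \<cdot>\<^bsub>q\<^esub> PhA D h p (Cmp (G P) g f p)"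
    by (simp only: glued_sel(1)[OF h(2)] glued_sel(1)[OF h(3)])
qed

lemma glued_ide_arr:
  assumes A: "A \<in> Obj (G P)"
  shows "arr (G P) A A (Ide (G P) A)"
proof (rule glued_arrI[OF A A glued_sel(6)])
  show "ar p (fst A p) (fst A p) (Ide (G P) A p)" if "p \<in> P" for p
    unfolding glued_sel(2)[OF that] by (rule C_ide_arr[OF subsetD[OF P that] glued_ob[OF A that]])
  fix g p q assume h: "g \<in> carrier W" "p \<in> P" "q \<in> P" "q = g \<otimes> p"
  note c = subsetD[OF P h(2)] subsetD[OF P h(3)]
  note a = glued_alpha[OF A h]
  show "Ide (G P) A q \<cdot>\<^bsub>q\<^esub> snd A g p = snd A g p \<cdot>\<^bsub>q\<^esub> PhA D g p (Ide (G P) A p)"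
    by (simp only: glued_sel(2)[OF h(2)] glued_sel(2)[OF h(3)] C_ide[OF c(2) a]
      PhA_ide[OF h(1) c(1) glued_ob[OF A h(2)] h(4)])
qed

lemma glued_zer_arr:
  assumes A: "A \<in> Obj (G P)" and B: "B \<in> Obj (G P)"
  shows "arr (G P) A B (Zer (G P) A B)"
proof (rule glued_arrI[OF A B glued_sel(8)])
  show "ar p (fst A p) (fst B p) (Zer (G P) A B p)" if "p \<in> P" for p
    unfolding glued_sel(4)[OF that]
    by (rule C_zer_arr[OF subsetD[OF P that] glued_ob[OF A that] glued_ob[OF B that]])
  fix g p q assume h: "g \<in> carrier W" "p \<in> P" "q \<in> P" "q = g \<otimes> p"
  note c = subsetD[OF P h(2)] subsetD[OF P h(3)]
  interpret Q: preadditive_category "Cat D q" by (rule C_pre[OF c(2)])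
  note a = glued_alpha[OF A h] glued_alpha[OF B h]
  show "Zer (G P) A B q \<cdot>\<^bsub>q\<^esub> snd A g p = snd B g p \<cdot>\<^bsub>q\<^esub> PhA D g p (Zer (G P) A B p)"
    by (simp only: glued_sel(4)[OF h(2)] glued_sel(4)[OF h(3)]
      PhA_zer[OF h(1) c(1) glued_ob[OF A h(2)] glued_ob[OF B h(2)] h(4)]
      Q.cmp_zer(2)[OF a(1) glued_ob[OF B h(3)]] Q.cmp_zer(1)[OF a(2) arr_objD(1)[OF a(1)]])
qed

lemma glued_add_arr:
  assumes f: "arr (G P) A B f" and f': "arr (G P) A B f'"
  shows "arr (G P) A B (Add (G P) f f')"
proof (rule glued_arrI[OF arr_objD[OF f] glued_sel(7)])
  show "ar p (fst A p) (fst B p) (Add (G P) f f' p)" if "p \<in> P" for p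
    unfolding glued_sel(3)[OF that]
    by (rule preadditive_category.add_arr[OF C_pre[OF subsetD[OF P that]] glued_arr_comp[OF f that] glued_arr_comp[OF f' that]])
  fix g p q assume h: "g \<in> carrier W" "p \<in> P" "q \<in> P" "q = g \<otimes> p"
  note c = subsetD[OF P h(2)] subsetD[OF P h(3)]
  interpret Q: preadditive_category "Cat D q" by (rule C_pre[OF c(2)])
  note a = glued_alpha[OF arr_objD(1)[OF f] h] glued_alpha[OF arr_objD(2)[OF f] h]
  note fq = glued_arr_comp[OF f h(3)] note gq = glued_arr_comp[OF f' h(3)]
  note fp = glued_arr_comp[OF f h(2)] note gp = glued_arr_comp[OF f' h(2)]
  note Ff = PhA_ar[OF h(1) c(1) fp h(4)] note Fg = PhA_ar[OF h(1) c(1) gp h(4)]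
  show "Add (G P) f f' q \<cdot>\<^bsub>q\<^esub> snd A g p = snd B g p \<cdot>\<^bsub>q\<^esub> PhA D g p (Add (G P) f f' p)"
    by (simp only: glued_sel(3)[OF h(2)] glued_sel(3)[OF h(3)] PhA_add[OF h(1) c(1) fp gp h(4)]
      Q.cmp_add(1)[OF Ff Fg a(2)] Q.cmp_add(2)[OF a(1) fq gq] glued_arr_sq[OF f h] glued_arr_sq[OF f' h])
qed

lemma glued_negative:
  assumes f: "arr (G P) A B f"
  obtains f' where "arr (G P) A B f'" "Add (G P) f' f = Zer (G P) A B"
proof -
  let ?f' = "\<lambda>p\<in>P. inv\<^bsub>hom_group (Cat D p) (fst A p) (fst B p)\<^esub> (f p)"
  have f': "arr (G P) A B ?f'"
  proof (rule glued_arrI[OF arr_objD[OF f]])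
    show "ar p (fst A p) (fst B p) (?f' p)" if "p \<in> P" for p
      using preadditive_category.neg_arr[OF C_pre[OF subsetD[OF P that]] glued_arr_comp[OF f that]] that
      by simp
    fix g p q assume h: "g \<in> carrier W" "p \<in> P" "q \<in> P" "q = g \<otimes> p"
    note c = subsetD[OF P h(2)] subsetD[OF P h(3)]
    interpret Q: preadditive_category "Cat D q" by (rule C_pre[OF c(2)])
    interpret V: preadditive_category "Cat D p" by (rule C_pre[OF c(1)])
    note a = glued_alpha[OF arr_objD(1)[OF f] h] glued_alpha[OF arr_objD(2)[OF f] h]
    note fq = glued_arr_comp[OF f h(3)] note fp = glued_arr_comp[OF f h(2)]
    note Ff = PhA_ar[OF h(1) c(1) fp h(4)]
    note Fn = PhA_ar[OF h(1) c(1) V.neg_arr[OF fp] h(4)]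
    have "PhA D g p (V.neg (fst A p) (fst B p) (f p)) =
        Q.neg (PhO D g p (fst A p)) (PhO D g p (fst B p)) (PhA D g p (f p))"
      by (rule Q.neg_unique[OF Ff Fn])
        (simp only: PhA_add[OF h(1) c(1) fp V.neg_arr[OF fp] h(4), symmetric] V.add_neg(1)[OF fp]
          PhA_zer[OF h(1) c(1) arr_objD[OF fp] h(4)])
    then show "?f' q \<cdot>\<^bsub>q\<^esub> snd A g p = snd B g p \<cdot>\<^bsub>q\<^esub> PhA D g p (?f' p)"
      using Q.cmp_neg(1)[OF Ff a(2)] Q.cmp_neg(2)[OF a(1) fq] glued_arr_sq[OF f h] h(2,3) by simp
  qed simp
  have "Add (G P) ?f' f = Zer (G P) A B"
  proof (rule glued_arr_eqI[OF glued_add_arr[OF f' f] glued_zer_arr[OF arr_objD[OF f]]])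
    fix p assume p: "p \<in> P"
    show "Add (G P) ?f' f p = Zer (G P) A B p"
      using preadditive_category.add_neg(2)[OF C_pre[OF subsetD[OF P p]] glued_arr_comp[OF f p]] p
      by (simp add: glued_sel(3,4)[OF p])
  qed
  with f' show ?thesis using that by blast
qed

lemma glued_preadditive: "preadditive_category (G P)"
proof
  have cat: "category (G P)"
    unfolding category_def
  proof (intro conjI ballI)
    fix A assume A: "A \<in> Obj (G P)"
    show "Ide (G P) A \<in> Hom (G P) A A" using glued_ide_arr[OF A] by (simp add: arr_def)
    fix B assume B: "B \<in> Obj (G P)"
    { fix f assume f: "f \<in> Hom (G P) A B"
      then have fa: "arr (G P) A B f" using A B by (simp add: arr_def)
      show "Cmp (G P) f (Ide (G P) A) = f"
        by (rule glued_arr_eqI[OF glued_cmp_arr[OF glued_ide_arr[OF A] fa] fa])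
          (simp add: glued_sel(1,2) C_ide(1)[OF subsetD[OF P] glued_arr_comp[OF fa]])
      show "Cmp (G P) (Ide (G P) B) f = f"
        by (rule glued_arr_eqI[OF glued_cmp_arr[OF fa glued_ide_arr[OF B]] fa])
          (simp add: glued_sel(1,2) C_ide(2)[OF subsetD[OF P] glued_arr_comp[OF fa]]) }
    fix E f g assume E: "E \<in> Obj (G P)" and f: "f \<in> Hom (G P) A B" and g: "g \<in> Hom (G P) B E"
    have fa: "arr (G P) A B f" and ga: "arr (G P) B E g" using A B E f g by (simp_all add: arr_def)
    show "Cmp (G P) g f \<in> Hom (G P) A E" using glued_cmp_arr[OF fa ga] by (simp add: arr_def)
    fix F h assume F: "F \<in> Obj (G P)" and h: "h \<in> Hom (G P) E F"
    have ha: "arr (G P) E F h" using E F h by (simp add: arr_def)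
    show "Cmp (G P) h (Cmp (G P) g f) = Cmp (G P) (Cmp (G P) h g) f"
      by (rule glued_arr_eqI[OF glued_cmp_arr[OF glued_cmp_arr[OF fa ga] ha]
            glued_cmp_arr[OF fa glued_cmp_arr[OF ga ha]]])
        (simp add: glued_sel(1) C_assoc[OF subsetD[OF P] glued_arr_comp[OF fa] glued_arr_comp[OF ga]
          glued_arr_comp[OF ha]])
  qed
  have grp: "comm_group (hom_group (G P) A B)" if A: "A \<in> Obj (G P)" and B: "B \<in> Obj (G P)" for A B
  proof -
    have ar: "f \<in> carrier (hom_group (G P) A B) \<longleftrightarrow> arr (G P) A B f" for f
      using A B by (simp add: hom_group_def arr_def)
    have m: "f \<otimes>\<^bsub>hom_group (G P) A B\<^esub> g = Add (G P) f g" "\<one>\<^bsub>hom_group (G P) A B\<^esub> = Zer (G P) A B" for f g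
      by (simp_all add: hom_group_def)
    show ?thesis
    proof (rule comm_groupI; unfold ar m)
      show "arr (G P) A B (Add (G P) x y)" if "arr (G P) A B x" "arr (G P) A B y" for x y
        by (rule glued_add_arr[OF that])
      show "arr (G P) A B (Zer (G P) A B)" by (rule glued_zer_arr[OF A B])
      show "Add (G P) (Add (G P) x y) z = Add (G P) x (Add (G P) y z)"
        if h: "arr (G P) A B x" "arr (G P) A B y" "arr (G P) A B z" for x y z
        by (rule glued_arr_eqI[OF glued_add_arr[OF glued_add_arr[OF h(1,2)] h(3)]
              glued_add_arr[OF h(1) glued_add_arr[OF h(2,3)]]])
          (simp add: glued_sel(3) preadditive_category.add_assoc[OF C_pre[OF subsetD[OF P]] glued_arr_comp[OF h(1)]
            glued_arr_comp[OF h(2)] glued_arr_comp[OF h(3)]])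
      show "Add (G P) x y = Add (G P) y x" if h: "arr (G P) A B x" "arr (G P) A B y" for x y
        by (rule glued_arr_eqI[OF glued_add_arr[OF h] glued_add_arr[OF h(2,1)]])
          (simp add: glued_sel(3) preadditive_category.add_commute[OF C_pre[OF subsetD[OF P]] glued_arr_comp[OF h(1)]
            glued_arr_comp[OF h(2)]])
      show "Add (G P) (Zer (G P) A B) x = x" if h: "arr (G P) A B x" for x
        by (rule glued_arr_eqI[OF glued_add_arr[OF glued_zer_arr[OF A B] h] h])
          (simp add: glued_sel(3,4) preadditive_category.add_zer[OF C_pre[OF subsetD[OF P]] glued_arr_comp[OF h]])
      show "\<exists>y\<in>carrier (hom_group (G P) A B). Add (G P) y x = Zer (G P) A B" if h: "arr (G P) A B x" for x
        using glued_negative[OF h] ar by metis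
    qed
  qed
  show "preadditive (G P)"
    unfolding preadditive_def
  proof (intro conjI cat ballI grp)
    fix A B E f f' g g'
    assume o: "A \<in> Obj (G P)" "B \<in> Obj (G P)" "E \<in> Obj (G P)" "f \<in> Hom (G P) A B"
      "f' \<in> Hom (G P) A B" "g \<in> Hom (G P) B E" "g' \<in> Hom (G P) B E"
    then have f: "arr (G P) A B f" "arr (G P) A B f'" and g: "arr (G P) B E g" "arr (G P) B E g'"
      by (simp_all add: arr_def)
    show "Cmp (G P) g (Add (G P) f f') = Add (G P) (Cmp (G P) g f) (Cmp (G P) g f')"
      by (rule glued_arr_eqI[OF glued_cmp_arr[OF glued_add_arr[OF f] g(1)]
            glued_add_arr[OF glued_cmp_arr[OF f(1) g(1)] glued_cmp_arr[OF f(2) g(1)]]])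
        (simp add: glued_sel(1,3) preadditive_category.cmp_add(1)[OF C_pre[OF subsetD[OF P]]
          glued_arr_comp[OF f(1)] glued_arr_comp[OF f(2)] glued_arr_comp[OF g(1)]])
    show "Cmp (G P) (Add (G P) g g') f = Add (G P) (Cmp (G P) g f) (Cmp (G P) g' f)"
      by (rule glued_arr_eqI[OF glued_cmp_arr[OF f(1) glued_add_arr[OF g]]
            glued_add_arr[OF glued_cmp_arr[OF f(1) g(1)] glued_cmp_arr[OF f(1) g(2)]]])
        (simp add: glued_sel(1,3) preadditive_category.cmp_add(2)[OF C_pre[OF subsetD[OF P]]
          glued_arr_comp[OF f(1)] glued_arr_comp[OF g(1)] glued_arr_comp[OF g(2)]])
  qed
qed

end

subsection \<open>Kernels and direct sums in glued categories\<close>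

context
  fixes P :: "'w set"
  assumes P: "P \<subseteq> carrier W"
begin

text \<open>The family \<open>q\<close> is jointly monic in each component, so identities between the \<open>\<beta>\<close> can be tested
  after composition with it, and there they are the axioms of the objects \<open>X i\<close>. Kernels, direct
  sums and \<open>\<iota> A\<close> become objects of the glued category in this way.\<close>

lemma glued_create:
  assumes X: "\<And>i. i \<in> I \<Longrightarrow> X i \<in> Obj (G P)"
    and Bo: "\<And>p. p \<in> P \<Longrightarrow> ob p (Bo p)"
    and q: "\<And>i p. i \<in> I \<Longrightarrow> p \<in> P \<Longrightarrow> ar p (Bo p) (fst (X i) p) (q i p)"
    and \<beta>: "\<And>g p r. g \<in> carrier W \<Longrightarrow> p \<in> P \<Longrightarrow> r \<in> P \<Longrightarrow> r = g \<otimes> p \<Longrightarrow>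
      ar r (PhO D g p (Bo p)) (Bo r) (\<beta> g p)"
    and \<beta>q: "\<And>i g p r. i \<in> I \<Longrightarrow> g \<in> carrier W \<Longrightarrow> p \<in> P \<Longrightarrow> r \<in> P \<Longrightarrow> r = g \<otimes> p \<Longrightarrow>
      q i r \<cdot>\<^bsub>r\<^esub> \<beta> g p = snd (X i) g p \<cdot>\<^bsub>r\<^esub> PhA D g p (q i p)"
    and mono: "\<And>p T t t'. p \<in> P \<Longrightarrow> ar p T (Bo p) t \<Longrightarrow> ar p T (Bo p) t' \<Longrightarrow>
      (\<And>i. i \<in> I \<Longrightarrow> q i p \<cdot>\<^bsub>p\<^esub> t = q i p \<cdot>\<^bsub>p\<^esub> t') \<Longrightarrow> t = t'"
    and B: "B = (\<lambda>w\<in>P. Bo w, \<lambda>g p. if alpha_ix W P g p then \<beta> g p else undefined)"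
  shows "B \<in> Obj (G P)" "\<And>i. i \<in> I \<Longrightarrow> arr (G P) B (X i) (\<lambda>p\<in>P. q i p)"
proof -
  show BG: "B \<in> Obj (G P)"
  proof (rule glued_objI[OF P B Bo \<beta>])
    fix p assume p: "p \<in> P"
    note c = subsetD[OF P p]
    have b: "ar p (Bo p) (Bo p) (\<beta> \<one> p)"
      using \<beta>[of \<one> p p] p c by (simp add: Ph_one(1)[OF c Bo[OF p]])
    show "\<beta> \<one> p = idn p (Bo p)"
    proof (rule mono[OF p b C_ide_arr[OF c Bo[OF p]]])
      fix i assume i: "i \<in> I"
      have "q i p \<cdot>\<^bsub>p\<^esub> \<beta> \<one> p = snd (X i) \<one> p \<cdot>\<^bsub>p\<^esub> PhA D \<one> p (q i p)"
        by (rule \<beta>q[OF i]) (use p c in auto)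
      then show "q i p \<cdot>\<^bsub>p\<^esub> \<beta> \<one> p = q i p \<cdot>\<^bsub>p\<^esub> idn p (Bo p)"
        by (simp only: glued_alpha_one[OF P X[OF i] p] Ph_one(2)[OF c q[OF i p]]
          C_ide[OF c q[OF i p]])
    qed
  next
    fix w1 w2 p s r x
    assume h: "w1 \<in> carrier W" "w2 \<in> carrier W" "p \<in> P" "s \<in> P" "r \<in> P"
      "s = w2 \<otimes> p" "r = w1 \<otimes> s" "x = w1 \<otimes> w2"
    note c = subsetD[OF P h(3)] subsetD[OF P h(4)] subsetD[OF P h(5)]
    have x: "x \<in> carrier W" "r = x \<otimes> p" using h c by (simp_all add: m_assoc)
    note b2 = \<beta>[OF h(2,3,4,6)] note b1 = \<beta>[OF h(1,4,5,7)] note bx = \<beta>[OF x(1) h(3,5) x(2)]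
    note F2 = PhA_ar[OF h(1) c(2) b2 h(7)]
    note N = nu_ar[OF h(1,2) c(1) Bo[OF h(3)] h(6,8,7)]
    show "\<beta> w1 s \<cdot>\<^bsub>r\<^esub> PhA D w1 s (\<beta> w2 p) = \<beta> x p \<cdot>\<^bsub>r\<^esub> Nu D w1 w2 p (Bo p)"
    proof (rule mono[OF h(5) C_cmp_arr[OF c(3) F2 b1] C_cmp_arr[OF c(3) N bx]])
      fix i assume i: "i \<in> I"
      note qp = q[OF i h(3)] note qs = q[OF i h(4)] note qr = q[OF i h(5)]
      note a1 = glued_alpha[OF P X[OF i] h(1,4,5,7)] note a2 = glued_alpha[OF P X[OF i] h(2,3,4,6)]
      note ax = glued_alpha[OF P X[OF i] x(1) h(3,5) x(2)]
      note F2q = PhA_ar[OF h(2) c(1) qp h(6)]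
      note NX = nu_ar[OF h(1,2) c(1) glued_ob[OF P X[OF i] h(3)] h(6,8,7)]
      have "q i r \<cdot>\<^bsub>r\<^esub> (\<beta> w1 s \<cdot>\<^bsub>r\<^esub> PhA D w1 s (\<beta> w2 p)) =
          snd (X i) w1 s \<cdot>\<^bsub>r\<^esub> (PhA D w1 s (q i s) \<cdot>\<^bsub>r\<^esub> PhA D w1 s (\<beta> w2 p))"
        by (simp only: C_assoc[OF c(3) F2 b1 qr] \<beta>q[OF i h(1,4,5,7)]
          C_assoc[OF c(3) F2 PhA_ar[OF h(1) c(2) qs h(7)] a1])
      also have "\<dots> = snd (X i) w1 s \<cdot>\<^bsub>r\<^esub> (PhA D w1 s (snd (X i) w2 p) \<cdot>\<^bsub>r\<^esub> PhA D w1 s (PhA D w2 p (q i p)))"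
        by (simp only: PhA_cmp[OF h(1) c(2) b2 qs h(7), symmetric] \<beta>q[OF i h(2,3,4,6)]
          PhA_cmp[OF h(1) c(2) F2q a2 h(7)])
      also have "\<dots> = snd (X i) x p \<cdot>\<^bsub>r\<^esub> (Nu D w1 w2 p (fst (X i) p) \<cdot>\<^bsub>r\<^esub> PhA D w1 s (PhA D w2 p (q i p)))"
        by (simp only: C_assoc[OF c(3) PhA_ar[OF h(1) c(2) F2q h(7)] PhA_ar[OF h(1) c(2) a2 h(7)] a1]
          glued_cocycle[OF P X[OF i] h] C_assoc[OF c(3) PhA_ar[OF h(1) c(2) F2q h(7)] NX ax])
      also have "\<dots> = (snd (X i) x p \<cdot>\<^bsub>r\<^esub> PhA D x p (q i p)) \<cdot>\<^bsub>r\<^esub> Nu D w1 w2 p (Bo p)"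
        by (simp only: nu_nat[OF h(1,2) c(1) qp h(6,8,7)]
          C_assoc[OF c(3) N PhA_ar[OF x(1) c(1) qp x(2)] ax])
      also have "\<dots> = q i r \<cdot>\<^bsub>r\<^esub> (\<beta> x p \<cdot>\<^bsub>r\<^esub> Nu D w1 w2 p (Bo p))"
        by (simp only: \<beta>q[OF i x(1) h(3,5) x(2)] C_assoc[OF c(3) N bx qr])
      finally show "q i r \<cdot>\<^bsub>r\<^esub> (\<beta> w1 s \<cdot>\<^bsub>r\<^esub> PhA D w1 s (\<beta> w2 p)) =
          q i r \<cdot>\<^bsub>r\<^esub> (\<beta> x p \<cdot>\<^bsub>r\<^esub> Nu D w1 w2 p (Bo p))" .
    qed
  qed
  fix i assume i: "i \<in> I"
  show "arr (G P) B (X i) (\<lambda>p\<in>P. q i p)"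
  proof (rule glued_arrI[OF P BG X[OF i]])
    show "ar p (fst B p) (fst (X i) p) ((\<lambda>p\<in>P. q i p) p)" if "p \<in> P" for p
      using q[OF i that] that by (simp add: B)
    fix g p r assume h: "g \<in> carrier W" "p \<in> P" "r \<in> P" "r = g \<otimes> p"
    then have "alpha_ix W P g p" by (simp add: alpha_ix_def)
    then show "(\<lambda>p\<in>P. q i p) r \<cdot>\<^bsub>r\<^esub> snd B g p = snd (X i) g p \<cdot>\<^bsub>r\<^esub> PhA D g p ((\<lambda>p\<in>P. q i p) p)"
      using \<beta>q[OF i h] h(2,3) by (simp add: B)
  qed simp
qed

text \<open>As in \<open>glued_create\<close>, the compatibility of \<open>f\<close> with the structure morphisms is tested after
  composition with the jointly monic family.\<close>

lemma glued_create_arr: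
  assumes T: "T \<in> Obj (G P)" and B: "B \<in> Obj (G P)"
    and Q: "\<And>i. i \<in> I \<Longrightarrow> arr (G P) B (X i) (q i)"
    and mono: "\<And>p T t t'. p \<in> P \<Longrightarrow> ar p T (fst B p) t \<Longrightarrow> ar p T (fst B p) t' \<Longrightarrow>
      (\<And>i. i \<in> I \<Longrightarrow> q i p \<cdot>\<^bsub>p\<^esub> t = q i p \<cdot>\<^bsub>p\<^esub> t') \<Longrightarrow> t = t'"
    and f: "\<And>p. p \<in> P \<Longrightarrow> ar p (fst T p) (fst B p) (f p)"
    and comp: "\<And>i. i \<in> I \<Longrightarrow> \<exists>h. arr (G P) T (X i) h \<and> (\<forall>p\<in>P. q i p \<cdot>\<^bsub>p\<^esub> f p = h p)"
  shows "arr (G P) T B (\<lambda>p\<in>P. f p)"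
proof (rule glued_arrI[OF P T B])
  show "ar p (fst T p) (fst B p) ((\<lambda>p\<in>P. f p) p)" if "p \<in> P" for p using f[OF that] that by simp
  fix g p r assume h: "g \<in> carrier W" "p \<in> P" "r \<in> P" "r = g \<otimes> p"
  note c = subsetD[OF P h(2)] subsetD[OF P h(3)]
  note aT = glued_alpha[OF P T h] note aB = glued_alpha[OF P B h]
  note Ff = PhA_ar[OF h(1) c(1) f[OF h(2)] h(4)]
  have "f r \<cdot>\<^bsub>r\<^esub> snd T g p = snd B g p \<cdot>\<^bsub>r\<^esub> PhA D g p (f p)"
  proof (rule mono[OF h(3) C_cmp_arr[OF c(2) aT f[OF h(3)]] C_cmp_arr[OF c(2) Ff aB]])
    fix i assume i: "i \<in> I"
    obtain k where k: "arr (G P) T (X i) k" "\<And>p. p \<in> P \<Longrightarrow> q i p \<cdot>\<^bsub>p\<^esub> f p = k p"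
      using comp[OF i] by blast
    note qr = glued_arr_comp[OF P Q[OF i] h(3)] note qp = glued_arr_comp[OF P Q[OF i] h(2)]
    note aX = glued_alpha[OF P arr_objD(2)[OF Q[OF i]] h]
    note Fq = PhA_ar[OF h(1) c(1) qp h(4)]
    show "q i r \<cdot>\<^bsub>r\<^esub> (f r \<cdot>\<^bsub>r\<^esub> snd T g p) = q i r \<cdot>\<^bsub>r\<^esub> (snd B g p \<cdot>\<^bsub>r\<^esub> PhA D g p (f p))"
      by (simp only: C_assoc[OF c(2) aT f[OF h(3)] qr] k(2)[OF h(3)] glued_arr_sq[OF P k(1) h]
        C_assoc[OF c(2) Ff aB qr] glued_arr_sq[OF P Q[OF i] h] C_assoc[OF c(2) Ff Fq aX, symmetric]
        PhA_cmp[OF h(1) c(1) f[OF h(2)] qp h(4), symmetric] k(2)[OF h(2)])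
  qed
  then show "(\<lambda>p\<in>P. f p) r \<cdot>\<^bsub>r\<^esub> snd T g p = snd B g p \<cdot>\<^bsub>r\<^esub> PhA D g p ((\<lambda>p\<in>P. f p) p)"
    using h(2,3) by simp
qed simp

lemma glued_iso_eval:
  assumes f: "arr (G P) A B f" and iso: "is_iso (G P) A B f" and p: "p \<in> P"
  shows "is_iso (Cat D p) (fst A p) (fst B p) (f p)"
proof -
  interpret GP: preadditive_category "G P" by (rule glued_preadditive[OF P])
  obtain g where g: "arr (G P) B A g" "Cmp (G P) g f = Ide (G P) A" "Cmp (G P) f g = Ide (G P) B"
    using GP.is_isoE[OF iso arr_objD[OF f]] by blast
  show ?thesis
  proof (rule preadditive_category.is_isoI[OF C_pre[OF subsetD[OF P p]] glued_arr_comp[OF P f p] glued_arr_comp[OF P g(1) p]])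
    show "g p \<cdot>\<^bsub>p\<^esub> f p = idn p (fst A p)" "f p \<cdot>\<^bsub>p\<^esub> g p = idn p (fst B p)"
      by (simp_all only: glued_sel(1,2)[OF P p, symmetric] g)
  qed
qed

lemma glued_isoI:
  assumes f: "arr (G P) A B f" and iso: "\<And>p. p \<in> P \<Longrightarrow> is_iso (Cat D p) (fst A p) (fst B p) (f p)"
  shows "is_iso (G P) A B f"
proof -
  interpret GP: preadditive_category "G P" by (rule glued_preadditive[OF P])
  note A = arr_objD(1)[OF f] note B = arr_objD(2)[OF f]
  define g where "g p = inv_arr (Cat D p) (fst A p) (fst B p) (f p)" for p
  have g: "ar p (fst B p) (fst A p) (g p)" "g p \<cdot>\<^bsub>p\<^esub> f p = idn p (fst A p)"
    "f p \<cdot>\<^bsub>p\<^esub> g p = idn p (fst B p)" if "p \<in> P" for p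
    unfolding g_def by (rule preadditive_category.inv_arr_facts[OF C_pre[OF subsetD[OF P that]] iso[OF that]
      glued_ob[OF P A that] glued_ob[OF P B that]])+
  have ga: "arr (G P) B A (\<lambda>p\<in>P. g p)"
  proof (rule glued_create_arr[where I = "{()}" and X = "\<lambda>_. B" and q = "\<lambda>_. f", OF B A f _ g(1)])
    show "t = t'" if "p \<in> P" "ar p T (fst A p) t" "ar p T (fst A p) t'"
      "\<And>i. i \<in> {()} \<Longrightarrow> f p \<cdot>\<^bsub>p\<^esub> t = f p \<cdot>\<^bsub>p\<^esub> t'" for p T t t'
      by (rule preadditive_category.iso_cancel_left[OF C_pre[OF subsetD[OF P that(1)]] iso[OF that(1)]
        glued_arr_comp[OF P f that(1)] that(2,3)]) (use that(4) in simp)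
    show "\<exists>h. arr (G P) B B h \<and> (\<forall>p\<in>P. f p \<cdot>\<^bsub>p\<^esub> g p = h p)"
      using GP.ide_arr[OF B] g(3) glued_sel(2)[OF P] by (intro exI[of _ "Ide (G P) B"]) simp
  qed
  show ?thesis
  proof (rule GP.is_isoI[OF f ga])
    show "Cmp (G P) (\<lambda>p\<in>P. g p) f = Ide (G P) A"
      by (rule glued_arr_eqI[OF P GP.cmp_arr[OF f ga] GP.ide_arr[OF A]])
        (simp add: glued_sel(1,2)[OF P] g)
    show "Cmp (G P) f (\<lambda>p\<in>P. g p) = Ide (G P) B"
      by (rule glued_arr_eqI[OF P GP.cmp_arr[OF ga f] GP.ide_arr[OF B]])
        (simp add: glued_sel(1,2)[OF P] g)
  qed
qed

text \<open>The structure morphism \<open>\<Phi>\<^sub>g K\<^sub>p \<rightarrow> K\<^sub>g\<^sub>p\<close> is the factorisation of \<open>\<Phi>\<^sub>g K\<^sub>p \<rightarrow> \<Phi>\<^sub>g A\<^sub>p \<rightarrow> A\<^sub>g\<^sub>p\<close>, a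
  composite annihilated by \<open>f\<close>.\<close>

lemma glued_kernel:
  assumes f: "arr (G P) A B f"
  shows "\<exists>K k. is_kernel (G P) A B f K k \<and>
    (\<forall>p\<in>P. is_kernel (Cat D p) (fst A p) (fst B p) (f p) (fst K p) (k p))"
proof -
  interpret GP: preadditive_category "G P" by (rule glued_preadditive[OF P])
  note A = arr_objD(1)[OF f] note B = arr_objD(2)[OF f]
  note fp = glued_arr_comp[OF P f]
  have "\<forall>p\<in>P. \<exists>Kk. is_kernel (Cat D p) (fst A p) (fst B p) (f p) (fst Kk) (snd Kk)"
  proof
    fix p assume p: "p \<in> P"
    have "\<exists>K k. is_kernel (Cat D p) (fst A p) (fst B p) (f p) K k"
      using abelian[OF subsetD[OF P p]] fp[OF p] unfolding abelian_category_def arr_def by blast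
    then show "\<exists>Kk. is_kernel (Cat D p) (fst A p) (fst B p) (f p) (fst Kk) (snd Kk)" by auto
  qed
  from bchoice[OF this] obtain Kk
    where Kk: "\<And>p. p \<in> P \<Longrightarrow> is_kernel (Cat D p) (fst A p) (fst B p) (f p) (fst (Kk p)) (snd (Kk p))"
    by blast
  define Ko where "Ko p = fst (Kk p)" for p
  define k where "k p = snd (Kk p)" for p
  have K: "is_kernel (Cat D p) (fst A p) (fst B p) (f p) (Ko p) (k p)" if "p \<in> P" for p
    using Kk[OF that] by (simp add: Ko_def k_def)
  note KF = preadditive_category.kernel_facts[OF C_pre[OF subsetD[OF P]] K fp]
  define \<beta> where "\<beta> g p = (SOME b. ar (g \<otimes> p) (PhO D g p (Ko p)) (Ko (g \<otimes> p)) b \<and>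
    k (g \<otimes> p) \<cdot>\<^bsub>g \<otimes> p\<^esub> b = snd A g p \<cdot>\<^bsub>g \<otimes> p\<^esub> PhA D g p (k p))" for g p
  have \<beta>: "ar r (PhO D g p (Ko p)) (Ko r) (\<beta> g p) \<and>
      k r \<cdot>\<^bsub>r\<^esub> \<beta> g p = snd A g p \<cdot>\<^bsub>r\<^esub> PhA D g p (k p)"
    if h: "g \<in> carrier W" "p \<in> P" "r \<in> P" "r = g \<otimes> p" for g p r
  proof -
    note c = subsetD[OF P h(2)] subsetD[OF P h(3)]
    interpret R: preadditive_category "Cat D r" by (rule C_pre[OF c(2)])
    note kp = KF(1)[OF h(2,2,2)]
    note a = glued_alpha[OF P A h] note b = glued_alpha[OF P B h]
    note Fk = PhA_ar[OF h(1) c(1) kp h(4)] note Ff = PhA_ar[OF h(1) c(1) fp[OF h(2)] h(4)]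
    note t = R.cmp_arr[OF Fk a]
    have "f r \<cdot>\<^bsub>r\<^esub> (snd A g p \<cdot>\<^bsub>r\<^esub> PhA D g p (k p)) = Zer (Cat D r) (PhO D g p (Ko p)) (fst B r)"
      by (simp only: R.cmp_assoc[OF Fk a fp[OF h(3)]] glued_arr_sq[OF P f h] R.cmp_assoc[OF Fk Ff b, symmetric]
        PhA_cmp[OF h(1) c(1) kp fp[OF h(2)] h(4), symmetric] KF(2)[OF h(2,2,2)]
        PhA_zer[OF h(1) c(1) arr_objD(1)[OF kp] arr_objD(2)[OF fp[OF h(2)]] h(4)]
        R.cmp_zer(1)[OF b arr_objD(1)[OF Fk]])
    from KF(4)[OF h(3,3,3) t this] show ?thesis
      unfolding \<beta>_def h(4)[symmetric] by (rule someI_ex)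
  qed
  define KG where "KG = (\<lambda>w\<in>P. Ko w, \<lambda>g p. if alpha_ix W P g p then \<beta> g p else undefined)"
  have kk: "ar p (Ko p) (fst A p) (k p)" if "p \<in> P" for p by (rule KF(1)[OF that that that])
  have mono: "t = t'" if "p \<in> P" "ar p T (Ko p) t" "ar p T (Ko p) t'" "k p \<cdot>\<^bsub>p\<^esub> t = k p \<cdot>\<^bsub>p\<^esub> t'"
    for p T t t' using KF(3)[OF that(1,1,1) that(2-4)] .
  have cr: "KG \<in> Obj (G P)" "arr (G P) KG A (\<lambda>p\<in>P. k p)"
    using glued_create[where I = "{()}" and X = "\<lambda>_. A" and q = "\<lambda>_. k" and Bo = Ko and \<beta> = \<beta> and B = KG,
        OF A arr_objD(1)[OF kk] kk _ _ _ KG_def] \<beta> mono by simp_all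
  have KGp: "fst KG p = Ko p" if "p \<in> P" for p using that by (simp add: KG_def)
  have "is_kernel (G P) A B f KG (\<lambda>p\<in>P. k p)"
  proof (rule GP.is_kernelI[OF cr(2)])
    show "Cmp (G P) f (\<lambda>p\<in>P. k p) = Zer (G P) KG B"
      by (rule glued_arr_eqI[OF P GP.cmp_arr[OF cr(2) f] GP.zer_arr[OF cr(1) B]])
        (simp add: glued_sel(1,4)[OF P] KF(2) KGp)
    show "u = v" if uv: "arr (G P) T KG u" "arr (G P) T KG v"
      "Cmp (G P) (\<lambda>p\<in>P. k p) u = Cmp (G P) (\<lambda>p\<in>P. k p) v" for T u v
    proof (rule glued_arr_eqI[OF P uv(1,2)])
      fix p assume p: "p \<in> P"
      have "k p \<cdot>\<^bsub>p\<^esub> u p = k p \<cdot>\<^bsub>p\<^esub> v p"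
        using fun_cong[OF uv(3), of p] p by (simp add: glued_sel(1)[OF P])
      then show "u p = v p"
        using mono[OF p] glued_arr_comp[OF P uv(1) p] glued_arr_comp[OF P uv(2) p] KGp[OF p] by simp
    qed
    fix T t assume t: "arr (G P) T A t" "Cmp (G P) f t = Zer (G P) T B"
    have "\<forall>p\<in>P. \<exists>u. ar p (fst T p) (Ko p) u \<and> k p \<cdot>\<^bsub>p\<^esub> u = t p"
    proof
      fix p assume p: "p \<in> P"
      have "f p \<cdot>\<^bsub>p\<^esub> t p = Zer (Cat D p) (fst T p) (fst B p)"
        using fun_cong[OF t(2), of p] p by (simp add: glued_sel(1,4)[OF P])
      from KF(4)[OF p p p glued_arr_comp[OF P t(1) p] this]
      show "\<exists>u. ar p (fst T p) (Ko p) u \<and> k p \<cdot>\<^bsub>p\<^esub> u = t p" .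
    qed
    from bchoice[OF this] obtain u
      where u: "\<And>p. p \<in> P \<Longrightarrow> ar p (fst T p) (Ko p) (u p)" "\<And>p. p \<in> P \<Longrightarrow> k p \<cdot>\<^bsub>p\<^esub> u p = t p" by blast
    have "arr (G P) T KG (\<lambda>p\<in>P. u p)"
    proof (rule glued_create_arr[where I = "{()}" and X = "\<lambda>_. A" and q = "\<lambda>_. \<lambda>p\<in>P. k p",
          OF arr_objD(1)[OF t(1)] cr(1) cr(2)])
      show "ar p (fst T p) (fst KG p) (u p)" if "p \<in> P" for p using u(1)[OF that] KGp[OF that] by simp
      show "\<exists>h. arr (G P) T A h \<and> (\<forall>p\<in>P. (\<lambda>p\<in>P. k p) p \<cdot>\<^bsub>p\<^esub> u p = h p)"
        using t(1) u(2) by (intro exI[of _ t]) simp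
      show "x = y" if "p \<in> P" "ar p U (fst KG p) x" "ar p U (fst KG p) y"
        "\<And>i. i \<in> {()} \<Longrightarrow> (\<lambda>p\<in>P. k p) p \<cdot>\<^bsub>p\<^esub> x = (\<lambda>p\<in>P. k p) p \<cdot>\<^bsub>p\<^esub> y" for p U x y
        using mono[OF that(1), of U x y] that(2,3) that(4)[OF singletonI] KGp[OF that(1)] that(1) by simp
    qed
    moreover have "Cmp (G P) (\<lambda>p\<in>P. k p) (\<lambda>p\<in>P. u p) = t"
      by (rule glued_arr_eqI[OF P GP.cmp_arr[OF calculation cr(2)] t(1)])
        (simp add: glued_sel(1)[OF P] u(2))
    ultimately show "\<exists>u. arr (G P) T KG u \<and> Cmp (G P) (\<lambda>p\<in>P. k p) u = t" by blast
  qed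
  moreover have "\<forall>p\<in>P. is_kernel (Cat D p) (fst A p) (fst B p) (f p) (fst KG p) ((\<lambda>p\<in>P. k p) p)"
    using K KGp by simp
  ultimately show ?thesis by blast
qed

text \<open>Homology is defined by a chosen kernel, about which only the universal property is known; it is
  isomorphic to the componentwise one.\<close>

lemma glued_kernel_eval:
  assumes f: "arr (G P) A B f" and K: "is_kernel (G P) A B f K k" and p: "p \<in> P"
  shows "is_kernel (Cat D p) (fst A p) (fst B p) (f p) (fst K p) (k p)"
proof -
  interpret GP: preadditive_category "G P" by (rule glued_preadditive[OF P])
  obtain K' k' where K': "is_kernel (G P) A B f K' k'"
    "is_kernel (Cat D p) (fst A p) (fst B p) (f p) (fst K' p) (k' p)"
    using glued_kernel[OF f] p by blast
  obtain v where v: "arr (G P) K' K v" "is_iso (G P) K' K v" "Cmp (G P) k v = k'"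
    using GP.kernel_comparison[OF K K'(1) f] by blast
  show ?thesis
    by (rule preadditive_category.kernel_transport[OF C_pre[OF subsetD[OF P p]] K'(2) glued_arr_comp[OF P f p]
        glued_arr_comp[OF P v(1) p] glued_iso_eval[OF v(1,2) p]
        glued_arr_comp[OF P GP.kernel_arr[OF K f] p]])
      (simp only: v(3)[symmetric] glued_sel(1)[OF P p])
qed

abbreviation GP_dsd where "GP_dsd \<equiv> preadditive_category.direct_sum_data (G P)"

lemma glued_direct_sum:
  assumes I: "finite I" and X: "\<And>i. i \<in> I \<Longrightarrow> X i \<in> Obj (G P)"
  shows "\<exists>B inc prj. GP_dsd I X B inc prj"
proof -
  interpret GP: preadditive_category "G P" by (rule glued_preadditive[OF P])
  have "\<forall>p\<in>P. \<exists>b. preadditive_category.direct_sum_data (Cat D p) I (\<lambda>i. fst (X i) p) (fst b)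
      (fst (snd b)) (snd (snd b))"
  proof
    fix p assume p: "p \<in> P"
    interpret V: preadditive_category "Cat D p" by (rule C_pre[OF subsetD[OF P p]])
    obtain z where z: "is_zero_object (Cat D p) z"
      using abelian[OF subsetD[OF P p]] unfolding abelian_category_def by blast
    have "\<exists>B inc prj. V.direct_sum_data I (\<lambda>i. fst (X i) p) B inc prj"
      by (rule V.dsd_exists[OF z _ I glued_ob[OF P X p]])
        (use abelian[OF subsetD[OF P p]] in \<open>unfold abelian_category_def, blast\<close>)
    then show "\<exists>b. V.direct_sum_data I (\<lambda>i. fst (X i) p) (fst b) (fst (snd b)) (snd (snd b))" by auto
  qed
  from bchoice[OF this] obtain b where b: "\<And>p. p \<in> P \<Longrightarrow>
      preadditive_category.direct_sum_data (Cat D p) I (\<lambda>i. fst (X i) p) (fst (b p))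
      (fst (snd (b p))) (snd (snd (b p)))" by blast
  define Bo where "Bo p = fst (b p)" for p
  define ic where "ic i p = fst (snd (b p)) i" for i p
  define pr where "pr i p = snd (snd (b p)) i" for i p
  have S: "preadditive_category.direct_sum_data (Cat D p) I (\<lambda>i. fst (X i) p) (Bo p)
      (\<lambda>i. ic i p) (\<lambda>i. pr i p)" if "p \<in> P" for p
    using b[OF that] by (simp add: Bo_def ic_def pr_def)
  note SF = preadditive_category.dsd_facts[OF C_pre[OF subsetD[OF P]] S]
  have ica: "ar p (fst (X i) p) (Bo p) (ic i p)" and pra: "ar p (Bo p) (fst (X i) p) (pr i p)"
    if "i \<in> I" "p \<in> P" for i p using SF(4,5)[OF that(2,2,1)] by simp_all
  have Bob: "ob p (Bo p)" if "p \<in> P" for p by (rule SF(2)[OF that that])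
  define \<beta> where "\<beta> g p = (SOME b. ar (g \<otimes> p) (PhO D g p (Bo p)) (Bo (g \<otimes> p)) b \<and>
    (\<forall>i\<in>I. pr i (g \<otimes> p) \<cdot>\<^bsub>g \<otimes> p\<^esub> b = snd (X i) g p \<cdot>\<^bsub>g \<otimes> p\<^esub> PhA D g p (pr i p)))" for g p
  have \<beta>: "ar r (PhO D g p (Bo p)) (Bo r) (\<beta> g p) \<and>
      (\<forall>i\<in>I. pr i r \<cdot>\<^bsub>r\<^esub> \<beta> g p = snd (X i) g p \<cdot>\<^bsub>r\<^esub> PhA D g p (pr i p))"
    if h: "g \<in> carrier W" "p \<in> P" "r \<in> P" "r = g \<otimes> p" for g p r
  proof -
    note c = subsetD[OF P h(2)] subsetD[OF P h(3)]
    interpret R: preadditive_category "Cat D r" by (rule C_pre[OF c(2)])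
    have t: "ar r (PhO D g p (Bo p)) (fst (X i) r) (snd (X i) g p \<cdot>\<^bsub>r\<^esub> PhA D g p (pr i p))" if "i \<in> I" for i
      by (rule R.cmp_arr[OF PhA_ar[OF h(1) c(1) pra[OF that h(2)] h(4)] glued_alpha[OF P X[OF that] h]])
    obtain bb where "ar r (PhO D g p (Bo p)) (Bo r) bb"
      "\<And>i. i \<in> I \<Longrightarrow> pr i r \<cdot>\<^bsub>r\<^esub> bb = snd (X i) g p \<cdot>\<^bsub>r\<^esub> PhA D g p (pr i p)"
      by (rule R.dsd_tuple[OF S[OF h(3)] PhO_ob[OF h(1) c(1) Bob[OF h(2)] h(4)] t]) simp_all
    then have "\<exists>b. ar r (PhO D g p (Bo p)) (Bo r) b \<and>
      (\<forall>i\<in>I. pr i r \<cdot>\<^bsub>r\<^esub> b = snd (X i) g p \<cdot>\<^bsub>r\<^esub> PhA D g p (pr i p))" by blast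
    then show ?thesis unfolding \<beta>_def h(4)[symmetric] by (rule someI_ex)
  qed
  define B where "B = (\<lambda>w\<in>P. Bo w, \<lambda>g p. if alpha_ix W P g p then \<beta> g p else undefined)"
  have mono: "t = t'" if "p \<in> P" "ar p T (Bo p) t" "ar p T (Bo p) t'"
    "\<And>i. i \<in> I \<Longrightarrow> pr i p \<cdot>\<^bsub>p\<^esub> t = pr i p \<cdot>\<^bsub>p\<^esub> t'" for p T t t'
    by (rule preadditive_category.dsd_ext[OF C_pre[OF subsetD[OF P that(1)]] S[OF that(1)] that(2-4)])
  have cr: "B \<in> Obj (G P)" "\<And>i. i \<in> I \<Longrightarrow> arr (G P) B (X i) (\<lambda>p\<in>P. pr i p)"
    by (rule glued_create[where \<beta> = \<beta> and Bo = Bo and X = X and I = I and q = pr, OF X Bob pra _ _ mono B_def];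
      use \<beta> in blast)+
  have Bp: "fst B p = Bo p" if "p \<in> P" for p using that by (simp add: B_def)
  have entry: "pr j p \<cdot>\<^bsub>p\<^esub> ic i p = (if i = j then Ide (G P) (X i) else Zer (G P) (X i) (X j)) p"
    if "i \<in> I" "j \<in> I" "p \<in> P" for i j p
    using SF(6)[OF that(3,3,1)] SF(7)[OF that(3,3,1,2)] that by (cases "i = j") (auto simp: glued_sel(2,4)[OF P])
  have ia: "arr (G P) (X i) B (\<lambda>p\<in>P. ic i p)" if i: "i \<in> I" for i
  proof (rule glued_create_arr[where I = I and X = X and q = "\<lambda>i. \<lambda>p\<in>P. pr i p", OF X[OF i] cr])
    show "ar p (fst (X i) p) (fst B p) (ic i p)" if "p \<in> P" for p using ica[OF i that] Bp[OF that] by simp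
    show "\<exists>h. arr (G P) (X i) (X j) h \<and> (\<forall>p\<in>P. (\<lambda>p\<in>P. pr j p) p \<cdot>\<^bsub>p\<^esub> ic i p = h p)" if j: "j \<in> I" for j
      using entry[OF i j] GP.ide_arr[OF X[OF i]] GP.zer_arr[OF X[OF i] X[OF j]]
      by (intro exI[of _ "if i = j then Ide (G P) (X i) else Zer (G P) (X i) (X j)"]) auto
    show "t = t'" if "p \<in> P" "ar p T (fst B p) t" "ar p T (fst B p) t'"
      "\<And>i. i \<in> I \<Longrightarrow> (\<lambda>p\<in>P. pr i p) p \<cdot>\<^bsub>p\<^esub> t = (\<lambda>p\<in>P. pr i p) p \<cdot>\<^bsub>p\<^esub> t'" for p T t t'
      by (rule mono[OF that(1)]) (use that Bp[OF that(1)] in auto)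
  qed
  have "GP_dsd I X B (\<lambda>i. \<lambda>p\<in>P. ic i p) (\<lambda>i. \<lambda>p\<in>P. pr i p)"
  proof (rule GP.dsd_intro[OF I cr(1) ia cr(2)])
    show "Cmp (G P) (\<lambda>p\<in>P. pr i p) (\<lambda>p\<in>P. ic i p) = Ide (G P) (X i)" if i: "i \<in> I" for i
      by (rule glued_arr_eqI[OF P GP.cmp_arr[OF ia[OF i] cr(2)[OF i]] GP.ide_arr[OF X[OF i]]])
        (use entry[OF i i] in \<open>simp add: glued_sel(1)[OF P]\<close>)
    show "Cmp (G P) (\<lambda>p\<in>P. pr j p) (\<lambda>p\<in>P. ic i p) = Zer (G P) (X i) (X j)"
      if i: "i \<in> I" "j \<in> I" "i \<noteq> j" for i j
      by (rule glued_arr_eqI[OF P GP.cmp_arr[OF ia[OF i(1)] cr(2)[OF i(2)]] GP.zer_arr[OF X[OF i(1)] X[OF i(2)]]])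
        (use entry[OF i(1,2)] i(3) in \<open>simp add: glued_sel(1)[OF P]\<close>)
    fix t t' assume t: "arr (G P) B B t" "arr (G P) B B t'"
      "\<And>i. i \<in> I \<Longrightarrow> Cmp (G P) (\<lambda>p\<in>P. pr i p) t = Cmp (G P) (\<lambda>p\<in>P. pr i p) t'"
    show "t = t'"
    proof (rule glued_arr_eqI[OF P t(1,2)])
      fix p assume p: "p \<in> P"
      show "t p = t' p"
      proof (rule mono[OF p])
        show "ar p (Bo p) (Bo p) (t p)" "ar p (Bo p) (Bo p) (t' p)"
          using glued_arr_comp[OF P t(1) p] glued_arr_comp[OF P t(2) p] Bp[OF p] by simp_all
        show "pr i p \<cdot>\<^bsub>p\<^esub> t p = pr i p \<cdot>\<^bsub>p\<^esub> t' p" if "i \<in> I" for i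
          using fun_cong[OF t(3)[OF that], of p] p by (simp add: glued_sel(1)[OF P])
      qed
    qed
  qed
  then show ?thesis by blast
qed

lemma glued_direct_sum_eval:
  assumes B: "GP_dsd I X B inc prj" and p: "p \<in> P"
  shows "preadditive_category.direct_sum_data (Cat D p) I (\<lambda>i. fst (X i) p) (fst B p)
    (\<lambda>i. inc i p) (\<lambda>i. prj i p)"
proof -
  interpret GP: preadditive_category "G P" by (rule glued_preadditive[OF P])
  interpret V: preadditive_category "Cat D p" by (rule C_pre[OF subsetD[OF P p]])
  note F = GP.dsd_facts[OF B]
  have sum: "GP.hsum B B f J p = V.hsum (fst B p) (fst B p) (\<lambda>i. f i p) J"
    if "finite J" "\<And>i. i \<in> J \<Longrightarrow> arr (G P) B B (f i)" for f and J :: "'i set"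
    using that
  proof (induction J rule: finite_induct)
    case empty
    then show ?case
      using glued_ob[OF P F(2) p] by (simp add: GP.hsum_empty V.hsum_empty F(2) glued_sel(4)[OF P p])
  next
    case (insert i J)
    have "\<And>j. j \<in> insert i J \<Longrightarrow> ar p (fst B p) (fst B p) (f j p)"
      by (rule glued_arr_comp[OF P insert.prems p])
    from V.hsum_insert[OF insert.hyps(1,2) this] show ?case
      using GP.hsum_insert[OF insert.hyps(1,2) insert.prems] insert by (simp add: glued_sel(3)[OF P p])
  qed
  have "V.hsum (fst B p) (fst B p) (\<lambda>i. inc i p \<cdot>\<^bsub>p\<^esub> prj i p) I = idn p (fst B p)"
    using sum[of I "\<lambda>i. Cmp (G P) (inc i) (prj i)", OF F(1) GP.cmp_arr[OF F(5) F(4)]] F(8)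
    by (simp add: glued_sel(1,2)[OF P p])
  moreover have "prj j p \<cdot>\<^bsub>p\<^esub> inc i p =
      (if i = j then idn p (fst (X i) p) else Zer (Cat D p) (fst (X i) p) (fst (X j) p))"
    if "i \<in> I" "j \<in> I" for i j
    using fun_cong[OF F(6)[OF that(1)], of p] fun_cong[OF F(7)[OF that], of p]
    by (auto simp: glued_sel(1,2,4)[OF P p])
  ultimately show ?thesis
    using F(1) glued_ob[OF P F(2) p] glued_ob[OF P F(3) p] glued_arr_comp[OF P F(4) p]
      glued_arr_comp[OF P F(5) p]
    unfolding V.direct_sum_data_def is_direct_sum_def arr_def by auto
qed

end

lemma PhA_iso:
  assumes "w \<in> carrier W" "v \<in> carrier W" "ar v X Y f" "is_iso (Cat D v) X Y f" "u = w \<otimes> v"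
  shows "is_iso (Cat D u) (PhO D w v X) (PhO D w v Y) (PhA D w v f)"
proof -
  obtain g where g: "ar v Y X g" "g \<cdot>\<^bsub>v\<^esub> f = idn v X" "f \<cdot>\<^bsub>v\<^esub> g = idn v Y"
    using preadditive_category.is_isoE[OF C_pre[OF assms(2)] assms(4) arr_objD[OF assms(3)]] by blast
  have u: "u \<in> carrier W" using assms by simp
  show ?thesis
    by (rule preadditive_category.is_isoI[OF C_pre[OF u] PhA_ar[OF assms(1,2,3,5)] PhA_ar[OF assms(1,2) g(1) assms(5)]])
      (simp_all only: PhA_cmp[OF assms(1,2,3) g(1) assms(5), symmetric]
        PhA_cmp[OF assms(1,2) g(1) assms(3,5), symmetric] g(2,3)
        PhA_ide[OF assms(1,2) arr_objD(1)[OF assms(3)] assms(5)]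
        PhA_ide[OF assms(1,2) arr_objD(2)[OF assms(3)] assms(5)])
qed

subsection \<open>Transition morphisms\<close>

text \<open>For length-additive \<open>g\<close> and \<open>m\<close>, the composite \<open>\<Phi>\<^sub>g\<^sub>m A\<^sub>p \<cong> \<Phi>\<^sub>g \<Phi>\<^sub>m A\<^sub>p \<rightarrow> \<Phi>\<^sub>g A\<^sub>m\<^sub>p\<close>. In each
  component, the canonical morphisms of the complex have this form.\<close>

definition trn :: "('w, 'o, 'm) glued \<Rightarrow> 'w \<Rightarrow> 'w \<Rightarrow> 'w \<Rightarrow> 'm" where
  "trn A g m p = PhA D g (m \<otimes> p) (snd A m p) \<cdot>\<^bsub>g \<otimes> m \<otimes> p\<^esub>
     inv_arr (Cat D (g \<otimes> m \<otimes> p)) (PhO D g (m \<otimes> p) (PhO D m p (fst A p))) (PhO D (g \<otimes> m) p (fst A p))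
       (Nu D g m p (fst A p))"

context
  fixes P :: "'w set"
  assumes P: "P \<subseteq> carrier W"
begin

lemma trn_facts:
  assumes A: "A \<in> Obj (G P)" and h: "g \<in> carrier W" "m \<in> carrier W" "p \<in> P" "q \<in> P" "additive g m"
    "q = m \<otimes> p" "x = g \<otimes> m" "z = g \<otimes> q"
  shows trn_ar: "ar z (PhO D x p (fst A p)) (PhO D g q (fst A q)) (trn A g m p)"
    and trn_nu: "trn A g m p \<cdot>\<^bsub>z\<^esub> Nu D g m p (fst A p) = PhA D g q (snd A m p)"
proof -
  note c = subsetD[OF P h(3)] subsetD[OF P h(4)]
  have z: "z = g \<otimes> m \<otimes> p" and zc: "z \<in> carrier W" using h c by (simp_all add: m_assoc)
  note o = glued_ob[OF P A h(3)]
  note F = PhA_ar[OF h(1) c(2) glued_alpha[OF P A h(2,3,4,6)] h(8)]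
  note N = nu_ar[OF h(1,2) c(1) o h(6,7,8)]
  note I = preadditive_category.inv_arr_facts[OF C_pre[OF zc] nu_iso[OF h(1,2) c(1) o h(5,6,7,8)]
      arr_objD(1)[OF N] arr_objD(2)[OF N]]
  have e: "trn A g m p = PhA D g q (snd A m p) \<cdot>\<^bsub>z\<^esub>
     inv_arr (Cat D z) (PhO D g q (PhO D m p (fst A p))) (PhO D x p (fst A p)) (Nu D g m p (fst A p))"
    by (simp only: trn_def z h(6,7))
  show "ar z (PhO D x p (fst A p)) (PhO D g q (fst A q)) (trn A g m p)"
    unfolding e by (rule C_cmp_arr[OF zc I(1) F])
  show "trn A g m p \<cdot>\<^bsub>z\<^esub> Nu D g m p (fst A p) = PhA D g q (snd A m p)"
    by (simp only: e C_assoc[OF zc N I(1) F, symmetric] I(2) C_ide(1)[OF zc F])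
qed

lemma trn_eqI:
  assumes A: "A \<in> Obj (G P)" and h: "g \<in> carrier W" "m \<in> carrier W" "p \<in> P" "q \<in> P" "additive g m"
    "q = m \<otimes> p" "x = g \<otimes> m" "z = g \<otimes> q"
    and t: "ar z (PhO D x p (fst A p)) Y t" "ar z (PhO D x p (fst A p)) Y t'"
    and eq: "t \<cdot>\<^bsub>z\<^esub> Nu D g m p (fst A p) = t' \<cdot>\<^bsub>z\<^esub> Nu D g m p (fst A p)"
  shows "t = t'"
proof -
  note c = subsetD[OF P h(3)] subsetD[OF P h(4)]
  have zc: "z \<in> carrier W" using h c by simp
  note o = glued_ob[OF P A h(3)]
  show ?thesis
    by (rule preadditive_category.iso_cancel_right[OF C_pre[OF zc] nu_iso[OF h(1,2) c(1) o h(5,6,7,8)]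
        nu_ar[OF h(1,2) c(1) o h(6,7,8)] t eq])
qed

lemma additive_one: "g \<in> carrier W \<Longrightarrow> additive g \<one>" "g \<in> carrier W \<Longrightarrow> additive \<one> g"
  by (simp_all add: additive_def)

lemma trn_one:
  assumes A: "A \<in> Obj (G P)" and "g \<in> carrier W" "p \<in> P" "z = g \<otimes> p"
  shows "trn A g \<one> p = idn z (PhO D g p (fst A p))"
proof -
  note c = subsetD[OF P assms(3)]
  note o = glued_ob[OF P A assms(3)]
  have zc: "z \<in> carrier W" using assms c by simp
  have h: "g \<in> carrier W" "\<one> \<in> carrier W" "p \<in> P" "p \<in> P" "additive g \<one>"
    "p = \<one> \<otimes> p" "g = g \<otimes> \<one>" "z = g \<otimes> p" using assms c additive_one by auto
  note t = trn_facts[OF A h]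
  show ?thesis
    using t(2) by (simp only: nu_one(2)[OF assms(2) c o assms(4)] glued_alpha_one[OF P A assms(3)]
      PhA_ide[OF assms(2) c o assms(4)] C_ide(1)[OF zc t(1)])
qed

lemma trn_left_one:
  assumes A: "A \<in> Obj (G P)" and "m \<in> carrier W" "p \<in> P" "q \<in> P" "q = m \<otimes> p"
  shows "trn A \<one> m p = snd A m p"
proof -
  note c = subsetD[OF P assms(3)] subsetD[OF P assms(4)]
  note o = glued_ob[OF P A assms(3)]
  note a = glued_alpha[OF P A assms(2-5)]
  have h: "\<one> \<in> carrier W" "m \<in> carrier W" "p \<in> P" "q \<in> P" "additive \<one> m"
    "q = m \<otimes> p" "m = \<one> \<otimes> m" "q = \<one> \<otimes> q" using assms c additive_one by auto
  note t = trn_facts[OF A h]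
  show ?thesis
    using t(2) by (simp only: nu_one(1)[OF assms(2) c(1) o assms(5)] Ph_one(2)[OF c(2) a] C_ide(1)[OF c(2) t(1)])
qed

text \<open>The cocycle condition of \<open>A\<close>, transported along \<open>\<nu>\<^sub>g\<^sub>,\<^sub>a\<close>. It is stated with \<open>\<nu>\<close> on the left, and
  not with a second transition morphism on the right, because \<open>g a\<close> and \<open>b\<close> may fail to be
  length-additive.\<close>

lemma trn_cocycle:
  assumes A: "A \<in> Obj (G P)" and h: "g \<in> carrier W" "a \<in> carrier W" "b \<in> carrier W" "p \<in> P" "q \<in> P" "r \<in> P"
    "additive g a" "additive g (a \<otimes> b)" "q = b \<otimes> p" "r = a \<otimes> q" "x = g \<otimes> a" "z = g \<otimes> r"
  shows "trn A g (a \<otimes> b) p \<cdot>\<^bsub>z\<^esub> Nu D x b p (fst A p) = trn A g a q \<cdot>\<^bsub>z\<^esub> PhA D x q (snd A b p)"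
proof -
  note c = subsetD[OF P h(4)] subsetD[OF P h(5)] subsetD[OF P h(6)]
  define ab where "ab = a \<otimes> b"
  have ab: "ab \<in> carrier W" "additive g ab" "r = ab \<otimes> p" using h c by (simp_all add: ab_def m_assoc)
  have xc: "x \<in> carrier W" "z \<in> carrier W" "z = x \<otimes> q" "g \<otimes> ab = x \<otimes> b" "z = g \<otimes> (a \<otimes> q)"
    using h c by (simp_all add: ab_def m_assoc)
  note o = glued_ob[OF P A h(4)]
  note ob = PhO_ob[OF h(3) c(1) o h(9)]
  note N1 = nu_ar[OF h(1,2) c(2) ob h(10,11,12)]
  note I1 = nu_iso[OF h(1,2) c(2) ob h(7,10,11,12)]
  note Nx = nu_ar[OF xc(1) h(3) c(1) o h(9) HOL.refl xc(3)]
  note T1 = trn_facts[OF A h(1) ab(1) h(4,6) ab(2,3) HOL.refl h(12)]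
  note T1' = T1(1)[unfolded xc(4)]
  note T2 = trn_facts[OF A h(1,2,5,6,7,10,11,12)]
  note al = glued_alpha[OF P A h(3,4,5,9)]
  note Fa = PhA_ar[OF xc(1) c(2) al xc(3)]
  note Na = nu_ar[OF h(2,3) c(1) o h(9) ab_def h(10)]
  note Ng = nu_ar[OF h(1) ab(1) c(1) o ab(3) HOL.refl h(12), unfolded xc(4)]
  note Naq = nu_ar[OF h(1,2) c(2) glued_ob[OF P A h(5)] h(10,11,12)]
  note Faa = PhA_ar[OF h(2) c(2) al h(10)]
  note aa = glued_alpha[OF P A h(2,5,6,10)] note aab = glued_alpha[OF P A ab(1) h(4,6) ab(3)]
  have "trn A g ab p \<cdot>\<^bsub>z\<^esub> Nu D x b p (fst A p) = trn A g a q \<cdot>\<^bsub>z\<^esub> PhA D x q (snd A b p)"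
  proof (rule preadditive_category.iso_cancel_right[OF C_pre[OF xc(2)] I1 N1
        C_cmp_arr[OF xc(2) Nx T1'] C_cmp_arr[OF xc(2) Fa T2(1)]])
    have "(trn A g ab p \<cdot>\<^bsub>z\<^esub> Nu D x b p (fst A p)) \<cdot>\<^bsub>z\<^esub> Nu D g a q (PhO D b p (fst A p)) =
        trn A g ab p \<cdot>\<^bsub>z\<^esub> (Nu D g ab p (fst A p) \<cdot>\<^bsub>z\<^esub> PhA D g r (Nu D a b p (fst A p)))"
      by (simp only: C_assoc[OF xc(2) N1 Nx T1', symmetric]
        nu_assoc[OF h(1,2,3) c(1) o h(11) ab_def h(9,10,12)])
    also have "\<dots> = PhA D g r (snd A ab p \<cdot>\<^bsub>r\<^esub> Nu D a b p (fst A p))"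
      by (simp only: C_assoc[OF xc(2) PhA_ar[OF h(1) c(3) Na h(12)] Ng T1'] T1(2)
        PhA_cmp[OF h(1) c(3) Na aab h(12)])
    also have "\<dots> = PhA D g r (snd A a q \<cdot>\<^bsub>r\<^esub> PhA D a q (snd A b p))"
      by (simp only: glued_cocycle[OF P A h(2,3,4,5,6,9,10) ab_def])
    also have "\<dots> = (trn A g a q \<cdot>\<^bsub>z\<^esub> PhA D x q (snd A b p)) \<cdot>\<^bsub>z\<^esub> Nu D g a q (PhO D b p (fst A p))"
      by (simp only: PhA_cmp[OF h(1) c(3) Faa aa h(12)] T2(2)[symmetric]
        C_assoc[OF xc(2) PhA_ar[OF h(1) c(3) Faa h(12)] Naq T2(1), symmetric]
        nu_nat[OF h(1,2) c(2) al h(10,11,12)] C_assoc[OF xc(2) N1 Fa T2(1)])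
    finally show "(trn A g ab p \<cdot>\<^bsub>z\<^esub> Nu D x b p (fst A p)) \<cdot>\<^bsub>z\<^esub> Nu D g a q (PhO D b p (fst A p)) =
        (trn A g a q \<cdot>\<^bsub>z\<^esub> PhA D x q (snd A b p)) \<cdot>\<^bsub>z\<^esub> Nu D g a q (PhO D b p (fst A p))" .
  qed
  then show ?thesis by (simp only: ab_def)
qed

lemma trn_comp:
  assumes A: "A \<in> Obj (G P)" and h: "g \<in> carrier W" "a \<in> carrier W" "b \<in> carrier W" "p \<in> P" "q \<in> P" "r \<in> P"
    "additive g a" "additive g (a \<otimes> b)" "q = b \<otimes> p" "r = a \<otimes> q" "x = g \<otimes> a" "z = g \<otimes> r"
    and add: "additive x b"
  shows "trn A g (a \<otimes> b) p = trn A g a q \<cdot>\<^bsub>z\<^esub> trn A x b p"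
proof -
  note c = subsetD[OF P h(4)] subsetD[OF P h(5)] subsetD[OF P h(6)]
  have xc: "x \<in> carrier W" "z \<in> carrier W" "z = x \<otimes> q" "a \<otimes> b \<in> carrier W" "r = a \<otimes> b \<otimes> p"
    "x \<otimes> b = g \<otimes> (a \<otimes> b)"
    using h c by (simp_all add: m_assoc)
  note o = glued_ob[OF P A h(4)]
  note T1 = trn_facts[OF A h(1) xc(4) h(4,6,8) xc(5) xc(6) h(12)]
  note T2 = trn_facts[OF A h(1,2,5,6,7,10,11,12)]
  note T3 = trn_facts[OF A xc(1) h(3,4,5) add h(9) HOL.refl xc(3)]
  note N = nu_ar[OF xc(1) h(3) c(1) o h(9) HOL.refl xc(3)]
  show ?thesis
    by (rule trn_eqI[OF A xc(1) h(3,4,5) add h(9) HOL.refl xc(3) T1(1) C_cmp_arr[OF xc(2) T3(1) T2(1)]])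
      (simp only: trn_cocycle[OF A h] C_assoc[OF xc(2) N T3(1) T2(1), symmetric] T3(2))
qed

text \<open>This becomes the cocycle condition of \<open>ext_obj\<close>: there \<open>q\<close> is the gate of \<open>v = n q\<close>, \<open>r\<close> is the
  gate of \<open>z = w v = n2 r\<close>, and \<open>p\<close> is the gate of an element from which \<open>v\<close> has been reached. Both
  sides are compared after composition with \<open>\<Phi>\<^sub>w\<close> of the isomorphism \<open>\<nu>\<close> for \<open>n\<close> and \<open>m1\<close>, where
  \<open>trn_cocycle\<close> applies.\<close>

lemma trn_push:
  assumes A: "A \<in> Obj (G P)"
    and h: "w \<in> carrier W" "n \<in> carrier W" "m1 \<in> carrier W" "n2 \<in> carrier W" "m2 \<in> carrier W"
      "p \<in> P" "q \<in> P" "r \<in> P" "additive n m1" "additive n2 m2" "additive n2 (m2 \<otimes> m1)"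
      "q = m1 \<otimes> p" "r = m2 \<otimes> q" "y = n \<otimes> m1" "w \<otimes> n = n2 \<otimes> m2" "v = n \<otimes> q" "z = n2 \<otimes> r"
  shows "trn A n2 (m2 \<otimes> m1) p \<cdot>\<^bsub>z\<^esub> Nu D w y p (fst A p) =
    trn A n2 m2 q \<cdot>\<^bsub>z\<^esub> (Nu D w n q (fst A q) \<cdot>\<^bsub>z\<^esub> PhA D w v (trn A n m1 p))"
proof -
  note c = subsetD[OF P h(6)] subsetD[OF P h(7)] subsetD[OF P h(8)]
  define x where "x = w \<otimes> n"
  have xc: "x \<in> carrier W" "x = n2 \<otimes> m2" "y \<in> carrier W" "v \<in> carrier W" "z \<in> carrier W"
    "m2 \<otimes> m1 \<in> carrier W" "r = m2 \<otimes> m1 \<otimes> p" "v = y \<otimes> p"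
    using h c by (simp_all add: x_def m_assoc)
  have zw: "z = n2 \<otimes> m2 \<otimes> q" unfolding h(13,17) using h c by (simp add: m_assoc)
  have zv: "z = w \<otimes> v" unfolding zw h(15)[symmetric] h(16) using h(1,2) c(2) by (simp add: m_assoc)
  have zx: "z = x \<otimes> q" using zw xc(2) by simp
  have xy: "w \<otimes> y = x \<otimes> m1" unfolding h(14) x_def using h(1-3) by (simp add: m_assoc)
  have xy2: "n2 \<otimes> (m2 \<otimes> m1) = x \<otimes> m1" unfolding xc(2) using h(3-5) by (simp add: m_assoc)
  note o = glued_ob[OF P A h(6)] note oq = glued_ob[OF P A h(7)]
  note T1 = trn_facts[OF A h(4) xc(6) h(6,8,11) xc(7) HOL.refl h(17), unfolded xy2]
  note T2 = trn_facts[OF A h(4,5,7,8,10,13) xc(2) h(17)]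
  note T3 = trn_facts[OF A h(2,3,6,7,9,12,14,16)]
  note Nn = nu_ar[OF h(2,3) c(1) o h(12,14,16)]
  note In = nu_iso[OF h(2,3) c(1) o h(9,12,14,16)]
  note PN = PhA_ar[OF h(1) xc(4) Nn zv] note PI = PhA_iso[OF h(1) xc(4) Nn In zv]
  note PT = PhA_ar[OF h(1) xc(4) T3(1) zv]
  note Nw = nu_ar[OF h(1) xc(3) c(1) o xc(8) xy[symmetric] zv]
  note Nq = nu_ar[OF h(1,2) c(2) oq h(16) x_def zv]
  note al = glued_alpha[OF P A h(3,6,7,12)]
  note ob = PhO_ob[OF h(3) c(1) o h(12)]
  note Nqb = nu_ar[OF h(1,2) c(2) ob h(16) x_def zv]
  note Fx = PhA_ar[OF xc(1) c(2) al zx]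
  note Nx = nu_ar[OF xc(1) h(3) c(1) o h(12) HOL.refl zx]
  show ?thesis
  proof (rule preadditive_category.iso_cancel_right[OF C_pre[OF xc(5)] PI PN
        C_cmp_arr[OF xc(5) Nw T1(1)] C_cmp_arr[OF xc(5) C_cmp_arr[OF xc(5) PT Nq] T2(1)]])
    have "(trn A n2 (m2 \<otimes> m1) p \<cdot>\<^bsub>z\<^esub> Nu D w y p (fst A p)) \<cdot>\<^bsub>z\<^esub> PhA D w v (Nu D n m1 p (fst A p)) =
        (trn A n2 (m2 \<otimes> m1) p \<cdot>\<^bsub>z\<^esub> Nu D x m1 p (fst A p)) \<cdot>\<^bsub>z\<^esub> Nu D w n q (PhO D m1 p (fst A p))"
      by (simp only: C_assoc[OF xc(5) PN Nw T1(1), symmetric]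
        nu_assoc[OF h(1,2,3) c(1) o x_def h(14,12,16) zv, symmetric] C_assoc[OF xc(5) Nqb Nx T1(1)])
    also have "\<dots> = trn A n2 m2 q \<cdot>\<^bsub>z\<^esub> (PhA D x q (snd A m1 p) \<cdot>\<^bsub>z\<^esub> Nu D w n q (PhO D m1 p (fst A p)))"
      by (simp only: trn_cocycle[OF A h(4,5,3,6,7,8,10,11,12,13) xc(2) h(17)] C_assoc[OF xc(5) Nqb Fx T2(1), symmetric])
    also have "\<dots> = trn A n2 m2 q \<cdot>\<^bsub>z\<^esub> (Nu D w n q (fst A q) \<cdot>\<^bsub>z\<^esub>
        (PhA D w v (trn A n m1 p) \<cdot>\<^bsub>z\<^esub> PhA D w v (Nu D n m1 p (fst A p))))"
      by (simp only: nu_nat[OF h(1,2) c(2) al h(16) x_def zv, symmetric] T3(2)[symmetric]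
        PhA_cmp[OF h(1) xc(4) Nn T3(1) zv])
    also have "\<dots> = (trn A n2 m2 q \<cdot>\<^bsub>z\<^esub> (Nu D w n q (fst A q) \<cdot>\<^bsub>z\<^esub> PhA D w v (trn A n m1 p))) \<cdot>\<^bsub>z\<^esub>
        PhA D w v (Nu D n m1 p (fst A p))"
      by (simp only: C_assoc[OF xc(5) PN PT Nq] C_assoc[OF xc(5) PN C_cmp_arr[OF xc(5) PT Nq] T2(1)])
    finally show "(trn A n2 (m2 \<otimes> m1) p \<cdot>\<^bsub>z\<^esub> Nu D w y p (fst A p)) \<cdot>\<^bsub>z\<^esub> PhA D w v (Nu D n m1 p (fst A p)) =
        (trn A n2 m2 q \<cdot>\<^bsub>z\<^esub> (Nu D w n q (fst A q) \<cdot>\<^bsub>z\<^esub> PhA D w v (trn A n m1 p))) \<cdot>\<^bsub>z\<^esub>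
        PhA D w v (Nu D n m1 p (fst A p))" .
  qed
qed

lemma trn_natural:
  assumes f: "arr (G P) A B f"
    and h: "g \<in> carrier W" "m \<in> carrier W" "p \<in> P" "q \<in> P" "additive g m"
    "q = m \<otimes> p" "x = g \<otimes> m" "z = g \<otimes> q"
  shows "PhA D g q (f q) \<cdot>\<^bsub>z\<^esub> trn A g m p = trn B g m p \<cdot>\<^bsub>z\<^esub> PhA D x p (f p)"
proof -
  note A = arr_objD(1)[OF f] note B = arr_objD(2)[OF f]
  note c = subsetD[OF P h(3)] subsetD[OF P h(4)]
  have xc: "x \<in> carrier W" "z \<in> carrier W" "z = x \<otimes> p" using h c by (simp_all add: m_assoc)
  note oA = glued_ob[OF P A h(3)] note oB = glued_ob[OF P B h(3)]
  note TA = trn_facts[OF A h] note TB = trn_facts[OF B h]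
  note fp = glued_arr_comp[OF P f h(3)] note fq = glued_arr_comp[OF P f h(4)]
  note NA = nu_ar[OF h(1,2) c(1) oA h(6,7,8)] note NB = nu_ar[OF h(1,2) c(1) oB h(6,7,8)]
  note Fq = PhA_ar[OF h(1) c(2) fq h(8)] note Fx = PhA_ar[OF xc(1) c(1) fp xc(3)]
  note Fm = PhA_ar[OF h(2) c(1) fp h(6)]
  note aA = glued_alpha[OF P A h(2,3,4,6)] note aB = glued_alpha[OF P B h(2,3,4,6)]
  show ?thesis
    by (rule trn_eqI[OF A h C_cmp_arr[OF xc(2) TA(1) Fq] C_cmp_arr[OF xc(2) Fx TB(1)]])
      (simp only: C_assoc[OF xc(2) NA TA(1) Fq, symmetric] TA(2) PhA_cmp[OF h(1) c(2) aA fq h(8), symmetric]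
        glued_arr_sq[OF P f h(2,3,4,6)] C_assoc[OF xc(2) NA Fx TB(1), symmetric]
        nu_nat[OF h(1,2) c(1) fp h(6,7,8), symmetric]
        C_assoc[OF xc(2) PhA_ar[OF h(1) c(2) Fm h(8)] NB TB(1)] TB(2) PhA_cmp[OF h(1) c(2) Fm aB h(8)])
qed

lemma alpha_trn:
  assumes A: "A \<in> Obj (G P)" and h: "g \<in> carrier W" "m \<in> carrier W" "p \<in> P" "q \<in> P" "additive g m"
    "q = m \<otimes> p" "x = g \<otimes> m" "z = g \<otimes> q" "z \<in> P"
  shows "snd A g q \<cdot>\<^bsub>z\<^esub> trn A g m p = snd A x p"
proof -
  note c = subsetD[OF P h(3)] subsetD[OF P h(4)] subsetD[OF P h(9)]
  have xc: "x \<in> carrier W" "z = x \<otimes> p" using h(1,2,6-8) c by (simp_all add: m_assoc)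
  note T = trn_facts[OF A h(1-8)]
  note N = nu_ar[OF h(1,2) c(1) glued_ob[OF P A h(3)] h(6,7,8)]
  note a = glued_alpha[OF P A h(1,4,9,8)]
  show ?thesis
    by (rule trn_eqI[OF A h(1-8) C_cmp_arr[OF c(3) T(1) a] glued_alpha[OF P A xc(1) h(3,9) xc(2)]])
      (simp only: C_assoc[OF c(3) N T(1) a, symmetric] T(2) glued_cocycle[OF P A h(1-4,9,6,8,7)])
qed

end

subsection \<open>The left adjoint of restriction to a gated set\<close>

lemma res_sel:
  "p \<in> P \<Longrightarrow> fst (res_obj W P X) p = fst X p"
  "g \<in> carrier W \<Longrightarrow> p \<in> P \<Longrightarrow> q \<in> P \<Longrightarrow> q = g \<otimes> p \<Longrightarrow> snd (res_obj W P X) g p = snd X g p"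
  "p \<in> P \<Longrightarrow> res_arr P f p = f p"
  by (simp_all add: res_obj_def res_arr_def alpha_ix_def)

lemma res_obj:
  assumes "P \<subseteq> Q" "Q \<subseteq> carrier W" "X \<in> Obj (G Q)"
  shows "res_obj W P X \<in> Obj (G P)"
proof (rule glued_objI[where Bo = "fst X" and \<beta> = "snd X"])
  show "P \<subseteq> carrier W" using assms by blast
  show "res_obj W P X = (\<lambda>w\<in>P. fst X w, \<lambda>g p. if alpha_ix W P g p then snd X g p else undefined)"
    by (simp add: res_obj_def)
  show "ob w (fst X w)" if "w \<in> P" for w using glued_ob[OF assms(2,3)] that assms(1) by blast
  show "ar q (PhO D g p (fst X p)) (fst X q) (snd X g p)"
    if "g \<in> carrier W" "p \<in> P" "q \<in> P" "q = g \<otimes> p" for g p q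
    by (rule glued_alpha[OF assms(2,3)]) (use that assms(1) in auto)
  show "snd X \<one> p = idn p (fst X p)" if "p \<in> P" for p
    using glued_alpha_one[OF assms(2,3)] that assms(1) by blast
  show "snd X w1 q \<cdot>\<^bsub>r\<^esub> PhA D w1 q (snd X w2 p) = snd X x p \<cdot>\<^bsub>r\<^esub> Nu D w1 w2 p (fst X p)"
    if "w1 \<in> carrier W" "w2 \<in> carrier W" "p \<in> P" "q \<in> P" "r \<in> P"
      "q = w2 \<otimes> p" "r = w1 \<otimes> q" "x = w1 \<otimes> w2" for w1 w2 p q r x
    by (rule glued_cocycle[OF assms(2,3)]) (use that assms(1) in auto)
qed

lemma res_arr:
  assumes "P \<subseteq> Q" "Q \<subseteq> carrier W" "arr (G Q) X Y f"
  shows "arr (G P) (res_obj W P X) (res_obj W P Y) (res_arr P f)"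
proof (rule glued_arrI)
  show "P \<subseteq> carrier W" using assms by blast
  show "res_obj W P X \<in> Obj (G P)" "res_obj W P Y \<in> Obj (G P)"
    using res_obj[OF assms(1,2)] arr_objD[OF assms(3)] by blast+
  show "res_arr P f \<in> extensional P" by (simp add: res_arr_def)
  show "ar p (fst (res_obj W P X) p) (fst (res_obj W P Y) p) (res_arr P f p)" if "p \<in> P" for p
    using glued_arr_comp[OF assms(2,3)] that assms(1) by (auto simp: res_sel)
  show "res_arr P f q \<cdot>\<^bsub>q\<^esub> snd (res_obj W P X) g p = snd (res_obj W P Y) g p \<cdot>\<^bsub>q\<^esub> PhA D g p (res_arr P f p)"
    if h: "g \<in> carrier W" "p \<in> P" "q \<in> P" "q = g \<otimes> p" for g p q
  proof -
    have Q: "p \<in> Q" "q \<in> Q" using h assms(1) by auto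
    show ?thesis
      unfolding res_sel(2)[OF h] res_sel(3)[OF h(2)] res_sel(3)[OF h(3)]
      by (rule glued_arr_sq[OF assms(2,3) h(1) Q h(4)])
  qed
qed

lemma trn_res:
  assumes "g \<in> carrier W" "m \<in> carrier W" "p \<in> P" "q \<in> P" "q = m \<otimes> p"
  shows "trn (res_obj W P X) g m p = trn X g m p"
  by (simp only: trn_def res_sel(1)[OF assms(3)] res_sel(2)[OF assms(2-5)])

text \<open>The shortest element that carries an element of \<open>P\<close> to \<open>w\<close>.\<close>

definition ngate :: "'w set \<Rightarrow> 'w \<Rightarrow> 'w" where
  "ngate P w = w \<otimes> inv (gate P w)"

lemma ngate_facts:
  assumes "gated P" "w \<in> carrier W"
  shows ngate_carrier: "ngate P w \<in> carrier W" and ngate_gate: "w = ngate P w \<otimes> gate P w"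
    and ngate_additive: "q \<in> P \<Longrightarrow> additive (ngate P w) (gate P w \<otimes> inv q)"
    and ngate_mult: "q \<in> P \<Longrightarrow> ngate P w \<otimes> (gate P w \<otimes> inv q) = w \<otimes> inv q"
proof -
  note g = gate_facts[OF assms]
  show "ngate P w \<in> carrier W" "w = ngate P w \<otimes> gate P w" using g assms by (simp_all add: ngate_def m_assoc)
  show e: "ngate P w \<otimes> (gate P w \<otimes> inv q) = w \<otimes> inv q" if "q \<in> P"
    using g assms gated_carrier[OF assms(1) that] by (simp add: ngate_def m_assoc mult_cancel)
  show "additive (ngate P w) (gate P w \<otimes> inv q)" if "q \<in> P"
    unfolding additive_def e[OF that] unfolding ngate_def by (rule g(3)[OF that])
qed

lemma ngate_self: "gated P \<Longrightarrow> p \<in> P \<Longrightarrow> ngate P p = \<one>"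
  using gate_self gated_carrier by (simp add: ngate_def)

text \<open>The value of the left adjoint of restriction. Let \<open>p\<close> and \<open>q\<close> be the gates of \<open>w'\<close> and \<open>w w'\<close>, and
  write \<open>w' = a p\<close>, \<open>w w' = b q\<close>, \<open>q = m p\<close>. Then \<open>w a = b m\<close>, and \<open>b\<close> and \<open>m\<close> are length-additive
  because \<open>q\<close> is a gate. The structure morphism is \<open>\<Phi>\<^sub>w \<Phi>\<^sub>a M\<^sub>p \<rightarrow> \<Phi>\<^sub>w\<^sub>a M\<^sub>p = \<Phi>\<^sub>b\<^sub>m M\<^sub>p \<rightarrow> \<Phi>\<^sub>b M\<^sub>q\<close>.\<close>

definition ext_obj :: "'w set \<Rightarrow> 'w set \<Rightarrow> ('w, 'o, 'm) glued \<Rightarrow> ('w, 'o, 'm) glued" where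
  "ext_obj P Q M = (\<lambda>w\<in>Q. PhO D (ngate P w) (gate P w) (fst M (gate P w)),
     \<lambda>w w'. if alpha_ix W Q w w'
       then trn M (ngate P (w \<otimes> w')) (gate P (w \<otimes> w') \<otimes> inv (gate P w')) (gate P w') \<cdot>\<^bsub>w \<otimes> w'\<^esub>
         Nu D w (ngate P w') (gate P w') (fst M (gate P w'))
       else undefined)"

context
  fixes P Q :: "'w set"
  assumes gat: "gated P" and PQ: "P \<subseteq> Q" and Q: "Q \<subseteq> carrier W"
begin

lemma Pcarr: "P \<subseteq> carrier W" using PQ Q by blast

lemma gate_step:
  assumes "g \<in> carrier W" "w \<in> Q" "u \<in> Q" "u = g \<otimes> w"
  defines "m \<equiv> gate P u \<otimes> inv (gate P w)"
  shows "w \<in> carrier W" "u \<in> carrier W" "gate P w \<in> P" "gate P u \<in> P" "m \<in> carrier W"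
    "ngate P w \<in> carrier W" "ngate P u \<in> carrier W" "additive (ngate P u) m" "gate P u = m \<otimes> gate P w"
    "g \<otimes> ngate P w = ngate P u \<otimes> m" "u = ngate P u \<otimes> gate P u" "w = ngate P w \<otimes> gate P w"
proof -
  show c: "w \<in> carrier W" "u \<in> carrier W" using assms Q by auto
  note gw = gate_facts[OF gat c(1)] note gu = gate_facts[OF gat c(2)]
  note nw = ngate_facts[OF gat c(1)] note nu = ngate_facts[OF gat c(2)]
  show "gate P w \<in> P" "gate P u \<in> P" "ngate P w \<in> carrier W" "ngate P u \<in> carrier W"
    "u = ngate P u \<otimes> gate P u" "w = ngate P w \<otimes> gate P w"
    using gw gu nw nu by blast+
  show "m \<in> carrier W" "gate P u = m \<otimes> gate P w" using gw gu by (simp_all add: m_def m_assoc)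
  show "additive (ngate P u) m" unfolding m_def by (rule nu(3)[OF gw(1)])
  show "g \<otimes> ngate P w = ngate P u \<otimes> m"
    unfolding m_def nu(4)[OF gw(1)] unfolding assms(4) ngate_def[of P w]
    using gw(2) c(1) assms(1) by (simp add: m_assoc)
qed

lemma ext_sel:
  "w \<in> Q \<Longrightarrow> fst (ext_obj P Q M) w = PhO D (ngate P w) (gate P w) (fst M (gate P w))"
  "g \<in> carrier W \<Longrightarrow> w \<in> Q \<Longrightarrow> u \<in> Q \<Longrightarrow> u = g \<otimes> w \<Longrightarrow> snd (ext_obj P Q M) g w =
    trn M (ngate P u) (gate P u \<otimes> inv (gate P w)) (gate P w) \<cdot>\<^bsub>u\<^esub>
      Nu D g (ngate P w) (gate P w) (fst M (gate P w))"
  by (simp_all add: ext_obj_def alpha_ix_def)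

lemma ext_obj:
  assumes M: "M \<in> Obj (G P)"
  shows "ext_obj P Q M \<in> Obj (G Q)"
proof (rule glued_objI[OF Q])
  let ?Bo = "\<lambda>w. PhO D (ngate P w) (gate P w) (fst M (gate P w))"
  let ?\<beta> = "\<lambda>w w'. trn M (ngate P (w \<otimes> w')) (gate P (w \<otimes> w') \<otimes> inv (gate P w')) (gate P w') \<cdot>\<^bsub>w \<otimes> w'\<^esub>
         Nu D w (ngate P w') (gate P w') (fst M (gate P w'))"
  show "ext_obj P Q M = (\<lambda>w\<in>Q. ?Bo w, \<lambda>g p. if alpha_ix W Q g p then ?\<beta> g p else undefined)"
    by (simp add: ext_obj_def)
  have c: "w \<in> carrier W" if "w \<in> Q" for w using that Q by blast
  show o: "ob w (?Bo w)" if "w \<in> Q" for w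
    by (rule PhO_ob[OF ngate_carrier[OF gat c[OF that]] gate_carrier[OF gat c[OF that]]
          glued_ob[OF Pcarr M gate_in[OF gat c[OF that]]] ngate_gate[OF gat c[OF that]]])
  have T: "ar u (PhO D (g \<otimes> ngate P w) (gate P w) (fst M (gate P w))) (?Bo u)
      (trn M (ngate P u) (gate P u \<otimes> inv (gate P w)) (gate P w))"
    if h: "g \<in> carrier W" "w \<in> Q" "u \<in> Q" "u = g \<otimes> w" for g w u
    using trn_ar[OF Pcarr M gate_step(7)[OF h] gate_step(5,3,4)[OF h] gate_step(8,9)[OF h] gate_step(10)[OF h] gate_step(11)[OF h]] .
  have N: "ar u (PhO D g w (?Bo w)) (PhO D (g \<otimes> ngate P w) (gate P w) (fst M (gate P w)))
      (Nu D g (ngate P w) (gate P w) (fst M (gate P w)))"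
    if h: "g \<in> carrier W" "w \<in> Q" "u \<in> Q" "u = g \<otimes> w" for g w u
    by (rule nu_ar[OF h(1) gate_step(6)[OF h] gate_carrier[OF gat c[OF h(2)]] glued_ob[OF Pcarr M gate_step(3)[OF h]]
        gate_step(12)[OF h] HOL.refl h(4)])
  show b: "ar u (PhO D g w (?Bo w)) (?Bo u) (?\<beta> g w)"
    if h: "g \<in> carrier W" "w \<in> Q" "u \<in> Q" "u = g \<otimes> w" for g w u
    unfolding h(4)[symmetric] by (rule C_cmp_arr[OF c[OF h(3)] N[OF h] T[OF h]])
  show "?\<beta> \<one> w = idn w (?Bo w)" if w: "w \<in> Q" for w
  proof -
    note cw = c[OF w]
    have e: "\<one> \<otimes> w = w" "gate P w \<otimes> inv (gate P w) = \<one>"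
      using cw gate_carrier[OF gat cw] by simp_all
    note i = C_ide_arr[OF cw o[OF w]]
    show ?thesis
      unfolding e trn_one[OF Pcarr M ngate_carrier[OF gat cw] gate_in[OF gat cw] ngate_gate[OF gat cw]]
        nu_one(1)[OF ngate_carrier[OF gat cw] gate_carrier[OF gat cw] glued_ob[OF Pcarr M gate_in[OF gat cw]]
          ngate_gate[OF gat cw]]
      by (rule C_ide(1)[OF cw i])
  qed
  fix w1 w2 p q r x
  assume h: "w1 \<in> carrier W" "w2 \<in> carrier W" "p \<in> Q" "q \<in> Q" "r \<in> Q"
      "q = w2 \<otimes> p" "r = w1 \<otimes> q" "x = w1 \<otimes> w2"
  note cp = c[OF h(3)] note cq = c[OF h(4)] note cr = c[OF h(5)]
  have x: "x \<in> carrier W" "r = x \<otimes> p" using h cp by (simp_all add: m_assoc)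
  note s1 = gate_step[OF h(2,3,4,6)] note s2 = gate_step[OF h(1,4,5,7)] note s3 = gate_step[OF x(1) h(3,5) x(2)]
  let ?np = "ngate P p" and ?nq = "ngate P q" and ?nr = "ngate P r"
  let ?gp = "gate P p" and ?gq = "gate P q" and ?gr = "gate P r"
  let ?m1 = "?gq \<otimes> inv ?gp" and ?m2 = "?gr \<otimes> inv ?gq"
  have m: "?gr \<otimes> inv ?gp = ?m2 \<otimes> ?m1"
    using gate_carrier[OF gat cp] gate_carrier[OF gat cq] gate_carrier[OF gat cr] by (simp add: m_assoc mult_cancel)
  note op = glued_ob[OF Pcarr M s1(3)]
  note cgp = gate_carrier[OF gat cp]
  note T1 = T[OF h(2,3,4,6)] note N1 = N[OF h(2,3,4,6)]
  note T2 = T[OF h(1,4,5,7)] note N2 = N[OF h(1,4,5,7)]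
  note T3 = T[OF x(1) h(3,5) x(2)] note N3 = N[OF x(1) h(3,5) x(2)]
  have qy: "q = w2 \<otimes> ?np \<otimes> ?gp" using s1(11) s1(10) s1(9) by (metis h(2) m_assoc s1(12) s1(6) cgp h(6))
  have yc: "w2 \<otimes> ?np \<in> carrier W" using h(2) s1(6) by simp
  note PN1 = PhA_ar[OF h(1) cq N1 h(7)] note PT1 = PhA_ar[OF h(1) cq T1 h(7)]
  have xy: "x \<otimes> ?np = w1 \<otimes> (w2 \<otimes> ?np)" using h(1,2,8) s1(6) by (simp add: m_assoc)
  note Nw = nu_ar[OF h(1) yc cgp op qy HOL.refl h(7)]
  have push: "trn M ?nr (?m2 \<otimes> ?m1) ?gp \<cdot>\<^bsub>r\<^esub> Nu D w1 (w2 \<otimes> ?np) ?gp (fst M ?gp) =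
      trn M ?nr ?m2 ?gq \<cdot>\<^bsub>r\<^esub> (Nu D w1 ?nq ?gq (fst M ?gq) \<cdot>\<^bsub>r\<^esub> PhA D w1 q (trn M ?nq ?m1 ?gp))"
    by (rule trn_push[OF Pcarr M h(1) s1(7,5) s2(7,5) s1(3,4) s2(4) s1(8) s2(8) s3(8)[unfolded m]
      s1(9) s2(9) s1(10) s2(10) s1(11) s2(11)])
  have "?\<beta> w1 q \<cdot>\<^bsub>r\<^esub> PhA D w1 q (?\<beta> w2 p) =
      (trn M ?nr ?m2 ?gq \<cdot>\<^bsub>r\<^esub> Nu D w1 ?nq ?gq (fst M ?gq)) \<cdot>\<^bsub>r\<^esub>
      (PhA D w1 q (trn M ?nq ?m1 ?gp) \<cdot>\<^bsub>r\<^esub> PhA D w1 q (Nu D w2 ?np ?gp (fst M ?gp)))"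
    by (simp only: h(6,7)[symmetric] PhA_cmp[OF h(1) cq N1 T1 h(7)])
  also have "\<dots> = (trn M ?nr ?m2 ?gq \<cdot>\<^bsub>r\<^esub> (Nu D w1 ?nq ?gq (fst M ?gq) \<cdot>\<^bsub>r\<^esub> PhA D w1 q (trn M ?nq ?m1 ?gp)))
      \<cdot>\<^bsub>r\<^esub> PhA D w1 q (Nu D w2 ?np ?gp (fst M ?gp))"
    by (simp only: C_assoc[OF cr PN1 PT1 C_cmp_arr[OF cr N2 T2]] C_assoc[OF cr PT1 N2 T2])
  also have "\<dots> = trn M ?nr (?m2 \<otimes> ?m1) ?gp \<cdot>\<^bsub>r\<^esub>
      (Nu D w1 (w2 \<otimes> ?np) ?gp (fst M ?gp) \<cdot>\<^bsub>r\<^esub> PhA D w1 q (Nu D w2 ?np ?gp (fst M ?gp)))"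
    by (simp only: push[symmetric] C_assoc[OF cr PN1 Nw T3[unfolded m xy], symmetric])
  also have "\<dots> = trn M ?nr (?m2 \<otimes> ?m1) ?gp \<cdot>\<^bsub>r\<^esub>
      (Nu D x ?np ?gp (fst M ?gp) \<cdot>\<^bsub>r\<^esub> Nu D w1 w2 p (?Bo p))"
    by (simp only: nu_assoc[OF h(1,2) s1(6) cgp op h(8) HOL.refl s1(12) h(6,7)])
  also have "\<dots> = ?\<beta> x p \<cdot>\<^bsub>r\<^esub> Nu D w1 w2 p (?Bo p)"
    by (simp only: x(2)[symmetric] m C_assoc[OF cr nu_ar[OF h(1,2) cp o[OF h(3)] h(6,8,7)] N3 T3[unfolded m]])
  finally show "?\<beta> w1 q \<cdot>\<^bsub>r\<^esub> PhA D w1 q (?\<beta> w2 p) = ?\<beta> x p \<cdot>\<^bsub>r\<^esub> Nu D w1 w2 p (?Bo p)" .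
qed

lemma ext_res:
  assumes M: "M \<in> Obj (G P)"
  shows "res_obj W P (ext_obj P Q M) = M"
proof (rule glued_eqI[OF Pcarr res_obj[OF PQ Q ext_obj[OF M]] M])
  have f: "fst (ext_obj P Q M) p = fst M p" if "p \<in> P" for p
    using ext_sel(1)[of p M] subsetD[OF PQ that] subsetD[OF Pcarr that] gate_self[OF gat that]
      ngate_self[OF gat that] Ph_one(1)[OF _ glued_ob[OF Pcarr M that]] by simp
  then show "fst (res_obj W P (ext_obj P Q M)) p = fst M p" if "p \<in> P" for p using that by (simp add: res_sel)
  fix g p q assume h: "g \<in> carrier W" "p \<in> P" "q \<in> P" "q = g \<otimes> p"
  have c: "p \<in> carrier W" "q \<in> carrier W" using h Pcarr by auto
  note o = glued_ob[OF Pcarr M h(2)]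
  have Qm: "p \<in> Q" "q \<in> Q" using h PQ by auto
  have m: "q \<otimes> inv p = g" using h c by (simp add: m_assoc)
  have "snd (ext_obj P Q M) g p = trn M \<one> g p \<cdot>\<^bsub>q\<^esub> Nu D g \<one> p (fst M p)"
    using ext_sel(2)[OF h(1) Qm h(4), of M]
    by (simp only: gate_self[OF gat h(2)] gate_self[OF gat h(3)] ngate_self[OF gat h(2)] ngate_self[OF gat h(3)] m)
  also have "\<dots> = snd M g p"
    unfolding nu_one(2)[OF h(1) c(1) o h(4)] trn_left_one[OF Pcarr M h]
    by (rule C_ide(1)[OF c(2) glued_alpha[OF Pcarr M h]])
  finally show "snd (res_obj W P (ext_obj P Q M)) g p = snd M g p" by (simp only: res_sel(2)[OF h])
qed

text \<open>The component over \<open>w\<close> is generated by the one over the gate of \<open>w\<close>; so an arrow from the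
  extension is determined by its restriction to \<open>P\<close>, by the formula in \<open>ext_arr_formula\<close>.\<close>

lemma ext_alpha:
  assumes M: "M \<in> Obj (G P)" and w: "w \<in> Q"
  shows "snd (ext_obj P Q M) (ngate P w) (gate P w) = idn w (fst (ext_obj P Q M) w)"
proof -
  have c: "w \<in> carrier W" using w Q by blast
  note g = gate_facts[OF gat c] note n = ngate_facts[OF gat c]
  have gQ: "gate P w \<in> Q" using g(1) PQ by blast
  note o = glued_ob[OF Pcarr M g(1)]
  have "snd (ext_obj P Q M) (ngate P w) (gate P w) =
      trn M (ngate P w) \<one> (gate P w) \<cdot>\<^bsub>w\<^esub> Nu D (ngate P w) \<one> (gate P w) (fst M (gate P w))"
    using ext_sel(2)[OF n(1) gQ w n(2), of M] g(2)
    by (simp only: gate_self[OF gat g(1)] ngate_self[OF gat g(1)] r_inv)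
  also have "\<dots> = idn w (PhO D (ngate P w) (gate P w) (fst M (gate P w)))"
    unfolding nu_one(2)[OF n(1) g(2) o n(2)] trn_one[OF Pcarr M n(1) g(1) n(2)]
    by (rule C_ide(1)[OF c C_ide_arr[OF c PhO_ob[OF n(1) g(2) o n(2)]]])
  finally show ?thesis by (simp only: ext_sel(1)[OF w])
qed

text \<open>The formula for the component over \<open>w\<close> is forced. It defines a morphism because transition
  morphisms are natural and, followed by a structure morphism of \<open>X\<close>, compose to a structure
  morphism (\<open>alpha_trn\<close>).\<close>

lemma ext_transpose:
  assumes M: "M \<in> Obj (G P)" and X: "X \<in> Obj (G Q)" and f: "arr (G P) M (res_obj W P X) f"
  shows "\<exists>h. arr (G Q) (ext_obj P Q M) X h \<and> (\<forall>p\<in>P. h p = f p)"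
proof -
  define t where "t w = snd X (ngate P w) (gate P w) \<cdot>\<^bsub>w\<^esub> PhA D (ngate P w) (gate P w) (f (gate P w))" for w
  have c: "w \<in> carrier W" if "w \<in> Q" for w using that Q by blast
  have fp: "ar p (fst M p) (fst X p) (f p)" if "p \<in> P" for p
    using glued_arr_comp[OF Pcarr f that] that by (simp add: res_sel)
  have a: "ar w (PhO D (ngate P w) (gate P w) (fst X (gate P w))) (fst X w) (snd X (ngate P w) (gate P w))"
    and F: "ar w (fst (ext_obj P Q M) w) (PhO D (ngate P w) (gate P w) (fst X (gate P w)))
      (PhA D (ngate P w) (gate P w) (f (gate P w)))" if w: "w \<in> Q" for w
  proof -
    note g = gate_facts[OF gat c[OF w]] note n = ngate_facts[OF gat c[OF w]]
    have gQ: "gate P w \<in> Q" using g(1) PQ by blast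
    show "ar w (PhO D (ngate P w) (gate P w) (fst X (gate P w))) (fst X w) (snd X (ngate P w) (gate P w))"
      by (rule glued_alpha[OF Q X n(1) gQ w n(2)])
    show "ar w (fst (ext_obj P Q M) w) (PhO D (ngate P w) (gate P w) (fst X (gate P w)))
      (PhA D (ngate P w) (gate P w) (f (gate P w)))"
      unfolding ext_sel(1)[OF w] by (rule PhA_ar[OF n(1) g(2) fp[OF g(1)] n(2)])
  qed
  have ta: "ar w (fst (ext_obj P Q M) w) (fst X w) (t w)" if w: "w \<in> Q" for w
    unfolding t_def by (rule C_cmp_arr[OF c[OF w] F[OF w] a[OF w]])
  have "arr (G Q) (ext_obj P Q M) X (\<lambda>w\<in>Q. t w)"
  proof (rule glued_arrI[OF Q ext_obj[OF M] X])
    show "ar w (fst (ext_obj P Q M) w) (fst X w) ((\<lambda>w\<in>Q. t w) w)" if w: "w \<in> Q" for w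
      using ta[OF w] w by simp
    fix g w u assume h: "g \<in> carrier W" "w \<in> Q" "u \<in> Q" "u = g \<otimes> w"
    note cw = c[OF h(2)] note cu = c[OF h(3)]
    note s = gate_step[OF h]
    let ?m = "gate P u \<otimes> inv (gate P w)" and ?x = "g \<otimes> ngate P w"
    let ?nw = "ngate P w" and ?nu = "ngate P u" and ?gw = "gate P w" and ?gu = "gate P u"
    have gQ: "?gw \<in> Q" "?gu \<in> Q" using s(3,4) PQ by auto
    note cg = c[OF gQ(1)] c[OF gQ(2)]
    have xc: "?x \<in> carrier W" "u = ?x \<otimes> ?gw" using h(1) s(6) cg s(12) h(4) by (simp_all add: m_assoc)
    note o = glued_ob[OF Pcarr M s(3)] note oX = glued_ob[OF Q X gQ(1)]
    note N = nu_ar[OF h(1) s(6) cg(1) o s(12) HOL.refl h(4)]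
    note NX = nu_ar[OF h(1) s(6) cg(1) oX s(12) HOL.refl h(4)]
    note TM = trn_ar[OF Pcarr M s(7,5,3,4,8,9,10,11)]
    note TX = trn_ar[OF Q X s(7,5) gQ s(8,9,10,11)]
    note Fu = F[OF h(3)] note au = a[OF h(3)] note aw = a[OF h(2)]
    note Fu' = Fu[unfolded ext_sel(1)[OF h(3)]]
    note Fw = PhA_ar[OF s(6) cg(1) fp[OF s(3)] s(12)]
    note Fx = PhA_ar[OF xc(1) cg(1) fp[OF s(3)] xc(2)]
    note ax = glued_alpha[OF Q X xc(1) gQ(1) h(3) xc(2)]
    note ag = glued_alpha[OF Q X h]
    have nat: "PhA D ?nu ?gu (f ?gu) \<cdot>\<^bsub>u\<^esub> trn M ?nu ?m ?gw = trn X ?nu ?m ?gw \<cdot>\<^bsub>u\<^esub> PhA D ?x ?gw (f ?gw)"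
      using trn_natural[OF Pcarr f s(7,5,3,4,8,9,10,11)] by (simp only: trn_res[OF s(7,5,3,4,9)])
    have "t u \<cdot>\<^bsub>u\<^esub> snd (ext_obj P Q M) g w = (snd X ?nu ?gu \<cdot>\<^bsub>u\<^esub> (PhA D ?nu ?gu (f ?gu) \<cdot>\<^bsub>u\<^esub> trn M ?nu ?m ?gw))
        \<cdot>\<^bsub>u\<^esub> Nu D g ?nw ?gw (fst M ?gw)"
      by (simp only: t_def ext_sel(2)[OF h] C_assoc[OF cu N TM C_cmp_arr[OF cu Fu' au]] C_assoc[OF cu TM Fu' au])
    also have "\<dots> = (snd X ?x ?gw \<cdot>\<^bsub>u\<^esub> PhA D ?x ?gw (f ?gw)) \<cdot>\<^bsub>u\<^esub> Nu D g ?nw ?gw (fst M ?gw)"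
      by (simp only: nat C_assoc[OF cu Fx TX au] alpha_trn[OF Q X s(7,5) gQ s(8,9,10,11) h(3)])
    also have "\<dots> = (snd X ?x ?gw \<cdot>\<^bsub>u\<^esub> Nu D g ?nw ?gw (fst X ?gw)) \<cdot>\<^bsub>u\<^esub> PhA D g w (PhA D ?nw ?gw (f ?gw))"
      by (simp only: C_assoc[OF cu N Fx ax, symmetric] nu_nat[OF h(1) s(6) cg(1) fp[OF s(3)] s(12) HOL.refl h(4), symmetric]
        C_assoc[OF cu PhA_ar[OF h(1) cw Fw h(4)] NX ax])
    also have "\<dots> = (snd X g w \<cdot>\<^bsub>u\<^esub> PhA D g w (snd X ?nw ?gw)) \<cdot>\<^bsub>u\<^esub> PhA D g w (PhA D ?nw ?gw (f ?gw))"
      by (simp only: glued_cocycle[OF Q X h(1) s(6) gQ(1) h(2,3) s(12) h(4) HOL.refl])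
    also have "\<dots> = snd X g w \<cdot>\<^bsub>u\<^esub> PhA D g w (t w)"
      by (simp only: t_def PhA_cmp[OF h(1) cw Fw aw h(4)]
        C_assoc[OF cu PhA_ar[OF h(1) cw Fw h(4)] PhA_ar[OF h(1) cw aw h(4)] ag])
    finally show "(\<lambda>w\<in>Q. t w) u \<cdot>\<^bsub>u\<^esub> snd (ext_obj P Q M) g w = snd X g w \<cdot>\<^bsub>u\<^esub> PhA D g w ((\<lambda>w\<in>Q. t w) w)"
      using h(2,3) by simp
  qed simp
  moreover have "(\<lambda>w\<in>Q. t w) p = f p" if p: "p \<in> P" for p
  proof -
    have q: "p \<in> Q" "p \<in> carrier W" using p PQ Q by auto
    show ?thesis
      using q(1) Ph_one(2)[OF q(2) fp[OF p]] glued_alpha_one[OF Q X q(1)] C_ide(2)[OF q(2) fp[OF p]]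
      by (simp add: t_def gate_self[OF gat p] ngate_self[OF gat p])
  qed
  ultimately show ?thesis by blast
qed

lemma ext_arr_formula:
  assumes M: "M \<in> Obj (G P)" and h: "arr (G Q) (ext_obj P Q M) X h" and w: "w \<in> Q"
  shows "h w = snd X (ngate P w) (gate P w) \<cdot>\<^bsub>w\<^esub> PhA D (ngate P w) (gate P w) (h (gate P w))"
proof -
  have c: "w \<in> carrier W" using w Q by blast
  note g = gate_facts[OF gat c] note n = ngate_facts[OF gat c]
  have gQ: "gate P w \<in> Q" using g(1) PQ by blast
  show ?thesis
    using glued_arr_sq[OF Q h n(1) gQ w n(2)]
    by (simp only: ext_alpha[OF M w] C_ide(1)[OF c glued_arr_comp[OF Q h w]])
qed

lemma ext_universal:
  assumes M: "M \<in> Obj (G P)"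
  shows "is_universal_arrow (G P) (G Q) (res_obj W P) (res_arr P) M (ext_obj P Q M) (Ide (G P) M)"
  unfolding is_universal_arrow_def
proof (intro conjI ballI)
  interpret GP: preadditive_category "G P" by (rule glued_preadditive[OF Pcarr])
  show "ext_obj P Q M \<in> Obj (G Q)" by (rule ext_obj[OF M])
  show "Ide (G P) M \<in> Hom (G P) M (res_obj W P (ext_obj P Q M))"
    using GP.ide_arr[OF M] by (simp add: ext_res[OF M] arr_def)
  fix X f assume X: "X \<in> Obj (G Q)" and f: "f \<in> Hom (G P) M (res_obj W P X)"
  have fa: "arr (G P) M (res_obj W P X) f" using M f res_obj[OF PQ Q X] by (simp add: arr_def)
  obtain h where h: "arr (G Q) (ext_obj P Q M) X h" "\<forall>p\<in>P. h p = f p" using ext_transpose[OF M X fa] by blast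
  have e: "Cmp (G P) (res_arr P k) (Ide (G P) M) = res_arr P k" if "arr (G Q) (ext_obj P Q M) X k" for k
    using GP.cmp_ide(1) res_arr[OF PQ Q that] by (simp add: ext_res[OF M])
  have iff: "Cmp (G P) (res_arr P k) (Ide (G P) M) = f \<longleftrightarrow> (\<forall>p\<in>P. k p = f p)"
    if k: "arr (G Q) (ext_obj P Q M) X k" for k
    using e[OF k] glued_arr_eqI[OF Pcarr res_arr[OF PQ Q k] fa] by (auto simp: res_sel)
  show "\<exists>!g. g \<in> Hom (G Q) (ext_obj P Q M) X \<and> Cmp (G P) (res_arr P g) (Ide (G P) M) = f"
  proof (rule ex1I[of _ h])
    show "h \<in> Hom (G Q) (ext_obj P Q M) X \<and> Cmp (G P) (res_arr P h) (Ide (G P) M) = f"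
      using iff[OF h(1)] h by (simp add: arr_def)
    fix k assume k: "k \<in> Hom (G Q) (ext_obj P Q M) X \<and> Cmp (G P) (res_arr P k) (Ide (G P) M) = f"
    then have ka: "arr (G Q) (ext_obj P Q M) X k" using ext_obj[OF M] X by (simp add: arr_def)
    then have kf: "\<forall>p\<in>P. k p = f p" using iff k by blast
    show "k = h"
    proof (rule glued_arr_eqI[OF Q ka h(1)])
      fix w assume w: "w \<in> Q"
      have "gate P w \<in> P" using gate_in[OF gat] w Q by blast
      then show "k w = h w" using ext_arr_formula[OF M ka w] ext_arr_formula[OF M h(1) w] kf h(2) by simp
    qed
  qed
qed

end

subsection \<open>Canonical morphisms\<close>

context
  fixes P Q :: "'w set"
  assumes gat: "gated P" and PQ: "P \<subseteq> Q" and Q: "Q \<subseteq> carrier W"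
begin

lemma PW: "P \<subseteq> carrier W" using PQ Q by blast

lemma shriek_universal:
  assumes M: "M \<in> Obj (G P)"
  shows "is_universal_arrow (G P) (G Q) (res_obj W P) (res_arr P) M
    (shriek_obj W D P Q M) (shriek_unit W D P Q M)"
proof -
  have "\<exists>x. case x of (L, e) \<Rightarrow>
      is_universal_arrow (G P) (G Q) (res_obj W P) (res_arr P) M L e"
    by (rule exI[of _ "(ext_obj P Q M, Ide (G P) M)"]) (simp add: ext_universal[OF gat PQ Q M])
  from someI_ex[OF this] show ?thesis
    unfolding shriek_obj_def shriek_unit_def shriek_def by (simp only: case_prod_unfold)
qed

lemma shriek_facts:
  assumes M: "M \<in> Obj (G P)"
  shows shriek_obj: "shriek_obj W D P Q M \<in> Obj (G Q)"
    and shriek_unit: "arr (G P) M (res_obj W P (shriek_obj W D P Q M)) (shriek_unit W D P Q M)"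
proof -
  note U = shriek_universal[OF M, unfolded is_universal_arrow_def]
  show o: "shriek_obj W D P Q M \<in> Obj (G Q)" using U by blast
  show "arr (G P) M (res_obj W P (shriek_obj W D P Q M)) (shriek_unit W D P Q M)"
    using U M res_obj[OF PQ Q o] by (simp add: arr_def)
qed

lemma shriek_transpose_facts:
  assumes f: "arr (G P) M (res_obj W P X) f" and X: "X \<in> Obj (G Q)"
  shows shriek_transpose_arr: "arr (G Q) (shriek_obj W D P Q M) X (shriek_transpose W D P Q M X f)"
    and shriek_transpose_unit:
      "Cmp (G P) (res_arr P (shriek_transpose W D P Q M X f)) (shriek_unit W D P Q M) = f"
proof -
  note M = arr_objD(1)[OF f]
  have "\<exists>!g. g \<in> Hom (G Q) (shriek_obj W D P Q M) X \<and>
      Cmp (G P) (res_arr P g) (shriek_unit W D P Q M) = f"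
    using shriek_universal[OF M] X f unfolding is_universal_arrow_def arr_def by blast
  from theI'[OF this]
  show "arr (G Q) (shriek_obj W D P Q M) X (shriek_transpose W D P Q M X f)"
    "Cmp (G P) (res_arr P (shriek_transpose W D P Q M X f)) (shriek_unit W D P Q M) = f"
    using shriek_facts(1)[OF M] X unfolding shriek_transpose_def arr_def by auto
qed

lemma shriek_ext:
  assumes M: "M \<in> Obj (G P)" and h: "arr (G Q) (shriek_obj W D P Q M) X h" "arr (G Q) (shriek_obj W D P Q M) X h'"
    and eq: "Cmp (G P) (res_arr P h) (shriek_unit W D P Q M) = Cmp (G P) (res_arr P h') (shriek_unit W D P Q M)"
  shows "h = h'"
proof -
  interpret GP: preadditive_category "G P" by (rule glued_preadditive[OF PW])
  note X = arr_objD(2)[OF h(1)]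
  have f: "arr (G P) M (res_obj W P X) (Cmp (G P) (res_arr P h) (shriek_unit W D P Q M))"
    by (rule GP.cmp_arr[OF shriek_facts(2)[OF M] res_arr[OF PQ Q h(1)]])
  have "\<exists>!g. g \<in> Hom (G Q) (shriek_obj W D P Q M) X \<and>
      Cmp (G P) (res_arr P g) (shriek_unit W D P Q M) = Cmp (G P) (res_arr P h) (shriek_unit W D P Q M)"
    using shriek_universal[OF M] X f unfolding is_universal_arrow_def arr_def by blast
  then show ?thesis using h eq unfolding arr_def by auto
qed

end

lemma res_cmp:
  assumes "P \<subseteq> Q" shows "res_arr P (Cmp (G Q) g f) = Cmp (G P) (res_arr P g) (res_arr P f)"
proof
  fix p show "res_arr P (Cmp (G Q) g f) p = Cmp (G P) (res_arr P g) (res_arr P f) p"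
    using assms by (cases "p \<in> P") (auto simp: res_arr_def glued_cat_def)
qed

lemma res_res:
  "P \<subseteq> Q \<Longrightarrow> res_obj W P (res_obj W Q X) = res_obj W P X"
  "P \<subseteq> Q \<Longrightarrow> res_arr P (res_arr Q f) = res_arr P f"
  by (auto simp: res_obj_def res_arr_def alpha_ix_def fun_eq_iff restrict_def subset_iff)

lemma shriek_comp_facts:
  assumes P: "gated P" and Q: "gated Q" and PQ: "P \<subseteq> Q" and M: "M \<in> Obj (G P)"
  defines "R \<equiv> shriek_obj W D Q (carrier W) (shriek_obj W D P Q M)"
  shows "arr (G (carrier W)) (shriek_obj W D P (carrier W) M) R (shriek_comp W D P Q M)"
    "Cmp (G P) (res_arr P (shriek_comp W D P Q M)) (shriek_unit W D P (carrier W) M) =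
      Cmp (G P) (res_arr P (shriek_unit W D Q (carrier W) (shriek_obj W D P Q M))) (shriek_unit W D P Q M)"
proof -
  have QW: "Q \<subseteq> carrier W" and PW: "P \<subseteq> carrier W" using P Q gated_carrier by blast+
  interpret GP: preadditive_category "G P" by (rule glued_preadditive[OF PW])
  note L = shriek_obj[OF P PQ QW M]
  note R = shriek_obj[OF Q QW subset_refl L, folded R_def]
  note uQ = shriek_unit[OF Q QW subset_refl L, folded R_def]
  have f: "arr (G P) M (res_obj W P R) (Cmp (G P) (res_arr P (shriek_unit W D Q (carrier W) (shriek_obj W D P Q M)))
      (shriek_unit W D P Q M))"
    using GP.cmp_arr[OF shriek_unit[OF P PQ QW M] res_arr[OF PQ QW uQ]] by (simp add: res_res(1)[OF PQ])
  show "arr (G (carrier W)) (shriek_obj W D P (carrier W) M) R (shriek_comp W D P Q M)"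
    unfolding shriek_comp_def R_def[symmetric] by (rule shriek_transpose_arr[OF P PW subset_refl f R])
  show "Cmp (G P) (res_arr P (shriek_comp W D P Q M)) (shriek_unit W D P (carrier W) M) =
      Cmp (G P) (res_arr P (shriek_unit W D Q (carrier W) (shriek_obj W D P Q M))) (shriek_unit W D P Q M)"
    using shriek_transpose_unit[OF P PW subset_refl f R] unfolding shriek_comp_def R_def .
qed

lemma shriek_arr_facts:
  assumes Q: "gated Q" and f: "arr (G Q) M N f"
  shows "arr (G (carrier W)) (shriek_obj W D Q (carrier W) M) (shriek_obj W D Q (carrier W) N)
      (shriek_arr W D Q (carrier W) M N f)"
    "Cmp (G Q) (res_arr Q (shriek_arr W D Q (carrier W) M N f)) (shriek_unit W D Q (carrier W) M) =
      Cmp (G Q) (shriek_unit W D Q (carrier W) N) f"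
proof -
  have QW: "Q \<subseteq> carrier W" using Q gated_carrier by blast
  interpret GQ: preadditive_category "G Q" by (rule glued_preadditive[OF QW])
  note N = arr_objD(2)[OF f]
  note c = GQ.cmp_arr[OF f shriek_unit[OF Q QW subset_refl N]]
  note t = shriek_transpose_facts[OF Q QW subset_refl c shriek_obj[OF Q QW subset_refl N]]
  show "arr (G (carrier W)) (shriek_obj W D Q (carrier W) M) (shriek_obj W D Q (carrier W) N)
      (shriek_arr W D Q (carrier W) M N f)" unfolding shriek_arr_def by (rule t(1))
  show "Cmp (G Q) (res_arr Q (shriek_arr W D Q (carrier W) M N f)) (shriek_unit W D Q (carrier W) M) =
      Cmp (G Q) (shriek_unit W D Q (carrier W) N) f" unfolding shriek_arr_def by (rule t(2))
qed

end

locale gluing_system_object = gluing_system W S D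
  for W :: "('w, 'x) monoid_scheme" (structure) and S and D :: "('w, 'o, 'm) gluing" +
  fixes A :: "('w, 'o, 'm) glued"
  assumes A: "A \<in> Obj (glued_cat W D (carrier W))"
begin

abbreviation GW where "GW \<equiv> glued_cat W D (carrier W)"
abbreviation pull where "pull \<equiv> shriek_pull W D A"
abbreviation pull_unit where "pull_unit P \<equiv> shriek_unit W D P (carrier W) (res_obj W P A)"
abbreviation canon where "canon \<equiv> canon_arr W D A"
abbreviation ext where "ext P \<equiv> ext_obj P (carrier W) (res_obj W P A)"

sublocale GW: preadditive_category GW
  by (rule glued_preadditive[OF subset_refl])

lemma gated_sub: "gated P \<Longrightarrow> P \<subseteq> carrier W"
  using gated_carrier by blast

lemma resA: "gated P \<Longrightarrow> res_obj W P A \<in> Obj (G P)"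
  by (rule res_obj[OF gated_sub subset_refl A])

lemma pull_obj: "gated P \<Longrightarrow> pull P \<in> Obj GW"
  unfolding shriek_pull_def by (rule shriek_obj[OF _ gated_sub subset_refl resA])

lemma pull_unit: "gated P \<Longrightarrow> arr (G P) (res_obj W P A) (res_obj W P (pull P)) (pull_unit P)"
  unfolding shriek_pull_def by (rule shriek_unit[OF _ gated_sub subset_refl resA])

lemma pull_ext:
  assumes P: "gated P" and "arr GW (pull P) X h" "arr GW (pull P) X h'"
    "Cmp (G P) (res_arr P h) (pull_unit P) = Cmp (G P) (res_arr P h') (pull_unit P)"
  shows "h = h'"
  using shriek_ext[OF P gated_sub[OF P] subset_refl resA[OF P]] assms unfolding shriek_pull_def by blast

text \<open>Unfolding the three adjunctions, the canonical morphism is the transpose of the restriction to \<open>P\<close>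
  of the unit of \<open>Q\<close>. From here on only this characterisation is used.\<close>

lemma canon_facts:
  assumes P: "gated P" and Q: "gated Q" and PQ: "P \<subseteq> Q"
  shows canon_arr: "arr GW (pull P) (pull Q) (canon P Q)"
    and canon_unit: "Cmp (G P) (res_arr P (canon P Q)) (pull_unit P) = res_arr P (pull_unit Q)"
proof -
  have QW: "Q \<subseteq> carrier W" and PW: "P \<subseteq> carrier W" using P Q gated_sub by blast+
  interpret GP: preadditive_category "G P" by (rule glued_preadditive[OF PW])
  interpret GQ: preadditive_category "G Q" by (rule glued_preadditive[OF QW])
  note AP = resA[OF P] note AQ = resA[OF Q]
  let ?L = "shriek_obj W D P Q (res_obj W P A)" and ?R = "shriek_obj W D Q (carrier W) (shriek_obj W D P Q (res_obj W P A))"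
  let ?c = "shriek_comp W D P Q (res_obj W P A)" and ?k = "shriek_counit W D P Q (res_obj W Q A)"
  let ?a = "shriek_arr W D Q (carrier W) ?L (res_obj W Q A) ?k"
  let ?uL = "shriek_unit W D Q (carrier W) ?L" and ?uPQ = "shriek_unit W D P Q (res_obj W P A)"
  note c = shriek_comp_facts[OF P Q PQ AP]
  have "arr (G P) (res_obj W P A) (res_obj W P (res_obj W Q A)) (Ide (G P) (res_obj W P (res_obj W Q A)))"
    using GP.ide_arr[OF AP] by (simp add: res_res(1)[OF PQ])
  note k0 = shriek_transpose_facts[OF P PQ QW this AQ]
  have k: "arr (G Q) ?L (res_obj W Q A) ?k"
    "Cmp (G P) (res_arr P ?k) ?uPQ = Ide (G P) (res_obj W P A)"
    using k0 by (simp_all add: shriek_counit_def res_res(1)[OF PQ])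
  note a = shriek_arr_facts[OF Q k(1)]
  have def: "canon P Q = Cmp GW ?a ?c" by (simp add: canon_arr_def)
  show "arr GW (pull P) (pull Q) (canon P Q)"
    unfolding def shriek_pull_def by (rule GW.cmp_arr[OF c(1) a(1)])
  note uL = shriek_unit[OF Q QW subset_refl shriek_obj[OF P PQ QW AP]]
  note uA = pull_unit[OF Q]
  note uP = pull_unit[OF P]
  note uPQ = shriek_unit[OF P PQ QW AP]
  note rc = res_arr[OF PW subset_refl c(1)] note ra = res_arr[OF PW subset_refl a(1)]
  note ruL = res_arr[OF PQ QW uL, unfolded res_res(1)[OF PQ]] note rk = res_arr[OF PQ QW k(1), unfolded res_res(1)[OF PQ]]
  note ruA = res_arr[OF PQ QW uA, unfolded res_res(1)[OF PQ]]
  have "Cmp (G P) (res_arr P (canon P Q)) (pull_unit P) =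
      Cmp (G P) (res_arr P ?a) (Cmp (G P) (res_arr P ?c) (pull_unit P))"
    unfolding def res_cmp[OF PW] using GP.cmp_assoc[OF uP[unfolded shriek_pull_def] rc ra] by simp
  also have "\<dots> = Cmp (G P) (Cmp (G P) (res_arr P ?a) (res_arr P ?uL)) ?uPQ"
    unfolding c(2) by (rule GP.cmp_assoc[OF uPQ ruL ra])
  also have "Cmp (G P) (res_arr P ?a) (res_arr P ?uL) = res_arr P (Cmp (G Q) (res_arr Q ?a) ?uL)"
    by (simp only: res_cmp[OF PQ] res_res(2)[OF PQ])
  also have "\<dots> = Cmp (G P) (res_arr P (pull_unit Q)) (res_arr P ?k)"
    by (simp only: a(2) res_cmp[OF PQ])
  also have "Cmp (G P) \<dots> ?uPQ = res_arr P (pull_unit Q)"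
    by (simp only: GP.cmp_assoc[OF uPQ rk ruA, symmetric] k(2) GP.cmp_ide(1)[OF ruA])
  finally show "Cmp (G P) (res_arr P (canon P Q)) (pull_unit P) = res_arr P (pull_unit Q)" .
qed

lemma canon_comp:
  assumes P: "gated P" and Q: "gated Q" and R: "gated R" and PQ: "P \<subseteq> Q" and QR: "Q \<subseteq> R"
  shows "Cmp GW (canon Q R) (canon P Q) = canon P R"
proof (rule pull_ext[OF P])
  have PR: "P \<subseteq> R" using PQ QR by blast
  note PW = gated_sub[OF P] note QW = gated_sub[OF Q]
  interpret GP: preadditive_category "G P" by (rule glued_preadditive[OF PW])
  note c1 = canon_facts[OF P Q PQ] note c2 = canon_facts[OF Q R QR] note c3 = canon_facts[OF P R PR]
  show "arr GW (pull P) (pull R) (Cmp GW (canon Q R) (canon P Q))" "arr GW (pull P) (pull R) (canon P R)"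
    by (rule GW.cmp_arr[OF c1(1) c2(1)], rule c3(1))
  note rc1 = res_arr[OF PW subset_refl c1(1)] note rc2 = res_arr[OF PW subset_refl c2(1)]
  have "Cmp (G P) (res_arr P (Cmp GW (canon Q R) (canon P Q))) (pull_unit P) =
      Cmp (G P) (res_arr P (canon Q R)) (res_arr P (pull_unit Q))"
    by (simp only: res_cmp[OF PW] GP.cmp_assoc[OF pull_unit[OF P] rc1 rc2, symmetric] c1(2))
  also have "\<dots> = res_arr P (Cmp (G Q) (res_arr Q (canon Q R)) (pull_unit Q))"
    by (simp only: res_cmp[OF PQ] res_res(2)[OF PQ])
  also have "\<dots> = Cmp (G P) (res_arr P (canon P R)) (pull_unit P)"
    by (simp only: c2(2) c3(2) res_res(2)[OF PQ])
  finally show "Cmp (G P) (res_arr P (Cmp GW (canon Q R) (canon P Q))) (pull_unit P) =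
      Cmp (G P) (res_arr P (canon P R)) (pull_unit P)" .
qed

text \<open>The comparison of the chosen value of the left adjoint with the explicit one.\<close>

definition theta :: "'w set \<Rightarrow> 'w \<Rightarrow> 'm" where
  "theta P = shriek_transpose W D P (carrier W) (res_obj W P A) (ext P) (Ide (G P) (res_obj W P A))"

lemma ext_ob: "gated P \<Longrightarrow> ext P \<in> Obj GW"
  by (rule ext_obj[OF _ gated_sub subset_refl resA])

lemma ext_resA: "gated P \<Longrightarrow> res_obj W P (ext P) = res_obj W P A"
  by (rule ext_res[OF _ gated_sub subset_refl resA])

lemma theta_facts:
  assumes P: "gated P"
  shows theta_arr: "arr GW (pull P) (ext P) (theta P)"
    and theta_unit: "Cmp (G P) (res_arr P (theta P)) (pull_unit P) = Ide (G P) (res_obj W P A)"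
    and theta_iso: "is_iso GW (pull P) (ext P) (theta P)"
proof -
  note PW = gated_sub[OF P]
  interpret GP: preadditive_category "G P" by (rule glued_preadditive[OF PW])
  have i: "arr (G P) (res_obj W P A) (res_obj W P (ext P)) (Ide (G P) (res_obj W P A))"
    using GP.ide_arr[OF resA[OF P]] by (simp add: ext_resA[OF P])
  note t = shriek_transpose_facts[OF P PW subset_refl i ext_ob[OF P]]
  show th: "arr GW (pull P) (ext P) (theta P)" unfolding theta_def shriek_pull_def by (rule t(1))
  show un: "Cmp (G P) (res_arr P (theta P)) (pull_unit P) = Ide (G P) (res_obj W P A)"
    unfolding theta_def by (rule t(2))
  note u = pull_unit[OF P]
  obtain h where h: "arr GW (ext P) (pull P) h" "\<forall>p\<in>P. h p = pull_unit P p"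
    using ext_transpose[OF P PW subset_refl resA[OF P] pull_obj[OF P] u] by blast
  have rh: "res_arr P h = pull_unit P"
    by (rule glued_arr_eqI[OF PW res_arr[OF PW subset_refl h(1)] u]) (use h(2) in \<open>simp add: res_sel\<close>)
  have rth: "arr (G P) (res_obj W P (pull P)) (res_obj W P A) (res_arr P (theta P))"
    using res_arr[OF PW subset_refl th] by (simp add: ext_resA[OF P])
  show "is_iso GW (pull P) (ext P) (theta P)"
  proof (rule GW.is_isoI[OF th h(1)])
    show "Cmp GW h (theta P) = Ide GW (pull P)"
    proof (rule pull_ext[OF P GW.cmp_arr[OF th h(1)] GW.ide_arr[OF pull_obj[OF P]]])
      have ri: "res_arr P (Ide GW (pull P)) = Ide (G P) (res_obj W P (pull P))"
        using PW by (auto simp: res_arr_def glued_cat_def fun_eq_iff res_obj_def)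
      show "Cmp (G P) (res_arr P (Cmp GW h (theta P))) (pull_unit P) =
          Cmp (G P) (res_arr P (Ide GW (pull P))) (pull_unit P)"
        by (simp only: res_cmp[OF PW] rh GP.cmp_assoc[OF u rth u, symmetric] un GP.cmp_ide(1)[OF u] ri
          GP.cmp_ide(2)[OF u])
    qed
    show "Cmp GW (theta P) h = Ide GW (ext P)"
    proof (rule glued_arr_eqI[OF subset_refl GW.cmp_arr[OF h(1) th] GW.ide_arr[OF ext_ob[OF P]]])
      fix w assume w: "w \<in> carrier W"
      have g: "gate P w \<in> P" "gate P w \<in> carrier W" using gate_facts[OF P w] by auto
      have "Cmp GW (theta P) h p = Ide GW (ext P) p" if p: "p \<in> P" for p
      proof -
        have c: "p \<in> carrier W" using p PW by blast
        have "theta P p \<cdot>\<^bsub>p\<^esub> pull_unit P p = idn p (fst A p)"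
          using fun_cong[OF un, of p] p by (simp add: glued_sel(1,2)[OF PW] res_sel)
        moreover have "fst (ext P) p = fst A p"
          using arg_cong[OF ext_resA[OF P], of "\<lambda>X. fst X p"] p by (simp add: res_sel)
        ultimately show ?thesis using h(2) p c by (simp add: glued_sel(1,2)[OF subset_refl])
      qed
      from this[OF g(1)] show "Cmp GW (theta P) h w = Ide GW (ext P) w"
        using ext_arr_formula[OF P PW subset_refl resA[OF P] GW.cmp_arr[OF h(1) th] w]
          ext_arr_formula[OF P PW subset_refl resA[OF P] GW.ide_arr[OF ext_ob[OF P]] w] by simp
    qed
  qed
qed

lemma theta_at:
  assumes P: "gated P" and w: "w \<in> carrier W"
  shows "ar w (fst (pull P) w) (PhO D (ngate P w) (gate P w) (fst A (gate P w))) (theta P w)"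
    "is_iso (Cat D w) (fst (pull P) w) (PhO D (ngate P w) (gate P w) (fst A (gate P w))) (theta P w)"
proof -
  have e: "fst (ext P) w = PhO D (ngate P w) (gate P w) (fst A (gate P w))"
    using ext_sel(1)[OF P gated_sub[OF P] subset_refl w, of "res_obj W P A"] gate_in[OF P w]
    by (simp add: res_sel)
  show "ar w (fst (pull P) w) (PhO D (ngate P w) (gate P w) (fst A (gate P w))) (theta P w)"
    using glued_arr_comp[OF subset_refl theta_arr[OF P] w] by (simp only: e)
  show "is_iso (Cat D w) (fst (pull P) w) (PhO D (ngate P w) (gate P w) (fst A (gate P w))) (theta P w)"
    using glued_iso_eval[OF subset_refl theta_arr[OF P] theta_iso[OF P] w] by (simp only: e)
qed

text \<open>Between the explicit values, the canonical morphism is an arrow \<open>ext P \<rightarrow> ext Q\<close> that restricts to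
  the identity on \<open>P\<close>. Over \<open>w\<close> it is therefore the structure morphism of \<open>ext Q\<close> from the gate of
  \<open>P\<close>. That gate lies in \<open>Q\<close> and is its own gate there, so this structure morphism is a transition
  morphism.\<close>

lemma canon_eval:
  assumes P: "gated P" and Q: "gated Q" and PQ: "P \<subseteq> Q" and w: "w \<in> carrier W"
  shows "theta Q w \<cdot>\<^bsub>w\<^esub> canon P Q w =
    trn A (ngate Q w) (gate Q w \<otimes> inv (gate P w)) (gate P w) \<cdot>\<^bsub>w\<^esub> theta P w"
proof -
  note PW = gated_sub[OF P] note QW = gated_sub[OF Q]
  note tP = theta_facts[OF P] note tQ = theta_facts[OF Q] note cn = canon_facts[OF P Q PQ]
  obtain h where h: "arr GW (ext P) (pull P) h" "Cmp GW h (theta P) = Ide GW (pull P)"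
    "Cmp GW (theta P) h = Ide GW (ext P)"
    using GW.is_isoE[OF tP(3) arr_objD[OF tP(1)]] by blast
  define k where "k = Cmp GW (Cmp GW (theta Q) (canon P Q)) h"
  have tc: "arr GW (pull P) (ext Q) (Cmp GW (theta Q) (canon P Q))" by (rule GW.cmp_arr[OF cn(1) tQ(1)])
  have k: "arr GW (ext P) (ext Q) k" unfolding k_def by (rule GW.cmp_arr[OF h(1) tc])
  have kt: "Cmp GW k (theta P) = Cmp GW (theta Q) (canon P Q)"
    by (simp only: k_def GW.cmp_assoc[OF tP(1) h(1) tc, symmetric] h(2) GW.cmp_ide(1)[OF tc])
  \<comment> \<open>on \<open>P\<close>, the inverse of \<open>theta P\<close> is the unit of \<open>P\<close>, and \<open>canon P Q\<close> turns it into
    the unit of \<open>Q\<close>\<close>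
  have kp: "k p = idn p (fst A p)" if p: "p \<in> P" for p
  proof -
    have c: "p \<in> carrier W" "p \<in> Q" using p PW PQ by auto
    interpret V: preadditive_category "Cat D p" by (rule C_pre[OF c(1)])
    have fx: "fst (ext P) p = fst A p" "fst (ext Q) p = fst A p"
      using arg_cong[OF ext_resA[OF P], of "\<lambda>X. fst X p"] arg_cong[OF ext_resA[OF Q], of "\<lambda>X. fst X p"] p c
      by (simp_all add: res_sel)
    have uP: "ar p (fst A p) (fst (pull P) p) (pull_unit P p)"
      using glued_arr_comp[OF PW pull_unit[OF P] p] p by (simp add: res_sel)
    have t: "ar p (fst (pull P) p) (fst A p) (theta P p)"
      using glued_arr_comp[OF subset_refl tP(1) c(1)] by (simp only: fx)
    have hp: "ar p (fst A p) (fst (pull P) p) (h p)"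
      using glued_arr_comp[OF subset_refl h(1) c(1)] by (simp only: fx)
    have t1: "theta P p \<cdot>\<^bsub>p\<^esub> pull_unit P p = idn p (fst A p)"
      using fun_cong[OF tP(2), of p] p by (simp add: glued_sel(1,2)[OF PW] res_sel)
    have t2: "theta Q p \<cdot>\<^bsub>p\<^esub> pull_unit Q p = idn p (fst A p)"
      using fun_cong[OF tQ(2), of p] c(2) by (simp add: glued_sel(1,2)[OF QW] res_sel)
    have t3: "h p \<cdot>\<^bsub>p\<^esub> theta P p = idn p (fst (pull P) p)"
      using fun_cong[OF h(2), of p] c by (simp add: glued_sel(1,2)[OF subset_refl])
    have hu: "h p = pull_unit P p" by (rule V.inverse_unique[OF t hp uP t3 t1])
    have cu: "canon P Q p \<cdot>\<^bsub>p\<^esub> pull_unit P p = pull_unit Q p"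
      using fun_cong[OF cn(2), of p] p by (simp add: glued_sel(1)[OF PW] res_sel)
    have "k p = (theta Q p \<cdot>\<^bsub>p\<^esub> canon P Q p) \<cdot>\<^bsub>p\<^esub> pull_unit P p"
      using c(1) by (simp add: k_def glued_sel(1)[OF subset_refl] hu)
    also have "\<dots> = idn p (fst A p)"
      by (simp only: V.cmp_assoc[OF uP glued_arr_comp[OF subset_refl cn(1) c(1)]
          glued_arr_comp[OF subset_refl tQ(1) c(1)], symmetric] cu t2)
    finally show ?thesis .
  qed
  note gP = gate_facts[OF P w] note nP = ngate_facts[OF P w]
  note gQ = gate_facts[OF Q w] note nQ = ngate_facts[OF Q w]
  have pQ: "gate P w \<in> Q" using gP(1) PQ by blast
  note oA = glued_ob[OF subset_refl A gP(2)]
  let ?m = "gate Q w \<otimes> inv (gate P w)"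
  have mc: "?m \<in> carrier W" "gate Q w = ?m \<otimes> gate P w" using gP(2) gQ(2) by (simp_all add: m_assoc)
  have nn: "ngate P w = ngate Q w \<otimes> ?m" by (simp only: nQ(4)[OF pQ] ngate_def[of P])
  note T = trn_ar[OF subset_refl A nQ(1) mc(1) gP(2) gQ(2) nQ(3)[OF pQ] mc(2) nn nQ(2)]
  have "k w = snd (ext Q) (ngate P w) (gate P w) \<cdot>\<^bsub>w\<^esub> PhA D (ngate P w) (gate P w) (k (gate P w))"
    by (rule ext_arr_formula[OF P PW subset_refl resA[OF P] k w])
  also have "PhA D (ngate P w) (gate P w) (k (gate P w)) = idn w (PhO D (ngate P w) (gate P w) (fst A (gate P w)))"
    unfolding kp[OF gP(1)] by (rule PhA_ide[OF nP(1) gP(2) oA nP(2)])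
  also have "snd (ext Q) (ngate P w) (gate P w) =
      trn (res_obj W Q A) (ngate Q w) ?m (gate P w) \<cdot>\<^bsub>w\<^esub> Nu D (ngate P w) \<one> (gate P w) (fst (res_obj W Q A) (gate P w))"
    using ext_sel(2)[OF Q QW subset_refl nP(1) gP(2) w nP(2), of "res_obj W Q A"]
    by (simp only: gate_self[OF Q pQ] ngate_self[OF Q pQ])
  also have "\<dots> = trn A (ngate Q w) ?m (gate P w)"
    by (simp only: trn_res[OF nQ(1) mc(1) pQ gQ(1) mc(2)] res_sel(1)[OF pQ]
      nu_one(2)[OF nP(1) gP(2) oA nP(2)] C_ide(1)[OF w T])
  finally have "k w = trn A (ngate Q w) ?m (gate P w)" by (simp only: C_ide(1)[OF w T])
  then show ?thesis
    using fun_cong[OF kt, of w] w by (simp add: glued_sel(1)[OF subset_refl])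
qed

text \<open>The gates coincide as well, and the transition morphism belongs to \<open>m = \<one>\<close>.\<close>

lemma canon_iso:
  assumes P: "gated P" and Q: "gated Q" and PQ: "P \<subseteq> Q" and w: "w \<in> carrier W" and eq: "ngate P w = ngate Q w"
  shows "is_iso (Cat D w) (fst (pull P) w) (fst (pull Q) w) (canon P Q w)"
proof -
  interpret V: preadditive_category "Cat D w" by (rule C_pre[OF w])
  note gP = gate_facts[OF P w] note nP = ngate_facts[OF P w]
  note gQ = gate_facts[OF Q w] note nQ = ngate_facts[OF Q w]
  have g: "gate P w = gate Q w" 
    using mult_cancel(1)[OF nP(1) gP(2)] mult_cancel(1)[OF nQ(1) gQ(2)] nP(2) nQ(2) eq by simp
  note tP = theta_at[OF P w] note tQ = theta_at[OF Q w]
  have "gate Q w \<otimes> inv (gate P w) = \<one>" using gQ(2) by (simp add: g)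
  then have "theta Q w \<cdot>\<^bsub>w\<^esub> canon P Q w = theta P w"
    using canon_eval[OF P Q PQ w] trn_one[OF subset_refl A nQ(1) gQ(2) nQ(2)] C_ide(2)[OF w tP(1)]
    by (simp add: g eq)
  moreover obtain h where h: "ar w (PhO D (ngate Q w) (gate Q w) (fst A (gate Q w))) (fst (pull Q) w) h"
    "h \<cdot>\<^bsub>w\<^esub> theta Q w = idn w (fst (pull Q) w)" "theta Q w \<cdot>\<^bsub>w\<^esub> h = idn w (PhO D (ngate Q w) (gate Q w) (fst A (gate Q w)))"
    using V.is_isoE[OF tQ(2) arr_objD[OF tQ(1)]] by blast
  moreover note c = glued_arr_comp[OF subset_refl canon_arr[OF P Q PQ] w]
  ultimately have "canon P Q w = h \<cdot>\<^bsub>w\<^esub> theta P w"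
    using V.cmp_assoc[OF c tQ(1) h(1)] V.cmp_ide(2)[OF c] by simp
  moreover have "is_iso (Cat D w) (fst (pull P) w) (fst (pull Q) w) (h \<cdot>\<^bsub>w\<^esub> theta P w)"
    by (rule V.is_iso_cmp[OF tP(2)[unfolded eq g] V.is_isoI[OF h(1) tQ(1) h(3,2)] tP(1)[unfolded eq g] h(1)])
  ultimately show ?thesis by simp
qed

lemma gated_carrier_set: "gated (carrier W)"
  unfolding gated_def
proof (intro conjI ballI subset_refl)
  fix w assume w: "w \<in> carrier W"
  show "\<exists>p\<in>carrier W. \<forall>q\<in>carrier W. len (w \<otimes> inv q) = len (w \<otimes> inv p) + len (p \<otimes> inv q)"
    by (rule bexI[OF _ w]) (use w in simp)
qed

lemma res_whole:
  assumes X: "X \<in> Obj GW" shows "res_obj W (carrier W) X = X"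
  by (rule glued_eqI[OF subset_refl res_obj[OF subset_refl subset_refl X] X])
    (simp_all only: res_sel(1,2))

lemma pull_whole: "isomorphic GW (pull (carrier W)) A"
proof -
  have "ext (carrier W) = A"
    using ext_resA[OF gated_carrier_set] unfolding res_whole[OF ext_ob[OF gated_carrier_set]]
    unfolding res_whole[OF A] .
  then show ?thesis
    using theta_iso[OF gated_carrier_set] pull_obj[OF gated_carrier_set] A unfolding isomorphic_def by auto
qed

end

section \<open>The canonical complex\<close>

locale canonical_complex = gluing_system_object W S D A + finite_coxeter W S
  for W :: "('w, 'x) monoid_scheme" (structure) and S and D :: "('w, 'o, 'm) gluing" and A +
  fixes n :: nat and s :: "nat \<Rightarrow> 'w"
  assumes bij: "bij_betw s {1..n} S" and n2: "n \<ge> 2"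
begin

subsection \<open>Cosets and descents\<close>

abbreviation par :: "nat set \<Rightarrow> 'w set" where "par J \<equiv> generate W (s ` ({1..n} - J))"
abbreviation pc :: "nat set \<Rightarrow> 'w set set" where "pc \<equiv> par_cosets W n s"

lemma s_S: "j \<in> {1..n} \<Longrightarrow> s j \<in> S" and s_surj: "k \<in> S \<Longrightarrow> \<exists>j\<in>{1..n}. k = s j"
  using bij by (auto simp: bij_betw_def)

lemma s_carrier: "j \<in> {1..n} \<Longrightarrow> s j \<in> carrier W"
  using s_S S_carrier by blast

lemma par_S: "s ` ({1..n} - J) \<subseteq> S"
  using s_S by auto

lemma par_subgroup: "subgroup (par J) W"
  by (rule generate_subgroup[OF par_S])

lemma pcI: "x \<in> carrier W \<Longrightarrow> par J #> x \<in> pc J"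
  unfolding par_cosets_def RCOSETS_def by blast

lemma pc_gated: "P \<in> pc J \<Longrightarrow> gated P"
  unfolding par_cosets_def RCOSETS_def using coset_gated[OF par_S] by blast

lemma pc_finite: "finite (pc J)"
  unfolding par_cosets_def RCOSETS_def using finite_carrier by simp

lemma pc_eq:
  assumes "P \<in> pc J" "p \<in> P" shows "P = par J #> p"
  using assms repr_independence[OF _ _ par_subgroup] unfolding par_cosets_def RCOSETS_def by blast

lemma coset_self: "p \<in> carrier W \<Longrightarrow> p \<in> par J #> p"
  using rcos_self[OF _ par_subgroup] .

lemma pc_step:
  assumes "P \<in> pc J" "p \<in> P" "j \<in> {1..n} - J" shows "s j \<otimes> p \<in> P"
proof -
  have p: "p \<in> carrier W" using gated_carrier[OF pc_gated] assms by blast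
  have "s j \<in> par J" using assms(3) by (intro generate.incl) auto
  then have "s j \<otimes> p \<in> par J #> p" using p by (auto simp: r_coset_def)
  then show ?thesis using pc_eq[OF assms(1,2)] by simp
qed

lemma par_mono: "J \<subseteq> J' \<Longrightarrow> par J' \<subseteq> par J"
  by (rule mono_generate) blast

lemma coset_mono: "J \<subseteq> J' \<Longrightarrow> par J' #> p \<subseteq> par J #> p"
  using par_mono[of J J'] unfolding r_coset_def by blast

lemma pc_super:
  assumes "P \<in> pc J'" "J \<subseteq> J'" "p \<in> P" shows "P \<subseteq> par J #> p"
  using pc_eq[OF assms(1,3)] coset_mono[OF assms(2)] by simp

lemma no_descent:
  assumes P: "P \<in> pc J" and w: "w \<in> carrier W" and j: "j \<in> {1..n} - J"
  shows "len (ngate P w) < len (ngate P w \<otimes> s j)"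
proof -
  note G = pc_gated[OF P]
  note g = gate_facts[OF G w]
  have sj: "s j \<in> S" "s j \<in> carrier W" using j s_S s_carrier by auto
  have q: "s j \<otimes> gate P w \<in> P" by (rule pc_step[OF P g(1) j])
  have e: "w \<otimes> inv (s j \<otimes> gate P w) = ngate P w \<otimes> s j" "gate P w \<otimes> inv (s j \<otimes> gate P w) = s j"
    using w g(2) sj S_inv[OF sj(1)] by (simp_all add: ngate_def inv_mult_group m_assoc mult_cancel)
  show ?thesis using g(3)[OF q] unfolding e len_S[OF sj(1)] by (simp add: ngate_def)
qed

text \<open>Together with \<open>no_descent\<close>: for fixed \<open>w\<close>, the cosets \<open>P\<close> of \<open>W\<^sub>S\<^sub>-\<^sub>J\<close> correspond by
  \<open>P \<mapsto> ngate P w\<close> to the elements without descents outside \<open>J\<close>.\<close>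

lemma gate_no_descent:
  assumes g: "g \<in> carrier W" "\<And>j. j \<in> {1..n} - J \<Longrightarrow> len g < len (g \<otimes> s j)" and w: "w \<in> carrier W"
  defines "P \<equiv> par J #> (inv g \<otimes> w)"
  shows "P \<in> pc J" "gate P w = inv g \<otimes> w" "ngate P w = g"
proof -
  have x: "inv g \<otimes> w \<in> carrier W" using g w by simp
  show P: "P \<in> pc J" unfolding P_def by (rule pcI[OF x])
  note G = pc_gated[OF P]
  note gt = gate_facts[OF G w]
  have xP: "inv g \<otimes> w \<in> P" unfolding P_def by (rule coset_self[OF x])
  have wx: "w \<otimes> inv (inv g \<otimes> w) = g" using g w by (simp add: inv_mult_group mult_cancel)
  show gate: "gate P w = inv g \<otimes> w"
  proof (rule gate_eqI[OF G w xP])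
    have u: "inv g \<otimes> w \<otimes> inv (gate P w) \<in> par J"
      by (rule coset_memD(1)[OF par_S x]) (use xP gt(1) in \<open>simp_all only: P_def\<close>)
    have "len (g \<otimes> (inv g \<otimes> w \<otimes> inv (gate P w))) = len g + len (inv g \<otimes> w \<otimes> inv (gate P w))"
      by (rule no_descent_additive[OF par_S g(1) _ u]) (use g(2) in auto)
    moreover have "g \<otimes> (inv g \<otimes> w \<otimes> inv (gate P w)) = w \<otimes> inv (gate P w)"
      using g w gt(2) by (simp add: m_assoc mult_cancel)
    ultimately show "len (w \<otimes> inv (inv g \<otimes> w)) \<le> len (w \<otimes> inv (gate P w))" unfolding wx by simp
  qed
  show "ngate P w = g" unfolding ngate_def gate by (rule wx)
qed

text \<open>The source of triangularity: enlarging a coset either keeps the gate or strictly shortens the way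
  to it.\<close>

lemma ngate_le:
  assumes "P \<in> pc J'" "Q \<in> pc J" "P \<subseteq> Q" "w \<in> carrier W"
  shows "len (ngate Q w) \<le> len (ngate P w)"
    "len (ngate Q w) = len (ngate P w) \<Longrightarrow> ngate Q w = ngate P w"
proof -
  note g = gate_facts[OF pc_gated[OF assms(1)] assms(4)]
  have gQ: "gate P w \<in> Q" using g(1) assms(3) by blast
  note l = gate_len[OF pc_gated[OF assms(2)] assms(4) gQ]
  show "len (ngate Q w) \<le> len (ngate P w)" using l by (simp add: ngate_def)
  assume "len (ngate Q w) = len (ngate P w)"
  then have "gate Q w = gate P w" using gate_eqI[OF pc_gated[OF assms(2)] assms(4) gQ] by (simp add: ngate_def)
  then show "ngate Q w = ngate P w" by (simp add: ngate_def)
qed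

subsection \<open>Cells and incidence morphisms\<close>

text \<open>In contrast to \<open>faces\<close>, the empty set is admitted, so that in degree \<open>- 1\<close> there is one cell,
  which contributes the augmentation.\<close>

definition cells :: "int \<Rightarrow> (nat set \<times> 'w set) set" where
  "cells i = Sigma {J. J \<subseteq> {1..n} \<and> int (card J) = i + 1} pc"

lemma cells_iff: "(J, P) \<in> cells i \<longleftrightarrow> J \<subseteq> {1..n} \<and> int (card J) = i + 1 \<and> P \<in> pc J"
  by (auto simp: cells_def)

lemma cells_gated: "c \<in> cells i \<Longrightarrow> gated (snd c)"
  by (cases c) (auto simp: cells_iff intro: pc_gated)

text \<open>A boolean stands for a sign, \<open>True\<close> for \<open>1\<close> and \<open>False\<close> for \<open>- 1\<close>; the product of signs is
  equality of booleans.\<close>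

definition signed :: "bool \<Rightarrow> 'w set \<Rightarrow> 'w set \<Rightarrow> ('w \<Rightarrow> 'm) \<Rightarrow> 'w \<Rightarrow> 'm" where
  "signed b P Q f = (if b then f else GW.neg (pull P) (pull Q) f)"

definition even_at :: "nat set \<Rightarrow> nat \<Rightarrow> bool" where
  "even_at J j = even (card {k \<in> J. k < j})"

definition entry :: "nat set \<times> 'w set \<Rightarrow> nat set \<times> 'w set \<Rightarrow> 'w \<Rightarrow> 'm" where
  "entry c c' = (if fst c' \<subseteq> fst c \<and> snd c \<subseteq> snd c'
     then signed (even_at (fst c) (the_elem (fst c - fst c'))) (snd c) (snd c') (canon (snd c) (snd c'))
     else Zer GW (pull (snd c)) (pull (snd c')))"

lemma signed_arr: "arr GW (pull P) (pull Q) f \<Longrightarrow> arr GW (pull P) (pull Q) (signed b P Q f)"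
  by (simp add: signed_def GW.neg_arr)

lemma signed_cmp:
  assumes "arr GW (pull P) (pull Q) f" "arr GW (pull Q) (pull R) g"
  shows "Cmp GW (signed b Q R g) (signed b' P Q f) = signed (b = b') P R (Cmp GW g f)"
  using GW.cmp_neg[OF assms] GW.cmp_neg(1)[OF assms(1) GW.neg_arr[OF assms(2)]]
    GW.neg_neg[OF GW.cmp_arr[OF assms]] by (auto simp: signed_def)

lemma signed_cancel:
  assumes "arr GW (pull P) (pull Q) f" "b \<noteq> b'"
  shows "Add GW (signed b P Q f) (signed b' P Q f) = Zer GW (pull P) (pull Q)"
  using GW.add_neg[OF assms(1)] assms(2) by (auto simp: signed_def)

lemma neg_eval:
  assumes "arr GW X Y f" "w \<in> carrier W"
  shows "GW.neg X Y f w = inv\<^bsub>hom_group (Cat D w) (fst X w) (fst Y w)\<^esub> (f w)"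
proof (rule preadditive_category.neg_unique[OF C_pre[OF assms(2)]])
  show "ar w (fst X w) (fst Y w) (f w)" "ar w (fst X w) (fst Y w) (GW.neg X Y f w)"
    using glued_arr_comp[OF subset_refl _ assms(2)] GW.neg_arr[OF assms(1)] assms(1) by blast+
  show "Add (Cat D w) (f w) (GW.neg X Y f w) = Zer (Cat D w) (fst X w) (fst Y w)"
    using fun_cong[OF GW.add_neg(1)[OF assms(1)], of w] assms(2) by (simp add: glued_sel(3,4)[OF subset_refl])
qed

lemma entry_arr:
  assumes "c \<in> cells i" "c' \<in> cells i'"
  shows "arr GW (pull (snd c)) (pull (snd c')) (entry c c')"
  unfolding entry_def
  using signed_arr[OF canon_arr[OF cells_gated[OF assms(1)] cells_gated[OF assms(2)]]]
    GW.zer_arr[OF pull_obj[OF cells_gated[OF assms(1)]] pull_obj[OF cells_gated[OF assms(2)]]] by auto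

text \<open>Exactness depends only on the matrix of incidence morphisms. Arbitrary direct sums are admitted in
  order to treat the chain objects together with the augmentation.\<close>

definition chain_data :: "int \<Rightarrow> ('w, 'o, 'm) glued \<Rightarrow> (nat set \<times> 'w set \<Rightarrow> 'w \<Rightarrow> 'm) \<Rightarrow>
    (nat set \<times> 'w set \<Rightarrow> 'w \<Rightarrow> 'm) \<Rightarrow> bool" where
  "chain_data i B inc prj = GW.direct_sum_data (cells i) (\<lambda>c. pull (snd c)) B inc prj"

definition diff_data where
  "diff_data i B inc B' prj' d \<longleftrightarrow> arr GW B B' d \<and>
    (\<forall>c\<in>cells i. \<forall>c'\<in>cells (i - 1). Cmp GW (prj' c') (Cmp GW d (inc c)) = entry c c')"

lemma card_remove:
  assumes "J \<subseteq> {1..n}" "j \<in> J" shows "int (card (J - {j})) = int (card J) - 1"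
proof -
  have "finite J" using assms finite_subset by blast
  from card_Suc_Diff1[OF this assms(2)] show ?thesis by linarith
qed

lemma pair_difference:
  assumes J: "J'' \<subseteq> {1..n}" "J \<subseteq> J''" "int (card J'') = int (card J) + 2"
  obtains a b where "a < b" "a \<in> J''" "b \<in> J''" "a \<notin> J" "b \<notin> J" "J'' = insert a (insert b J)"
proof -
  have "finite J''" using J(1) finite_subset by blast
  then have "finite J" using J(2) finite_subset by blast
  from card_Diff_subset[OF this J(2)] have "card (J'' - J) = 2" using J(3) by linarith
  then obtain x y where xy: "J'' - J = {x, y}" "x \<noteq> y" unfolding card_2_iff by blast
  have mem: "x \<in> J''" "y \<in> J''" "x \<notin> J" "y \<notin> J" using xy(1) by blast+
  have eq: "J'' = insert x (insert y J)" using xy(1) J(2) by blast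
  have eq': "J'' = insert y (insert x J)" by (subst insert_commute) (rule eq)
  have "x < y \<or> y < x" using xy(2) by linarith
  then show ?thesis
    by (elim disjE) (rule that[OF _ mem eq] that[OF _ mem(2,1,4,3) eq']; assumption)+
qed

text \<open>If \<open>a\<close> is removed first, it is missing among the elements below \<open>b\<close>; if \<open>b\<close> is removed first,
  nothing changes for \<open>a\<close>.\<close>

lemma sign_flip:
  assumes J: "J'' \<subseteq> {1..n}" and ab: "a < b" "a \<in> J''" "b \<in> J''"
  shows "(even_at (J'' - {a}) b = even_at J'' a) \<noteq> (even_at (J'' - {b}) a = even_at J'' b)"
proof -
  have fin: "finite J''" using J finite_subset by blast
  have "{k \<in> J''. k < b} = insert a {k \<in> J'' - {a}. k < b}" using ab by auto
  then have "card {k \<in> J''. k < b} = Suc (card {k \<in> J'' - {a}. k < b})" using fin by simp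
  moreover have "{k \<in> J'' - {b}. k < a} = {k \<in> J''. k < a}" using ab by auto
  ultimately show ?thesis by (auto simp: even_at_def)
qed

text \<open>A cell \<open>(J'', P)\<close> and a cell \<open>(J, R)\<close> with \<open>J'' = J \<union> {a, b}\<close> and \<open>P \<subseteq> R\<close> have exactly two cells
  between them, the cosets containing \<open>P\<close> that belong to \<open>J'' - {a}\<close> and to \<open>J'' - {b}\<close>. By
  \<open>canon_comp\<close> both composites are the canonical morphism up to sign, and the signs are opposite.\<close>

lemma diff_diff:
  assumes C2: "chain_data (i + 1) B2 inc2 prj2" and C1: "chain_data i B1 inc1 prj1"
    and C0: "chain_data (i - 1) B0 inc0 prj0"
    and d2: "diff_data (i + 1) B2 inc2 B1 prj1 d2" and d1: "diff_data i B1 inc1 B0 prj0 d1"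
  shows "Cmp GW d1 d2 = Zer GW B2 B0"
proof -
  note D2 = GW.dsd_facts[OF C2[unfolded chain_data_def]]
  note D1 = GW.dsd_facts[OF C1[unfolded chain_data_def]]
  note D0 = GW.dsd_facts[OF C0[unfolded chain_data_def]]
  have a2: "arr GW B2 B1 d2" and a1: "arr GW B1 B0 d1" using d1 d2 by (auto simp: diff_data_def)
  have e2: "Cmp GW (prj1 c') (Cmp GW d2 (inc2 c)) = entry c c'" if "c \<in> cells (i + 1)" "c' \<in> cells i" for c c'
    using d2 that by (simp add: diff_data_def)
  have e1: "Cmp GW (prj0 c') (Cmp GW d1 (inc1 c)) = entry c c'" if "c \<in> cells i" "c' \<in> cells (i - 1)" for c c'
    using d1 that by (simp add: diff_data_def)
  note dd = GW.cmp_arr[OF a2 a1]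
  note zz = GW.zer_arr[OF D2(2) D0(2)]
  show ?thesis
  proof (rule GW.dsd_ext_inc[OF C2[unfolded chain_data_def] dd zz])
    fix c assume c: "c \<in> cells (i + 1)"
    note ic = D2(4)[OF c]
    show "Cmp GW (Cmp GW d1 d2) (inc2 c) = Cmp GW (Zer GW B2 B0) (inc2 c)"
    proof (rule GW.dsd_ext[OF C0[unfolded chain_data_def] GW.cmp_arr[OF ic dd] GW.cmp_arr[OF ic zz]])
      fix c0 assume c0: "c0 \<in> cells (i - 1)"
      note p0 = D0(5)[OF c0]
      have o: "pull (snd c) \<in> Obj GW" "pull (snd c0) \<in> Obj GW"
        using pull_obj cells_gated[OF c] cells_gated[OF c0] by blast+
      have zero: "Cmp GW (prj0 c0) (Cmp GW (Zer GW B2 B0) (inc2 c)) = Zer GW (pull (snd c)) (pull (snd c0))"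
        by (simp only: GW.cmp_zer(2)[OF ic D0(2)] GW.cmp_zer(1)[OF p0 o(1)])
      define f where "f = Cmp GW (prj0 c0) d1"
      define t where "t = Cmp GW d2 (inc2 c)"
      have f: "arr GW B1 (pull (snd c0)) f" unfolding f_def by (rule GW.cmp_arr[OF a1 p0])
      have t: "arr GW (pull (snd c)) B1 t" unfolding t_def by (rule GW.cmp_arr[OF ic a2])
      have fi: "Cmp GW f (inc1 c1) = entry c1 c0" and pt: "Cmp GW (prj1 c1) t = entry c c1"
        if "c1 \<in> cells i" for c1
        unfolding f_def t_def using GW.cmp_assoc[OF D1(4)[OF that] a1 p0] e1[OF that c0] e2[OF c that] by simp_all
      have "Cmp GW (prj0 c0) (Cmp GW (Cmp GW d1 d2) (inc2 c)) = Cmp GW f t"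
        unfolding f_def t_def by (simp only: GW.cmp_assoc[OF ic a2 a1, symmetric] GW.cmp_assoc[OF t[unfolded t_def] a1 p0])
      also have "Cmp GW f t = Zer GW (pull (snd c)) (pull (snd c0))"
      proof -
        obtain J'' P where cc: "c = (J'', P)" by fastforce
        obtain J R where cc0: "c0 = (J, R)" by fastforce
        have J'': "J'' \<subseteq> {1..n}" "int (card J'') = i + 2" "P \<in> pc J''" using c by (auto simp: cc cells_iff)
        have J: "J \<subseteq> {1..n}" "int (card J) = i" "R \<in> pc J" using c0 by (auto simp: cc0 cells_iff)
        show ?thesis
        proof (cases "J \<subseteq> J'' \<and> P \<subseteq> R")
          case False
          have z: "Cmp GW (Cmp GW f (inc1 c1)) (Cmp GW (prj1 c1) t) = Zer GW (pull (snd c)) (pull (snd c0))"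
            if c1: "c1 \<in> cells i" for c1
          proof -
            have "\<not> (fst c1 \<subseteq> J'' \<and> P \<subseteq> snd c1 \<and> J \<subseteq> fst c1 \<and> snd c1 \<subseteq> R)" using False by auto
            then have "entry c1 c0 = Zer GW (pull (snd c1)) (pull (snd c0)) \<or> entry c c1 = Zer GW (pull (snd c)) (pull (snd c1))"
              by (auto simp: entry_def cc cc0)
            then show ?thesis
              using GW.cmp_zer(1)[OF entry_arr[OF c1 c0] o(1)] GW.cmp_zer(2)[OF entry_arr[OF c c1] o(2)]
              by (auto simp: fi[OF c1] pt[OF c1])
          qed
          show ?thesis unfolding GW.dsd_expand[OF C1[unfolded chain_data_def] t f]
            by (rule GW.hsum_zero[OF o z])
        next
          case True
          obtain a b where ab: "a < b" "a \<in> J''" "b \<in> J''" "a \<notin> J" "b \<notin> J" "J'' = insert a (insert b J)"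
            using pair_difference[OF J''(1) conjunct1[OF True]] J''(2) J(2) by auto
          note gP = pc_gated[OF J''(3)] note gR = pc_gated[OF J(3)]
          obtain p where p: "p \<in> P" using gate_in[OF gP one_closed] by blast
          have pcar: "p \<in> carrier W" using gated_carrier[OF gP p] .
          have R: "R = par J #> p" using pc_eq[OF J(3)] p True by blast
          \<comment> \<open>the two intermediate cells; \<open>p\<close> is any element of \<open>P\<close>\<close>
          define cell where "cell j = (J'' - {j}, par (J'' - {j}) #> p)" for j
          have cell: "cell j \<in> cells i" "P \<subseteq> snd (cell j)" "snd (cell j) \<subseteq> R" "J \<subseteq> J'' - {j}" if "j = a \<or> j = b" for j
          proof -
            have j: "j \<in> J''" "j \<notin> J" using that ab by auto
            show "cell j \<in> cells i"
              unfolding cell_def cells_iff using card_remove[OF J''(1) j(1)] J''(1,2) pcI[OF pcar] by auto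
            show "P \<subseteq> snd (cell j)" unfolding cell_def snd_conv by (rule pc_super[OF J''(3) _ p]) blast
            show JJ: "J \<subseteq> J'' - {j}" using True j by blast
            show "snd (cell j) \<subseteq> R" unfolding cell_def R snd_conv by (rule coset_mono[OF JJ])
          qed
          have val: "Cmp GW (Cmp GW f (inc1 (cell j))) (Cmp GW (prj1 (cell j)) t) =
              signed (even_at (J'' - {j}) j' = even_at J'' j) P R (canon P R)"
            if "(j, j') = (a, b) \<or> (j, j') = (b, a)" for j j'
          proof -
            have jab: "j = a \<or> j = b" using that by auto
            note ce = cell[OF jab]
            note gj = cells_gated[OF ce(1)]
            have d: "J'' - (J'' - {j}) = {j}" "J'' - {j} - J = {j'}" using that ab by auto
            have "entry (cell j) c0 = signed (even_at (J'' - {j}) j') (snd (cell j)) R (canon (snd (cell j)) R)"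
              using ce d by (simp add: entry_def cc0 cell_def)
            moreover have "entry c (cell j) = signed (even_at J'' j) P (snd (cell j)) (canon P (snd (cell j)))"
              using ce d by (simp add: entry_def cc cell_def)
            ultimately show ?thesis
              using signed_cmp[OF canon_arr[OF gP gj ce(2)] canon_arr[OF gj gR ce(3)]]
                canon_comp[OF gP gj gR ce(2,3)] by (simp add: fi[OF ce(1)] pt[OF ce(1)])
          qed
          have "Cmp GW f t = Add GW (Cmp GW (Cmp GW f (inc1 (cell a))) (Cmp GW (prj1 (cell a)) t))
              (Cmp GW (Cmp GW f (inc1 (cell b))) (Cmp GW (prj1 (cell b)) t))"
          proof (rule GW.dsd_expand_pair[OF C1[unfolded chain_data_def] t f])
            show "cell a \<in> cells i" "cell b \<in> cells i" using cell by blast+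
            show "cell a \<noteq> cell b" using ab by (auto simp: cell_def)
            fix c1 assume c1: "c1 \<in> cells i" "c1 \<noteq> cell a" "c1 \<noteq> cell b"
            obtain J' Q where cc1: "c1 = (J', Q)" by fastforce
            have J': "J' \<subseteq> {1..n}" "int (card J') = i + 1" "Q \<in> pc J'" using c1(1) by (auto simp: cc1 cells_iff)
            have "\<not> (J' \<subseteq> J'' \<and> P \<subseteq> Q \<and> J \<subseteq> J' \<and> Q \<subseteq> R)"
            proof
              assume h: "J' \<subseteq> J'' \<and> P \<subseteq> Q \<and> J \<subseteq> J' \<and> Q \<subseteq> R"
              have fin: "finite J'" using J'(1) finite_subset by blast
              have "J' \<noteq> J" "J' \<noteq> J''" using J'(2) J(2) J''(2) by auto
              then have "J' = J'' - {a} \<or> J' = J'' - {b}" using h ab by auto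
              moreover have "Q = par J' #> p" using pc_eq[OF J'(3)] h p by blast
              ultimately show False using c1(2,3) by (auto simp: cell_def cc1)
            qed
            then show "Cmp GW f (inc1 c1) = Zer GW (pull (snd c1)) (pull (snd c0)) \<or>
                Cmp GW (prj1 c1) t = Zer GW (pull (snd c)) (pull (snd c1))"
              unfolding fi[OF c1(1)] pt[OF c1(1)] by (auto simp: entry_def cc cc0 cc1)
          qed
          also have "\<dots> = Zer GW (pull P) (pull R)"
            unfolding val[of a b, simplified] val[of b a, simplified]
            using signed_cancel[OF canon_arr[OF gP gR conjunct2[OF True]] sign_flip[OF J''(1) ab(1-3)]] .
          finally show ?thesis by (simp add: cc cc0)
        qed
      qed
      finally show "Cmp GW (prj0 c0) (Cmp GW (Cmp GW d1 d2) (inc2 c)) =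
          Cmp GW (prj0 c0) (Cmp GW (Zer GW B2 B0) (inc2 c))" unfolding zero .
    qed
  qed
qed

subsection \<open>Exactness below the top degree\<close>

text \<open>For the longest element there is no such index, and the value is arbitrary.\<close>

definition least_ascent :: "'w \<Rightarrow> nat" where
  "least_ascent g = (LEAST j. j \<in> {1..n} \<and> len g < len (g \<otimes> s j))"

lemma least_ascent:
  assumes "j \<in> {1..n}" "len g < len (g \<otimes> s j)"
  shows "least_ascent g \<in> {1..n}" "len g < len (g \<otimes> s (least_ascent g))"
  using LeastI[of "\<lambda>j. j \<in> {1..n} \<and> len g < len (g \<otimes> s j)" j] assms unfolding least_ascent_def by blast+

text \<open>The upper partner of a cell: the index of an ascent is adjoined to \<open>J\<close>, and the coset is replaced
  by the smaller one with the same gate.\<close>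

definition raise :: "'w \<Rightarrow> nat set \<times> 'w set \<Rightarrow> nat set \<times> 'w set" where
  "raise w c = (let J = insert (least_ascent (ngate (snd c) w)) (fst c) in (J, par J #> gate (snd c) w))"

definition low_cells :: "'w \<Rightarrow> int \<Rightarrow> (nat set \<times> 'w set) set" where
  "low_cells w i = {c \<in> cells i. least_ascent (ngate (snd c) w) \<notin> fst c}"

text \<open>Below the top degree some index is missing in \<open>J\<close>, and missing indices are ascents.\<close>

lemma cell_ascent:
  assumes "(J, P) \<in> cells i" "i \<le> int n - 2" "w \<in> carrier W"
  shows "least_ascent (ngate P w) \<in> {1..n}"
    "len (ngate P w) < len (ngate P w \<otimes> s (least_ascent (ngate P w)))"
proof -
  have J: "J \<subseteq> {1..n}" "int (card J) = i + 1" "P \<in> pc J" using assms(1) by (auto simp: cells_iff)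
  have "J \<noteq> {1..n}" using J(2) assms(2) by auto
  then obtain j where "j \<in> {1..n} - J" using J(1) by blast
  then show "least_ascent (ngate P w) \<in> {1..n}"
    "len (ngate P w) < len (ngate P w \<otimes> s (least_ascent (ngate P w)))"
    using least_ascent[of j "ngate P w"] no_descent[OF J(3) assms(3)] by blast+
qed

lemma raise_facts:
  assumes c: "(J, P) \<in> low_cells w i" and i: "i \<le> int n - 2" and w: "w \<in> carrier W"
  defines "k \<equiv> least_ascent (ngate P w)"
  shows "raise w (J, P) \<in> cells (i + 1)" "fst (raise w (J, P)) = insert k J" "k \<notin> J"
    "snd (raise w (J, P)) \<subseteq> P" "ngate (snd (raise w (J, P))) w = ngate P w"
proof -
  have cc: "(J, P) \<in> cells i" and k: "k \<notin> J" using c by (auto simp: low_cells_def k_def)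
  have J: "J \<subseteq> {1..n}" "int (card J) = i + 1" "P \<in> pc J" using cc by (auto simp: cells_iff)
  note kf = cell_ascent[OF cc i w, folded k_def]
  note g = gate_facts[OF pc_gated[OF J(3)] w] note nn = ngate_facts[OF pc_gated[OF J(3)] w]
  have r: "raise w (J, P) = (insert k J, par (insert k J) #> gate P w)"
    by (simp add: raise_def k_def Let_def)
  have fin: "finite J" using J(1) finite_subset by blast
  show "k \<notin> J" by (rule k)
  show "fst (raise w (J, P)) = insert k J" by (simp add: r)
  show "raise w (J, P) \<in> cells (i + 1)"
    unfolding r cells_iff using J kf(1) k fin pcI[OF g(2)] by auto
  show "snd (raise w (J, P)) \<subseteq> P"
    using coset_mono[of J "insert k J" "gate P w"] pc_eq[OF J(3) g(1)] by (auto simp: r)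
  have e: "gate P w = inv (ngate P w) \<otimes> w" using mult_cancel(1)[OF nn(1) g(2)] nn(2) by simp
  have "ngate (par (insert k J) #> (inv (ngate P w) \<otimes> w)) w = ngate P w"
    by (rule gate_no_descent(3)[OF nn(1) _ w]) (use no_descent[OF J(3) w] in auto)
  then show "ngate (snd (raise w (J, P))) w = ngate P w" by (simp only: r snd_conv e[symmetric])
qed

text \<open>A cell and its partner have the same gate, so \<open>canon_iso\<close> applies. If the coset of the partner of
  \<open>c'\<close> is contained in that of \<open>c\<close>, the element \<open>g\<close> of \<open>c\<close> is at most as long as that of \<open>c'\<close>. In
  case of equality both are the same element, and since its least ascent is not in the set \<open>J\<close> of
  \<open>c\<close>, the inclusion of \<open>J\<close> in the set of the partner forces \<open>c = c'\<close>.\<close>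

lemma raise_matching:
  assumes B: "chain_data (i + 1) B inc prj" and B': "chain_data i B' inc' prj'"
    and d: "diff_data (i + 1) B inc B' prj' d" and i: "i \<le> int n - 2" and w: "w \<in> carrier W"
    and c: "c \<in> low_cells w i"
  shows "is_iso (Cat D w) (fst (pull (snd (raise w c))) w) (fst (pull (snd c)) w)
      (prj' c w \<cdot>\<^bsub>w\<^esub> (d w \<cdot>\<^bsub>w\<^esub> inc (raise w c) w))"
    "c' \<in> low_cells w i \<Longrightarrow> c \<noteq> c' \<Longrightarrow> len (ngate (snd c) w) \<ge> len (ngate (snd c') w) \<Longrightarrow>
      prj' c w \<cdot>\<^bsub>w\<^esub> (d w \<cdot>\<^bsub>w\<^esub> inc (raise w c') w) =
        Zer (Cat D w) (fst (pull (snd (raise w c'))) w) (fst (pull (snd c)) w)"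
proof -
  obtain J P where cc: "c = (J, P)" by fastforce
  have cell: "(J, P) \<in> cells i" using c by (auto simp: low_cells_def cc)
  have J: "J \<subseteq> {1..n}" "int (card J) = i + 1" "P \<in> pc J" using cell by (auto simp: cells_iff)
  note r = raise_facts[OF c[unfolded cc] i w]
  have ent: "prj' c w \<cdot>\<^bsub>w\<^esub> (d w \<cdot>\<^bsub>w\<^esub> inc x w) = entry x c w" if "x \<in> cells (i + 1)" for x
  proof -
    have "Cmp GW (prj' c) (Cmp GW d (inc x)) = entry x c"
      using d that cell by (simp add: diff_data_def cc)
    from fun_cong[OF this, of w] show ?thesis using w by (simp add: glued_sel(1)[OF subset_refl])
  qed
  interpret V: preadditive_category "Cat D w" by (rule C_pre[OF w])
  have gP: "gated P" by (rule pc_gated[OF J(3)])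
  note gr = cells_gated[OF r(1)]
  note ca = canon_arr[OF gr gP r(4)] note ci = canon_iso[OF gr gP r(4) w r(5)]
  note caw = glued_arr_comp[OF subset_refl ca w]
  have "entry (raise w c) c w = signed (even_at (fst (raise w c)) (the_elem (fst (raise w c) - J)))
      (snd (raise w c)) P (canon (snd (raise w c)) P) w"
    using r(2,4) by (auto simp: entry_def cc)
  then show "is_iso (Cat D w) (fst (pull (snd (raise w c))) w) (fst (pull (snd c)) w)
      (prj' c w \<cdot>\<^bsub>w\<^esub> (d w \<cdot>\<^bsub>w\<^esub> inc (raise w c) w))"
    using ent[OF r(1)[folded cc]] ci V.is_iso_neg[OF ci caw] neg_eval[OF ca w]
    by (auto simp: signed_def cc)
  assume c': "c' \<in> low_cells w i" "c \<noteq> c'" "len (ngate (snd c) w) \<ge> len (ngate (snd c') w)"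
  obtain J' P' where cc': "c' = (J', P')" by fastforce
  have cell': "(J', P') \<in> cells i" using c' by (auto simp: low_cells_def cc')
  have J': "J' \<subseteq> {1..n}" "int (card J') = i + 1" "P' \<in> pc J'" using cell' by (auto simp: cells_iff)
  note r' = raise_facts[OF c'(1)[unfolded cc'] i w]
  have "\<not> (J \<subseteq> fst (raise w c') \<and> snd (raise w c') \<subseteq> P)"
  proof
    assume h: "J \<subseteq> fst (raise w c') \<and> snd (raise w c') \<subseteq> P"
    have pcr: "snd (raise w c') \<in> pc (fst (raise w c'))"
      using r'(1) by (cases "raise w c'") (auto simp: cells_iff cc')
    note le = ngate_le[OF pcr J(3) conjunct2[OF h] w]
    have eq: "ngate P w = ngate P' w"
      using le c'(3) r'(5) by (simp add: cc cc')
    then have "least_ascent (ngate P' w) \<notin> J" using r(3) by simp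
    then have "J \<subseteq> J'" using h r'(2) by (auto simp: cc')
    moreover have "finite J'" using J'(1) finite_subset by blast
    ultimately have JJ: "J = J'" using card_subset_eq[of J' J] J(2) J'(2) by simp
    have "gate P w = gate P' w"
      using mult_cancel(1)[OF ngate_carrier[OF gP w] gate_carrier[OF gP w]] ngate_gate[OF gP w]
        mult_cancel(1)[OF ngate_carrier[OF pc_gated[OF J'(3)] w] gate_carrier[OF pc_gated[OF J'(3)] w]]
        ngate_gate[OF pc_gated[OF J'(3)] w] eq by simp
    then have "P = P'"
      using pc_eq[OF J(3) gate_in[OF gP w]] pc_eq[OF J'(3) gate_in[OF pc_gated[OF J'(3)] w]] JJ by simp
    then show False using c'(2) JJ by (simp add: cc cc')
  qed
  then have "entry (raise w c') c = Zer GW (pull (snd (raise w c'))) (pull P)" by (auto simp: entry_def cc)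
  then show "prj' c w \<cdot>\<^bsub>w\<^esub> (d w \<cdot>\<^bsub>w\<^esub> inc (raise w c') w) =
        Zer (Cat D w) (fst (pull (snd (raise w c'))) w) (fst (pull (snd c)) w)"
    using ent[OF r'(1)[folded cc']] w by (simp add: glued_sel(4)[OF subset_refl] cc)
qed

text \<open>If the least ascent \<open>k\<close> of \<open>g\<close> belongs to \<open>J\<close>, the descents of \<open>g\<close> still lie in \<open>J - {k}\<close>, and
  there is a cell with this set and the same \<open>g\<close>, whose partner is the given one.\<close>

lemma cells_cover:
  assumes i: "i \<le> int n - 2" and w: "w \<in> carrier W"
  shows "cells i \<subseteq> low_cells w i \<union> raise w ` low_cells w (i - 1)"
proof
  fix c assume c: "c \<in> cells i"
  obtain J P where cc: "c = (J, P)" by fastforce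
  have J: "J \<subseteq> {1..n}" "int (card J) = i + 1" "P \<in> pc J" using c by (auto simp: cells_iff cc)
  define g where "g = ngate P w"
  define k where "k = least_ascent g"
  note kf = cell_ascent[OF c[unfolded cc] i w, folded g_def, folded k_def]
  note gt = gate_facts[OF pc_gated[OF J(3)] w] note nn = ngate_facts[OF pc_gated[OF J(3)] w, folded g_def]
  show "c \<in> low_cells w i \<union> raise w ` low_cells w (i - 1)"
  proof (cases "k \<in> J")
    case False
    then show ?thesis using c by (simp add: low_cells_def cc k_def g_def)
  next
    case True
    have e: "gate P w = inv g \<otimes> w" using mult_cancel(1)[OF nn(1) gt(2)] nn(2) by simp
    define P' where "P' = par (J - {k}) #> (inv g \<otimes> w)"
    have P': "P' \<in> pc (J - {k})" "gate P' w = inv g \<otimes> w" "ngate P' w = g"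
      unfolding P'_def
      by (rule gate_no_descent[OF nn(1) _ w]; use no_descent[OF J(3) w, folded g_def] kf(2) in blast)+
    have "(J - {k}, P') \<in> cells (i - 1)"
      unfolding cells_iff using J P'(1) card_remove[OF J(1) True] by auto
    then have low: "(J - {k}, P') \<in> low_cells w (i - 1)" by (simp add: low_cells_def P'(3) k_def)
    have "raise w (J - {k}, P') = (insert k (J - {k}), par (insert k (J - {k})) #> (inv g \<otimes> w))"
      by (simp add: raise_def P'(2,3) k_def Let_def)
    also have "\<dots> = c" using True pc_eq[OF J(3) gt(1)] e by (simp add: cc insert_absorb)
    finally show ?thesis using low by force
  qed
qed

lemma exact_at:
  assumes C2: "chain_data (i + 1) B2 inc2 prj2" and C1: "chain_data i B1 inc1 prj1"
    and C0: "chain_data (i - 1) B0 inc0 prj0"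
    and d2: "diff_data (i + 1) B2 inc2 B1 prj1 d2" and d1: "diff_data i B1 inc1 B0 prj0 d1"
    and i: "i \<le> int n - 2" and w: "w \<in> carrier W"
    and t: "ar w T (fst B1 w) t" "d1 w \<cdot>\<^bsub>w\<^esub> t = Zer (Cat D w) T (fst B0 w)"
  shows "\<exists>b. ar w T (fst B2 w) b \<and> d2 w \<cdot>\<^bsub>w\<^esub> b = t"
proof -
  interpret V: preadditive_category "Cat D w" by (rule C_pre[OF w])
  note E = glued_direct_sum_eval[OF subset_refl _ w]
  note S2 = E[OF C2[unfolded chain_data_def]] note S1 = E[OF C1[unfolded chain_data_def]]
  note S0 = E[OF C0[unfolded chain_data_def]]
  have a2: "arr GW B2 B1 d2" and a1: "arr GW B1 B0 d1" using d1 d2 by (auto simp: diff_data_def)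
  note dd = fun_cong[OF diff_diff[OF C2 C1 C0 d2 d1], of w]
  have dd: "d1 w \<cdot>\<^bsub>w\<^esub> d2 w = Zer (Cat D w) (fst B2 w) (fst B0 w)"
    using dd w by (simp add: glued_sel(1,4)[OF subset_refl])
  have C1': "chain_data (i - 1 + 1) B1 inc1 prj1" and d1': "diff_data (i - 1 + 1) B1 inc1 B0 prj0 d1"
    using C1 d1 by simp_all
  have i': "i - 1 \<le> int n - 2" using i by simp
  have rc: "raise w l \<in> cells (j + 1)" if "l \<in> low_cells w j" "j \<le> int n - 2" for l j
    using raise_facts(1)[of "fst l" "snd l", OF _ that(2) w] that(1) by simp
  show ?thesis
  proof (rule V.matched_exact[OF S2 S1 S0 glued_arr_comp[OF subset_refl a2 w] glued_arr_comp[OF subset_refl a1 w] dd,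
        where ?L1.0 = "low_cells w i" and ?\<phi>1.0 = "raise w" and ?r1.0 = "\<lambda>c. len (ngate (snd c) w)"
          and ?L0.0 = "low_cells w (i - 1)" and ?\<phi>0.0 = "raise w" and ?r0.0 = "\<lambda>c. len (ngate (snd c) w)"])
    show "low_cells w i \<subseteq> cells i" "low_cells w (i - 1) \<subseteq> cells (i - 1)" by (auto simp: low_cells_def)
    show "raise w l \<in> cells (i + 1)" if "l \<in> low_cells w i" for l by (rule rc[OF that i])
    show "raise w l \<in> cells i" if "l \<in> low_cells w (i - 1)" for l using rc[OF that i'] by simp
    show "cells i \<subseteq> low_cells w i \<union> raise w ` low_cells w (i - 1)" by (rule cells_cover[OF i w])
  qed (rule raise_matching[OF C2 C1 d2 i w] raise_matching[OF C1' C0 d1' i' w] t; assumption)+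
qed

subsection \<open>The chain objects and differentials\<close>

abbreviation coeff where "coeff \<equiv> coeff_obj W n s D A"
abbreviation chn where "chn \<equiv> chain_obj W n s D A"
abbreviation dif where "dif \<equiv> chain_diff W n s D A"

definition cinc :: "int \<Rightarrow> nat set \<times> 'w set \<Rightarrow> 'w \<Rightarrow> 'm" where
  "cinc i = (\<lambda>(J, P). Cmp GW (dsum_inj GW (faces n i) coeff J) (dsum_inj GW (pc J) pull P))"

definition cprj :: "int \<Rightarrow> nat set \<times> 'w set \<Rightarrow> 'w \<Rightarrow> 'm" where
  "cprj i = (\<lambda>(J, P). Cmp GW (dsum_prj GW (pc J) pull P) (dsum_prj GW (faces n i) coeff J))"

lemma faces_finite: "finite (faces n i)"
  by (rule finite_subset[of _ "Pow {1..n}"]) (auto simp: faces_def)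

lemma faces_empty: "i < 0 \<or> i \<ge> int n \<Longrightarrow> faces n i = {}"
proof (rule equals0I)
  fix J assume i: "i < 0 \<or> i \<ge> int n" and "J \<in> faces n i"
  then have J: "J \<subseteq> {1..n}" "J \<noteq> {}" "int (card J) = i + 1" by (auto simp: faces_def)
  have "card J \<le> n" using card_mono[OF _ J(1)] by simp
  moreover have "card J \<noteq> 0" using J(1,2) finite_subset[OF J(1)] by simp
  ultimately show False using i J(3) by linarith
qed

lemma cells_faces: "i \<ge> 0 \<Longrightarrow> cells i = Sigma (faces n i) pc"
  unfolding cells_def faces_def by auto

lemma coeff_sum_ex: "\<exists>B inc prj. GW.direct_sum_data (pc J) pull B inc prj"
  by (rule glued_direct_sum[OF subset_refl pc_finite pull_obj[OF pc_gated]])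

lemma coeff_sum:
  "GW.direct_sum_data (pc J) pull (coeff J) (dsum_inj GW (pc J) pull) (dsum_prj GW (pc J) pull)"
  unfolding coeff_obj_def by (rule GW.dsum_data[OF coeff_sum_ex])

lemma chain_sum_ex: "\<exists>B inc prj. GW.direct_sum_data (faces n i) coeff B inc prj"
  by (rule glued_direct_sum[OF subset_refl faces_finite GW.dsd_obj[OF coeff_sum]])

lemma chain_sum: "GW.direct_sum_data (faces n i) coeff (chn i)
    (dsum_inj GW (faces n i) coeff) (dsum_prj GW (faces n i) coeff)"
  unfolding chain_obj_def by (rule GW.dsum_data[OF chain_sum_ex])

lemma chn_obj: "chn i \<in> Obj GW"
  by (rule GW.dsd_obj[OF chain_sum])

lemma chain_data_chn: "i \<ge> 0 \<Longrightarrow> chain_data i (chn i) (cinc i) (cprj i)"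
proof -
  assume i: "i \<ge> 0"
  have e: "(\<lambda>(J, P). pull P) = (\<lambda>c::nat set \<times> 'w set. pull (snd c))" by (simp add: fun_eq_iff)
  show ?thesis
    using GW.dsd_flatten[OF chain_sum[of i] coeff_sum]
    unfolding chain_data_def cells_faces[OF i] cinc_def cprj_def e .
qed

lemma coeff_arr_facts:
  shows "arr GW (coeff J') (coeff J) (coeff_arr W n s D A J' J)"
    "P \<in> pc J' \<Longrightarrow> Q \<in> pc J \<Longrightarrow>
      Cmp GW (dsum_prj GW (pc J) pull Q) (Cmp GW (coeff_arr W n s D A J' J) (dsum_inj GW (pc J') pull P)) =
      (if P \<subseteq> Q then canon P Q else Zer GW (pull P) (pull Q))"
proof -
  have m: "arr GW (pull P) (pull Q) (if P \<subseteq> Q then canon P Q else Zer GW (pull P) (pull Q))"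
    if "P \<in> pc J'" "Q \<in> pc J" for P Q
    using canon_arr[OF pc_gated[OF that(1)] pc_gated[OF that(2)]]
      GW.zer_arr[OF pull_obj[OF pc_gated[OF that(1)]] pull_obj[OF pc_gated[OF that(2)]]] by simp
  note f = GW.dsum_arr_facts[OF coeff_sum_ex coeff_sum_ex m]
  show "arr GW (coeff J') (coeff J) (coeff_arr W n s D A J' J)"
    unfolding coeff_obj_def coeff_arr_def by (rule f(1))
  show "P \<in> pc J' \<Longrightarrow> Q \<in> pc J \<Longrightarrow>
      Cmp GW (dsum_prj GW (pc J) pull Q) (Cmp GW (coeff_arr W n s D A J' J) (dsum_inj GW (pc J') pull P)) =
      (if P \<subseteq> Q then canon P Q else Zer GW (pull P) (pull Q))"
    unfolding coeff_arr_def by (rule f(2))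
qed

definition face_map :: "nat set \<Rightarrow> nat set \<Rightarrow> 'w \<Rightarrow> 'm" where
  "face_map J' J = (if J \<subseteq> J'
     then (if even_at J' (the_elem (J' - J)) then coeff_arr W n s D A J' J
       else GW.neg (coeff J') (coeff J) (coeff_arr W n s D A J' J))
     else Zer GW (coeff J') (coeff J))"

lemma face_map_arr: "arr GW (coeff J') (coeff J) (face_map J' J)"
  using coeff_arr_facts(1) GW.neg_arr[OF coeff_arr_facts(1)]
    GW.zer_arr[OF GW.dsd_obj[OF coeff_sum] GW.dsd_obj[OF coeff_sum]] by (simp add: face_map_def)

lemma dif_def: "dif i = dsum_arr GW (faces n i) coeff (faces n (i - 1)) coeff face_map"
  unfolding chain_diff_def Let_def face_map_def even_at_def ..

lemma dif_facts:
  shows dif_arr: "arr GW (chn i) (chn (i - 1)) (dif i)"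
    and "J' \<in> faces n i \<Longrightarrow> J \<in> faces n (i - 1) \<Longrightarrow>
      Cmp GW (dsum_prj GW (faces n (i - 1)) coeff J) (Cmp GW (dif i) (dsum_inj GW (faces n i) coeff J')) =
      face_map J' J"
  unfolding dif_def chain_obj_def
  by (rule GW.dsum_arr_facts[OF chain_sum_ex chain_sum_ex face_map_arr]; assumption)+

text \<open>In degree \<open>0\<close> the differential takes values in a zero object, whereas \<open>cells (- 1)\<close> contains the
  cell of the augmentation; hence the bound.\<close>

lemma diff_data_dif:
  assumes i: "i \<ge> 1"
  shows "diff_data i (chn i) (cinc i) (chn (i - 1)) (cprj (i - 1)) (dif i)"
  unfolding diff_data_def
proof (intro conjI ballI)
  show "arr GW (chn i) (chn (i - 1)) (dif i)" by (rule dif_arr)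
  fix c c' assume c: "c \<in> cells i" "c' \<in> cells (i - 1)"
  obtain J' P where cc: "c = (J', P)" by fastforce
  obtain J Q where cc': "c' = (J, Q)" by fastforce
  have J': "J' \<in> faces n i" "P \<in> pc J'" using c(1) cells_faces[of i] i by (auto simp: cc)
  have J: "J \<in> faces n (i - 1)" "Q \<in> pc J" using c(2) cells_faces[of "i - 1"] i by (auto simp: cc')
  let ?iJ = "dsum_inj GW (faces n i) coeff J'" and ?pJ = "dsum_prj GW (faces n (i - 1)) coeff J"
  let ?iP = "dsum_inj GW (pc J') pull P" and ?pQ = "dsum_prj GW (pc J) pull Q"
  note iJ = GW.dsd_inc[OF chain_sum J'(1)] note pJ = GW.dsd_prj[OF chain_sum J(1)]
  note iP = GW.dsd_inc[OF coeff_sum J'(2)] note pQ = GW.dsd_prj[OF coeff_sum J(2)]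
  note d = dif_arr[of i]
  note cf = coeff_arr_facts[where J' = J' and J = J]
  have o: "pull P \<in> Obj GW" "pull Q \<in> Obj GW" using pull_obj pc_gated J'(2) J(2) by blast+
  have "Cmp GW (cprj (i - 1) c') (Cmp GW (dif i) (cinc i c)) =
      Cmp GW ?pQ (Cmp GW (Cmp GW ?pJ (Cmp GW (dif i) ?iJ)) ?iP)"
    by (simp only: cc cc' cinc_def cprj_def prod.case
      GW.cmp_assoc[OF GW.cmp_arr[OF iP GW.cmp_arr[OF iJ d]] pJ pQ, symmetric]
      GW.cmp_assoc[OF iP iJ d] GW.cmp_assoc[OF iP GW.cmp_arr[OF iJ d] pJ])
  also have "\<dots> = Cmp GW ?pQ (Cmp GW (face_map J' J) ?iP)" by (simp only: dif_facts(2)[OF J'(1) J(1)])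
  also have "\<dots> = entry c c'"
  proof (cases "J \<subseteq> J'")
    case False
    then show ?thesis
      using GW.cmp_zer(2)[OF iP GW.dsd_obj[OF coeff_sum]] GW.cmp_zer(1)[OF pQ o(1)]
      by (simp add: face_map_def entry_def cc cc')
  next
    case True
    have neg: "Cmp GW ?pQ (Cmp GW (GW.neg (coeff J') (coeff J) (coeff_arr W n s D A J' J)) ?iP) =
        GW.neg (pull P) (pull Q) (Cmp GW ?pQ (Cmp GW (coeff_arr W n s D A J' J) ?iP))"
      by (simp only: GW.cmp_neg(2)[OF iP cf(1)] GW.cmp_neg(1)[OF GW.cmp_arr[OF iP cf(1)] pQ])
    show ?thesis
      using True neg cf(2)[OF J'(2) J(2)] GW.neg_zer[OF o]
      by (simp add: face_map_def entry_def cc cc' signed_def)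
  qed
  finally show "Cmp GW (cprj (i - 1) c') (Cmp GW (dif i) (cinc i c)) = entry c c'" .
qed

lemma chn_zero_target:
  assumes "i < 0 \<or> i \<ge> int n" "arr GW X (chn i) f" "arr GW X (chn i) g"
  shows "f = g"
  by (rule GW.dsd_ext[OF chain_sum assms(2,3)]) (use faces_empty[OF assms(1)] in simp)

lemma chn_zero_source:
  assumes "i < 0 \<or> i \<ge> int n" "arr GW (chn i) X f" "arr GW (chn i) X g"
  shows "f = g"
  by (rule GW.dsd_ext_inc[OF chain_sum assms(2,3)]) (use faces_empty[OF assms(1)] in simp)

lemma chn_zero_target_at:
  assumes "i < 0 \<or> i \<ge> int n" "w \<in> carrier W" "ar w X (fst (chn i) w) f" "ar w X (fst (chn i) w) g"
  shows "f = g"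
  by (rule preadditive_category.dsd_ext[OF C_pre[OF assms(2)]
      glued_direct_sum_eval[OF subset_refl chain_sum assms(2)] assms(3,4)])
    (use faces_empty[OF assms(1)] in simp)

lemma dif_dif: "Cmp GW (dif i) (dif (i + 1)) = Zer GW (chn (i + 1)) (chn (i - 1))"
proof (cases "i \<ge> 1")
  case True
  have d: "diff_data (i + 1) (chn (i + 1)) (cinc (i + 1)) (chn i) (cprj i) (dif (i + 1))"
    using diff_data_dif[of "i + 1"] True by simp
  show ?thesis
    by (rule diff_diff[OF chain_data_chn chain_data_chn chain_data_chn d diff_data_dif]) (use True in auto)
next
  case False
  have d: "arr GW (chn (i + 1)) (chn i) (dif (i + 1))" using dif_arr[of "i + 1"] by simp
  show ?thesis
    by (rule chn_zero_target[OF _ GW.cmp_arr[OF d dif_arr] GW.zer_arr[OF chn_obj chn_obj]]) (use False in simp)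
qed

subsection \<open>Vanishing of the middle homology\<close>

lemma homology_kernel:
  obtains K k u where "is_kernel GW (chn i) (chn (i - 1)) (dif i) K k" "arr GW (chn (i + 1)) K u"
    "Cmp GW k u = dif (i + 1)"
    "\<And>Q q. is_cokernel GW (chn (i + 1)) K u Q q \<Longrightarrow> isomorphic GW (chain_homology W n s D A i) Q"
proof -
  have d: "arr GW (chn (i + 1)) (chn i) (dif (i + 1))" using dif_arr[of "i + 1"] by simp
  have "\<exists>K k. is_kernel GW (chn i) (chn (i - 1)) (dif i) K k"
    using glued_kernel[OF subset_refl dif_arr] by blast
  from GW.homology_obtain[OF d dif_arr dif_dif this] show ?thesis
    using that unfolding chain_homology_def by blast
qed

text \<open>Exactness in terms of generalized elements over each \<open>w\<close>. Applied to the inclusion of the cycles,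
  it provides a section of the arrow \<open>u\<close> from chains to cycles over each \<open>w\<close>. These sections need
  not respect the structure morphisms, but they show that \<open>u\<close> is epic.\<close>

lemma homology_zero:
  assumes ex: "\<And>w T t. w \<in> carrier W \<Longrightarrow> ar w T (fst (chn i) w) t \<Longrightarrow>
      dif i w \<cdot>\<^bsub>w\<^esub> t = Zer (Cat D w) T (fst (chn (i - 1)) w) \<Longrightarrow>
      \<exists>b. ar w T (fst (chn (i + 1)) w) b \<and> dif (i + 1) w \<cdot>\<^bsub>w\<^esub> b = t"
  shows "is_zero_object GW (chain_homology W n s D A i)"
proof -
  obtain K k u where K: "is_kernel GW (chn i) (chn (i - 1)) (dif i) K k" and u: "arr GW (chn (i + 1)) K u"
    and ku: "Cmp GW k u = dif (i + 1)"
    and H: "\<And>Q q. is_cokernel GW (chn (i + 1)) K u Q q \<Longrightarrow> isomorphic GW (chain_homology W n s D A i) Q"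
    by (rule homology_kernel[of i]) (rule that)
  have k: "arr GW K (chn i) k" by (rule GW.kernel_arr[OF K dif_arr])
  have "is_zero_object GW (chn (- 1))"
    by (rule GW.dsd_empty) (use chain_sum[of "- 1"] faces_empty[of "- 1"] in simp)
  moreover have "v = v'" if v: "arr GW K T v" "arr GW K T v'" "Cmp GW v u = Cmp GW v' u" for T v v'
  proof (rule glued_arr_eqI[OF subset_refl v(1,2)])
    fix w assume w: "w \<in> carrier W"
    interpret V: preadditive_category "Cat D w" by (rule C_pre[OF w])
    note dw = glued_arr_comp[OF subset_refl dif_arr w]
    note KF = V.kernel_facts[OF glued_kernel_eval[OF subset_refl dif_arr K w] dw]
    note uw = glued_arr_comp[OF subset_refl u w]
    obtain b where b: "ar w (fst K w) (fst (chn (i + 1)) w) b" "dif (i + 1) w \<cdot>\<^bsub>w\<^esub> b = k w"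
      using ex[OF w KF(1,2)] by blast
    have kuw: "k w \<cdot>\<^bsub>w\<^esub> u w = dif (i + 1) w"
      using fun_cong[OF ku, of w] w by (simp add: glued_sel(1)[OF subset_refl])
    have ub: "u w \<cdot>\<^bsub>w\<^esub> b = idn w (fst K w)"
      by (rule KF(3)[OF V.cmp_arr[OF b(1) uw] V.ide_arr[OF arr_objD(1)[OF KF(1)]]])
        (simp only: V.cmp_assoc[OF b(1) uw KF(1)] kuw b(2) V.cmp_ide(1)[OF KF(1)])
    have "v w \<cdot>\<^bsub>w\<^esub> u w = v' w \<cdot>\<^bsub>w\<^esub> u w"
      using fun_cong[OF v(3), of w] w by (simp add: glued_sel(1)[OF subset_refl])
    then have "v w \<cdot>\<^bsub>w\<^esub> (u w \<cdot>\<^bsub>w\<^esub> b) = v' w \<cdot>\<^bsub>w\<^esub> (u w \<cdot>\<^bsub>w\<^esub> b)"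
      by (simp only: V.cmp_assoc[OF b(1) uw glued_arr_comp[OF subset_refl v(1) w]]
        V.cmp_assoc[OF b(1) uw glued_arr_comp[OF subset_refl v(2) w]])
    then show "v w = v' w"
      by (simp only: ub V.cmp_ide(1)[OF glued_arr_comp[OF subset_refl v(1) w]]
        V.cmp_ide(1)[OF glued_arr_comp[OF subset_refl v(2) w]])
  qed
  ultimately show ?thesis
    using GW.isomorphic_zero[OF H[OF GW.epic_cokernel_zero[OF u]]] by blast
qed

lemma homology_middle:
  assumes "i \<noteq> 0" "i \<noteq> int n - 1"
  shows "is_zero_object GW (chain_homology W n s D A i)"
proof (rule homology_zero)
  fix w T t assume w: "w \<in> carrier W" and t: "ar w T (fst (chn i) w) t"
    and dt: "dif i w \<cdot>\<^bsub>w\<^esub> t = Zer (Cat D w) T (fst (chn (i - 1)) w)"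
  have d: "arr GW (chn (i + 1)) (chn i) (dif (i + 1))" using dif_arr[of "i + 1"] by simp
  show "\<exists>b. ar w T (fst (chn (i + 1)) w) b \<and> dif (i + 1) w \<cdot>\<^bsub>w\<^esub> b = t"
  proof (cases "1 \<le> i \<and> i \<le> int n - 2")
    case True
    have d: "diff_data (i + 1) (chn (i + 1)) (cinc (i + 1)) (chn i) (cprj i) (dif (i + 1))"
      using diff_data_dif[of "i + 1"] True by simp
    show ?thesis
      by (rule exact_at[OF chain_data_chn chain_data_chn chain_data_chn d diff_data_dif _ w t dt]) (use True in auto)
  next
    case False
    then have i: "i < 0 \<or> i \<ge> int n" using assms by linarith
    note z = C_zer_arr[OF w arr_objD(1)[OF t] glued_ob[OF subset_refl chn_obj w]]
    have "dif (i + 1) w \<cdot>\<^bsub>w\<^esub> Zer (Cat D w) T (fst (chn (i + 1)) w) = t"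
      by (rule chn_zero_target_at[OF i w C_cmp_arr[OF w z glued_arr_comp[OF subset_refl d w]] t])
    then show ?thesis using z by blast
  qed
qed

subsection \<open>The homology in degree zero\<close>

lemma cells_minus_one: "cells (- 1) = {({}, carrier W)}"
proof -
  have par: "par {} = carrier W" using bij S_generate by (simp add: bij_betw_def)
  have "pc {} = {carrier W}"
  proof (intro equalityI subsetI)
    fix P assume P: "P \<in> pc {}"
    obtain p where p: "p \<in> P" using gate_in[OF pc_gated[OF P] one_closed] by blast
    have pW: "p \<in> carrier W" by (rule gated_carrier[OF pc_gated[OF P] p])
    have "P = carrier W #> p" using pc_eq[OF P p] by (simp only: par)
    then show "P \<in> {carrier W}" using coset_join2[OF pW subgroup_self pW] by simp
  next
    fix P assume "P \<in> {carrier W}"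
    moreover have "carrier W #> \<one> \<in> pc {}" using pcI[OF one_closed, of "{}"] by (simp only: par)
    ultimately show "P \<in> pc {}" using coset_join2[OF one_closed subgroup_self one_closed] by simp
  qed
  moreover have "J = {}" if "J \<subseteq> {1..n}" "int (card J) = - 1 + 1" for J
    using that finite_subset[OF that(1)] by simp
  ultimately show ?thesis unfolding cells_def by auto
qed

lemma chain_data_minus_one:
  "chain_data (- 1) (pull (carrier W)) (\<lambda>_. Ide GW (pull (carrier W))) (\<lambda>_. Ide GW (pull (carrier W)))"
proof -
  note o = pull_obj[OF gated_carrier_set]
  note i = GW.ide_arr[OF o]
  show ?thesis
    unfolding chain_data_def cells_minus_one
    by (rule GW.dsd_intro) (use o i GW.cmp_ide[OF i] GW.cmp_ide(2) in auto)
qed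

lemma augmentation:
  obtains e where "diff_data 0 (chn 0) (cinc 0) (pull (carrier W)) (\<lambda>_. Ide GW (pull (carrier W))) e"
proof -
  note C0 = chain_data_chn[of 0, simplified]
  note ex = GW.dsd_matrix[OF C0[unfolded chain_data_def] chain_data_minus_one[unfolded chain_data_def]
      entry_arr[of _ 0 _ "- 1"]]
  then obtain e where "e \<in> Hom GW (chn 0) (pull (carrier W)) \<and> (\<forall>c\<in>cells 0. \<forall>c'\<in>cells (- 1).
      Cmp GW (Ide GW (pull (carrier W))) (Cmp GW e (cinc 0 c)) = entry c c')" by blast
  then show ?thesis
    using that chn_obj pull_obj[OF gated_carrier_set] unfolding diff_data_def arr_def by auto
qed

text \<open>Compatibility of \<open>v\<close> with the structure morphisms can be tested after composition with \<open>\<Phi>\<^sub>g\<close> of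
  \<open>q\<close>. This is an epimorphism since \<open>q\<close> has a section over each \<open>w\<close>, which every functor preserves.\<close>

lemma split_quotient_arr:
  assumes q: "arr GW K B q" and t: "arr GW K T t"
    and e: "\<And>w. w \<in> carrier W \<Longrightarrow> ar w (fst B w) (fst K w) (e w)"
      "\<And>w. w \<in> carrier W \<Longrightarrow> q w \<cdot>\<^bsub>w\<^esub> e w = idn w (fst B w)"
    and v: "\<And>w. w \<in> carrier W \<Longrightarrow> ar w (fst B w) (fst T w) (v w)"
      "\<And>w. w \<in> carrier W \<Longrightarrow> v w \<cdot>\<^bsub>w\<^esub> q w = t w"
  shows "arr GW B T (\<lambda>w\<in>carrier W. v w)"
proof (rule glued_arrI[OF subset_refl arr_objD(2)[OF q] arr_objD(2)[OF t]])
  note B = arr_objD(2)[OF q] note T = arr_objD(2)[OF t] note K = arr_objD(1)[OF q]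
  show "ar w (fst B w) (fst T w) ((\<lambda>w\<in>carrier W. v w) w)" if "w \<in> carrier W" for w using v(1)[OF that] that by simp
  fix g p r assume h: "g \<in> carrier W" "p \<in> carrier W" "r \<in> carrier W" "r = g \<otimes> p"
  note aB = glued_alpha[OF subset_refl B h] note aT = glued_alpha[OF subset_refl T h] note aK = glued_alpha[OF subset_refl K h]
  note qp = glued_arr_comp[OF subset_refl q h(2)] note qr = glued_arr_comp[OF subset_refl q h(3)]
  note Fe = PhA_ar[OF h(1,2) e(1)[OF h(2)] h(4)] note Fq = PhA_ar[OF h(1,2) qp h(4)]
  note Fv = PhA_ar[OF h(1,2) v(1)[OF h(2)] h(4)]
  have "(v r \<cdot>\<^bsub>r\<^esub> snd B g p) \<cdot>\<^bsub>r\<^esub> PhA D g p (q p) = (snd T g p \<cdot>\<^bsub>r\<^esub> PhA D g p (v p)) \<cdot>\<^bsub>r\<^esub> PhA D g p (q p)"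
    by (simp only: C_assoc[OF h(3) Fq aB v(1)[OF h(3)], symmetric] glued_arr_sq[OF subset_refl q h, symmetric]
      C_assoc[OF h(3) aK qr v(1)[OF h(3)]] v(2)[OF h(3)] C_assoc[OF h(3) Fq Fv aT, symmetric]
      PhA_cmp[OF h(1,2) qp v(1)[OF h(2)] h(4), symmetric] v(2)[OF h(2)] glued_arr_sq[OF subset_refl t h])
  then have "((v r \<cdot>\<^bsub>r\<^esub> snd B g p) \<cdot>\<^bsub>r\<^esub> PhA D g p (q p)) \<cdot>\<^bsub>r\<^esub> PhA D g p (e p) =
      ((snd T g p \<cdot>\<^bsub>r\<^esub> PhA D g p (v p)) \<cdot>\<^bsub>r\<^esub> PhA D g p (q p)) \<cdot>\<^bsub>r\<^esub> PhA D g p (e p)" by simp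
  then have "v r \<cdot>\<^bsub>r\<^esub> snd B g p = snd T g p \<cdot>\<^bsub>r\<^esub> PhA D g p (v p)"
    by (simp only: C_assoc[OF h(3) Fe Fq C_cmp_arr[OF h(3) aB v(1)[OF h(3)]], symmetric]
      C_assoc[OF h(3) Fe Fq C_cmp_arr[OF h(3) Fv aT], symmetric]
      PhA_cmp[OF h(1,2) e(1)[OF h(2)] qp h(4), symmetric] e(2)[OF h(2)]
      PhA_ide[OF h(1,2) arr_objD(1)[OF e(1)[OF h(2)]] h(4)]
      C_ide(1)[OF h(3) C_cmp_arr[OF h(3) aB v(1)[OF h(3)]]] C_ide(1)[OF h(3) C_cmp_arr[OF h(3) Fv aT]])
  then show "(\<lambda>w\<in>carrier W. v w) r \<cdot>\<^bsub>r\<^esub> snd B g p = snd T g p \<cdot>\<^bsub>r\<^esub> PhA D g p ((\<lambda>w\<in>carrier W. v w) p)"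
    using h(2,3) by simp
qed simp

text \<open>Exactness of the augmented complex in degree \<open>- 1\<close> gives a section of the augmentation over each
  \<open>w\<close>, and exactness in degree \<open>0\<close> says that its kernel consists of boundaries. So the augmentation,
  restricted to the cycles of degree \<open>0\<close>, is a cokernel of the arrow from the chains of degree \<open>1\<close>.\<close>

lemma homology_bottom: "isomorphic GW (chain_homology W n s D A 0) A"
proof -
  let ?A = "pull (carrier W)"
  note oA = pull_obj[OF gated_carrier_set]
  obtain ep where ep: "diff_data 0 (chn 0) (cinc 0) ?A (\<lambda>_. Ide GW ?A) ep" using augmentation .
  have epa: "arr GW (chn 0) ?A ep" using ep by (simp add: diff_data_def)
  note C1 = chain_data_chn[of 1, simplified] note C0 = chain_data_chn[of 0, simplified]
  note Cm = chain_data_minus_one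
  have d1: "diff_data 1 (chn 1) (cinc 1) (chn 0) (cprj 0) (dif 1)" using diff_data_dif[of 1] by simp
  have d1a: "arr GW (chn 1) (chn 0) (dif 1)" using dif_arr[of 1] by simp
  have d0a: "arr GW (chn 0) (chn (- 1)) (dif 0)" using dif_arr[of 0] by simp
  have epd: "Cmp GW ep (dif 1) = Zer GW (chn 1) ?A"
    by (rule diff_diff[of 0, simplified, OF C1 C0 Cm d1 ep])
  have z: "(0::int) - 1 = - 1" "(0::int) + 1 = 1" by simp_all
  \<comment> \<open>the augmented complex is continued by a zero object in degree \<open>- 2\<close>\<close>
  have c2: "cells (- 2) = {}" by (auto simp: cells_def)
  obtain Z incZ prjZ where Z: "GW.direct_sum_data (cells (- 2)) (\<lambda>c. pull (snd c)) Z incZ prjZ"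
    using glued_direct_sum[OF subset_refl, of "cells (- 2)" "\<lambda>c. pull (snd c)"] c2 by auto
  then have Zd: "chain_data (- 2) Z incZ prjZ" by (simp add: chain_data_def)
  have dz: "diff_data (- 1) ?A (\<lambda>_. Ide GW ?A) Z prjZ (Zer GW ?A Z)"
    using c2 GW.zer_arr[OF oA GW.dsd_obj[OF Z]] by (simp add: diff_data_def)
  have ex0: "\<exists>b. ar w T (fst (chn 1) w) b \<and> dif 1 w \<cdot>\<^bsub>w\<^esub> b = t"
    if "w \<in> carrier W" "ar w T (fst (chn 0) w) t" "ep w \<cdot>\<^bsub>w\<^esub> t = Zer (Cat D w) T (fst ?A w)" for w T t
    by (rule exact_at[of 0, simplified, OF C1 C0 Cm d1 ep _ that]) (use n2 in simp)
  have sec: "\<exists>b. ar w (fst ?A w) (fst (chn 0) w) b \<and> ep w \<cdot>\<^bsub>w\<^esub> b = idn w (fst ?A w)" if w: "w \<in> carrier W" for w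
  proof (rule exact_at[of "- 1", simplified, OF C0 Cm Zd ep dz _ w])
    show "ar w (fst ?A w) (fst ?A w) (idn w (fst ?A w))" by (rule C_ide_arr[OF w glued_ob[OF subset_refl oA w]])
    have "ar w (fst ?A w) (fst Z w) (Zer (Cat D w) (fst ?A w) (fst Z w))"
      by (rule C_zer_arr[OF w glued_ob[OF subset_refl oA w] glued_ob[OF subset_refl GW.dsd_obj[OF Z] w]])
    then show "Zer GW ?A Z w \<cdot>\<^bsub>w\<^esub> idn w (fst ?A w) = Zer (Cat D w) (fst ?A w) (fst Z w)"
      using C_ide(1)[OF w] w by (simp add: glued_sel(4)[OF subset_refl])
  qed (use n2 in simp)
  obtain K k u where K: "is_kernel GW (chn 0) (chn (- 1)) (dif 0) K k" and u: "arr GW (chn 1) K u"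
    and ku: "Cmp GW k u = dif 1"
    and H: "\<And>Q q. is_cokernel GW (chn 1) K u Q q \<Longrightarrow> isomorphic GW (chain_homology W n s D A 0) Q"
    by (rule homology_kernel[of 0, unfolded z]) (rule that)
  have k: "arr GW K (chn 0) k" by (rule GW.kernel_arr[OF K d0a])
  have KF: "is_kernel (Cat D w) (fst (chn 0) w) (fst (chn (- 1)) w) (dif 0 w) (fst K w) (k w)"
    if "w \<in> carrier W" for w by (rule glued_kernel_eval[OF subset_refl d0a K that])
  have "\<forall>w\<in>carrier W. \<exists>b. ar w (fst ?A w) (fst K w) b \<and> ep w \<cdot>\<^bsub>w\<^esub> (k w \<cdot>\<^bsub>w\<^esub> b) = idn w (fst ?A w)"
  proof
    fix w assume w: "w \<in> carrier W"
    obtain b where b: "ar w (fst ?A w) (fst (chn 0) w) b" "ep w \<cdot>\<^bsub>w\<^esub> b = idn w (fst ?A w)" using sec[OF w] by blast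
    note d0w = glued_arr_comp[OF subset_refl d0a w]
    have "dif 0 w \<cdot>\<^bsub>w\<^esub> b = Zer (Cat D w) (fst ?A w) (fst (chn (- 1)) w)"
      by (rule chn_zero_target_at[OF _ w C_cmp_arr[OF w b(1) d0w] C_zer_arr[OF w arr_objD(1)[OF b(1)] arr_objD(2)[OF d0w]]]) simp
    from preadditive_category.kernel_lift[OF C_pre[OF w] KF[OF w] d0w b(1) this]
    show "\<exists>b. ar w (fst ?A w) (fst K w) b \<and> ep w \<cdot>\<^bsub>w\<^esub> (k w \<cdot>\<^bsub>w\<^esub> b) = idn w (fst ?A w)" using b(2) by auto
  qed
  from bchoice[OF this] obtain e where e: "\<And>w. w \<in> carrier W \<Longrightarrow> ar w (fst ?A w) (fst K w) (e w)"
    "\<And>w. w \<in> carrier W \<Longrightarrow> ep w \<cdot>\<^bsub>w\<^esub> (k w \<cdot>\<^bsub>w\<^esub> e w) = idn w (fst ?A w)" by blast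
  define q where "q = Cmp GW ep k"
  have q: "arr GW K ?A q" unfolding q_def by (rule GW.cmp_arr[OF k epa])
  have qw: "q w = ep w \<cdot>\<^bsub>w\<^esub> k w" if "w \<in> carrier W" for w using that by (simp add: q_def glued_sel(1)[OF subset_refl])
  have qe: "q w \<cdot>\<^bsub>w\<^esub> e w = idn w (fst ?A w)" if w: "w \<in> carrier W" for w
    by (simp only: qw[OF w] C_assoc[OF w e(1)[OF w] glued_arr_comp[OF subset_refl k w]
      glued_arr_comp[OF subset_refl epa w], symmetric] e(2)[OF w])
  have "is_cokernel GW (chn 1) K u ?A q"
  proof (rule GW.is_cokernelI[OF q])
    show "Cmp GW q u = Zer GW (chn 1) ?A"
      by (simp only: q_def GW.cmp_assoc[OF u k epa, symmetric] ku epd)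
    show "v = v'" if v: "arr GW ?A T v" "arr GW ?A T v'" "Cmp GW v q = Cmp GW v' q" for T v v'
    proof (rule glued_arr_eqI[OF subset_refl v(1,2)])
      fix w assume w: "w \<in> carrier W"
      note va = glued_arr_comp[OF subset_refl v(1) w] glued_arr_comp[OF subset_refl v(2) w]
      note qa = glued_arr_comp[OF subset_refl q w]
      have "v w \<cdot>\<^bsub>w\<^esub> q w = v' w \<cdot>\<^bsub>w\<^esub> q w"
        using fun_cong[OF v(3), of w] w by (simp add: glued_sel(1)[OF subset_refl])
      then have "v w \<cdot>\<^bsub>w\<^esub> (q w \<cdot>\<^bsub>w\<^esub> e w) = v' w \<cdot>\<^bsub>w\<^esub> (q w \<cdot>\<^bsub>w\<^esub> e w)"
        by (simp only: C_assoc[OF w e(1)[OF w] qa va(1)] C_assoc[OF w e(1)[OF w] qa va(2)])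
      then show "v w = v' w" by (simp only: qe[OF w] C_ide(1)[OF w va(1)] C_ide(1)[OF w va(2)])
    qed
    fix T t assume t: "arr GW K T t" "Cmp GW t u = Zer GW (chn 1) T"
    define v where "v w = t w \<cdot>\<^bsub>w\<^esub> e w" for w
    have va: "ar w (fst ?A w) (fst T w) (v w)" if w: "w \<in> carrier W" for w
      unfolding v_def by (rule C_cmp_arr[OF w e(1)[OF w] glued_arr_comp[OF subset_refl t(1) w]])
    have vq: "v w \<cdot>\<^bsub>w\<^esub> q w = t w" if w: "w \<in> carrier W" for w
    proof -
      interpret V: preadditive_category "Cat D w" by (rule C_pre[OF w])
      note kw = glued_arr_comp[OF subset_refl k w] note ew = e(1)[OF w] note qa = glued_arr_comp[OF subset_refl q w]
      note tw = glued_arr_comp[OF subset_refl t(1) w] note epw = glued_arr_comp[OF subset_refl epa w]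
      note uw = glued_arr_comp[OF subset_refl u w]
      have Ko: "ob w (fst K w)" using kw by (rule arr_objD)
      note i = V.ide_arr[OF Ko]
      note eq = V.cmp_arr[OF qa ew]
      \<comment> \<open>the augmentation annihilates \<open>1 - e q\<close>, so this arrow factors through the chains of
        degree \<open>1\<close>, on which \<open>t\<close> vanishes\<close>
      let ?x = "Add (Cat D w) (idn w (fst K w)) (V.neg (fst K w) (fst K w) (e w \<cdot>\<^bsub>w\<^esub> q w))"
      note ne = V.neg_arr[OF eq]
      have x: "ar w (fst K w) (fst K w) ?x" by (rule V.add_arr[OF i ne])
      have "q w \<cdot>\<^bsub>w\<^esub> ?x = Zer (Cat D w) (fst K w) (fst ?A w)"
        by (simp only: V.cmp_add(1)[OF i ne qa] V.cmp_neg(1)[OF eq qa] V.cmp_assoc[OF qa ew qa] qe[OF w]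
          V.cmp_ide[OF qa] V.add_neg(1)[OF qa])
      then have "ep w \<cdot>\<^bsub>w\<^esub> (k w \<cdot>\<^bsub>w\<^esub> ?x) = Zer (Cat D w) (fst K w) (fst ?A w)"
        by (simp only: V.cmp_assoc[OF x kw epw] qw[OF w, symmetric])
      from ex0[OF w V.cmp_arr[OF x kw] this] obtain b
        where b: "ar w (fst K w) (fst (chn 1) w) b" "dif 1 w \<cdot>\<^bsub>w\<^esub> b = k w \<cdot>\<^bsub>w\<^esub> ?x" by blast
      have kuw: "k w \<cdot>\<^bsub>w\<^esub> u w = dif 1 w"
        using fun_cong[OF ku, of w] w by (simp add: glued_sel(1)[OF subset_refl])
      have ub: "u w \<cdot>\<^bsub>w\<^esub> b = ?x"
        by (rule V.kernel_mono[OF KF[OF w] glued_arr_comp[OF subset_refl d0a w] V.cmp_arr[OF b(1) uw] x])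
          (simp only: V.cmp_assoc[OF b(1) uw kw] kuw b(2))
      have tu: "t w \<cdot>\<^bsub>w\<^esub> u w = Zer (Cat D w) (fst (chn 1) w) (fst T w)"
        using fun_cong[OF t(2), of w] w by (simp add: glued_sel(1,4)[OF subset_refl])
      have "t w \<cdot>\<^bsub>w\<^esub> ?x = Zer (Cat D w) (fst K w) (fst T w)"
        by (simp only: ub[symmetric] V.cmp_assoc[OF b(1) uw tw] tu V.cmp_zer(2)[OF b(1) arr_objD(2)[OF tw]])
      then have "Add (Cat D w) (t w) (V.neg (fst K w) (fst T w) (v w \<cdot>\<^bsub>w\<^esub> q w)) = Zer (Cat D w) (fst K w) (fst T w)"
        by (simp only: V.cmp_add(1)[OF i ne tw] V.cmp_neg(1)[OF eq tw] V.cmp_ide(1)[OF tw] V.cmp_assoc[OF qa ew tw] v_def)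
      then show ?thesis using V.diff_zer_eq[OF tw V.cmp_arr[OF qa va[OF w]]] by simp
    qed
    have a: "arr GW ?A T (\<lambda>w\<in>carrier W. v w)" by (rule split_quotient_arr[OF q t(1) e(1) qe va vq])
    moreover have "Cmp GW (\<lambda>w\<in>carrier W. v w) q = t"
      by (rule glued_arr_eqI[OF subset_refl GW.cmp_arr[OF q a] t(1)]) (simp add: glued_sel(1)[OF subset_refl] vq)
    ultimately show "\<exists>v. arr GW ?A T v \<and> Cmp GW v q = t" by blast
  qed
  from GW.isomorphic_trans[OF H[OF this] pull_whole] show ?thesis .
qed

text \<open>There are no chains in degree \<open>n\<close>, so the homology consists of all cycles.\<close>

lemma homology_top_kernel:
  obtains K k where "is_kernel GW (chn (int n - 1)) (chn (int n - 2)) (dif (int n - 1)) K k"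
    "isomorphic GW (chain_homology W n s D A (int n - 1)) K"
proof -
  have e: "int n - 1 - 1 = int n - 2" "int n - 1 + 1 = int n" by simp_all
  obtain K k u where K: "is_kernel GW (chn (int n - 1)) (chn (int n - 2)) (dif (int n - 1)) K k"
    and u: "arr GW (chn (int n)) K u"
    and H: "\<And>Q q. is_cokernel GW (chn (int n)) K u Q q \<Longrightarrow> isomorphic GW (chain_homology W n s D A (int n - 1)) Q"
    by (rule homology_kernel[of "int n - 1", unfolded e]) (rule that)
  note o = arr_objD[OF u]
  have "is_cokernel GW (chn (int n)) K u K (Ide GW K)"
  proof (rule GW.is_cokernelI[OF GW.ide_arr[OF o(2)]])
    show "Cmp GW (Ide GW K) u = Zer GW (chn (int n)) K"
      by (rule chn_zero_source[OF _ GW.cmp_arr[OF u GW.ide_arr[OF o(2)]] GW.zer_arr[OF o]]) simp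
    show "\<exists>v. arr GW K T v \<and> Cmp GW v (Ide GW K) = t" if "arr GW K T t" for T t
      using that GW.cmp_ide(1)[OF that] by blast
    show "v = v'" if "arr GW K T v" "arr GW K T v'" "Cmp GW v (Ide GW K) = Cmp GW v' (Ide GW K)" for T v v'
      using that GW.cmp_ide(1)[OF that(1)] GW.cmp_ide(1)[OF that(2)] by simp
  qed
  from that[OF K H[OF this]] show ?thesis .
qed

subsection \<open>Signs\<close>

lemma PhA_neg:
  assumes "w \<in> carrier W" "v \<in> carrier W" "ar v X Y f" "u = w \<otimes> v"
  shows "PhA D w v (inv\<^bsub>hom_group (Cat D v) X Y\<^esub> f) =
    inv\<^bsub>hom_group (Cat D u) (PhO D w v X) (PhO D w v Y)\<^esub> (PhA D w v f)"
proof -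
  interpret V: preadditive_category "Cat D v" by (rule C_pre[OF assms(2)])
  interpret U: preadditive_category "Cat D u" by (rule C_pre) (use assms in simp)
  show ?thesis
    by (rule U.neg_unique[OF PhA_ar[OF assms] PhA_ar[OF assms(1,2) V.neg_arr[OF assms(3)] assms(4)]])
      (simp only: PhA_add[OF assms(1,2,3) V.neg_arr[OF assms(3)] assms(4), symmetric] V.add_neg(1)[OF assms(3)]
        PhA_zer[OF assms(1,2) arr_objD[OF assms(3)] assms(4)])
qed

text \<open>The analogue of \<open>signed\<close> in the components.\<close>

definition sg :: "'w \<Rightarrow> bool \<Rightarrow> 'o \<Rightarrow> 'o \<Rightarrow> 'm \<Rightarrow> 'm" where
  "sg w b X Y f = (if b then f else inv\<^bsub>hom_group (Cat D w) X Y\<^esub> f)"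

lemma sg_arr: "w \<in> carrier W \<Longrightarrow> ar w X Y f \<Longrightarrow> ar w X Y (sg w b X Y f)"
  by (simp add: sg_def preadditive_category.neg_arr[OF C_pre])

lemma sg_cmp:
  assumes "w \<in> carrier W" "ar w X Y f" "ar w Y Z g"
  shows "g \<cdot>\<^bsub>w\<^esub> sg w b X Y f = sg w b X Z (g \<cdot>\<^bsub>w\<^esub> f)" "sg w b Y Z g \<cdot>\<^bsub>w\<^esub> f = sg w b X Z (g \<cdot>\<^bsub>w\<^esub> f)"
  by (simp_all add: sg_def preadditive_category.cmp_neg[OF C_pre[OF assms(1)] assms(2,3)])

lemma sg_sg:
  assumes "w \<in> carrier W" "ar w X Y f"
  shows "sg w b X Y (sg w b' X Y f) = sg w (b = b') X Y f"
  using preadditive_category.neg_neg[OF C_pre[OF assms(1)] assms(2)] by (simp add: sg_def)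

lemma sg_iso:
  assumes "w \<in> carrier W" "ar w X Y f" "is_iso (Cat D w) X Y f"
  shows "is_iso (Cat D w) X Y (sg w b X Y f)"
  using preadditive_category.is_iso_neg[OF C_pre[OF assms(1)] assms(3,2)] assms(3) by (simp add: sg_def)

lemma PhA_sg:
  assumes "w \<in> carrier W" "v \<in> carrier W" "ar v X Y f" "u = w \<otimes> v"
  shows "PhA D w v (sg v b X Y f) = sg u b (PhO D w v X) (PhO D w v Y) (PhA D w v f)"
  using PhA_neg[OF assms] by (simp add: sg_def)

lemma sg_sum_zero:
  assumes w: "w \<in> carrier W" and f: "ar w X Y f" and g: "ar w X Y g"
  shows "Add (Cat D w) (sg w b X Y f) (sg w b X Y g) = Zer (Cat D w) X Y \<longleftrightarrow> f = sg w False X Y g"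
proof -
  interpret V: preadditive_category "Cat D w" by (rule C_pre[OF w])
  have iff: "Add (Cat D w) f g = Zer (Cat D w) X Y \<longleftrightarrow> f = V.neg X Y g"
    if "ar w X Y f" "ar w X Y g" for f g
    using V.neg_unique[OF that(2,1)] V.add_commute[OF that] V.add_neg(2)[OF that(2)] by auto
  show ?thesis
  proof (cases b)
    case True
    then show ?thesis using iff[OF f g] by (simp add: sg_def)
  next
    case False
    have "V.neg X Y f = V.neg X Y (V.neg X Y g) \<longleftrightarrow> f = V.neg X Y g"
      using V.neg_neg[OF f] V.neg_neg[OF V.neg_arr[OF g]] by metis
    then show ?thesis using False iff[OF V.neg_arr[OF f] V.neg_arr[OF g]] by (simp add: sg_def)
  qed
qed

subsection \<open>Cycles of top degree\<close>

abbreviation top :: "'w \<Rightarrow> nat set \<times> 'w set" where "top x \<equiv> ({1..n}, {x})"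
abbreviation Ntop :: int where "Ntop \<equiv> int n - 1"

lemma par_top: "par {1..n} = {\<one>}"
  by (simp add: generate_empty)

lemma pc_top: "pc {1..n} = (\<lambda>x. {x}) ` carrier W"
  unfolding par_cosets_def par_top RCOSETS_def r_coset_def by auto

lemma top_gated: "x \<in> carrier W \<Longrightarrow> gated {x}"
  using pc_gated[of "{x}" "{1..n}"] pc_top by blast

lemma top_gate: "x \<in> carrier W \<Longrightarrow> w \<in> carrier W \<Longrightarrow> gate {x} w = x"
  "x \<in> carrier W \<Longrightarrow> w \<in> carrier W \<Longrightarrow> ngate {x} w = w \<otimes> inv x"
  using gate_in[OF top_gated] by (auto simp: ngate_def)

lemma cells_top: "cells Ntop = top ` carrier W"
proof -
  have "J = {1..n}" if "J \<subseteq> {1..n}" "card J = n" for J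
    using card_subset_eq[of "{1..n}" J] that by simp
  then have "{J. J \<subseteq> {1..n} \<and> int (card J) = int n - 1 + 1} = {{1..n}}" by auto
  then show ?thesis unfolding cells_def using pc_top by auto
qed

lemma par_edge:
  assumes "j \<in> {1..n}" shows "par ({1..n} - {j}) = {\<one>, s j}"
proof -
  have e: "{1..n} - ({1..n} - {j}) = {j}" using assms by auto
  note sj = s_carrier[OF assms] S_sq[OF s_S[OF assms]]
  have "x = \<one> \<or> x = s j" if "x \<in> generate W {s j}" for x
    using that
  proof (induction x rule: generate.induct)
    case (inv h)
    then show ?case using S_inv[OF s_S[OF assms]] by simp
  next
    case (eng h1 h2)
    then show ?case using sj by auto
  qed auto
  moreover have "\<one> \<in> generate W {s j}" "s j \<in> generate W {s j}" by (auto intro: generate.intros)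
  ultimately show ?thesis unfolding e by auto
qed

text \<open>The component at the cell of \<open>x\<close>, moved to the explicit value \<open>FF w x\<close> of the left adjoint.\<close>

definition comp :: "'w \<Rightarrow> 'w \<Rightarrow> 'm \<Rightarrow> 'm" where
  "comp w x t = theta {x} w \<cdot>\<^bsub>w\<^esub> (cprj Ntop (top x) w \<cdot>\<^bsub>w\<^esub> t)"

abbreviation FF :: "'w \<Rightarrow> 'w \<Rightarrow> 'o" where "FF w x \<equiv> PhO D (w \<otimes> inv x) x (fst A x)"

abbreviation F0 where "F0 w \<equiv> PhO D w0 (w0 \<otimes> w) (fst A (w0 \<otimes> w))"

context
  fixes w assumes w: "w \<in> carrier W"
begin

interpretation V: preadditive_category "Cat D w" by (rule C_pre[OF w])

lemma chain_at:
  assumes "i \<ge> 0"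
  shows "V.direct_sum_data (cells i) (\<lambda>c. fst (pull (snd c)) w) (fst (chn i) w) (\<lambda>c. cinc i c w) (\<lambda>c. cprj i c w)"
  using glued_direct_sum_eval[OF subset_refl chain_data_chn[OF assms, unfolded chain_data_def] w] .

lemma Ntop_nonneg: "Ntop \<ge> 0" "Ntop - 1 \<ge> 0" "Ntop \<ge> 1"
  using n2 by auto

lemma top_cell: "x \<in> carrier W \<Longrightarrow> top x \<in> cells Ntop"
  using cells_top by blast

lemma theta_top:
  assumes "x \<in> carrier W"
  shows "ar w (fst (pull {x}) w) (FF w x) (theta {x} w)"
    "is_iso (Cat D w) (fst (pull {x}) w) (FF w x) (theta {x} w)"
  using theta_at[OF top_gated[OF assms] w] by (simp_all only: top_gate[OF assms w])

lemma prj_top: "x \<in> carrier W \<Longrightarrow> ar w (fst (chn Ntop) w) (fst (pull {x}) w) (cprj Ntop (top x) w)"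
  using V.dsd_prj[OF chain_at[OF Ntop_nonneg(1)] top_cell] by simp

lemma comp_ar: "x \<in> carrier W \<Longrightarrow> ar w T (fst (chn Ntop) w) t \<Longrightarrow> ar w T (FF w x) (comp w x t)"
  unfolding comp_def by (rule V.cmp_arr[OF V.cmp_arr[OF _ prj_top] theta_top(1)])

lemma comp_ext:
  assumes t: "ar w T (fst (chn Ntop) w) t" "ar w T (fst (chn Ntop) w) t'"
    and eq: "\<And>x. x \<in> carrier W \<Longrightarrow> comp w x t = comp w x t'"
  shows "t = t'"
proof (rule V.dsd_ext[OF chain_at[OF Ntop_nonneg(1)] t])
  fix c assume "c \<in> cells Ntop"
  then obtain x where x: "x \<in> carrier W" "c = top x" using cells_top by blast
  show "cprj Ntop c w \<cdot>\<^bsub>w\<^esub> t = cprj Ntop c w \<cdot>\<^bsub>w\<^esub> t'"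
    unfolding x(2)
    by (rule V.iso_cancel_left[OF theta_top(2,1)[OF x(1)] V.cmp_arr[OF t(1) prj_top[OF x(1)]]
        V.cmp_arr[OF t(2) prj_top[OF x(1)]] eq[OF x(1), unfolded comp_def]])
qed

lemma comp_cmp:
  assumes "x \<in> carrier W" "ar w T (fst (chn Ntop) w) t" "ar w U T u"
  shows "comp w x (t \<cdot>\<^bsub>w\<^esub> u) = comp w x t \<cdot>\<^bsub>w\<^esub> u"
  unfolding comp_def
  by (simp only: V.cmp_assoc[OF assms(3,2) prj_top[OF assms(1)]]
    V.cmp_assoc[OF assms(3) V.cmp_arr[OF assms(2) prj_top[OF assms(1)]] theta_top(1)[OF assms(1)]])

lemma edge_transition:
  assumes x: "x \<in> carrier W" and j: "j \<in> {1..n}" and less: "len (w \<otimes> inv x) < len (w \<otimes> inv x \<otimes> s j)"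
  shows "additive (w \<otimes> inv x) (s j)" "w \<otimes> inv x \<otimes> s j = w \<otimes> inv (s j \<otimes> x)" "x = s j \<otimes> (s j \<otimes> x)"
    "ar w (FF w (s j \<otimes> x)) (FF w x) (trn A (w \<otimes> inv x) (s j) (s j \<otimes> x))"
proof -
  note sj = s_carrier[OF j] s_S[OF j]
  have g: "w \<otimes> inv x \<in> carrier W" using w x by simp
  show add: "additive (w \<otimes> inv x) (s j)"
    unfolding additive_def len_S[OF sj(2)] using len_mult_S[OF g sj(2)] less by linarith
  show e: "w \<otimes> inv x \<otimes> s j = w \<otimes> inv (s j \<otimes> x)"
    using w x sj(1) S_inv[OF sj(2)] by (simp add: inv_mult_group m_assoc)
  show xx: "x = s j \<otimes> (s j \<otimes> x)" using x sj(1) S_sq[OF sj(2)] by (simp add: m_assoc[symmetric])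
  show "ar w (FF w (s j \<otimes> x)) (FF w x) (trn A (w \<otimes> inv x) (s j) (s j \<otimes> x))"
    by (rule trn_ar[OF subset_refl A g sj(1) _ x add xx e[symmetric]]) (use x sj w in \<open>simp_all add: m_assoc\<close>)
qed

lemma edge_cell:
  assumes x: "x \<in> carrier W" and j: "j \<in> {1..n}" and less: "len (w \<otimes> inv x) < len (w \<otimes> inv x \<otimes> s j)"
  defines "J \<equiv> {1..n} - {j}" and "Q \<equiv> par ({1..n} - {j}) #> x"
  shows "(J, Q) \<in> cells (Ntop - 1)" "Q = {x, s j \<otimes> x}" "gate Q w = x" "ngate Q w = w \<otimes> inv x"
proof -
  note sj = s_carrier[OF j]
  have g: "w \<otimes> inv x \<in> carrier W" and xe: "inv (w \<otimes> inv x) \<otimes> w = x"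
    using w x by (simp_all add: inv_mult_group m_assoc)
  have less': "len (w \<otimes> inv x) < len (w \<otimes> inv x \<otimes> s k)" if "k \<in> {1..n} - J" for k
    using that less by (auto simp: J_def)
  note gn = gate_no_descent[OF g less' w, unfolded xe]
  have "Q \<in> pc J" "gate Q w = x" "ngate Q w = w \<otimes> inv x" using gn unfolding Q_def J_def by blast+
  then show "(J, Q) \<in> cells (Ntop - 1)" "gate Q w = x" "ngate Q w = w \<otimes> inv x"
    using card_remove[OF subset_refl j] unfolding cells_iff J_def by auto
  show "Q = {x, s j \<otimes> x}" unfolding Q_def par_edge[OF j] using x by (auto simp: r_coset_def)
qed

text \<open>Only the cells of \<open>x\<close> and of \<open>s\<^sub>j x\<close> lie below the coset \<open>{x, s\<^sub>j x}\<close>, and with the same sign.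
  Seen from \<open>w\<close>, the gate of this coset is \<open>x\<close>. Hence the canonical morphism from \<open>x\<close> is the
  identity on explicit values, and the one from \<open>s\<^sub>j x\<close> is a transition morphism.\<close>

lemma edge_condition:
  assumes x: "x \<in> carrier W" and j: "j \<in> {1..n}" and less: "len (w \<otimes> inv x) < len (w \<otimes> inv x \<otimes> s j)"
    and t: "ar w T (fst (chn Ntop) w) t"
  defines "c0 \<equiv> ({1..n} - {j}, par ({1..n} - {j}) #> x)"
  shows "cprj (Ntop - 1) c0 w \<cdot>\<^bsub>w\<^esub> (dif Ntop w \<cdot>\<^bsub>w\<^esub> t) = Zer (Cat D w) T (fst (pull (snd c0)) w) \<longleftrightarrow>
    comp w x t = sg w False T (FF w x) (trn A (w \<otimes> inv x) (s j) (s j \<otimes> x) \<cdot>\<^bsub>w\<^esub> comp w (s j \<otimes> x) t)"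
proof -
  let ?Q = "par ({1..n} - {j}) #> x" and ?y = "s j \<otimes> x" and ?g = "w \<otimes> inv x"
  note sj = s_carrier[OF j] s_S[OF j]
  note ec = edge_cell[OF x j less] note et = edge_transition[OF x j less]
  have y: "?y \<in> carrier W" using x sj by simp
  have xy: "x \<noteq> ?y"
  proof
    assume "x = ?y"
    then have "s j = \<one>" using x sj(1) by (metis r_cancel_one)
    then show False using S_not_one[OF sj(2)] by simp
  qed
  have c0: "c0 \<in> cells (Ntop - 1)" "fst c0 = {1..n} - {j}" "snd c0 = ?Q" using ec(1) by (simp_all add: c0_def)
  note S1 = chain_at[OF Ntop_nonneg(1)] note S0 = chain_at[OF Ntop_nonneg(2)]
  note p0 = V.dsd_prj[OF S0 c0(1)]
  note dw = glued_arr_comp[OF subset_refl dif_arr[of Ntop] w]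
  define f where "f = cprj (Ntop - 1) c0 w \<cdot>\<^bsub>w\<^esub> dif Ntop w"
  have f: "ar w (fst (chn Ntop) w) (fst (pull ?Q) w) f" unfolding f_def using V.cmp_arr[OF dw p0] by (simp only: c0(3))
  have ent: "f \<cdot>\<^bsub>w\<^esub> cinc Ntop c w = entry c c0 w" if c: "c \<in> cells Ntop" for c
  proof -
    have "Cmp GW (cprj (Ntop - 1) c0) (Cmp GW (dif Ntop) (cinc Ntop c)) = entry c c0"
      using diff_data_dif[OF Ntop_nonneg(3)] c c0(1) unfolding diff_data_def by blast
    from fun_cong[OF this, of w]
    have "cprj (Ntop - 1) c0 w \<cdot>\<^bsub>w\<^esub> (dif Ntop w \<cdot>\<^bsub>w\<^esub> cinc Ntop c w) = entry c c0 w"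
      using w by (simp add: glued_sel(1)[OF subset_refl])
    then show ?thesis by (simp only: f_def V.cmp_assoc[OF V.dsd_inc[OF S1 c] dw p0])
  qed
  have gQ: "gated ?Q" using cells_gated[OF c0(1)] by (simp only: c0(3))
  have di: "{1..n} - ({1..n} - {j}) = {j}" using j by auto
  define b where "b = even_at {1..n} j"
  have val: "entry (top z) c0 w = sg w b (fst (pull {z}) w) (fst (pull ?Q) w) (canon {z} ?Q w)"
    if z: "z \<in> carrier W" "{z} \<subseteq> ?Q" for z
  proof -
    have "entry (top z) c0 = signed b {z} ?Q (canon {z} ?Q)" using z(2) di by (simp add: entry_def c0(2,3) b_def)
    then show ?thesis
      using neg_eval[OF canon_arr[OF top_gated[OF z(1)] gQ z(2)] w] by (simp add: signed_def sg_def)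
  qed
  have xQ: "{x} \<subseteq> ?Q" and yQ: "{?y} \<subseteq> ?Q" using ec(2) by auto
  note cx = glued_arr_comp[OF subset_refl canon_arr[OF top_gated[OF x] gQ xQ] w]
  note cy = glued_arr_comp[OF subset_refl canon_arr[OF top_gated[OF y] gQ yQ] w]
  note tx = V.cmp_arr[OF t prj_top[OF x]] note ty = V.cmp_arr[OF t prj_top[OF y]]
  have thQ: "ar w (fst (pull ?Q) w) (FF w x) (theta ?Q w)" "is_iso (Cat D w) (fst (pull ?Q) w) (FF w x) (theta ?Q w)"
    using theta_at[OF gQ w] by (simp_all only: ec(3,4))
  note thx = theta_top[OF x] note thy = theta_top[OF y]
  have ex: "theta ?Q w \<cdot>\<^bsub>w\<^esub> canon {x} ?Q w = theta {x} w"
  proof -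
    have g: "?g \<in> carrier W" "w = ?g \<otimes> x" using w x by (simp_all add: m_assoc)
    show ?thesis
      using canon_eval[OF top_gated[OF x] gQ xQ w] x
      by (simp only: ec(3,4) top_gate[OF x w] r_inv trn_one[OF subset_refl A g(1) x g(2)] V.cmp_ide(2)[OF thx(1)])
  qed
  have yx: "x \<otimes> inv ?y = s j" using x sj S_inv[OF sj(2)] by (simp add: inv_mult_group m_assoc mult_cancel)
  have ey: "theta ?Q w \<cdot>\<^bsub>w\<^esub> canon {?y} ?Q w = trn A ?g (s j) ?y \<cdot>\<^bsub>w\<^esub> theta {?y} w"
    using canon_eval[OF top_gated[OF y] gQ yQ w] by (simp only: ec(3,4) top_gate[OF y w] yx)
  define a where "a = canon {x} ?Q w \<cdot>\<^bsub>w\<^esub> (cprj Ntop (top x) w \<cdot>\<^bsub>w\<^esub> t)"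
  define a' where "a' = canon {?y} ?Q w \<cdot>\<^bsub>w\<^esub> (cprj Ntop (top ?y) w \<cdot>\<^bsub>w\<^esub> t)"
  have aa: "ar w T (fst (pull ?Q) w) a" "ar w T (fst (pull ?Q) w) a'"
    unfolding a_def a'_def by (rule V.cmp_arr[OF tx cx], rule V.cmp_arr[OF ty cy])
  have ta: "theta ?Q w \<cdot>\<^bsub>w\<^esub> a = comp w x t"
    by (simp only: a_def V.cmp_assoc[OF tx cx thQ(1)] ex comp_def)
  have ta': "theta ?Q w \<cdot>\<^bsub>w\<^esub> a' = trn A ?g (s j) ?y \<cdot>\<^bsub>w\<^esub> comp w ?y t"
    by (simp only: a'_def V.cmp_assoc[OF ty cy thQ(1)] ey V.cmp_assoc[OF ty thy(1) et(4), symmetric] comp_def)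
  have "f \<cdot>\<^bsub>w\<^esub> t = Add (Cat D w) ((f \<cdot>\<^bsub>w\<^esub> cinc Ntop (top x) w) \<cdot>\<^bsub>w\<^esub> (cprj Ntop (top x) w \<cdot>\<^bsub>w\<^esub> t))
      ((f \<cdot>\<^bsub>w\<^esub> cinc Ntop (top ?y) w) \<cdot>\<^bsub>w\<^esub> (cprj Ntop (top ?y) w \<cdot>\<^bsub>w\<^esub> t))"
  proof (rule V.dsd_expand_pair[OF S1 t f top_cell[OF x] top_cell[OF y]])
    show "top x \<noteq> top ?y" using xy by simp
    fix c assume c: "c \<in> cells Ntop" "c \<noteq> top x" "c \<noteq> top ?y"
    obtain z where z: "z \<in> carrier W" "c = top z" using c(1) cells_top by blast
    have "\<not> {z} \<subseteq> ?Q" using c(2,3) z(2) ec(2) by auto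
    then have "entry c c0 = Zer GW (pull (snd c)) (pull ?Q)" by (simp add: entry_def c0(2,3) z(2))
    then show "f \<cdot>\<^bsub>w\<^esub> cinc Ntop c w = Zer (Cat D w) (fst (pull (snd c)) w) (fst (pull ?Q) w) \<or>
        cprj Ntop c w \<cdot>\<^bsub>w\<^esub> t = Zer (Cat D w) T (fst (pull (snd c)) w)"
      using ent[OF c(1)] w by (simp add: glued_sel(4)[OF subset_refl])
  qed
  also have "\<dots> = Add (Cat D w) (sg w b T (fst (pull ?Q) w) a) (sg w b T (fst (pull ?Q) w) a')"
    by (simp only: ent[OF top_cell[OF x]] ent[OF top_cell[OF y]] val[OF x xQ] val[OF y yQ]
      sg_cmp(2)[OF w tx cx] sg_cmp(2)[OF w ty cy] a_def a'_def)
  finally have "f \<cdot>\<^bsub>w\<^esub> t = Zer (Cat D w) T (fst (pull ?Q) w) \<longleftrightarrow> a = sg w False T (fst (pull ?Q) w) a'"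
    using sg_sum_zero[OF w aa] by simp
  also have "a = sg w False T (fst (pull ?Q) w) a' \<longleftrightarrow>
      theta ?Q w \<cdot>\<^bsub>w\<^esub> a = theta ?Q w \<cdot>\<^bsub>w\<^esub> sg w False T (fst (pull ?Q) w) a'"
    using V.iso_cancel_left[OF thQ(2,1) aa(1) sg_arr[OF w aa(2)]] by auto
  also have "\<dots> \<longleftrightarrow> comp w x t = sg w False T (FF w x) (trn A ?g (s j) ?y \<cdot>\<^bsub>w\<^esub> comp w ?y t)"
    by (simp only: ta sg_cmp(1)[OF w aa(2) thQ(1)] ta')
  finally show ?thesis by (simp only: f_def V.cmp_assoc[OF t dw p0] c0(3))
qed

lemma cycle_iff:
  assumes t: "ar w T (fst (chn Ntop) w) t"
  shows "dif Ntop w \<cdot>\<^bsub>w\<^esub> t = Zer (Cat D w) T (fst (chn (Ntop - 1)) w) \<longleftrightarrow>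
    (\<forall>x\<in>carrier W. \<forall>j\<in>{1..n}. len (w \<otimes> inv x) < len (w \<otimes> inv x \<otimes> s j) \<longrightarrow>
      comp w x t = sg w False T (FF w x) (trn A (w \<otimes> inv x) (s j) (s j \<otimes> x) \<cdot>\<^bsub>w\<^esub> comp w (s j \<otimes> x) t))"
    (is "?L \<longleftrightarrow> ?R")
proof
  note S0 = chain_at[OF Ntop_nonneg(2)]
  have T: "ob w T" using t by (rule arr_objD)
  note dw = glued_arr_comp[OF subset_refl dif_arr[of Ntop] w]
  note z = V.zer_arr[OF T arr_objD(2)[OF dw]]
  show "?L \<Longrightarrow> ?R"
  proof (intro ballI impI)
    fix x j assume L: ?L and x: "x \<in> carrier W" and j: "j \<in> {1..n}" and less: "len (w \<otimes> inv x) < len (w \<otimes> inv x \<otimes> s j)"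
    note p0 = V.dsd_prj[OF S0 edge_cell(1)[OF x j less]]
    show "comp w x t = sg w False T (FF w x) (trn A (w \<otimes> inv x) (s j) (s j \<otimes> x) \<cdot>\<^bsub>w\<^esub> comp w (s j \<otimes> x) t)"
      by (rule edge_condition[OF x j less t, THEN iffD1]) (simp only: L V.cmp_zer(1)[OF p0 T])
  qed
  show "?R \<Longrightarrow> ?L"
  proof (rule V.dsd_ext[OF S0 V.cmp_arr[OF t dw] z])
    fix c0 assume R: ?R and c0: "c0 \<in> cells (Ntop - 1)"
    obtain J Q where cc: "c0 = (J, Q)" by fastforce
    have J: "J \<subseteq> {1..n}" "int (card J) = int n - 1" "Q \<in> pc J" using c0 by (auto simp: cc cells_iff)
    have fin: "finite J" using J(1) finite_subset by blast
    have "card ({1..n} - J) = 1" using card_Diff_subset[OF fin J(1)] J(2) n2 by simp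
    then obtain j where j: "{1..n} - J = {j}" using card_1_singletonE by blast
    have jm: "j \<in> {1..n} - J" and jn: "j \<in> {1..n}" "J = {1..n} - {j}" using j J(1) by blast+
    define x where "x = gate Q w"
    have x: "x \<in> Q" "x \<in> carrier W" unfolding x_def using gate_facts[OF pc_gated[OF J(3)] w] by auto
    have less: "len (w \<otimes> inv x) < len (w \<otimes> inv x \<otimes> s j)"
      using no_descent[OF J(3) w jm] by (simp add: ngate_def x_def)
    have e: "c0 = ({1..n} - {j}, par ({1..n} - {j}) #> x)" using pc_eq[OF J(3) x(1)] jn(2) by (simp add: cc)
    note p0 = V.dsd_prj[OF S0 c0]
    have "cprj (Ntop - 1) c0 w \<cdot>\<^bsub>w\<^esub> (dif Ntop w \<cdot>\<^bsub>w\<^esub> t) = Zer (Cat D w) T (fst (pull (snd c0)) w)"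
      unfolding e by (rule edge_condition[OF x(2) jn(1) less t, THEN iffD2]) (use R x(2) jn(1) less in blast)
    then show "cprj (Ntop - 1) c0 w \<cdot>\<^bsub>w\<^esub> (dif Ntop w \<cdot>\<^bsub>w\<^esub> t) =
        cprj (Ntop - 1) c0 w \<cdot>\<^bsub>w\<^esub> Zer (Cat D w) T (fst (chn (Ntop - 1)) w)"
      by (simp only: V.cmp_zer(1)[OF p0 T])
  qed
qed

text \<open>The transition morphism from the component at \<open>w\<^sub>0 w\<close>, the element that is carried to \<open>w\<close> by
  \<open>w\<^sub>0\<close>, to the one at \<open>x\<close>.\<close>

definition from_top :: "'w \<Rightarrow> 'm" where
  "from_top x = trn A (w \<otimes> inv x) (x \<otimes> inv w \<otimes> w0) (w0 \<otimes> w)"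

abbreviation top_sign :: "'w \<Rightarrow> bool" where "top_sign x \<equiv> even (len w0 + len (w \<otimes> inv x))"

lemma from_top_facts:
  assumes x: "x \<in> carrier W"
  shows "additive (w \<otimes> inv x) (x \<otimes> inv w \<otimes> w0)" "w \<otimes> inv x \<otimes> (x \<otimes> inv w \<otimes> w0) = w0"
    "x = x \<otimes> inv w \<otimes> w0 \<otimes> (w0 \<otimes> w)" "w = w \<otimes> inv x \<otimes> x"
    "ar w (F0 w) (FF w x) (from_top x)"
proof -
  note c = w0_carrier
  have g: "w \<otimes> inv x \<in> carrier W" using w x by simp
  have m: "inv (w \<otimes> inv x) \<otimes> w0 = x \<otimes> inv w \<otimes> w0" using w x c by (simp add: inv_mult_group)
  show mm: "w \<otimes> inv x \<otimes> (x \<otimes> inv w \<otimes> w0) = w0" using w x c by (simp add: m_assoc mult_cancel)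
  show add: "additive (w \<otimes> inv x) (x \<otimes> inv w \<otimes> w0)"
    unfolding additive_def mm using w0_additive[OF g] unfolding m .
  have "w0 \<otimes> (w0 \<otimes> w) = w" using w c w0_sq by (simp add: m_assoc[symmetric])
  then show q: "x = x \<otimes> inv w \<otimes> w0 \<otimes> (w0 \<otimes> w)" using w x c by (simp add: m_assoc)
  show ww: "w = w \<otimes> inv x \<otimes> x" using w x by (simp add: m_assoc)
  show "ar w (F0 w) (FF w x) (from_top x)"
    unfolding from_top_def
    by (rule trn_ar[OF subset_refl A g _ _ x add q mm[symmetric] ww]) (use w x c in simp_all)
qed

lemma from_top_top: "from_top (w0 \<otimes> w) = idn w (F0 w)" "w \<otimes> inv (w0 \<otimes> w) = w0"
proof -
  note c = w0_carrier
  show e: "w \<otimes> inv (w0 \<otimes> w) = w0" using w c w0_inv by (simp add: inv_mult_group m_assoc[symmetric])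
  have m: "w0 \<otimes> w \<otimes> inv w \<otimes> w0 = \<one>" using w c w0_sq by (simp add: m_assoc mult_cancel)
  have ww: "w = w0 \<otimes> (w0 \<otimes> w)" using w c w0_sq by (simp add: m_assoc[symmetric])
  show "from_top (w0 \<otimes> w) = idn w (F0 w)"
    unfolding from_top_def e m by (rule trn_one[OF subset_refl A c _ ww]) (use w c in simp)
qed

lemma from_top_step:
  assumes x: "x \<in> carrier W" and j: "j \<in> {1..n}" and less: "len (w \<otimes> inv x) < len (w \<otimes> inv x \<otimes> s j)"
  shows "from_top x = trn A (w \<otimes> inv x) (s j) (s j \<otimes> x) \<cdot>\<^bsub>w\<^esub> from_top (s j \<otimes> x)"
proof -
  note sj = s_carrier[OF j] s_S[OF j] note c = w0_carrier
  note et = edge_transition[OF x j less]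
  have y: "s j \<otimes> x \<in> carrier W" using x sj by simp
  have ab: "s j \<otimes> (s j \<otimes> x \<otimes> inv w \<otimes> w0) = x \<otimes> inv w \<otimes> w0"
    using x w c sj S_inv[OF sj(2)] mult_cancel(1)[OF sj(1)] by (simp add: m_assoc)
  have g: "w \<otimes> inv x \<in> carrier W" using w x by simp
  have "trn A (w \<otimes> inv x) (s j \<otimes> (s j \<otimes> x \<otimes> inv w \<otimes> w0)) (w0 \<otimes> w) =
      trn A (w \<otimes> inv x) (s j) (s j \<otimes> x) \<cdot>\<^bsub>w\<^esub> trn A (w \<otimes> inv (s j \<otimes> x)) (s j \<otimes> x \<otimes> inv w \<otimes> w0) (w0 \<otimes> w)"
    by (rule trn_comp[OF subset_refl A g sj(1) _ _ y x et(1) _ from_top_facts(3)[OF y] et(3) et(2)[symmetric]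
          from_top_facts(4)[OF x] from_top_facts(1)[OF y]])
      (use x w c sj from_top_facts(1)[OF x] in \<open>simp_all add: ab\<close>)
  then show ?thesis by (simp only: ab from_top_def)
qed

lemma top_sign_step:
  assumes x: "x \<in> carrier W" and j: "j \<in> {1..n}" and less: "len (w \<otimes> inv x) < len (w \<otimes> inv x \<otimes> s j)"
  shows "top_sign x \<longleftrightarrow> \<not> top_sign (s j \<otimes> x)"
  using edge_transition(1,2)[OF x j less] unfolding additive_def len_S[OF s_S[OF j]] by simp

text \<open>Follow ascents from \<open>w x\<inverse>\<close> up to \<open>w\<^sub>0\<close>. Each of them contributes a transition morphism, which
  compose by \<open>from_top_step\<close>, and a sign.\<close>

lemma cycle_formula:
  assumes t: "ar w T (fst (chn Ntop) w) t" and dt: "dif Ntop w \<cdot>\<^bsub>w\<^esub> t = Zer (Cat D w) T (fst (chn (Ntop - 1)) w)"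
    and x: "x \<in> carrier W"
  shows "comp w x t = sg w (top_sign x) T (FF w x) (from_top x \<cdot>\<^bsub>w\<^esub> comp w (w0 \<otimes> w) t)"
  using x
proof (induction "len w0 - len (w \<otimes> inv x)" arbitrary: x rule: less_induct)
  case less
  note x = less.prems
  note c = w0_carrier
  have w0w: "w0 \<otimes> w \<in> carrier W" using w c by simp
  have g: "w \<otimes> inv x \<in> carrier W" using w x by simp
  note top = comp_ar[OF w0w t, unfolded from_top_top(2)]
  show ?case
  proof (cases "\<exists>j\<in>{1..n}. len (w \<otimes> inv x) < len (w \<otimes> inv x \<otimes> s j)")
    case False
    have "w \<otimes> inv x = w0"
    proof (rule all_descents[OF g])
      fix k assume k: "k \<in> S"
      obtain j where "j \<in> {1..n}" "k = s j" using s_surj[OF k] by blast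
      then have "\<not> len (w \<otimes> inv x) < len (w \<otimes> inv x \<otimes> k)" using False by blast
      then show "len (w \<otimes> inv x \<otimes> k) < len (w \<otimes> inv x)" using len_mult_S[OF g k] by linarith
    qed
    then have "inv (w \<otimes> inv x) \<otimes> w = w0 \<otimes> w" by (simp add: w0_inv)
    then have xe: "x = w0 \<otimes> w" using w x by (simp add: inv_mult_group m_assoc)
    show ?thesis unfolding xe from_top_top by (simp add: V.cmp_ide(2)[OF top] sg_def)
  next
    case True
    then obtain j where j: "j \<in> {1..n}" "len (w \<otimes> inv x) < len (w \<otimes> inv x \<otimes> s j)" by blast
    note sj = s_carrier[OF j(1)] s_S[OF j(1)]
    note et = edge_transition[OF x j]
    have y: "s j \<otimes> x \<in> carrier W" using x sj by simp
    have "len (w \<otimes> inv (s j \<otimes> x)) \<le> len w0" by (rule w0_max) (use w y in simp)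
    then have "len w0 - len (w \<otimes> inv (s j \<otimes> x)) < len w0 - len (w \<otimes> inv x)" using j(2) et(2) by simp
    note IH = less.hyps[OF this y]
    note Ty = from_top_facts(5)[OF y]
    note Tt = V.cmp_arr[OF top Ty]
    have "comp w x t = sg w False T (FF w x) (trn A (w \<otimes> inv x) (s j) (s j \<otimes> x) \<cdot>\<^bsub>w\<^esub> comp w (s j \<otimes> x) t)"
      using cycle_iff[OF t] dt x j by blast
    also have "\<dots> = sg w False T (FF w x) (sg w (top_sign (s j \<otimes> x)) T (FF w x) (from_top x \<cdot>\<^bsub>w\<^esub> comp w (w0 \<otimes> w) t))"
      by (simp only: IH sg_cmp(1)[OF w Tt et(4)] V.cmp_assoc[OF top Ty et(4)] from_top_step[OF x j, symmetric])
    also have "\<dots> = sg w (top_sign x) T (FF w x) (from_top x \<cdot>\<^bsub>w\<^esub> comp w (w0 \<otimes> w) t)"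
      using sg_sg[OF w V.cmp_arr[OF top from_top_facts(5)[OF x]]] top_sign_step[OF x j] by simp
    finally show ?thesis .
  qed
qed

text \<open>The right-hand side of \<open>cycle_formula\<close>, read as a definition with the identity at \<open>w\<^sub>0 w\<close>,
  satisfies the conditions of \<open>cycle_iff\<close>, again by \<open>from_top_step\<close>.\<close>

lemma top_cycle:
  obtains t where "ar w (F0 w) (fst (chn Ntop) w) t" "dif Ntop w \<cdot>\<^bsub>w\<^esub> t = Zer (Cat D w) (F0 w) (fst (chn (Ntop - 1)) w)"
    "\<And>x. x \<in> carrier W \<Longrightarrow> comp w x t = sg w (top_sign x) (F0 w) (FF w x) (from_top x)"
proof -
  have w0w: "w0 \<otimes> w \<in> carrier W" using w w0_carrier by simp
  have F0: "ob w (F0 w)" using from_top_facts(5)[OF w0w] by (rule arr_objD)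
  define f where "f c = inv_arr (Cat D w) (fst (pull (snd c)) w) (FF w (the_elem (snd c))) (theta (snd c) w) \<cdot>\<^bsub>w\<^esub>
      sg w (top_sign (the_elem (snd c))) (F0 w) (FF w (the_elem (snd c))) (from_top (the_elem (snd c)))" for c :: "nat set \<times> 'w set"
  have I: "ar w (FF w x) (fst (pull {x}) w) (inv_arr (Cat D w) (fst (pull {x}) w) (FF w x) (theta {x} w))"
    "theta {x} w \<cdot>\<^bsub>w\<^esub> inv_arr (Cat D w) (fst (pull {x}) w) (FF w x) (theta {x} w) = idn w (FF w x)"
    if x: "x \<in> carrier W" for x
    by (rule V.inv_arr_facts(1)[OF theta_top(2)[OF x] arr_objD[OF theta_top(1)[OF x]]],
        rule V.inv_arr_facts(3)[OF theta_top(2)[OF x] arr_objD[OF theta_top(1)[OF x]]])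
  note sT = sg_arr[OF w from_top_facts(5)]
  have fa: "ar w (F0 w) (fst (pull (snd c)) w) (f c)" if "c \<in> cells Ntop" for c
  proof -
    from that have "c \<in> top ` carrier W" unfolding cells_top .
    then obtain x where x: "c = top x" "x \<in> carrier W" by (rule imageE)
    have "ar w (F0 w) (fst (pull {x}) w) (inv_arr (Cat D w) (fst (pull {x}) w) (FF w x) (theta {x} w) \<cdot>\<^bsub>w\<^esub>
        sg w (top_sign x) (F0 w) (FF w x) (from_top x))" by (rule V.cmp_arr[OF sT[OF x(2)] I(1)[OF x(2)]])
    then show ?thesis
      by (simp only: f_def x(1) snd_conv the_elem_eq)
  qed
  obtain t where t: "ar w (F0 w) (fst (chn Ntop) w) t" "\<And>c. c \<in> cells Ntop \<Longrightarrow> cprj Ntop c w \<cdot>\<^bsub>w\<^esub> t = f c"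
    by (rule V.dsd_tuple[OF chain_at[OF Ntop_nonneg(1)] F0 fa]) simp_all
  have comp: "comp w x t = sg w (top_sign x) (F0 w) (FF w x) (from_top x)" if x: "x \<in> carrier W" for x
  proof -
    have "f (top x) = inv_arr (Cat D w) (fst (pull {x}) w) (FF w x) (theta {x} w) \<cdot>\<^bsub>w\<^esub> sg w (top_sign x) (F0 w) (FF w x) (from_top x)"
      by (simp only: f_def snd_conv the_elem_eq)
    then show ?thesis
      by (simp only: comp_def t(2)[OF top_cell[OF x]] V.cmp_assoc[OF sT[OF x] I(1)[OF x] theta_top(1)[OF x]] I(2)[OF x]
        V.cmp_ide(2)[OF sT[OF x]])
  qed
  have "dif Ntop w \<cdot>\<^bsub>w\<^esub> t = Zer (Cat D w) (F0 w) (fst (chn (Ntop - 1)) w)"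
  proof (rule cycle_iff[OF t(1), THEN iffD2], intro ballI impI)
    fix x j assume x: "x \<in> carrier W" and j: "j \<in> {1..n}" "len (w \<otimes> inv x) < len (w \<otimes> inv x \<otimes> s j)"
    have y: "s j \<otimes> x \<in> carrier W" using x s_carrier[OF j(1)] by simp
    have "sg w False (F0 w) (FF w x) (trn A (w \<otimes> inv x) (s j) (s j \<otimes> x) \<cdot>\<^bsub>w\<^esub> comp w (s j \<otimes> x) t) =
        sg w False (F0 w) (FF w x) (sg w (top_sign (s j \<otimes> x)) (F0 w) (FF w x) (from_top x))"
      by (simp only: comp[OF y] sg_cmp(1)[OF w from_top_facts(5)[OF y] edge_transition(4)[OF x j]] from_top_step[OF x j, symmetric])
    also have "\<dots> = comp w x t"
      by (simp only: sg_sg[OF w from_top_facts(5)[OF x]] top_sign_step[OF x j] comp[OF x]) simp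
    finally show "comp w x t = sg w False (F0 w) (FF w x) (trn A (w \<otimes> inv x) (s j) (s j \<otimes> x) \<cdot>\<^bsub>w\<^esub> comp w (s j \<otimes> x) t)" by (rule HOL.sym)
  qed
  from that[OF t(1) this comp] show ?thesis .
qed

text \<open>The inverse is the arrow to the kernel induced by \<open>top_cycle\<close>.\<close>

lemma top_component_iso:
  assumes K: "is_kernel (Cat D w) (fst (chn Ntop) w) (fst (chn (Ntop - 1)) w) (dif Ntop w) Ko k"
  shows "ar w Ko (F0 w) (comp w (w0 \<otimes> w) k)" "is_iso (Cat D w) Ko (F0 w) (comp w (w0 \<otimes> w) k)"
    "x \<in> carrier W \<Longrightarrow> comp w x k = sg w (top_sign x) Ko (FF w x) (from_top x \<cdot>\<^bsub>w\<^esub> comp w (w0 \<otimes> w) k)"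
proof -
  have w0w: "w0 \<otimes> w \<in> carrier W" using w w0_carrier by simp
  note dw = glued_arr_comp[OF subset_refl dif_arr[of Ntop] w]
  note KF = V.kernel_facts[OF K dw]
  show p: "ar w Ko (F0 w) (comp w (w0 \<otimes> w) k)" using comp_ar[OF w0w KF(1)] unfolding from_top_top(2) .
  have cf: "comp w x k = sg w (top_sign x) Ko (FF w x) (from_top x \<cdot>\<^bsub>w\<^esub> comp w (w0 \<otimes> w) k)" if "x \<in> carrier W" for x
    by (rule cycle_formula[OF KF(1,2) that])
  then show "x \<in> carrier W \<Longrightarrow> comp w x k = sg w (top_sign x) Ko (FF w x) (from_top x \<cdot>\<^bsub>w\<^esub> comp w (w0 \<otimes> w) k)" .
  obtain t where t: "ar w (F0 w) (fst (chn Ntop) w) t" "dif Ntop w \<cdot>\<^bsub>w\<^esub> t = Zer (Cat D w) (F0 w) (fst (chn (Ntop - 1)) w)"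
    "\<And>x. x \<in> carrier W \<Longrightarrow> comp w x t = sg w (top_sign x) (F0 w) (FF w x) (from_top x)" by (rule top_cycle) (rule that)
  obtain v where v: "ar w (F0 w) Ko v" "k \<cdot>\<^bsub>w\<^esub> v = t" using KF(4)[OF t(1,2)] by blast
  have pv: "comp w (w0 \<otimes> w) k \<cdot>\<^bsub>w\<^esub> v = idn w (F0 w)"
  proof -
    have "comp w (w0 \<otimes> w) k \<cdot>\<^bsub>w\<^esub> v = sg w (top_sign (w0 \<otimes> w)) (F0 w) (FF w (w0 \<otimes> w)) (from_top (w0 \<otimes> w))"
      by (simp only: comp_cmp[OF w0w KF(1) v(1), symmetric] v(2) t(3)[OF w0w])
    then show ?thesis unfolding from_top_top by (simp add: sg_def)
  qed
  have vp: "v \<cdot>\<^bsub>w\<^esub> comp w (w0 \<otimes> w) k = idn w Ko"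
  proof (rule KF(3)[OF V.cmp_arr[OF p v(1)] V.ide_arr[OF arr_objD(1)[OF p]]])
    have "t \<cdot>\<^bsub>w\<^esub> comp w (w0 \<otimes> w) k = k"
    proof (rule comp_ext[OF V.cmp_arr[OF p t(1)] KF(1)])
      fix x assume x: "x \<in> carrier W"
      show "comp w x (t \<cdot>\<^bsub>w\<^esub> comp w (w0 \<otimes> w) k) = comp w x k"
        by (simp only: comp_cmp[OF x t(1) p] t(3)[OF x] sg_cmp(2)[OF w p from_top_facts(5)[OF x]] cf[OF x, symmetric])
    qed
    then show "k \<cdot>\<^bsub>w\<^esub> (v \<cdot>\<^bsub>w\<^esub> comp w (w0 \<otimes> w) k) = k \<cdot>\<^bsub>w\<^esub> idn w Ko"
      by (simp only: V.cmp_assoc[OF p v(1) KF(1)] v(2) V.cmp_ide(1)[OF KF(1)])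
  qed
  show "is_iso (Cat D w) Ko (F0 w) (comp w (w0 \<otimes> w) k)" by (rule V.is_isoI[OF p v(1) vp pv])
qed

end

subsection \<open>The functor iota\<close>

abbreviation iota where "iota \<equiv> iota_obj W S D A"

lemma iota_fst: "w \<in> carrier W \<Longrightarrow> fst iota w = F0 w"
  by (simp add: iota_obj_def Let_def)

text \<open>Naturality of \<open>\<nu>\<close> moves \<open>\<Phi>\<^sub>w\<^sub>0(\<alpha>)\<close> past the last step of the braid isomorphism. Inside \<open>\<Phi>\<^sub>g\<close> it
  then meets the inverse of \<open>\<nu>\<close>, and both form a transition morphism.\<close>

lemma iota_alpha:
  assumes h: "g \<in> carrier W" "w \<in> carrier W" "u \<in> carrier W" "u = g \<otimes> w"
  defines "x \<equiv> w0 \<otimes> u" and "c \<equiv> w0 \<otimes> g \<otimes> w0" and "u0 \<equiv> inv g \<otimes> w0"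
  shows "snd iota g w = Nu D g u0 x (fst A x) \<cdot>\<^bsub>u\<^esub> PhA D g w (trn A u0 c (w0 \<otimes> w))"
    "ar u (PhO D g w (F0 w)) (F0 u) (snd iota g w)"
proof -
  note c0 = w0_carrier
  define v where "v = w0 \<otimes> w"
  have cr: "x \<in> carrier W" "c \<in> carrier W" "u0 \<in> carrier W" "v \<in> carrier W"
    using h c0 by (simp_all add: x_def c_def u0_def v_def)
  have sq: "w0 \<otimes> (w0 \<otimes> y) = y" if "y \<in> carrier W" for y using that c0 w0_sq by (simp add: m_assoc[symmetric])
  have e1: "x = c \<otimes> v" using h c0 sq by (simp add: x_def c_def v_def m_assoc)
  have e2: "w0 = u0 \<otimes> c" using h(1) c0 sq by (simp add: u0_def c_def m_assoc mult_cancel)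
  have e3: "w = u0 \<otimes> x" using h c0 sq by (simp add: u0_def x_def m_assoc mult_cancel)
  have e4: "w0 = g \<otimes> u0" using h(1) c0 by (simp add: u0_def mult_cancel)
  have e5: "w0 \<otimes> g \<otimes> w = x" using h c0 by (simp add: x_def m_assoc)
  have e6: "u = w0 \<otimes> x" using h c0 sq by (simp add: x_def)
  have e7': "w0 \<otimes> v = w" using sq[OF h(2)] by (simp add: v_def)
  have add: "additive u0 c"
  proof -
    have "c = inv u0 \<otimes> w0" using h(1) c0 w0_inv by (simp add: c_def u0_def inv_mult_group)
    then show ?thesis using w0_additive[OF cr(3)] e2 by (simp add: additive_def)
  qed
  note oX = glued_ob[OF subset_refl A cr(4)]
  note al = glued_alpha[OF subset_refl A cr(2,4,1) e1]
  note oc = PhO_ob[OF cr(2,4) oX e1]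
  note N = nu_ar[OF cr(3,2,4) oX e1 e2 e3] note Ni = nu_iso[OF cr(3,2,4) oX add e1 e2 e3]
  note I = preadditive_category.inv_arr_facts[OF C_pre[OF h(2)] Ni arr_objD[OF N]]
  let ?I = "inv_arr (Cat D w) (PhO D u0 x (PhO D c v (fst A v))) (PhO D w0 v (fst A v)) (Nu D u0 c v (fst A v))"
  note FI = PhA_ar[OF h(1,2) I(1) h(4)]
  note Fal = PhA_ar[OF cr(3,1) al e3] note FFal = PhA_ar[OF h(1,2) Fal h(4)]
  note Fw = PhA_ar[OF c0 cr(1) al e6]
  note Nc = nu_ar[OF h(1) cr(3,1) oc e3 e4 h(4)]
  note NA = nu_ar[OF h(1) cr(3,1) glued_ob[OF subset_refl A cr(1)] e3 e4 h(4)]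
  have tr: "trn A u0 c v = PhA D u0 x (snd A c v) \<cdot>\<^bsub>w\<^esub> ?I"
    by (simp only: trn_def e7' e1[symmetric] e2[symmetric])
  have br: "braid_iso W S D g w (fst A v) = Nu D g u0 x (PhO D c v (fst A v)) \<cdot>\<^bsub>u\<^esub> PhA D g w ?I"
    by (simp only: braid_iso_def Let_def c_def[symmetric] u0_def[symmetric] v_def[symmetric] e1[symmetric] h(4)[symmetric])
  have "alpha_ix W (carrier W) g w" using h by (simp add: alpha_ix_def)
  then have "snd iota g w = PhA D w0 x (snd A c v) \<cdot>\<^bsub>u\<^esub> braid_iso W S D g w (fst A v)"
    by (simp add: iota_obj_def Let_def e5 c_def[symmetric] v_def[symmetric] h(4)[symmetric])
  also have "\<dots> = (PhA D w0 x (snd A c v) \<cdot>\<^bsub>u\<^esub> Nu D g u0 x (PhO D c v (fst A v))) \<cdot>\<^bsub>u\<^esub> PhA D g w ?I"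
    unfolding br by (rule C_assoc[OF h(3) FI Nc Fw])
  also have "\<dots> = Nu D g u0 x (fst A x) \<cdot>\<^bsub>u\<^esub> (PhA D g w (PhA D u0 x (snd A c v)) \<cdot>\<^bsub>u\<^esub> PhA D g w ?I)"
    by (simp only: nu_nat[OF h(1) cr(3,1) al e3 e4 h(4), symmetric] C_assoc[OF h(3) FI FFal NA])
  also have "\<dots> = Nu D g u0 x (fst A x) \<cdot>\<^bsub>u\<^esub> PhA D g w (trn A u0 c v)"
    by (simp only: tr PhA_cmp[OF h(1,2) I(1) Fal h(4)])
  finally show eq: "snd iota g w = Nu D g u0 x (fst A x) \<cdot>\<^bsub>u\<^esub> PhA D g w (trn A u0 c (w0 \<otimes> w))" by (simp only: v_def)
  have "ar w (PhO D w0 v (fst A v)) (PhO D u0 x (fst A x)) (trn A u0 c v)"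
    unfolding tr by (rule C_cmp_arr[OF h(2) I(1) Fal])
  from C_cmp_arr[OF h(3) PhA_ar[OF h(1,2) this h(4)] NA]
  show "ar u (PhO D g w (F0 w)) (F0 u) (snd iota g w)" unfolding eq by (simp only: v_def x_def)
qed

text \<open>For \<open>x = w\<^sub>0 g w\<close>, the projection of the cycles to the cell of \<open>x\<close> is a morphism \<open>K \<rightarrow> ext {x}\<close>.
  Its component over \<open>g w\<close> is the isomorphism of \<open>top_component_iso\<close>, and its component over \<open>w\<close> is,
  by \<open>cycle_formula\<close>, the isomorphism over \<open>w\<close> followed by a transition morphism and a sign
  depending on \<open>\<ell>(g)\<close>. So its compatibility with the structure morphisms of \<open>g\<close> is, up to this sign,
  the compatibility of these isomorphisms with the structure morphism in \<open>iota_alpha\<close>.\<close>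

lemma kernel_iota:
  assumes K: "is_kernel GW (chn Ntop) (chn (Ntop - 1)) (dif Ntop) K k"
  shows "isomorphic GW K iota"
proof -
  note ka = GW.kernel_arr[OF K dif_arr]
  note Ko = arr_objD(1)[OF ka]
  note Kw = glued_kernel_eval[OF subset_refl dif_arr K]
  define p where "p w = comp w (w0 \<otimes> w) (k w)" for w
  note pf = top_component_iso[OF _ Kw, folded p_def]
  define z where "z x = Cmp GW (Cmp GW (theta {x}) (cprj Ntop (top x))) k" for x
  have za: "arr GW K (ext {x}) (z x)" and zw: "w \<in> carrier W \<Longrightarrow> z x w = comp w x (k w)" if x: "x \<in> carrier W" for x w
  proof -
    have pr: "arr GW (chn Ntop) (pull {x}) (cprj Ntop (top x))"
      using GW.dsd_prj[OF chain_data_chn[OF Ntop_nonneg(1)[OF one_closed], unfolded chain_data_def] top_cell[OF one_closed x]] by simp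
    note th = theta_arr[OF top_gated[OF x]]
    show "arr GW K (ext {x}) (z x)" unfolding z_def by (rule GW.cmp_arr[OF ka GW.cmp_arr[OF pr th]])
    show "z x w = comp w x (k w)" if w: "w \<in> carrier W"
      unfolding z_def GW.cmp_assoc[OF ka pr th, symmetric] comp_def using w by (simp add: glued_sel(1)[OF subset_refl])
  qed
  have pa: "ar w (fst K w) (F0 w) (p w)" and pi: "is_iso (Cat D w) (fst K w) (F0 w) (p w)"
    and pc: "x \<in> carrier W \<Longrightarrow> comp w x (k w) = sg w (even (len w0 + len (w \<otimes> inv x))) (fst K w) (FF w x)
      (from_top w x \<cdot>\<^bsub>w\<^esub> p w)" if w: "w \<in> carrier W" for w x
    using pf[OF w w] by blast+
  \<comment> \<open>the sign that makes the isomorphisms \<open>p w\<close> compatible with the structure morphisms\<close>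
  define q where "q w = sg w (even (len w)) (fst K w) (F0 w) (p w)" for w
  have qa: "ar w (fst K w) (F0 w) (q w)" and qi: "is_iso (Cat D w) (fst K w) (F0 w) (q w)" if w: "w \<in> carrier W" for w
    unfolding q_def using sg_arr[OF w pa[OF w]] sg_iso[OF w pa[OF w] pi[OF w]] by auto
  have sq: "q u \<cdot>\<^bsub>u\<^esub> snd K g w = snd iota g w \<cdot>\<^bsub>u\<^esub> PhA D g w (q w)"
    if h: "g \<in> carrier W" "w \<in> carrier W" "u \<in> carrier W" "u = g \<otimes> w" for g w u
  proof -
    note c0 = w0_carrier
    define x where "x = w0 \<otimes> u"
    define c where "c = w0 \<otimes> g \<otimes> w0"
    define u0 where "u0 = inv g \<otimes> w0"
    have x: "x \<in> carrier W" using h c0 by (simp add: x_def)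
    have sq: "w0 \<otimes> (w0 \<otimes> y) = y" if "y \<in> carrier W" for y using that c0 w0_sq by (simp add: m_assoc[symmetric])
    have e1: "w \<otimes> inv x = u0"
      using h c0 w0_inv by (simp add: x_def u0_def inv_mult_group mult_cancel m_assoc)
    have e2: "x \<otimes> inv w \<otimes> w0 = c" using h c0 by (simp add: x_def c_def m_assoc mult_cancel)
    have e3: "u \<otimes> inv x = w0" unfolding x_def by (rule from_top_top(2)[OF h(3)])
    have e4: "w = u0 \<otimes> x" using from_top_facts(4)[OF h(2) x] e1 by simp
    have u0: "u0 \<in> carrier W" "w0 = g \<otimes> u0" using h(1) c0 by (simp_all add: u0_def mult_cancel)
    have e5: "u = w0 \<otimes> x" using sq[OF h(3)] by (simp add: x_def)
    note oA = glued_ob[OF subset_refl A x]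
    note Tx = from_top_facts(5)[OF h(2) x] 
    note Tp = C_cmp_arr[OF h(2) pa[OF h(2)] Tx]
    note N = nu_ar[OF h(1) u0(1) x oA e4 u0(2) h(4)]
    have ext: "snd (ext {x}) g w = Nu D g u0 x (fst A x)"
    proof -
      have tg: "gate {x} w = x" "gate {x} u = x" "ngate {x} w = u0" "ngate {x} u = w0"
        using top_gate[OF x h(2)] top_gate[OF x h(3)] e1 e3 by simp_all
      have xin: "x \<in> {x}" by simp
      have "snd (ext {x}) g w = trn (res_obj W {x} A) w0 \<one> x \<cdot>\<^bsub>u\<^esub> Nu D g u0 x (fst (res_obj W {x} A) x)"
        using ext_sel(2)[OF top_gated[OF x] gated_sub[OF top_gated[OF x]] subset_refl h, of "res_obj W {x} A"] x
        by (simp only: tg r_inv)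
      also have "\<dots> = trn A w0 \<one> x \<cdot>\<^bsub>u\<^esub> Nu D g u0 x (fst A x)"
        using trn_res[OF c0 one_closed xin xin, of A] x by (simp add: res_sel(1)[OF xin])
      also have "\<dots> = Nu D g u0 x (fst A x)"
        by (simp only: trn_one[OF subset_refl A c0 x e5] C_ide(2)[OF h(3) N])
      finally show ?thesis .
    qed
    have TRe: "from_top w x = trn A u0 c (w0 \<otimes> w)" unfolding from_top_def[OF h(2)] e1 e2 ..
    have par: "even (len w0 + len u0) = even (len g)"
      using w0_additive[OF h(1)] by (auto simp: u0_def)
    have zu: "z x u = p u" unfolding zw[OF x h(3)] by (simp only: p_def x_def)
    have zw': "z x w = sg w (even (len g)) (fst K w) (FF w x) (from_top w x \<cdot>\<^bsub>w\<^esub> p w)"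
      unfolding zw[OF x h(2)] pc[OF h(2) x] by (simp only: e1 par)
    note FT = PhA_ar[OF h(1,2) Tx h(4)] note Fp = PhA_ar[OF h(1,2) pa[OF h(2)] h(4)]
    note io = iota_alpha[OF h, folded x_def c_def u0_def]
    note Fs = C_cmp_arr[OF h(3) Fp FT]
    have N': "ar u (PhO D g w (FF w x)) (F0 u) (Nu D g u0 x (fst A x))"
      unfolding e1 using N by (simp only: x_def[symmetric])
    have "p u \<cdot>\<^bsub>u\<^esub> snd K g w = Nu D g u0 x (fst A x) \<cdot>\<^bsub>u\<^esub> PhA D g w (z x w)"
      using glued_arr_sq[OF subset_refl za[OF x] h] by (simp only: ext zu)
    also have "\<dots> = sg u (even (len g)) (PhO D g w (fst K w)) (F0 u)
        (Nu D g u0 x (fst A x) \<cdot>\<^bsub>u\<^esub> (PhA D g w (from_top w x) \<cdot>\<^bsub>u\<^esub> PhA D g w (p w)))"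
      by (simp only: zw' PhA_sg[OF h(1,2) Tp h(4)] sg_cmp(1)[OF h(3) Fs N'] PhA_cmp[OF h(1,2) pa[OF h(2)] Tx h(4)])
    also have "\<dots> = sg u (even (len g)) (PhO D g w (fst K w)) (F0 u) (snd iota g w \<cdot>\<^bsub>u\<^esub> PhA D g w (p w))"
      by (simp only: io(1) TRe[symmetric] C_assoc[OF h(3) Fp FT N'])
    finally have main: "p u \<cdot>\<^bsub>u\<^esub> snd K g w =
        sg u (even (len g)) (PhO D g w (fst K w)) (F0 u) (snd iota g w \<cdot>\<^bsub>u\<^esub> PhA D g w (p w))" .
    note aK = glued_alpha[OF subset_refl Ko h]
    note ioa = iota_alpha(2)[OF h]
    note ip = C_cmp_arr[OF h(3) Fp ioa]
    have pr: "(even (len u) = even (len g)) = even (len w)"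
      using len_mult_parity[OF h(1,2)] h(4) by auto
    show ?thesis
      unfolding q_def
      by (simp only: sg_cmp(2)[OF h(3) aK pa[OF h(3)]] main sg_sg[OF h(3) ip] pr
        PhA_sg[OF h(1,2) pa[OF h(2)] h(4)] sg_cmp(1)[OF h(3) Fp ioa])
  qed
  define r where "r w = inv_arr (Cat D w) (fst K w) (F0 w) (q w)" for w
  have rf: "ar w (F0 w) (fst K w) (r w)" "r w \<cdot>\<^bsub>w\<^esub> q w = idn w (fst K w)" "q w \<cdot>\<^bsub>w\<^esub> r w = idn w (F0 w)"
    if w: "w \<in> carrier W" for w
    unfolding r_def using preadditive_category.inv_arr_facts[OF C_pre[OF w] qi[OF w] arr_objD[OF qa[OF w]]] by auto
  have ri: "is_iso (Cat D w) (F0 w) (fst K w) (r w)" if w: "w \<in> carrier W" for w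
    by (rule preadditive_category.is_isoI[OF C_pre[OF w] rf(1)[OF w] qa[OF w] rf(3,2)[OF w]])
  have rsq: "r u \<cdot>\<^bsub>u\<^esub> snd iota g w = snd K g w \<cdot>\<^bsub>u\<^esub> PhA D g w (r w)"
    if h: "g \<in> carrier W" "w \<in> carrier W" "u \<in> carrier W" "u = g \<otimes> w" for g w u
  proof -
    note aK = glued_alpha[OF subset_refl Ko h] note io = iota_alpha(2)[OF h]
    note Fr = PhA_ar[OF h(1,2) rf(1)[OF h(2)] h(4)] note Fq = PhA_ar[OF h(1,2) qa[OF h(2)] h(4)]
    have "snd iota g w = snd iota g w \<cdot>\<^bsub>u\<^esub> (PhA D g w (q w) \<cdot>\<^bsub>u\<^esub> PhA D g w (r w))"
      by (simp only: PhA_cmp[OF h(1,2) rf(1)[OF h(2)] qa[OF h(2)] h(4), symmetric] rf(3)[OF h(2)]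
        PhA_ide[OF h(1,2) arr_objD(1)[OF rf(1)[OF h(2)]] h(4)] C_ide(1)[OF h(3) io])
    also have "\<dots> = q u \<cdot>\<^bsub>u\<^esub> (snd K g w \<cdot>\<^bsub>u\<^esub> PhA D g w (r w))"
      by (simp only: C_assoc[OF h(3) Fr Fq io] sq[OF h, symmetric] C_assoc[OF h(3) Fr aK qa[OF h(3)]])
    finally have e: "snd iota g w = q u \<cdot>\<^bsub>u\<^esub> (snd K g w \<cdot>\<^bsub>u\<^esub> PhA D g w (r w))" .
    note y = C_cmp_arr[OF h(3) Fr aK]
    have "r u \<cdot>\<^bsub>u\<^esub> (q u \<cdot>\<^bsub>u\<^esub> (snd K g w \<cdot>\<^bsub>u\<^esub> PhA D g w (r w))) = snd K g w \<cdot>\<^bsub>u\<^esub> PhA D g w (r w)"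
      by (simp only: C_assoc[OF h(3) y qa[OF h(3)] rf(1)[OF h(3)]] rf(2)[OF h(3)] C_ide(2)[OF h(3) y])
    then show ?thesis by (simp only: e[symmetric])
  qed
  have iota_eq: "iota = (\<lambda>w\<in>carrier W. F0 w, \<lambda>g w. if alpha_ix W (carrier W) g w then snd iota g w else undefined)"
    by (simp add: iota_obj_def Let_def fun_eq_iff)
  have mono: "t = t'" if "w \<in> carrier W" "ar w T (F0 w) t" "ar w T (F0 w) t'"
    "\<And>i. i \<in> {()} \<Longrightarrow> r w \<cdot>\<^bsub>w\<^esub> t = r w \<cdot>\<^bsub>w\<^esub> t'" for w T t t'
    by (rule preadditive_category.iso_cancel_left[OF C_pre[OF that(1)] ri[OF that(1)] rf(1)[OF that(1)] that(2,3)])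
      (use that(4) in simp)
  \<comment> \<open>that \<open>\<iota> A\<close> satisfies the axioms follows from its identification with the components
    of \<open>K\<close>\<close>
  note cr = glued_create[OF subset_refl, where I = "{()}" and X = "\<lambda>_. K" and q = "\<lambda>_. r" and Bo = F0
      and \<beta> = "snd iota" and B = iota]
  have io: "iota \<in> Obj GW"
    by (rule cr(1)) (assumption | rule Ko arr_objD(1)[OF rf(1)] rf(1) iota_alpha(2) rsq mono iota_eq)+
  have "arr GW iota ((\<lambda>_. K) ()) (\<lambda>w\<in>carrier W. (\<lambda>_. r) () w)"
    by (rule cr(2)) (assumption | rule singletonI | rule Ko arr_objD(1)[OF rf(1)] rf(1) iota_alpha(2) rsq mono iota_eq)+
  then have ra: "arr GW iota K (\<lambda>w\<in>carrier W. r w)" by simp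
  have "is_iso GW iota K (\<lambda>w\<in>carrier W. r w)"
    by (rule glued_isoI[OF subset_refl ra]) (simp add: iota_fst ri)
  then obtain h where "arr GW K iota h" "Cmp GW h (\<lambda>w\<in>carrier W. r w) = Ide GW iota"
    "Cmp GW (\<lambda>w\<in>carrier W. r w) h = Ide GW K"
    using GW.is_isoE[OF _ io Ko] by blast
  then have "is_iso GW K iota h" using GW.is_isoI[OF _ ra] by blast
  then show ?thesis unfolding isomorphic_def using Ko io by blast
qed

lemma homology_top: "isomorphic GW (chain_homology W n s D A Ntop) iota"
proof -
  have e: "int n - 2 = Ntop - 1" by simp
  obtain K k where K: "is_kernel GW (chn Ntop) (chn (Ntop - 1)) (dif Ntop) K k"
    and H: "isomorphic GW (chain_homology W n s D A Ntop) K"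
    by (rule homology_top_kernel[unfolded e]) (rule that)
  from GW.isomorphic_trans[OF H kernel_iota[OF K]] show ?thesis .
qed

end

theorem theorem7p2p1:
  fixes W :: "('w, 'x) monoid_scheme"
    and S :: "'w set"
    and s :: "nat \<Rightarrow> 'w"
    and n :: nat
    and D :: "('w, 'o, 'm) gluing"
    and A :: "('w, 'o, 'm) glued"
  assumes "coxeter_system W S"
    and "finite (carrier W)"
    and "bij_betw s {1..n} S"
    and "n \<ge> 2"
    and "\<forall>w\<in>carrier W. abelian_category (Cat D w)"
    and "gluing_data W S D"
    and "A \<in> Obj (glued_cat W D (carrier W))"
  shows "(\<forall>i. i \<noteq> 0 \<and> i \<noteq> int n - 1 \<longrightarrow>
            is_zero_object (glued_cat W D (carrier W)) (chain_homology W n s D A i)) \<and>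
         isomorphic (glued_cat W D (carrier W)) (chain_homology W n s D A 0) A \<and>
         isomorphic (glued_cat W D (carrier W)) (chain_homology W n s D A (int n - 1))
           (iota_obj W S D A)"
proof -
  interpret canonical_complex W S D A n s
    by unfold_locales (use assms in auto)
  show ?thesis using homology_middle homology_bottom homology_top by blast
qed

end
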